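(* Let $n=2p$, $J_n=i\begin{pmatrix} I_p & 0 \\ 0 & -I_p \end{pmatrix}$, $Q\in L^1_{\mathrm{loc}}(\mathbb{R}_+,\mathbb{C}^{2p\times 2p})$, and let $j$ be the conjugation in $L^2(\mathbb{R}_+,\mathbb{C}^{2p})$ given by $(jf)(t)=\begin{pmatrix} 0 & I_p \\ I_p & 0 \end{pmatrix}\overline{f(t)}$. Suppose that the minimal Dirac operator $D^+_{\min}(Q)$ in $L^2(\mathbb{R}_+,\mathbb{C}^{2p})$ is $j$-symmetric and that its field of regularity $\widehat\rho(D^+_{\min}(Q))$ is nonempty. Then $$\dim\ker\bigl(D^+_{\max}(Q)-z\bigr)=p\qquad\text{for every } z\in\widehat\rho\bigl(D^+_{\min}(Q)\bigr).$$ Moreover, for every $z\in\widehat\rho(D^+_{\min}(Q))$ there exists a $2p\times p$ Weyl-type matrix solution $\Psi_+(z,\cdot)\in L^2(\mathbb{R}_+,\mathbb{C}^{2p\times p})$ of the equation $J_n\frac{dy}{dx}+Q(x)y=zy$, $x\in\mathbb{R}_+$, which can be chosen to be holomorphic in $z$.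
   Context: $\mathbb{R}_+=[0,\infty)$. For $D(Q)y=J_ny'+Qy$, the maximal operator $D^+_{\max}(Q)$ in $L^2(\mathbb{R}_+,\mathbb{C}^n)$ has domain $\{y\in L^2: y\in AC_{\mathrm{loc}}(\mathbb{R}_+,\mathbb{C}^n),\ D(Q)y\in L^2\}$ and acts as $y\mapsto D(Q)y$; the minimal operator $D^+_{\min}(Q)$ is the closure of its restriction to those $y\in\mathrm{dom}\,D^+_{\max}(Q)$ with compact support contained in $(0,\infty)$. A conjugation $j$ in a Hilbert space is an antilinear map with $j^2=I$ and $(ju,v)=(jv,u)$. A densely defined operator $A$ is $j$-symmetric if $A\subseteq jA^*j$. The field of regularity $\widehat\rho(A)$ of a closed operator $A$ is the set of $\lambda\in\mathbb{C}$ for which there is $\varepsilon>0$ with $\|Af-\lambda f\|\ge\varepsilon\|f\|$ for all $f\in\mathrm{dom}\,A$. A $2p\times p$ Weyl-type matrix solution is a locally absolutely continuous $2p\times p$ matrix-valued solution whose $p$ columns are linearly independent and belong to $L^2(\mathbb{R}_+,\mathbb{C}^{2p})$. *)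

theory Defs
  imports "HOL-Analysis.Analysis"
begin

section \<open>The Hilbert space \<open>L\<^sup>2(\<real>\<^sub>+, \<complex>\<^sup>n)\<close>\<close>

abbreviation half_line :: "real measure" where
  "half_line \<equiv> lebesgue_on {0..}"

definition square_integrable :: "(real \<Rightarrow> complex ^ 'n::finite) \<Rightarrow> bool" where
  "square_integrable f \<longleftrightarrow>
     f \<in> borel_measurable half_line \<and> integrable half_line (\<lambda>t. (norm (f t))\<^sup>2)"

definition cdot :: "complex ^ 'n::finite \<Rightarrow> complex ^ 'n \<Rightarrow> complex" where
  "cdot x y = (\<Sum>k\<in>UNIV. x $ k * cnj (y $ k))"

lemma Re_cdot: "Re (cdot x y) = inner x y"
  by (simp add: cdot_def inner_vec_def inner_complex_def)

lemma cdot_add_left: "cdot (x + y) z = cdot x z + cdot y z"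
  by (simp add: cdot_def algebra_simps sum.distrib)

lemma cdot_scale_left: "cdot (c *s x) z = c * cdot x z"
  by (simp add: cdot_def algebra_simps sum_distrib_left)

lemma cdot_commute: "cdot y x = cnj (cdot x y)"
  by (simp add: cdot_def mult.commute)

lemma continuous_vector_smult [continuous_intros]:
  "continuous_on S (\<lambda>x::complex ^ 'n::finite. c *s x)"
  unfolding vector_scalar_mult_def by (intro continuous_intros)

lemma measurable_vector_smult [measurable (raw)]:
  fixes f :: "'b \<Rightarrow> complex ^ 'n::finite"
  assumes "f \<in> borel_measurable M"
  shows "(\<lambda>t. c *s f t) \<in> borel_measurable M"
  by (rule measurable_compose[OF assms])
     (intro borel_measurable_continuous_onI continuous_intros)

lemma norm_vector_smult: "norm (c *s x) = cmod c * norm (x :: complex ^ 'n::finite)"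
  by (simp add: norm_vec_def norm_mult L2_set_right_distrib)

lemma measurable_cdot [measurable (raw)]:
  fixes f g :: "'b \<Rightarrow> complex ^ 'n::finite"
  assumes "f \<in> borel_measurable M" "g \<in> borel_measurable M"
  shows "(\<lambda>t. cdot (f t) (g t)) \<in> borel_measurable M"
proof -
  have nth: "(\<lambda>x::complex ^ 'n. x $ k) \<in> borel_measurable borel"
    and cnj_nth: "(\<lambda>x::complex ^ 'n. cnj (x $ k)) \<in> borel_measurable borel" for k
    by (intro borel_measurable_continuous_onI continuous_intros)+
  show ?thesis
    unfolding cdot_def
    by (intro borel_measurable_sum borel_measurable_times measurable_compose[OF assms(1) nth]
        measurable_compose[OF assms(2) cnj_nth])
qed

lemma norm_cdot_le:
  fixes x y :: "complex ^ 'n::finite"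
  shows "norm (cdot x y) \<le> real CARD('n) * ((norm x)\<^sup>2 + (norm y)\<^sup>2)"
proof -
  have "norm (x $ k * cnj (y $ k)) \<le> (norm x)\<^sup>2 + (norm y)\<^sup>2" for k
  proof -
    have "norm (x $ k * cnj (y $ k)) \<le> norm x * norm y"
      unfolding norm_mult complex_mod_cnj
      by (intro mult_mono Finite_Cartesian_Product.norm_nth_le) auto
    also have "\<dots> \<le> (norm x)\<^sup>2 + (norm y)\<^sup>2"
      using sum_squares_bound[of "norm x" "norm y"]
        mult_nonneg_nonneg[OF norm_ge_zero[of x] norm_ge_zero[of y]]
      by linarith
    finally show ?thesis .
  qed
  then show ?thesis
    unfolding cdot_def
    using sum_bounded_above[of UNIV "\<lambda>k. norm (x $ k * cnj (y $ k))" "(norm x)\<^sup>2 + (norm y)\<^sup>2"]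
    by (intro order_trans[OF norm_sum]) simp
qed

lemma square_integrable_zero: "square_integrable (\<lambda>_. 0)"
  by (simp add: square_integrable_def)

lemma square_integrable_add:
  assumes "square_integrable f" "square_integrable g"
  shows "square_integrable (\<lambda>t. f t + g t)"
proof -
  note [measurable] = conjunct1[OF assms(1)[unfolded square_integrable_def]]
    conjunct1[OF assms(2)[unfolded square_integrable_def]]
  have "integrable half_line (\<lambda>t. (norm (f t + g t))\<^sup>2)"
  proof (rule Bochner_Integration.integrable_bound)
    show "integrable half_line (\<lambda>t. 2 * (norm (f t))\<^sup>2 + 2 * (norm (g t))\<^sup>2)"
      using assms by (auto simp: square_integrable_def)
    have "(norm (f t + g t))\<^sup>2 \<le> 2 * (norm (f t))\<^sup>2 + 2 * (norm (g t))\<^sup>2" for t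
    proof -
      have "(norm (f t + g t))\<^sup>2 \<le> (norm (f t) + norm (g t))\<^sup>2"
        by (intro power_mono norm_triangle_ineq) auto
      also have "\<dots> \<le> 2 * (norm (f t))\<^sup>2 + 2 * (norm (g t))\<^sup>2"
        using sum_squares_bound[of "norm (f t)" "norm (g t)"] by (simp add: power2_sum)
      finally show ?thesis .
    qed
    then show "AE t in half_line. norm ((norm (f t + g t))\<^sup>2)
        \<le> norm (2 * (norm (f t))\<^sup>2 + 2 * (norm (g t))\<^sup>2)"
      by simp
  qed measurable
  then show ?thesis
    by (simp add: square_integrable_def)
qed

lemma square_integrable_scale:
  assumes "square_integrable f"
  shows "square_integrable (\<lambda>t. c *s f t)"
  using assms by (auto simp: square_integrable_def norm_vector_smult power_mult_distrib
      intro!: measurable_vector_smult)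

lemma integrable_cdot:
  assumes "square_integrable f" "square_integrable g"
  shows "integrable half_line (\<lambda>t. cdot (f t) (g t))"
proof (rule Bochner_Integration.integrable_bound)
  show "integrable half_line (\<lambda>t. real CARD('a) * ((norm (f t))\<^sup>2 + (norm (g t))\<^sup>2))"
    using assms by (auto simp: square_integrable_def)
  show "(\<lambda>t. cdot (f t) (g t)) \<in> borel_measurable half_line"
    using assms by (auto simp: square_integrable_def)
  show "AE t in half_line. norm (cdot (f t) (g t))
      \<le> norm (real CARD('a) * ((norm (f t))\<^sup>2 + (norm (g t))\<^sup>2))"
    unfolding real_norm_def
    by (intro AE_I2 order_trans[OF norm_cdot_le abs_ge_self])
qed

definition l2_rel :: "(real \<Rightarrow> complex ^ 'n::finite) \<Rightarrow> (real \<Rightarrow> complex ^ 'n) \<Rightarrow> bool" where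
  "l2_rel f g \<longleftrightarrow> square_integrable f \<and> square_integrable g \<and> (AE t in half_line. f t = g t)"

quotient_type (overloaded) 'n l2 = "real \<Rightarrow> complex ^ ('n::finite)" / partial: l2_rel
  morphisms l2_rep l2_class
proof (rule part_equivpI)
  show "\<exists>f::real \<Rightarrow> complex ^ 'n. l2_rel f f"
    using square_integrable_zero by (auto simp: l2_rel_def)
  show "symp (l2_rel :: (real \<Rightarrow> complex ^ 'n) \<Rightarrow> _)"
    by (auto simp: symp_def l2_rel_def eq_commute)
  show "transp (l2_rel :: (real \<Rightarrow> complex ^ 'n) \<Rightarrow> _)"
  proof (rule transpI)
    fix f g h :: "real \<Rightarrow> complex ^ 'n"
    assume "l2_rel f g" "l2_rel g h"
    then have sq: "square_integrable f" "square_integrable h"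
      and ae: "AE t in half_line. f t = g t" "AE t in half_line. g t = h t"
      by (simp_all add: l2_rel_def)
    from ae have "AE t in half_line. f t = h t"
      by eventually_elim simp
    with sq show "l2_rel f h"
      by (simp add: l2_rel_def)
  qed
qed

lemma l2_rel_map:
  assumes "l2_rel f g" and "\<And>h. square_integrable h \<Longrightarrow> square_integrable (\<lambda>t. \<phi> (h t))"
  shows "l2_rel (\<lambda>t. \<phi> (f t)) (\<lambda>t. \<phi> (g t))"
proof -
  have "AE t in half_line. f t = g t"
    using assms(1) by (simp add: l2_rel_def)
  then have "AE t in half_line. \<phi> (f t) = \<phi> (g t)"
    by eventually_elim simp
  then show ?thesis
    using assms by (simp add: l2_rel_def)
qed

lift_definition scaleC :: "complex \<Rightarrow> 'n::finite l2 \<Rightarrow> 'n l2" (infixr \<open>*\<^sub>C\<close> 75)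
  is "\<lambda>c f t. c *s f t"
  by (rule l2_rel_map) (auto intro: square_integrable_scale)

text \<open>The inner product is linear in the first argument.\<close>

lift_definition cinner :: "'n::finite l2 \<Rightarrow> 'n l2 \<Rightarrow> complex"
  is "\<lambda>f g. integral\<^sup>L half_line (\<lambda>t. cdot (f t) (g t))"
proof -
  fix f f' g g' :: "real \<Rightarrow> complex ^ 'n"
  assume a: "l2_rel f f'" "l2_rel g g'"
  then have "(\<lambda>t. cdot (f t) (g t)) \<in> borel_measurable half_line"
    "(\<lambda>t. cdot (f' t) (g' t)) \<in> borel_measurable half_line"
    by (auto simp: l2_rel_def square_integrable_def)
  moreover have "AE t in half_line. f t = f' t" "AE t in half_line. g t = g' t"
    using a by (simp_all add: l2_rel_def)
  then have "AE t in half_line. cdot (f t) (g t) = cdot (f' t) (g' t)"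
    by eventually_elim simp
  ultimately show "integral\<^sup>L half_line (\<lambda>t. cdot (f t) (g t))
      = integral\<^sup>L half_line (\<lambda>t. cdot (f' t) (g' t))"
    by (rule integral_cong_AE)
qed

instantiation l2 :: (finite) real_vector
begin

lift_definition zero_l2 :: "'a l2" is "\<lambda>_. 0"
  by (simp add: l2_rel_def square_integrable_zero)

lift_definition plus_l2 :: "'a l2 \<Rightarrow> 'a l2 \<Rightarrow> 'a l2" is "\<lambda>f g t. f t + g t"
proof -
  fix f f' g g' :: "real \<Rightarrow> complex ^ 'a"
  assume a: "l2_rel f f'" "l2_rel g g'"
  then have "AE t in half_line. f t = f' t" "AE t in half_line. g t = g' t"
    by (simp_all add: l2_rel_def)
  then have "AE t in half_line. f t + g t = f' t + g' t"
    by eventually_elim simp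
  then show "l2_rel (\<lambda>t. f t + g t) (\<lambda>t. f' t + g' t)"
    using a by (simp add: l2_rel_def square_integrable_add)
qed

definition uminus_l2 :: "'a l2 \<Rightarrow> 'a l2" where
  "uminus_l2 u = (- 1) *\<^sub>C u"

definition minus_l2 :: "'a l2 \<Rightarrow> 'a l2 \<Rightarrow> 'a l2" where
  "minus_l2 u v = u + - v"

definition scaleR_l2 :: "real \<Rightarrow> 'a l2 \<Rightarrow> 'a l2" where
  "scaleR_l2 r u = complex_of_real r *\<^sub>C u"

instance
proof
  fix a b c :: "'a l2" and r s :: real
  show "a + b + c = a + (b + c)"
    by transfer (simp add: l2_rel_def square_integrable_add add.assoc)
  show "a + b = b + a"
    by transfer (simp add: l2_rel_def square_integrable_add add.commute)
  show "0 + a = a"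
    by transfer (simp add: l2_rel_def)
  show "- a + a = 0"
    unfolding uminus_l2_def
    by transfer (simp add: l2_rel_def square_integrable_zero)
  show "a - b = a + - b"
    by (simp add: minus_l2_def)
  show "r *\<^sub>R (a + b) = r *\<^sub>R a + r *\<^sub>R b"
    unfolding scaleR_l2_def
    by transfer (simp add: l2_rel_def square_integrable_add square_integrable_scale
        vector_add_ldistrib)
  show "(r + s) *\<^sub>R a = r *\<^sub>R a + s *\<^sub>R a"
    unfolding scaleR_l2_def
    by transfer (simp add: l2_rel_def square_integrable_add square_integrable_scale
        vector_sadd_rdistrib)
  show "r *\<^sub>R s *\<^sub>R a = (r * s) *\<^sub>R a"
    unfolding scaleR_l2_def
    by transfer (simp add: l2_rel_def square_integrable_scale vector_smult_assoc)
  show "1 *\<^sub>R a = a"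
    unfolding scaleR_l2_def
    by transfer (simp add: l2_rel_def)
qed

end

interpretation l2: vector_space "scaleC :: complex \<Rightarrow> 'n::finite l2 \<Rightarrow> 'n l2"
proof
  fix a b :: complex and x y :: "'n l2"
  show "a *\<^sub>C (x + y) = a *\<^sub>C x + a *\<^sub>C y"
    by transfer (simp add: l2_rel_def square_integrable_add square_integrable_scale
        vector_add_ldistrib)
  show "(a + b) *\<^sub>C x = a *\<^sub>C x + b *\<^sub>C x"
    by transfer (simp add: l2_rel_def square_integrable_add square_integrable_scale
        vector_sadd_rdistrib)
  show "a *\<^sub>C b *\<^sub>C x = (a * b) *\<^sub>C x"
    by transfer (simp add: l2_rel_def square_integrable_scale vector_smult_assoc)
  show "1 *\<^sub>C x = x"
    by transfer (simp add: l2_rel_def)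
qed

lemma cinner_add_left: "cinner (u + v) w = cinner u w + cinner v w"
  by transfer (simp add: l2_rel_def cdot_add_left integrable_cdot)

lemma cinner_scaleC_left: "cinner (c *\<^sub>C u) w = c * cinner u w"
  by transfer (simp add: l2_rel_def cdot_scale_left integrable_cdot)

lemma cinner_commute: "cinner v u = cnj (cinner u v)"
proof transfer
  fix u v :: "real \<Rightarrow> complex ^ 'a"
  assume "l2_rel v v" "l2_rel u u"
  have "(\<lambda>t. cdot (v t) (u t)) = (\<lambda>t. cnj (cdot (u t) (v t)))"
    by (rule ext) (rule cdot_commute)
  then show "integral\<^sup>L half_line (\<lambda>t. cdot (v t) (u t))
      = cnj (integral\<^sup>L half_line (\<lambda>t. cdot (u t) (v t)))"
    by simp
qed

lemma Re_cinner_self: "Re (cinner u u) \<ge> 0 \<and> (Re (cinner u u) = 0 \<longleftrightarrow> u = 0)"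
proof transfer
  fix f :: "real \<Rightarrow> complex ^ 'a"
  assume f: "l2_rel f f"
  then have sq: "square_integrable f" by (simp add: l2_rel_def)
  have eq: "Re (integral\<^sup>L half_line (\<lambda>t. cdot (f t) (f t)))
      = integral\<^sup>L half_line (\<lambda>t. (norm (f t))\<^sup>2)"
    using integral_Re[OF integrable_cdot[OF sq sq]]
    by (simp add: Re_cdot power2_norm_eq_inner)
  have "integral\<^sup>L half_line (\<lambda>t. (norm (f t))\<^sup>2) = 0
      \<longleftrightarrow> (AE t in half_line. (norm (f t))\<^sup>2 = 0)"
    using sq by (intro integral_nonneg_eq_0_iff_AE) (auto simp: square_integrable_def)
  then show "0 \<le> Re (integral\<^sup>L half_line (\<lambda>t. cdot (f t) (f t))) \<and>
      (Re (integral\<^sup>L half_line (\<lambda>t. cdot (f t) (f t))) = 0 \<longleftrightarrow> l2_rel f (\<lambda>_. 0))"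
    using sq by (simp add: eq l2_rel_def square_integrable_zero)
qed

instantiation l2 :: (finite) real_inner
begin

definition inner_l2 :: "'a l2 \<Rightarrow> 'a l2 \<Rightarrow> real" where
  "inner_l2 u v = Re (cinner u v)"

definition norm_l2 :: "'a l2 \<Rightarrow> real" where
  "norm_l2 u = sqrt (inner u u)"

definition sgn_l2 :: "'a l2 \<Rightarrow> 'a l2" where
  "sgn_l2 u = u /\<^sub>R norm u"

definition dist_l2 :: "'a l2 \<Rightarrow> 'a l2 \<Rightarrow> real" where
  "dist_l2 u v = norm (u - v)"

definition uniformity_l2 :: "('a l2 \<times> 'a l2) filter" where
  "uniformity_l2 = (INF e\<in>{0<..}. principal {(x, y). dist x y < e})"

definition open_l2 :: "'a l2 set \<Rightarrow> bool" where
  "open_l2 U \<longleftrightarrow> (\<forall>x\<in>U. \<forall>\<^sub>F (x', y) in uniformity. x' = x \<longrightarrow> y \<in> U)"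

instance
proof
  fix x y z :: "'a l2" and r :: real
  show "inner x y = inner y x"
    using cinner_commute[of y x] by (simp add: inner_l2_def)
  show "inner (x + y) z = inner x z + inner y z"
    by (simp add: inner_l2_def cinner_add_left)
  show "inner (r *\<^sub>R x) y = r * inner x y"
    by (simp add: inner_l2_def scaleR_l2_def cinner_scaleC_left)
  show "0 \<le> inner x x" "inner x x = 0 \<longleftrightarrow> x = 0"
    using Re_cinner_self[of x] by (simp_all add: inner_l2_def)
qed (simp_all add: norm_l2_def sgn_l2_def dist_l2_def uniformity_l2_def open_l2_def)

end

text \<open>Complex differentiability in norm, in analogy to \<open>holomorphic_on\<close>.\<close>

definition l2_holomorphic_on :: "(complex \<Rightarrow> 'n::finite l2) \<Rightarrow> complex set \<Rightarrow> bool" where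
  "l2_holomorphic_on F S \<longleftrightarrow>
     (\<forall>z\<in>S. \<exists>D. (F has_derivative (\<lambda>h. h *\<^sub>C D)) (at z within S))"


section \<open>Unbounded operators in \<open>L\<^sup>2(\<real>\<^sub>+, \<complex>\<^sup>n)\<close>\<close>

text \<open>An operator is identified with its graph; its closure is then the closure of the graph
  in the product topology.\<close>

type_synonym 'n op_graph = "('n l2 \<times> 'n l2) set"

definition densely_defined :: "'n::finite op_graph \<Rightarrow> bool" where
  "densely_defined A \<longleftrightarrow> closure (Domain A) = UNIV"

definition adjoint_op :: "'n::finite op_graph \<Rightarrow> 'n op_graph" where
  "adjoint_op A = {(v, w). \<forall>(u, f)\<in>A. cinner f v = cinner u w}"

definition shift_op :: "'n::finite op_graph \<Rightarrow> complex \<Rightarrow> 'n op_graph" where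
  "shift_op A z = {(u, f - z *\<^sub>C u) | u f. (u, f) \<in> A}"

definition kernel_op :: "'n::finite op_graph \<Rightarrow> 'n l2 set" where
  "kernel_op A = {u. (u, 0) \<in> A}"

definition field_of_regularity :: "'n::finite op_graph \<Rightarrow> complex set" where
  "field_of_regularity A =
     {z. \<exists>\<epsilon>>0. \<forall>(u, f)\<in>A. norm (f - z *\<^sub>C u) \<ge> \<epsilon> * norm u}"

definition conjugation :: "('n::finite l2 \<Rightarrow> 'n l2) \<Rightarrow> bool" where
  "conjugation j \<longleftrightarrow>
     (\<forall>u v. j (u + v) = j u + j v) \<and> (\<forall>c u. j (c *\<^sub>C u) = cnj c *\<^sub>C j u) \<and>
     (\<forall>u. j (j u) = u) \<and> (\<forall>u v. cinner (j u) v = cinner (j v) u)"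

text \<open>The set \<open>{(u, j w) | (j u, w) \<in> A\<^sup>*}\<close> is the graph of \<open>j A\<^sup>* j\<close>.\<close>

definition j_symmetric :: "('n::finite l2 \<Rightarrow> 'n l2) \<Rightarrow> 'n op_graph \<Rightarrow> bool" where
  "j_symmetric j A \<longleftrightarrow>
     densely_defined A \<and> A \<subseteq> {(u, j w) | u w. (j u, w) \<in> adjoint_op A}"


section \<open>Locally absolutely continuous functions\<close>

text \<open>The library has absolute continuity of measures only; this is the classical
  \<open>\<epsilon>\<close>-\<open>\<delta>\<close> definition for functions on \<open>{c..d}\<close>.\<close>

definition absolutely_continuous_on_interval ::
    "real \<Rightarrow> real \<Rightarrow> (real \<Rightarrow> 'a::real_normed_vector) \<Rightarrow> bool" where
  "absolutely_continuous_on_interval c d u \<longleftrightarrow>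
     (\<forall>\<epsilon>>0. \<exists>\<delta>>0. \<forall>(m::nat) a b.
        (\<forall>i<m. c \<le> a i \<and> a i \<le> b i \<and> b i \<le> d) \<longrightarrow>
        (\<forall>i<m. \<forall>k<m. i \<noteq> k \<longrightarrow> {a i<..<b i} \<inter> {a k<..<b k} = {}) \<longrightarrow>
        (\<Sum>i<m. b i - a i) < \<delta> \<longrightarrow>
        (\<Sum>i<m. norm (u (b i) - u (a i))) < \<epsilon>)"

definition AC_loc :: "(real \<Rightarrow> 'a::real_normed_vector) \<Rightarrow> bool" where
  "AC_loc u \<longleftrightarrow> (\<forall>d\<ge>0. absolutely_continuous_on_interval 0 d u)"

definition L1_loc :: "(real \<Rightarrow> 'a::euclidean_space) \<Rightarrow> bool" where
  "L1_loc q \<longleftrightarrow> (\<forall>d\<ge>0. q absolutely_integrable_on {0..d})"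

text \<open>Locally absolutely continuous functions with values in a finite-dimensional space are
  differentiable almost everywhere; \<open>v\<close> is the derivative of \<open>u\<close>, unique up to a null set.\<close>

definition ae_derivative ::
    "(real \<Rightarrow> 'a::real_normed_vector) \<Rightarrow> (real \<Rightarrow> 'a) \<Rightarrow> bool" where
  "ae_derivative u v \<longleftrightarrow>
     (AE t in half_line. (u has_vector_derivative v t) (at t within {0..}))"


section \<open>Dirac operators\<close>

text \<open>Vectors of length \<open>2p\<close> are indexed by \<^typ>\<open>'p + 'p\<close> with \<open>p = CARD('p)\<close>.\<close>

definition block_matrix ::
    "complex ^ 'p ^ 'p \<Rightarrow> complex ^ 'p ^ 'p \<Rightarrow> complex ^ 'p ^ 'p \<Rightarrow> complex ^ 'p ^ 'p
      \<Rightarrow> complex ^ ('p::finite + 'p) ^ ('p + 'p)" where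
  "block_matrix A B C D = (\<chi> i k.
     case i of
       Inl i \<Rightarrow> (case k of Inl k \<Rightarrow> A $ i $ k | Inr k \<Rightarrow> B $ i $ k)
     | Inr i \<Rightarrow> (case k of Inl k \<Rightarrow> C $ i $ k | Inr k \<Rightarrow> D $ i $ k))"

definition J_mat :: "complex ^ ('p::finite + 'p) ^ ('p + 'p)" where
  "J_mat = block_matrix (mat \<i>) 0 0 (mat (- \<i>))"

definition swap_conj :: "complex ^ ('p::finite + 'p) \<Rightarrow> complex ^ ('p + 'p)" where
  "swap_conj x = block_matrix 0 (mat 1) (mat 1) 0 *v (\<chi> k. cnj (x $ k))"

lemma swap_conj_nth:
  "swap_conj x $ i = cnj (x $ (case i of Inl k \<Rightarrow> Inr k | Inr k \<Rightarrow> Inl k))"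
proof -
  have UNIV_Plus: "(UNIV :: ('p + 'p) set) = UNIV <+> UNIV"
    by simp
  show ?thesis
    by (cases i) (simp_all add: swap_conj_def block_matrix_def matrix_vector_mult_def
        UNIV_Plus sum.Plus mat_def if_distrib[where f = "\<lambda>c. c * _"] cong: if_cong del: UNIV_Plus_UNIV)
qed

lemma sum_case_swap:
  fixes h :: "('p::finite + 'p) \<Rightarrow> 'b::comm_monoid_add"
  shows "(\<Sum>i\<in>UNIV. h (case i of Inl k \<Rightarrow> Inr k | Inr k \<Rightarrow> Inl k)) = (\<Sum>i\<in>UNIV. h i)"
  by (rule sum.reindex_bij_witness[where i = "\<lambda>i. case i of Inl k \<Rightarrow> Inr k | Inr k \<Rightarrow> Inl k"
        and j = "\<lambda>i. case i of Inl k \<Rightarrow> Inr k | Inr k \<Rightarrow> Inl k"]) (auto split: sum.splits)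

lemma norm_swap_conj: "norm (swap_conj x) = norm x"
  using sum_case_swap[of "\<lambda>i. (cmod (x $ i))\<^sup>2"]
  by (simp add: norm_vec_def L2_set_def swap_conj_nth)

lemma cdot_swap_conj: "cdot (swap_conj x) y = cdot (swap_conj y) x"
proof -
  have "cdot (swap_conj x) y
      = (\<Sum>i\<in>UNIV. (\<lambda>i. cnj (x $ i) * cnj (y $ (case i of Inl k \<Rightarrow> Inr k | Inr k \<Rightarrow> Inl k)))
           (case i of Inl k \<Rightarrow> Inr k | Inr k \<Rightarrow> Inl k))"
    by (auto simp: cdot_def swap_conj_nth intro!: sum.cong split: sum.splits)
  also have "\<dots> = (\<Sum>i\<in>UNIV. cnj (x $ i) * cnj (y $ (case i of Inl k \<Rightarrow> Inr k | Inr k \<Rightarrow> Inl k)))"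
    by (rule sum_case_swap)
  also have "\<dots> = cdot (swap_conj y) x"
    by (simp add: cdot_def swap_conj_nth mult.commute)
  finally show ?thesis .
qed

lemma square_integrable_swap_conj:
  assumes "square_integrable f"
  shows "square_integrable (\<lambda>t. swap_conj (f t))"
proof -
  have "continuous_on UNIV (swap_conj :: complex ^ ('a + 'a) \<Rightarrow> _)"
  proof -
    have "swap_conj = (\<lambda>x::complex ^ ('a + 'a).
        \<chi> i. cnj (x $ (case i of Inl k \<Rightarrow> Inr k | Inr k \<Rightarrow> Inl k)))"
      by (simp add: fun_eq_iff vec_eq_iff swap_conj_nth)
    then show ?thesis
      by (rule ssubst) (intro continuous_intros)
  qed
  then show ?thesis
    using assms unfolding square_integrable_def norm_swap_conj
    by (blast intro: measurable_compose borel_measurable_continuous_onI)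
qed

lift_definition dirac_conj :: "('p::finite + 'p) l2 \<Rightarrow> ('p + 'p) l2"
  is "\<lambda>f t. swap_conj (f t)"
  by (rule l2_rel_map) (auto intro: square_integrable_swap_conj)

lemma conjugation_dirac_conj: "conjugation dirac_conj"
  unfolding conjugation_def
proof (intro conjI allI)
  fix u v :: "('a + 'a) l2" and c
  have add: "swap_conj (x + y) = swap_conj x + swap_conj y" for x y :: "complex ^ ('a + 'a)"
    by (simp add: vec_eq_iff swap_conj_nth)
  have scale: "swap_conj (c *s x) = cnj c *s swap_conj x"
    for c and x :: "complex ^ ('a + 'a)"
    by (simp add: vec_eq_iff swap_conj_nth)
  have inv: "swap_conj (swap_conj x) = x" for x :: "complex ^ ('a + 'a)"
    by (auto simp: vec_eq_iff swap_conj_nth split: sum.splits)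
  show "dirac_conj (u + v) = dirac_conj u + dirac_conj v"
    by transfer (simp add: l2_rel_def add square_integrable_swap_conj square_integrable_add)
  show "dirac_conj (c *\<^sub>C u) = cnj c *\<^sub>C dirac_conj u"
    by transfer (simp add: l2_rel_def scale square_integrable_swap_conj square_integrable_scale)
  show "dirac_conj (dirac_conj u) = u"
    by transfer (simp add: l2_rel_def inv)
  show "cinner (dirac_conj u) v = cinner (dirac_conj v) u"
    by transfer (simp add: cdot_swap_conj)
qed

definition dirac_max ::
    "(real \<Rightarrow> complex ^ ('p::finite + 'p) ^ ('p + 'p)) \<Rightarrow> ('p + 'p) op_graph" where
  "dirac_max Q = {(l2_class y, l2_class g) | y g.
     AC_loc y \<and> square_integrable y \<and> square_integrable g \<and>
     (\<exists>y'. ae_derivative y y' \<and> (AE t in half_line. g t = J_mat *v y' t + Q t *v y t))}"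

definition compactly_supported :: "'n::finite l2 \<Rightarrow> bool" where
  "compactly_supported u \<longleftrightarrow>
     (\<exists>y. square_integrable y \<and> u = l2_class y \<and>
        compact (closure {t\<in>{0..}. y t \<noteq> 0}) \<and> closure {t\<in>{0..}. y t \<noteq> 0} \<subseteq> {0<..})"

definition dirac_min ::
    "(real \<Rightarrow> complex ^ ('p::finite + 'p) ^ ('p + 'p)) \<Rightarrow> ('p + 'p) op_graph" where
  "dirac_min Q = closure {(u, f) \<in> dirac_max Q. compactly_supported u}"

definition weyl_matrix_solution ::
    "(real \<Rightarrow> complex ^ ('p::finite + 'p) ^ ('p + 'p)) \<Rightarrow> complex
      \<Rightarrow> (real \<Rightarrow> complex ^ 'p ^ ('p + 'p)) \<Rightarrow> bool" where
  "weyl_matrix_solution Q z \<Psi> \<longleftrightarrow>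
     AC_loc \<Psi> \<and>
     (\<exists>\<Psi>'. ae_derivative \<Psi> \<Psi>' \<and>
        (AE t in half_line. J_mat ** \<Psi>' t + Q t ** \<Psi> t = mat z ** \<Psi> t)) \<and>
     (\<forall>k. square_integrable (\<lambda>t. column k (\<Psi> t))) \<and>
     (\<forall>c :: complex ^ 'p. (\<forall>t\<ge>0. (\<Sum>k\<in>UNIV. c $ k *s column k (\<Psi> t)) = 0) \<longrightarrow> c = 0)"

end

theory Submission
  imports Defs "HOL-Complex_Analysis.Weierstrass_Factorization"
begin

text \<open>For \<open>z\<close> in the field of regularity let \<open>V(z)\<close> be the space of initial values of the square
integrable solutions of \<open>J y' + Q y = z y\<close>. A solution is determined by its initial value, so
the kernel of \<open>D\<^sub>m\<^sub>a\<^sub>x - z\<close> is a copy of \<open>V(z)\<close>, and a holomorphic Weyl solution is the fundamental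
matrix multiplied by a holomorphic basis of \<open>V(z)\<close>. Everything is therefore reduced to the family
of subspaces \<open>V(z)\<close> of \<open>\<complex>\<^sup>2\<^sup>p\<close>.

\<^emph>\<open>Dimension.\<close> Let \<open>b\<close> be the bilinear form with \<open>b(x, y) = \<langle>x, jy\<rangle>\<close> pointwise and let
\<open>s(x, y) = b(x, J y)\<close>, a nondegenerate alternating form. Testing \<open>j\<close>-symmetry on cut-off solutions
of \<open>J y' + Q y = 0\<close> shows that almost every \<open>Q(t)\<close> is symmetric for \<open>b\<close>
(\<open>j_symmetric_imp_sharp\<close>). This gives Green's formula for \<open>b\<close> with boundary form \<open>s\<close>
(\<open>green_formula_half_line\<close>), and the adjoint of the minimal operator is contained in
\<open>j D\<^sub>m\<^sub>a\<^sub>x j\<close> (\<open>adjoint_dirac_min\<close>). Green's formula on the half-line makes \<open>V(z)\<close> isotropic for \<open>s\<close>.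
Conversely, if \<open>v\<close> is \<open>s\<close>-orthogonal to \<open>V(z)\<close>, cut the solution starting at \<open>v\<close> off to a compactly
supported function \<open>u\<close>; then \<open>f = (D - z) u\<close> is orthogonal to the orthogonal complement of the range of
\<open>D\<^sub>m\<^sub>i\<^sub>n - z\<close>. That range is closed because \<open>z\<close> is in the field of regularity, hence
\<open>f = (D\<^sub>m\<^sub>i\<^sub>n - z) u\<^sub>1\<close>, and \<open>u - u\<^sub>1\<close> is a square integrable solution with initial value \<open>v\<close>
(\<open>boundary_space_coisotropic\<close>). So \<open>V(z)\<close> is its own \<open>s\<close>-orthogonal complement and has dimension
\<open>p\<close> (\<open>lagrangian_dim\<close>).

\<^emph>\<open>Local holomorphy.\<close> For \<open>z\<^sub>0\<close> in the field of regularity, \<open>D\<^sub>m\<^sub>a\<^sub>x - z\<^sub>0\<close> has a bounded linear right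
inverse \<open>G\<close>, because the adjoint of the minimal operator has one
(\<open>adjoint_right_inverse_exists\<close>). A kernel element \<open>y\<^sub>0\<close> at \<open>z\<^sub>0\<close> is continued to kernel elements
\<open>S(z)\<close> at nearby \<open>z\<close> by solving \<open>S(z) = y\<^sub>0 + (z - z\<^sub>0) G S(z)\<close>. As point evaluation is a bounded
functional of \<open>y\<close> and \<open>D y\<close> (\<open>evaluation_functional\<close>), the initial values of a basis
continued in this way are holomorphic, and they span \<open>V(z)\<close> because all \<open>V(z)\<close> have the same
dimension (\<open>boundary_space_chart\<close>).

\<^emph>\<open>Global holomorphy.\<close> It remains to find a global frame for a holomorphic family of subspaces over
an open \<open>\<Omega> \<subseteq> \<complex>\<close> (\<open>holomorphic_frame_exists\<close>); this is the triviality of holomorphic vector bundles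
over an open subset of the plane, made elementary. Inverting on \<open>V(z)\<close> a fixed linear map
to \<open>\<complex>\<^sup>p\<close> gives a frame with poles on a discrete set. A pole or a degeneracy at one point \<open>a\<close> can be
removed by finitely many multiplications with matrices \<open>\<Phi>(e(z))\<close>, where \<open>\<Phi>\<close> is a rational matrix
function with \<open>\<Phi>(1) = 1\<close> and \<open>e\<close> is a Weierstrass type factor with a single zero at \<open>a\<close> that is as
close to \<open>1\<close> as desired on a given member of a compact exhaustion of \<open>\<Omega>\<close>
(\<open>elementary_factor_exists\<close>). Working outwards along the exhaustion, the infinite product of these
corrections converges to an invertible matrix function (\<open>infinite_matrix_product\<close>).\<close>

unbundle no fps_syntax

section \<open>Locally absolutely continuous functions\<close>

lemma AE_half_line_iff: "(AE t in half_line. P t) \<longleftrightarrow> negligible {t. 0 \<le> t \<and> \<not> P t}"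
proof -
  have "(AE t in half_line. P t) \<longleftrightarrow> (AE t in lebesgue. 0 \<le> t \<longrightarrow> P t)"
    by (subst AE_restrict_space_iff) auto
  also have "\<dots> \<longleftrightarrow> {t \<in> space lebesgue. \<not> (0 \<le> t \<longrightarrow> P t)} \<in> null_sets lebesgue"
    by (rule completion.AE_iff_null_sets)
  finally show ?thesis
    by (simp add: negligible_iff_null_sets)
qed

text \<open>The inner part of the \<open>\<epsilon>\<close>-\<open>\<delta>\<close> definition of absolute continuity, with \<open>\<epsilon>\<close> and \<open>\<delta>\<close> as parameters, so
that its long quantifier prefix need not be unfolded again.\<close>

definition AC_modulus :: "real \<Rightarrow> real \<Rightarrow> (real \<Rightarrow> 'a::real_normed_vector) \<Rightarrow> real \<Rightarrow> real \<Rightarrow> bool" where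
  "AC_modulus c d u \<epsilon> \<delta> \<longleftrightarrow> \<delta> > 0 \<and> (\<forall>(m::nat) a b.
        (\<forall>i<m. c \<le> a i \<and> a i \<le> b i \<and> b i \<le> d) \<longrightarrow>
        (\<forall>i<m. \<forall>k<m. i \<noteq> k \<longrightarrow> {a i<..<b i} \<inter> {a k<..<b k} = {}) \<longrightarrow>
        (\<Sum>i<m. b i - a i) < \<delta> \<longrightarrow> (\<Sum>i<m. norm (u (b i) - u (a i))) < \<epsilon>)"

lemma AC_interval_iff_modulus:
  "absolutely_continuous_on_interval c d u \<longleftrightarrow> (\<forall>\<epsilon>>0. \<exists>\<delta>. AC_modulus c d u \<epsilon> \<delta>)"
  unfolding absolutely_continuous_on_interval_def AC_modulus_def ..

lemma AC_modulus_pos: "AC_modulus c d u \<epsilon> \<delta> \<Longrightarrow> \<delta> > 0"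
  by (simp add: AC_modulus_def)

lemma AC_modulusD:
  fixes m :: nat
  assumes "AC_modulus c d u \<epsilon> \<delta>"
    and "\<And>i. i < m \<Longrightarrow> c \<le> a i \<and> a i \<le> b i \<and> b i \<le> d"
    and "\<And>i k. i < m \<Longrightarrow> k < m \<Longrightarrow> i \<noteq> k \<Longrightarrow> {a i<..<b i} \<inter> {a k<..<b k} = {}"
    and "(\<Sum>i<m. b i - a i) < \<delta>"
  shows "(\<Sum>i<m. norm (u (b i) - u (a i))) < \<epsilon>"
proof (rule conjunct2[OF assms(1)[unfolded AC_modulus_def], THEN spec, THEN spec, THEN spec,
        THEN mp, THEN mp, THEN mp])
  show "\<forall>i<m. c \<le> a i \<and> a i \<le> b i \<and> b i \<le> d" using assms(2) by iprover
  show "\<forall>i<m. \<forall>k<m. i \<noteq> k \<longrightarrow> {a i<..<b i} \<inter> {a k<..<b k} = {}" using assms(3) by iprover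
qed (rule assms(4))

lemma AC_modulusI:
  assumes "\<delta> > 0" and "\<And>(m::nat) a b. \<lbrakk>\<And>i. i < m \<Longrightarrow> c \<le> a i \<and> a i \<le> b i \<and> b i \<le> d;
      \<And>i k. i < m \<Longrightarrow> k < m \<Longrightarrow> i \<noteq> k \<Longrightarrow> {a i<..<b i} \<inter> {a k<..<b k} = {};
      (\<Sum>i<m. b i - a i) < \<delta>\<rbrakk> \<Longrightarrow> (\<Sum>i<m. norm (u (b i) - u (a i))) < \<epsilon>"
  shows "AC_modulus c d u \<epsilon> \<delta>"
  unfolding AC_modulus_def
proof (intro conjI assms(1) allI impI)
  fix m :: nat and a b
  assume a: "\<forall>i<m. c \<le> a i \<and> a i \<le> b i \<and> b i \<le> d"
    and d: "\<forall>i<m. \<forall>k<m. i \<noteq> k \<longrightarrow> {a i<..<b i} \<inter> {a k<..<b k} = {}"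
    and s: "(\<Sum>i<m. b i - a i) < \<delta>"
  show "(\<Sum>i<m. norm (u (b i) - u (a i))) < \<epsilon>"
    by (rule assms(2)[OF _ _ s]) (use a d in iprover)+
qed

text \<open>The gauge integral makes the classical argument direct. At points outside the exceptional set \<open>N\<close> the
gauge comes from differentiability, as for everywhere differentiable functions; at points of \<open>N\<close> it
is so small that the intervals tagged there lie in an open set of small measure, and absolute
continuity bounds the sum of the increments of \<open>u\<close> over them.\<close>

theorem AC_fundamental_theorem:
  fixes u :: "real \<Rightarrow> 'a::banach"
  assumes "a \<le> b" and AC: "absolutely_continuous_on_interval a b u" and N: "negligible N"
    and der: "\<And>t. t \<in> {a..b} - N \<Longrightarrow> (u has_vector_derivative v t) (at t within {a..b})"
  shows "(v has_integral (u b - u a)) {a..b}"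
proof -
  define w where "w t = (if t \<in> N then 0 else v t)" for t
  have "(w has_integral (u b - u a)) {a..b}"
    unfolding has_integral_real
  proof (intro allI impI)
    fix e :: real assume "e > 0"
    define c where "c = e / (2 * (b - a + 1))"
    have "c > 0" using \<open>e > 0\<close> \<open>a \<le> b\<close> by (simp add: c_def)
    have cle: "c * (b - a) < e / 2"
      using \<open>e > 0\<close> \<open>a \<le> b\<close> by (simp add: c_def field_simps)
    define P where "P x d \<longleftrightarrow> 0 < d \<and> (x \<in> {a..b} - N \<longrightarrow>
         (\<forall>y\<in>{a..b}. norm (y-x) < d \<longrightarrow> norm (u y - u x - (y-x) *\<^sub>R v x) \<le> c * norm (y-x)))" for x d
    have "\<exists>d. P x d" for x
    proof (cases "x \<in> {a..b} - N")
      case True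
      from der[OF True] \<open>c > 0\<close> show ?thesis
        unfolding has_vector_derivative_def has_derivative_within_alt P_def by blast
    next
      case False
      then show ?thesis unfolding P_def using zero_less_one by blast
    qed
    then obtain d where P: "\<And>x. P x (d x)"
      by metis
    have d: "0 < d x"
         "\<lbrakk>x \<in> {a..b} - N; y \<in> {a..b}; norm (y-x) < d x\<rbrakk>
             \<Longrightarrow> norm (u y - u x - (y-x) *\<^sub>R v x) \<le> c * norm (y-x)" for x y
      using P[of x] unfolding P_def by blast+
    obtain \<delta> where \<delta>: "AC_modulus a b u (e / 2) \<delta>"
      using AC half_gt_zero[OF \<open>e > 0\<close>] unfolding AC_interval_iff_modulus by blast
    have "\<delta> > 0" by (rule AC_modulus_pos[OF \<delta>])
    have Nnull: "N \<in> null_sets lebesgue" using N by (simp add: negligible_iff_null_sets)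
    then obtain T where T: "open T" "N \<subseteq> T" "(T - N) \<in> lmeasurable" "emeasure lebesgue (T - N) < ennreal \<delta>"
      using sets_lebesgue_outer_open[of N \<delta>] \<open>\<delta> > 0\<close> by blast
    have Tm: "T \<in> lmeasurable" "measure lebesgue T < \<delta>"
    proof -
      have eq: "T = (T - N) \<union> N" using T by auto
      have Nm: "N \<in> lmeasurable" using N by (rule negligible_imp_measurable)
      show "T \<in> lmeasurable" by (subst eq) (intro fmeasurable.Un T Nm)
      have "measure lebesgue T = measure lebesgue (T - N)"
        using Nnull T \<open>T \<in> lmeasurable\<close> by (metis measure_Diff_null_set fmeasurableD)
      also have "\<dots> < \<delta>"
        using T(3,4) \<open>\<delta> > 0\<close> by (simp add: emeasure_eq_measure2 ennreal_less_iff)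
      finally show "measure lebesgue T < \<delta>" .
    qed
    have "\<forall>x. \<exists>r>0. x \<in> N \<longrightarrow> ball x r \<subseteq> T"
      using T(1,2) by (meson open_contains_ball subsetD zero_less_one)
    from choice[OF this] obtain r where r: "\<And>x. 0 < r x" "\<And>x. x \<in> N \<Longrightarrow> ball x (r x) \<subseteq> T"
      by blast
    define \<gamma> where "\<gamma> x = ball x (if x \<in> N then r x else d x)" for x
    have gauge: "gauge \<gamma>" unfolding \<gamma>_def by (rule gauge_ball_dependent) (use r d in auto)
    have bound: "norm ((\<Sum>(x,k)\<in>p. measure lborel k *\<^sub>R w x) - (u b - u a)) < e"
      if p: "p tagged_division_of {a..b}" and fine: "\<gamma> fine p" for p
    proof -
      have fin: "finite p" using p by blast
      define S where "S = {(x,K) \<in> p. x \<in> N}"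
      define S' where "S' = p - S"
      have "S \<subseteq> p" by (auto simp: S_def)
      then have pS: "p = S \<union> S'" "S \<inter> S' = {}" "finite S" "finite S'"
        using fin finite_subset by (auto simp: S'_def)
      have K: "\<exists>l h. l \<le> h \<and> K = {l..h} \<and> a \<le> l \<and> h \<le> b \<and> x \<in> K \<and> K \<subseteq> \<gamma> x \<and> Inf K = l \<and> Sup K = h
          \<and> measure lborel K = h - l" if "(x,K) \<in> p" for x K
      proof -
        note td = tagged_division_ofD(2-4)[OF p that]
        have "x \<in> K" "K \<subseteq> {a..b}" by (rule td)+
        obtain l h where lh: "K = cbox l h" using td(3) by (elim exE)
        have "l \<le> h" using \<open>x \<in> K\<close> lh by auto
        have "K \<subseteq> \<gamma> x" using fineD[OF fine that] .
        moreover have "a \<le> l" "h \<le> b" using \<open>K \<subseteq> {a..b}\<close> \<open>l \<le> h\<close> by (auto simp: lh)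
        ultimately show ?thesis using \<open>x \<in> K\<close> \<open>l \<le> h\<close>
          by (intro exI[of _ l] exI[of _ h]) (simp add: lh)
      qed
      let ?g = "\<lambda>(x,K). measure lborel K *\<^sub>R w x - (u (Sup K) - u (Inf K))"
      have "(\<Sum>(x,k)\<in>p. measure lborel k *\<^sub>R w x) - (u b - u a) = sum ?g p"
        using additive_tagged_division_1[OF \<open>a \<le> b\<close> p, of u]
        by (simp add: split_def sum_subtractf)
      also have "\<dots> = sum ?g S + sum ?g S'"
        using pS sum.union_disjoint[of S S' ?g] by simp
      finally have eq: "(\<Sum>(x,k)\<in>p. measure lborel k *\<^sub>R w x) - (u b - u a) = sum ?g S + sum ?g S'" .
      have "norm (sum ?g S') \<le> (\<Sum>(x,K)\<in>S'. c * (Sup K - Inf K))"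
      proof (rule sum_norm_le, clarify)
        fix x K assume xK: "(x,K) \<in> S'"
        then have xp: "(x,K) \<in> p" and xN: "x \<notin> N" by (auto simp: S_def S'_def)
        obtain l h where lh: "l \<le> h" "K = {l..h}" "a \<le> l" "h \<le> b" "x \<in> K" "K \<subseteq> \<gamma> x"
            "Inf K = l" "Sup K = h" "measure lborel K = h - l"
          using K[OF xp] by blast
        have \<gamma>: "l \<in> \<gamma> x" "h \<in> \<gamma> x" using lh by auto
        then have near: "norm (l - x) < d x" "norm (h - x) < d x"
          using xN by (auto simp: \<gamma>_def dist_real_def)
        have xab: "x \<in> {a..b} - N" using xN lh by auto
        have "norm (measure lborel K *\<^sub>R w x - (u h - u l))
            = norm ((u l - u x - (l - x) *\<^sub>R v x) - (u h - u x - (h - x) *\<^sub>R v x))"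
          unfolding lh(9) using xN by (simp add: w_def algebra_simps)
        also have "\<dots> \<le> c * norm (l - x) + c * norm (h - x)"
          using d(2)[OF xab _ near(1)] d(2)[OF xab _ near(2)] lh norm_triangle_ineq4
          by (smt (verit, best) atLeastAtMost_iff)
        also have "\<dots> = c * (h - l)" using lh(2,5) by (auto simp: algebra_simps)
        finally show "norm (measure lborel K *\<^sub>R w x - (u (Sup K) - u (Inf K))) \<le> c * (Sup K - Inf K)"
          using lh by simp
      qed
      also have "\<dots> \<le> (\<Sum>(x,K)\<in>p. c * (Sup K - Inf K))"
        using \<open>c > 0\<close> pS fin by (intro sum_mono2) (auto dest!: K simp: S'_def)
      also have "\<dots> = c * (b - a)"
        using additive_tagged_division_1[OF \<open>a \<le> b\<close> p, of "\<lambda>x. x"]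
        by (simp add: split_def sum_distrib_left[symmetric])
      finally have 1: "norm (sum ?g S') < e / 2" using cle by linarith
      obtain h where h: "bij_betw h {0..<card S} S" using ex_bij_betw_nat_finite[OF pS(3)] by blast
      define m where "m = card S"
      have h: "bij_betw h {..<m} S" using h by (simp add: m_def atLeast0LessThan)
      define A where "A i = Inf (snd (h i))" for i
      define B where "B i = Sup (snd (h i))" for i
      have hS: "h i \<in> S" if "i < m" for i using h that by (auto simp: bij_betw_def)
      have hK: "snd (h i) = {A i..B i} \<and> A i \<le> B i \<and> a \<le> A i \<and> B i \<le> b \<and> {A i..B i} \<subseteq> T" if "i < m" for i
      proof -
        obtain x K' where xK: "h i = (x,K')" by (cases "h i")
        then have xp: "(x,K') \<in> p" and xN: "x \<in> N" using hS[OF that] by (auto simp: S_def)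
        obtain l r' where lh: "l \<le> r'" "K' = {l..r'}" "a \<le> l" "r' \<le> b" "x \<in> K'" "K' \<subseteq> \<gamma> x"
            "Inf K' = l" "Sup K' = r'" using K[OF xp] by blast
        have "\<gamma> x \<subseteq> T" using xN r(2) by (simp add: \<gamma>_def)
        then show ?thesis using lh xK by (auto simp: A_def B_def)
      qed
      have disj: "{A i<..<B i} \<inter> {A k<..<B k} = {}" if "i < m" "k < m" "i \<noteq> k" for i k
      proof -
        have "h i \<noteq> h k" using h that by (auto simp: bij_betw_def inj_on_def)
        moreover have "h i \<in> p" "h k \<in> p" using hS that \<open>S \<subseteq> p\<close> by blast+
        ultimately have "interior (snd (h i)) \<inter> interior (snd (h k)) = {}"
          using tagged_division_ofD(5)[OF p, of "fst (h i)" "snd (h i)" "fst (h k)" "snd (h k)"]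
          by auto
        then show ?thesis using hK[OF that(1)] hK[OF that(2)] by simp
      qed
      have "(\<Sum>i<m. B i - A i) = (\<Sum>i<m. measure lebesgue {A i<..<B i})"
        by (intro sum.cong) (use hK in auto)
      also have "\<dots> = measure lebesgue (\<Union>i<m. {A i<..<B i})"
        by (rule measure_negligible_finite_Union_image[symmetric])
           (use disj in \<open>auto simp: pairwise_def\<close>)
      also have "\<dots> \<le> measure lebesgue T"
      proof (rule measure_mono_fmeasurable)
        show "(\<Union>i<m. {A i<..<B i}) \<subseteq> T"
          using hK by fastforce
      qed (use Tm in auto)
      also have "\<dots> < \<delta>" by (rule Tm)
      finally have "(\<Sum>i<m. norm (u (B i) - u (A i))) < e / 2"
        by (intro AC_modulusD[OF \<delta>] disj) (use hK in auto)
      moreover have "norm (sum ?g S) \<le> (\<Sum>i<m. norm (u (B i) - u (A i)))"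
      proof -
        have "sum ?g S = (\<Sum>i<m. ?g (h i))"
          using sum.reindex_bij_betw[OF h, of ?g] by simp
        also have "\<dots> = (\<Sum>i<m. - (u (B i) - u (A i)))"
        proof (rule sum.cong)
          fix i assume "i \<in> {..<m}"
          then have "fst (h i) \<in> N" using hS[of i] by (simp add: S_def split_def)
          then show "?g (h i) = - (u (B i) - u (A i))"
            by (simp add: split_def w_def A_def B_def)
        qed simp
        also have "norm \<dots> \<le> (\<Sum>i<m. norm (u (B i) - u (A i)))"
          by (rule sum_norm_le) (simp add: norm_minus_commute)
        finally show ?thesis .
      qed
      ultimately show ?thesis
        unfolding eq using 1 norm_triangle_ineq[of "sum ?g S" "sum ?g S'"] by linarith
    qed
    show "\<exists>\<gamma>. gauge \<gamma> \<and> (\<forall>p. p tagged_division_of {a..b} \<and> \<gamma> fine p \<longrightarrow>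
        norm ((\<Sum>(x,k)\<in>p. measure lborel k *\<^sub>R w x) - (u b - u a)) < e)"
      by (intro exI[of _ \<gamma>] conjI gauge allI impI bound) simp_all
  qed
  then show ?thesis
    by (rule has_integral_spike[OF N, rotated]) (simp add: w_def)
qed

text \<open>Membership in the Sobolev class \<open>W\<^sup>1\<^sup>,\<^sup>1\<close> on bounded intervals, with weak derivative \<open>v\<close>.\<close>

definition AC_deriv :: "(real \<Rightarrow> 'a::real_normed_vector) \<Rightarrow> (real \<Rightarrow> 'a) \<Rightarrow> bool" where
  "AC_deriv u v \<longleftrightarrow> AC_loc u \<and> ae_derivative u v"

lemma AC_interval_subset:
  assumes "absolutely_continuous_on_interval c d u" "c \<le> a" "b \<le> d"
  shows "absolutely_continuous_on_interval a b u"
  unfolding AC_interval_iff_modulus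
proof (intro allI impI)
  fix e :: real assume "e > 0"
  then obtain \<delta> where \<delta>: "AC_modulus c d u e \<delta>"
    using assms(1) unfolding AC_interval_iff_modulus by blast
  have "AC_modulus a b u e \<delta>"
    by (intro AC_modulusI AC_modulus_pos[OF \<delta>] AC_modulusD[OF \<delta>]) (use assms in force)+
  then show "\<exists>\<delta>. AC_modulus a b u e \<delta>" ..
qed

lemma AC_interval_continuous:
  assumes "absolutely_continuous_on_interval c d u"
  shows "continuous_on {c..d} u"
  unfolding continuous_on_iff
proof (intro ballI allI impI)
  fix x e :: real assume x: "x \<in> {c..d}" and "e > 0"
  obtain \<delta> where \<delta>: "AC_modulus c d u e \<delta>"
      using assms \<open>e > 0\<close> unfolding AC_interval_iff_modulus by blast
    have "\<delta> > 0" by (rule AC_modulus_pos[OF \<delta>])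
  have "dist (u y) (u x) < e" if "y \<in> {c..d}" "dist y x < \<delta>" for y
    using AC_modulusD[OF \<delta>, of 1 "\<lambda>_. min x y" "\<lambda>_. max x y"] that x
    by (cases "x \<le> y") (auto simp: dist_norm norm_minus_commute)
  then show "\<exists>\<delta>>0. \<forall>y\<in>{c..d}. dist y x < \<delta> \<longrightarrow> dist (u y) (u x) < e"
    by (intro exI[of _ \<delta>] conjI \<open>\<delta> > 0\<close> ballI impI)
qed

lemma AC_loc_continuous:
  assumes "AC_loc u"
  shows "continuous_on {0..} u"
  unfolding continuous_on_eq_continuous_within
proof
  fix x :: real assume x: "x \<in> {0..}"
  have "continuous_on {0..x+1} u"
    by (rule AC_interval_continuous) (use assms x in \<open>simp add: AC_loc_def\<close>)
  then have "continuous (at x within {0..x+1}) u"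
    using x by (simp add: continuous_on_eq_continuous_within)
  moreover have "at x within {0..x+1} = at x within {0..}"
    by (rule at_within_nhd[of _ "{..<x+1}"]) (use x in auto)
  ultimately show "continuous (at x within {0..}) u" by simp
qed

lemma AC_deriv_integral:
  fixes u :: "real \<Rightarrow> 'a::banach"
  assumes "AC_deriv u v" "0 \<le> a" "a \<le> b"
  shows "(v has_integral (u b - u a)) {a..b}"
proof (rule AC_fundamental_theorem)
  show "absolutely_continuous_on_interval a b u"
    using assms AC_interval_subset[of 0 b u a b] by (auto simp: AC_deriv_def AC_loc_def)
  show "negligible {t. 0 \<le> t \<and> \<not> (u has_vector_derivative v t) (at t within {0..})}"
    using assms(1) by (simp add: AC_deriv_def ae_derivative_def AE_half_line_iff)
  show "(u has_vector_derivative v t) (at t within {a..b})"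
    if "t \<in> {a..b} - {t. 0 \<le> t \<and> \<not> (u has_vector_derivative v t) (at t within {0..})}" for t
    using that assms by (auto intro: has_vector_derivative_within_subset[where S = "{0..}"])
qed fact

lemma ae_derivative_cong:
  assumes "ae_derivative u v" "AE t in half_line. v t = w t"
  shows "ae_derivative u w"
  using assms unfolding ae_derivative_def by eventually_elim simp

lemma AC_deriv_cong_AE:
  assumes "AC_deriv u v" "AE t in half_line. v t = w t"
  shows "AC_deriv u w"
  using assms ae_derivative_cong by (auto simp: AC_deriv_def)

lemma AE_half_line_nonneg: "AE t in half_line. 0 \<le> t"
  by (simp add: AE_half_line_iff)

lemma AC_deriv_cong:
  assumes "AC_deriv u v" "\<And>t. 0 \<le> t \<Longrightarrow> u t = w t"
  shows "AC_deriv w v"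
  unfolding AC_deriv_def
proof
  have "absolutely_continuous_on_interval 0 d w" if AC: "absolutely_continuous_on_interval 0 d u" for d
    unfolding AC_interval_iff_modulus
  proof (intro allI impI)
    fix e :: real assume "e > 0"
    obtain \<delta> where \<delta>: "AC_modulus 0 d u e \<delta>"
      using AC \<open>e > 0\<close> unfolding AC_interval_iff_modulus by blast
    have "\<delta> > 0" by (rule AC_modulus_pos[OF \<delta>])
    have "AC_modulus 0 d w e \<delta>"
    proof (intro AC_modulusI AC_modulus_pos[OF \<delta>])
      fix m :: nat and a b
      assume ab: "\<And>i. i < m \<Longrightarrow> 0 \<le> a i \<and> a i \<le> b i \<and> b i \<le> d"
        and *: "\<And>i k. i < m \<Longrightarrow> k < m \<Longrightarrow> i \<noteq> k \<Longrightarrow> {a i<..<b i} \<inter> {a k<..<b k} = {}"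
          "(\<Sum>i<m. b i - a i) < \<delta>"
      have "(\<Sum>i<m. norm (w (b i) - w (a i))) = (\<Sum>i<m. norm (u (b i) - u (a i)))"
      proof (intro sum.cong refl)
        fix i assume "i \<in> {..<m}"
        then have "0 \<le> a i" "0 \<le> b i" using ab by force+
        then show "norm (w (b i) - w (a i)) = norm (u (b i) - u (a i))" by (simp add: assms(2))
      qed
      then show "(\<Sum>i<m. norm (w (b i) - w (a i))) < e"
        using AC_modulusD[OF \<delta> ab *] by simp
    qed
    then show "\<exists>\<delta>. AC_modulus 0 d w e \<delta>" ..
  qed
  then show "AC_loc w" using assms(1) by (auto simp: AC_deriv_def AC_loc_def)
  have "AE t in half_line. (u has_vector_derivative v t) (at t within {0..})"
    using assms(1) by (simp add: AC_deriv_def ae_derivative_def)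
  then show "ae_derivative w v"
    unfolding ae_derivative_def using AE_half_line_nonneg
    by eventually_elim
      (rule has_vector_derivative_transform[where f = u], auto simp: assms(2))
qed

lemma AC_deriv_const: "AC_deriv (\<lambda>_. c) (\<lambda>_. 0)"
  by (auto simp: AC_deriv_def AC_loc_def absolutely_continuous_on_interval_def ae_derivative_def
      intro!: exI[of _ 1])

lemma AC_deriv_bilinear:
  fixes prod :: "'a::real_normed_vector \<Rightarrow> 'b::real_normed_vector \<Rightarrow> 'c::real_normed_vector"
  assumes "bounded_bilinear prod" and u: "AC_deriv u u'" and w: "AC_deriv w w'"
  shows "AC_deriv (\<lambda>t. prod (u t) (w t)) (\<lambda>t. prod (u t) (w' t) + prod (u' t) (w t))"
  unfolding AC_deriv_def
proof
  interpret bounded_bilinear prod by fact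
  obtain K where K: "K > 0" "\<And>a b. norm (prod a b) \<le> norm a * norm b * K"
    using pos_bounded by blast
  show "AC_loc (\<lambda>t. prod (u t) (w t))"
    unfolding AC_loc_def
  proof (intro allI impI)
    fix d :: real assume "0 \<le> d"
    have au: "absolutely_continuous_on_interval 0 d u" and aw: "absolutely_continuous_on_interval 0 d w"
      using u w \<open>0 \<le> d\<close> by (auto simp: AC_deriv_def AC_loc_def)
    have "bounded (u ` {0..d})" "bounded (w ` {0..d})"
      using AC_interval_continuous[OF au] AC_interval_continuous[OF aw]
      by (auto intro!: compact_imp_bounded compact_continuous_image)
    then obtain B C where B: "\<And>t. t \<in> {0..d} \<Longrightarrow> norm (u t) \<le> B"
      and C: "\<And>t. t \<in> {0..d} \<Longrightarrow> norm (w t) \<le> C"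
      unfolding bounded_iff by (metis image_eqI)
    define M where "M = K * (\<bar>B\<bar> + \<bar>C\<bar> + 1)"
    have "M > 0" using K(1) by (auto simp: M_def intro!: mult_pos_pos)
    have step: "norm (prod (u b) (w b) - prod (u a) (w a)) \<le> M * norm (u b - u a) + M * norm (w b - w a)"
      if "a \<in> {0..d}" "b \<in> {0..d}" for a b
    proof -
      have "prod (u b) (w b) - prod (u a) (w a) = prod (u b - u a) (w b) + prod (u a) (w b - w a)"
        by (simp add: diff_left diff_right)
      also have "norm \<dots> \<le> norm (u b - u a) * norm (w b) * K + norm (u a) * norm (w b - w a) * K"
        by (intro order_trans[OF norm_triangle_ineq] add_mono K)
      also have "\<dots> \<le> norm (u b - u a) * (\<bar>B\<bar> + \<bar>C\<bar> + 1) * K + (\<bar>B\<bar> + \<bar>C\<bar> + 1) * norm (w b - w a) * K"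
        using B[OF that(1)] C[OF that(2)] K(1) by (intro add_mono mult_right_mono mult_left_mono) auto
      finally show ?thesis by (simp add: M_def algebra_simps)
    qed
    show "absolutely_continuous_on_interval 0 d (\<lambda>t. prod (u t) (w t))"
      unfolding AC_interval_iff_modulus
    proof (intro allI impI)
      fix e :: real assume "e > 0"
      define \<epsilon> where "\<epsilon> = e / (2 * M)"
      have "\<epsilon> > 0" using \<open>e > 0\<close> \<open>M > 0\<close> by (simp add: \<epsilon>_def)
      obtain \<delta> where \<delta>: "AC_modulus 0 d u \<epsilon> \<delta>"
      using au \<open>\<epsilon> > 0\<close> unfolding AC_interval_iff_modulus by blast
    have "\<delta> > 0" by (rule AC_modulus_pos[OF \<delta>])
      obtain \<eta> where \<eta>: "AC_modulus 0 d w \<epsilon> \<eta>"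
      using aw \<open>\<epsilon> > 0\<close> unfolding AC_interval_iff_modulus by blast
    have "\<eta> > 0" by (rule AC_modulus_pos[OF \<eta>])
      have "AC_modulus 0 d (\<lambda>t. prod (u (t)) (w (t))) e (min \<delta> \<eta>)"
      proof (intro AC_modulusI)
        fix m :: nat and a b
        assume ab: "\<And>i. i < m \<Longrightarrow> 0 \<le> a i \<and> a i \<le> b i \<and> b i \<le> d"
        "\<And>i k. i < m \<Longrightarrow> k < m \<Longrightarrow> i \<noteq> k \<Longrightarrow> {a i<..<b i} \<inter> {a k<..<b k} = {}"
        "(\<Sum>i<m. b i - a i) < min \<delta> \<eta>"
        note \<delta>' = AC_modulusD[OF \<delta> ab(1,2)]
        note \<eta>' = AC_modulusD[OF \<eta> ab(1,2)]
        have "(\<Sum>i<m. norm (prod (u (b i)) (w (b i)) - prod (u (a i)) (w (a i))))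
            \<le> (\<Sum>i<m. M * norm (u (b i) - u (a i)) + M * norm (w (b i) - w (a i)))"
          by (intro sum_mono step) (use ab(1) in force)+
        also have "\<dots> = M * (\<Sum>i<m. norm (u (b i) - u (a i))) + M * (\<Sum>i<m. norm (w (b i) - w (a i)))"
          by (simp add: sum.distrib sum_distrib_left)
        also have "\<dots> < M * \<epsilon> + M * \<epsilon>"
          using ab(3) \<delta>' \<eta>' \<open>M > 0\<close> by (intro add_strict_mono mult_strict_left_mono) auto
        also have "\<dots> = e" using \<open>M > 0\<close> by (simp add: \<epsilon>_def field_simps)
        finally show "(\<Sum>i<m. norm (prod (u (b i)) (w (b i)) - prod (u (a i)) (w (a i)))) < e" .
      qed (simp add: \<open>\<delta> > 0\<close> \<open>\<eta> > 0\<close>)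
      then show "\<exists>\<delta>. AC_modulus 0 d (\<lambda>t. prod (u t) (w t)) e \<delta>" ..
    qed
  qed
  have "AE t in half_line. (u has_vector_derivative u' t) (at t within {0..})"
    "AE t in half_line. (w has_vector_derivative w' t) (at t within {0..})"
    using u w by (simp_all add: AC_deriv_def ae_derivative_def)
  then show "ae_derivative (\<lambda>t. prod (u t) (w t)) (\<lambda>t. prod (u t) (w' t) + prod (u' t) (w t))"
    unfolding ae_derivative_def
    by eventually_elim (rule has_vector_derivative)
qed

lemma AC_deriv_linear:
  assumes "bounded_linear f" "AC_deriv u v"
  shows "AC_deriv (\<lambda>t. f (u t)) (\<lambda>t. f (v t))"
proof -
  interpret bounded_linear f by fact
  have "bounded_bilinear (\<lambda>(r::real) x. r *\<^sub>R f x)"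
    by (rule bounded_bilinear.comp[OF bounded_bilinear_scaleR bounded_linear_ident assms(1)])
  from AC_deriv_bilinear[OF this AC_deriv_const[of 1] assms(2)] show ?thesis
    by simp
qed

lemma AC_deriv_Pair:
  fixes u :: "real \<Rightarrow> 'a::real_normed_vector" and w :: "real \<Rightarrow> 'b::real_normed_vector"
  assumes u: "AC_deriv u u'" and w: "AC_deriv w w'"
  shows "AC_deriv (\<lambda>t. (u t, w t)) (\<lambda>t. (u' t, w' t))"
  unfolding AC_deriv_def
proof
  show "AC_loc (\<lambda>t. (u t, w t))"
    unfolding AC_loc_def AC_interval_iff_modulus
  proof (intro allI impI)
    fix d e :: real assume "0 \<le> d" "e > 0"
    have au: "absolutely_continuous_on_interval 0 d u" and aw: "absolutely_continuous_on_interval 0 d w"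
      using u w \<open>0 \<le> d\<close> by (auto simp: AC_deriv_def AC_loc_def)
    have "e / 2 > 0" using \<open>e > 0\<close> by simp
    obtain \<delta> where \<delta>: "AC_modulus 0 d u (e / 2) \<delta>"
      using au \<open>e / 2 > 0\<close> unfolding AC_interval_iff_modulus by blast
    have "\<delta> > 0" by (rule AC_modulus_pos[OF \<delta>])
    obtain \<eta> where \<eta>: "AC_modulus 0 d w (e / 2) \<eta>"
      using aw \<open>e / 2 > 0\<close> unfolding AC_interval_iff_modulus by blast
    have "\<eta> > 0" by (rule AC_modulus_pos[OF \<eta>])
    have "AC_modulus 0 d (\<lambda>t. (u (t), w (t))) e (min \<delta> \<eta>)"
    proof (intro AC_modulusI)
      fix m :: nat and a b
      assume ab: "\<And>i. i < m \<Longrightarrow> 0 \<le> a i \<and> a i \<le> b i \<and> b i \<le> d"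
        "\<And>i k. i < m \<Longrightarrow> k < m \<Longrightarrow> i \<noteq> k \<Longrightarrow> {a i<..<b i} \<inter> {a k<..<b k} = {}"
        "(\<Sum>i<m. b i - a i) < min \<delta> \<eta>"
      note \<delta>' = AC_modulusD[OF \<delta> ab(1,2)]
      note \<eta>' = AC_modulusD[OF \<eta> ab(1,2)]
      have "(\<Sum>i<m. norm ((u (b i), w (b i)) - (u (a i), w (a i))))
          \<le> (\<Sum>i<m. norm (u (b i) - u (a i)) + norm (w (b i) - w (a i)))"
        by (intro sum_mono) (simp add: norm_Pair_le)
      also have "\<dots> < e / 2 + e / 2"
        unfolding sum.distrib
        using ab(3) \<delta>' \<eta>' by (intro add_strict_mono) auto
      finally show "(\<Sum>i<m. norm ((u (b i), w (b i)) - (u (a i), w (a i)))) < e" by simp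
    qed (simp add: \<open>\<delta> > 0\<close> \<open>\<eta> > 0\<close>)
    then show "\<exists>\<delta>. AC_modulus 0 d (\<lambda>t. (u t, w t)) e \<delta>" ..
  qed
  have "AE t in half_line. (u has_vector_derivative u' t) (at t within {0..})"
    "AE t in half_line. (w has_vector_derivative w' t) (at t within {0..})"
    using u w by (simp_all add: AC_deriv_def ae_derivative_def)
  then show "ae_derivative (\<lambda>t. (u t, w t)) (\<lambda>t. (u' t, w' t))"
    unfolding ae_derivative_def
    by eventually_elim (auto intro: has_vector_derivative_Pair)
qed

lemma AC_deriv_add:
  assumes "AC_deriv u u'" "AC_deriv w w'"
  shows "AC_deriv (\<lambda>t. u t + w t) (\<lambda>t. u' t + w' t)"
  using AC_deriv_linear[OF bounded_linear_add[OF bounded_linear_fst bounded_linear_snd]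
      AC_deriv_Pair[OF assms]] by simp

lemma L1_loc_add: "L1_loc f \<Longrightarrow> L1_loc g \<Longrightarrow> L1_loc (\<lambda>t. f t + g t)"
  by (auto simp: L1_loc_def intro: set_integral_add)

lemma L1_loc_linear:
  assumes "bounded_linear f" "L1_loc g" shows "L1_loc (\<lambda>t. f (g t))"
  using assms absolutely_integrable_linear[where f = g and h = f] by (auto simp: L1_loc_def o_def)

lemma L1_loc_continuous: "continuous_on {0..} f \<Longrightarrow> L1_loc f"
  unfolding L1_loc_def by (auto intro!: absolutely_integrable_continuous_real elim: continuous_on_subset)

lemma L1_loc_bilinear:
  fixes prod :: "'a::euclidean_space \<Rightarrow> 'b::euclidean_space \<Rightarrow> 'c::euclidean_space"
  assumes "bounded_bilinear prod" "continuous_on {0..} f" "L1_loc g"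
  shows "L1_loc (\<lambda>t. prod (f t) (g t))"
  unfolding L1_loc_def
proof (intro allI impI)
  fix d :: real assume "0 \<le> d"
  have c: "continuous_on {0..d} f" using assms(2) by (rule continuous_on_subset) auto
  show "(\<lambda>t. prod (f t) (g t)) absolutely_integrable_on {0..d}"
  proof (rule absolutely_integrable_bounded_measurable_product[where h = prod])
    show "bilinear prod" using assms(1) bilinear_conv_bounded_bilinear by blast
    show "f \<in> borel_measurable (lebesgue_on {0..d})"
      using c by (intro continuous_imp_measurable_on_sets_lebesgue) auto
    show "bounded (f ` {0..d})" using c by (auto intro!: compact_imp_bounded compact_continuous_image)
    show "g absolutely_integrable_on {0..d}" using assms(3) \<open>0 \<le> d\<close> by (simp add: L1_loc_def)
  qed auto
qed

lemma L1_loc_bilinear':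
  fixes prod :: "'a::euclidean_space \<Rightarrow> 'b::euclidean_space \<Rightarrow> 'c::euclidean_space"
  assumes "bounded_bilinear prod" "L1_loc f" "continuous_on {0..} g"
  shows "L1_loc (\<lambda>t. prod (f t) (g t))"
  using L1_loc_bilinear[OF bounded_bilinear.flip[OF assms(1)] assms(3,2)] .

lemma L1_loc_norm: "L1_loc f \<Longrightarrow> L1_loc (\<lambda>t. norm (f t))"
  by (simp add: L1_loc_def absolutely_integrable_norm[unfolded o_def])

lemma L1_loc_integrable:
  assumes "L1_loc f" "0 \<le> a" shows "f integrable_on {a..b}"
proof -
  have "f integrable_on {0..max a b}" by (rule set_lebesgue_integral_eq_integral(1)) (use assms in \<open>simp add: L1_loc_def\<close>)
  then show ?thesis by (rule integrable_on_subinterval) (use assms in auto)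
qed

text \<open>Truncating the norm of \<open>q\<close> at a large \<open>n\<close> leaves a remainder of small integral; over a set of
measure \<open>\<delta>\<close> the truncated part contributes at most \<open>n \<delta>\<close>.\<close>

lemma AC_loc_indefinite_integral:
  fixes q :: "real \<Rightarrow> 'a::euclidean_space"
  assumes "L1_loc q"
  shows "AC_loc (\<lambda>x. c + integral {0..x} q)"
  unfolding AC_loc_def AC_interval_iff_modulus
proof (intro allI impI)
  fix d e :: real assume "0 \<le> d" "e > 0"
  have q: "q absolutely_integrable_on {0..d}" using assms \<open>0 \<le> d\<close> by (simp add: L1_loc_def)
  define f where "f x = indicator {0..d} x * norm (q x)" for x
  have f: "integrable lebesgue f"
    using absolutely_integrable_norm[OF q] by (simp add: set_integrable_def f_def[abs_def] o_def)
  have f0: "f x \<ge> 0" for x by (simp add: f_def)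
  note [measurable] = borel_measurable_integrable[OF f]
  define g where "g n x = f x - min (f x) (real n)" for n x
  have "(\<lambda>n. integral\<^sup>L lebesgue (g n)) \<longlonglongrightarrow> integral\<^sup>L lebesgue (\<lambda>_::real. 0 :: real)"
  proof (rule Bochner_Integration.integral_dominated_convergence[where w = f])
    show "AE x in lebesgue. (\<lambda>n. g n x) \<longlonglongrightarrow> 0"
    proof (rule AE_I2)
      fix x
      obtain N :: nat where N: "f x \<le> real N" using real_arch_simple by blast
      have "eventually (\<lambda>n. g n x = 0) sequentially"
        using eventually_ge_at_top[of N] by eventually_elim (use N in \<open>auto simp: g_def\<close>)
      then show "(\<lambda>n. g n x) \<longlonglongrightarrow> 0" by (rule tendsto_eventually)
    qed
    show "AE x in lebesgue. norm (g n x) \<le> f x" for n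
      by (rule AE_I2) (use f0 in \<open>auto simp: g_def min_def\<close>)
  qed (use f in \<open>auto simp: g_def[abs_def]\<close>)
  then have "eventually (\<lambda>n. integral\<^sup>L lebesgue (g n) < e / 2) sequentially"
    using \<open>e > 0\<close> by (intro order_tendstoD(2)) auto
  then obtain n where n: "integral\<^sup>L lebesgue (g n) < e / 2"
    by (auto simp: eventually_sequentially)
  have gn: "integrable lebesgue (g n)"
    by (rule Bochner_Integration.integrable_bound[OF f]) (use f0 in \<open>auto simp: g_def[abs_def] min_def\<close>)
  define \<delta> where "\<delta> = e / (2 * (real n + 1))"
  have "\<delta> > 0" using \<open>e > 0\<close> by (simp add: \<delta>_def)
  have "AC_modulus 0 d (\<lambda>x. c + integral {0..x} q) e \<delta>"
  proof (intro AC_modulusI \<open>\<delta> > 0\<close>)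
    fix m :: nat and a b
    assume ab: "\<And>i. i < m \<Longrightarrow> 0 \<le> a i \<and> a i \<le> b i \<and> b i \<le> d"
      and disj: "\<And>i k. i < m \<Longrightarrow> k < m \<Longrightarrow> i \<noteq> k \<Longrightarrow> {a i<..<b i} \<inter> {a k<..<b k} = {}"
      and len: "(\<Sum>i<m. b i - a i) < \<delta>"
    define ind where "ind i = (indicator {a i<..<b i} :: real \<Rightarrow> real)" for i
    have ind_int: "integrable lebesgue (\<lambda>x. ind i x * h x)" if "integrable lebesgue h" for i and h :: "real \<Rightarrow> real"
      using integrable_mult_indicator[OF _ that, of "{a i<..<b i}"] by (simp add: ind_def)
    have one: "norm (integral {0..b i} q - integral {0..a i} q)
        \<le> integral\<^sup>L lebesgue (\<lambda>x. ind i x * g n x) + real n * (b i - a i)" if i: "i < m" for i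
    proof -
      note abi = ab[OF i]
      have qi: "q absolutely_integrable_on {a i<..<b i}"
        by (rule set_integrable_subset[OF q]) (use abi in auto)
      have "q integrable_on {0..b i}"
        using assms abi by (intro L1_loc_integrable) auto
      then have "integral {0..b i} q - integral {0..a i} q = integral {a i..b i} q"
        using Henstock_Kurzweil_Integration.integral_combine[of 0 "a i" "b i" q] abi
        by (simp add: algebra_simps)
      also have "\<dots> = integral {a i<..<b i} q" by (rule integral_open_interval_real)
      also have "norm \<dots> \<le> integral {a i<..<b i} (\<lambda>x. norm (q x))"
        using qi by (intro Henstock_Kurzweil_Integration.integral_norm_bound_integral
            set_lebesgue_integral_eq_integral(1) absolutely_integrable_norm[unfolded o_def]) auto
      also have "\<dots> = (LINT x:{a i<..<b i}|lebesgue. norm (q x))"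
        using absolutely_integrable_norm[OF qi]
        by (simp add: set_lebesgue_integral_eq_integral(2) o_def)
      also have "\<dots> = integral\<^sup>L lebesgue (\<lambda>x. ind i x * f x)"
        unfolding set_lebesgue_integral_def using abi
        by (intro Bochner_Integration.integral_cong) (auto simp: ind_def f_def indicator_def)
      also have "\<dots> \<le> integral\<^sup>L lebesgue (\<lambda>x. ind i x * g n x + real n * ind i x)"
      proof (rule integral_mono)
        show "integrable lebesgue (\<lambda>x. ind i x * f x)" by (rule ind_int[OF f])
        show "integrable lebesgue (\<lambda>x. ind i x * g n x + real n * ind i x)"
          by (intro Bochner_Integration.integrable_add ind_int[OF gn] integrable_mult_right)
            (use lmeasurable_iff_integrable[of "{a i<..<b i}"] in \<open>simp add: ind_def[abs_def]\<close>)
        show "ind i x * f x \<le> ind i x * g n x + real n * ind i x" for x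
          by (auto simp: ind_def g_def indicator_def)
      qed
      also have "\<dots> = integral\<^sup>L lebesgue (\<lambda>x. ind i x * g n x) + real n * integral\<^sup>L lebesgue (ind i)"
        using lmeasurable_iff_integrable[of "{a i<..<b i}"]
        by (subst Bochner_Integration.integral_add[OF ind_int[OF gn]]) (auto simp: ind_def[abs_def])
      also have "integral\<^sup>L lebesgue (ind i) = b i - a i"
        using abi by (simp add: ind_def)
      finally show ?thesis .
    qed
    have "(\<Sum>i<m. norm ((c + integral {0..b i} q) - (c + integral {0..a i} q)))
        \<le> (\<Sum>i<m. integral\<^sup>L lebesgue (\<lambda>x. ind i x * g n x) + real n * (b i - a i))"
      by (intro sum_mono) (use one in simp)
    also have "\<dots> = integral\<^sup>L lebesgue (\<lambda>x. \<Sum>i<m. ind i x * g n x) + real n * (\<Sum>i<m. b i - a i)"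
      using ind_int[OF gn] by (simp add: sum.distrib sum_distrib_left Bochner_Integration.integral_sum)
    also have "integral\<^sup>L lebesgue (\<lambda>x. \<Sum>i<m. ind i x * g n x) \<le> integral\<^sup>L lebesgue (g n)"
    proof (rule integral_mono[OF _ gn])
      show "integrable lebesgue (\<lambda>x. \<Sum>i<m. ind i x * g n x)"
        by (intro Bochner_Integration.integrable_sum ind_int[OF gn])
      fix x
      have "(\<Sum>i<m. ind i x) = indicator (\<Union>i<m. {a i<..<b i}) x"
        unfolding ind_def by (rule indicator_UN_disjoint[symmetric]) (use disj in \<open>auto simp: disjoint_family_on_def\<close>)
      then have "(\<Sum>i<m. ind i x * g n x) = indicator (\<Union>i<m. {a i<..<b i}) x * g n x"
        by (simp add: sum_distrib_right[symmetric])
      also have "\<dots> \<le> g n x" by (auto simp: indicator_def g_def)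
      finally show "(\<Sum>i<m. ind i x * g n x) \<le> g n x" .
    qed
    also have "real n * (\<Sum>i<m. b i - a i) \<le> (real n + 1) * \<delta>"
      using len \<open>\<delta> > 0\<close> ab by (intro mult_mono) (auto intro!: sum_nonneg)
    also have "\<dots> = e / 2" by (simp add: \<delta>_def field_simps)
    finally show "(\<Sum>i<m. norm ((c + integral {0..b i} q) - (c + integral {0..a i} q))) < e"
      using n by simp
  qed
  then show "\<exists>\<delta>. AC_modulus 0 d (\<lambda>x. c + integral {0..x} q) e \<delta>" ..
qed

text \<open>A one-dimensional reading of the Lebesgue differentiation theorem for the gauge integral.\<close>

lemma right_difference_quotients_AE:
  fixes p :: "real \<Rightarrow> 'a::euclidean_space"
  assumes "\<And>a b. p integrable_on {a..b}"
  shows "\<exists>N. negligible N \<and> (\<forall>x e. x \<notin> N \<longrightarrow> 0 < e \<longrightarrow>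
      (\<exists>d>0. \<forall>h. 0 < h \<and> h < d \<longrightarrow> norm (integral {x..x + h} p /\<^sub>R h - p x) < e))"
proof (rule integrable_ccontinuous_explicit)
  show "p integrable_on cbox a b" for a b using assms by simp
next
  fix N assume "negligible N" and *: "\<And>x e. \<lbrakk>x \<notin> N; 0 < e\<rbrakk> \<Longrightarrow> \<exists>d>0. \<forall>h. 0 < h \<and> h < d \<longrightarrow>
      norm (integral (cbox x (x + h *\<^sub>R One)) p /\<^sub>R h ^ DIM(real) - p x) < e"
  show ?thesis
    by (intro exI[of _ N] conjI allI impI \<open>negligible N\<close>) (use * in simp)
qed

text \<open>Right difference quotients of \<open>q\<close> and of its reflection at the origin together give two-sided ones.\<close>

lemma ae_derivative_indefinite_integral:
  fixes q :: "real \<Rightarrow> 'a::euclidean_space"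
  assumes "L1_loc q"
  shows "ae_derivative (\<lambda>x. c + integral {0..x} q) q"
proof -
  define p where "p t = (if 0 \<le> t then q t else 0)" for t
  have p: "p integrable_on {a..b}" for a b
  proof -
    have "q integrable_on {0..max 0 b}" using assms by (rule L1_loc_integrable) simp
    then have "p integrable_on {0..max 0 b}"
      by (rule integrable_eq) (auto simp: p_def)
    moreover have "p integrable_on {min 0 a..0}"
      by (rule integrable_spike[where f = "\<lambda>_. 0" and S = "{0}"]) (simp_all add: p_def integrable_0)
    ultimately have "p integrable_on {min 0 a..max 0 b}"
      using Henstock_Kurzweil_Integration.integrable_combine[of "min 0 a" 0 "max 0 b" p] by simp
    then show ?thesis by (rule integrable_on_subinterval) simp
  qed
  have p': "(\<lambda>t. p (- t)) integrable_on {a..b}" for a b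
    using Henstock_Kurzweil_Integration.integrable_reflect_real[of p "-a" "-b"] p[of "-b" "-a"]
    by (simp only: minus_minus)
  define good where "good p N \<longleftrightarrow> (\<forall>x e. x \<notin> N \<longrightarrow> 0 < e \<longrightarrow>
      (\<exists>d>0. \<forall>h. 0 < h \<and> h < d \<longrightarrow> norm (integral {x..x + h} p /\<^sub>R h - p x) < e))"
    for p :: "real \<Rightarrow> 'a" and N
  have "\<exists>N. negligible N \<and> good p N" unfolding good_def by (rule right_difference_quotients_AE[OF p])
  then obtain N1 where N1: "negligible N1" "good p N1" by (elim exE conjE)
  have "\<exists>N. negligible N \<and> good (\<lambda>t. p (- t)) N" unfolding good_def by (rule right_difference_quotients_AE[OF p'])
  then obtain N2 where N2: "negligible N2" "good (\<lambda>t. p (- t)) N2" by (elim exE conjE)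
  have neg: "negligible (N1 \<union> uminus ` N2)"
    by (intro negligible_Un N1(1) negligible_differentiable_image_negligible[OF _ N2(1)])
      (simp_all add: differentiable_on_minus)
  have "((\<lambda>x. c + integral {0..x} q) has_vector_derivative q t) (at t within {0..})"
    if t: "0 \<le> t" "t \<notin> N1 \<union> uminus ` N2" for t
    unfolding has_vector_derivative_def has_derivative_within_alt
  proof (intro conjI allI impI bounded_linear_scaleR_left)
    fix e :: real assume "e > 0"
    have "t \<in> uminus ` N2" if "- t \<in> N2" using that by (rule rev_image_eqI) simp
    then have tN: "t \<notin> N1" "- t \<notin> N2" using t(2) by blast+
    obtain d1 where d1: "d1 > 0"
      "\<And>h. 0 < h \<Longrightarrow> h < d1 \<Longrightarrow> norm (integral {t..t + h} p /\<^sub>R h - p t) < e"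
      using N1(2)[unfolded good_def, rule_format, OF tN(1) \<open>e > 0\<close>] by blast
    obtain d2 where d2: "d2 > 0"
      "\<And>h. 0 < h \<Longrightarrow> h < d2 \<Longrightarrow> norm (integral {-t..-t + h} (\<lambda>t. p (- t)) /\<^sub>R h - p t) < e"
      using N2(2)[unfolded good_def, rule_format, OF tN(2) \<open>e > 0\<close>] unfolding minus_minus by blast
    have comb: "integral {0..b} q - integral {0..a} q = integral {a..b} p" if "0 \<le> a" "a \<le> b" for a b
    proof -
      have "integral {0..b} q - integral {0..a} q = integral {a..b} q"
        using Henstock_Kurzweil_Integration.integral_combine[of 0 a b q] that
          L1_loc_integrable[OF assms, of 0 b] by (simp add: algebra_simps)
      also have "\<dots> = integral {a..b} p"
        by (rule Henstock_Kurzweil_Integration.integral_cong) (use that in \<open>auto simp: p_def\<close>)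
      finally show ?thesis .
    qed
    have scale: "norm (I - h *\<^sub>R w) \<le> e * h" if "norm (I /\<^sub>R h - w) < e" "h > 0" for I w :: 'a and h
    proof -
      have "norm (I - h *\<^sub>R w) = norm (h *\<^sub>R (I /\<^sub>R h - w))"
        using that(2) by (simp add: algebra_simps)
      also have "\<dots> = h * norm (I /\<^sub>R h - w)" using that(2) by simp
      also have "\<dots> \<le> h * e" using that by (intro mult_left_mono) auto
      finally show ?thesis by (simp add: mult.commute)
    qed
    show "\<exists>d>0. \<forall>y\<in>{0..}. norm (y - t) < d \<longrightarrow>
        norm ((c + integral {0..y} q) - (c + integral {0..t} q) - (y - t) *\<^sub>R q t) \<le> e * norm (y - t)"
    proof (intro exI[of _ "min d1 d2"] conjI ballI impI)
      fix y :: real assume y: "y \<in> {0..}" "norm (y - t) < min d1 d2"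
      consider "y = t" | "y > t" | "y < t" by linarith
      then show "norm ((c + integral {0..y} q) - (c + integral {0..t} q) - (y - t) *\<^sub>R q t) \<le> e * norm (y - t)"
      proof cases
        case 2
        with comb[of t y] t(1) d1(2)[of "y - t"] y scale[where I = "integral {t..y} p" and h = "y - t" and w = "p t"] show ?thesis
          by (simp add: p_def)
      next
        case 3
        have "integral {-t..-y} (\<lambda>t. p (- t)) = integral {y..t} p"
          by (rule Henstock_Kurzweil_Integration.integral_reflect_real)
        with 3 comb[of y t] t(1) d2(2)[of "t - y"] y scale[where I = "integral {y..t} p" and h = "t - y" and w = "p t"]
        have "norm ((integral {0..t} q - integral {0..y} q) - (t - y) *\<^sub>R q t) \<le> e * (t - y)"
          by (simp add: p_def)
        also have "norm ((integral {0..t} q - integral {0..y} q) - (t - y) *\<^sub>R q t)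
            = norm ((c + integral {0..y} q) - (c + integral {0..t} q) - (y - t) *\<^sub>R q t)"
          by (subst norm_minus_commute) (simp add: algebra_simps)
        finally show ?thesis using 3 by simp
      qed auto
    qed (use d1 d2 in auto)
  qed
  then have "{t. 0 \<le> t \<and> \<not> ((\<lambda>x. c + integral {0..x} q) has_vector_derivative q t) (at t within {0..})}
      \<subseteq> N1 \<union> uminus ` N2"
    by auto
  then show ?thesis
    unfolding ae_derivative_def AE_half_line_iff using neg negligible_subset by blast
qed

lemma AC_deriv_indefinite_integral:
  fixes q :: "real \<Rightarrow> 'a::euclidean_space"
  assumes "L1_loc q"
  shows "AC_deriv (\<lambda>x. c + integral {0..x} q) q"
  unfolding AC_deriv_def
  using AC_loc_indefinite_integral[OF assms] ae_derivative_indefinite_integral[OF assms] by blast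

section \<open>Linear systems with locally integrable coefficients\<close>

lemma AC_deriv_power:
  fixes m :: "real \<Rightarrow> real"
  assumes "AC_deriv m m'"
  shows "AC_deriv (\<lambda>t. m t ^ Suc n) (\<lambda>t. real (Suc n) * m t ^ n * m' t)"
proof (induction n)
  case 0 then show ?case using assms by simp
next
  case (Suc n)
  have "AC_deriv (\<lambda>t. m t * m t ^ Suc n)
      (\<lambda>t. m t * (real (Suc n) * m t ^ n * m' t) + m' t * m t ^ Suc n)"
    by (rule AC_deriv_bilinear[OF bounded_bilinear_mult assms Suc])
  then show ?case by (simp add: algebra_simps)
qed

text \<open>Picard iteration. With \<open>m(x)\<close> the integral of \<open>K \<parallel>M\<parallel>\<close> over \<open>[0, x]\<close>, the difference of consecutive iterates is
bounded by \<open>m\<^sup>n / n!\<close>; the induction step integrates \<open>m\<^sup>n m'\<close>, which is legitimate because \<open>m\<close> is locally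
absolutely continuous. The iterates converge uniformly on bounded intervals. The product is an arbitrary
bilinear map so that equations for matrices with the coefficient on either side are covered.\<close>

theorem linear_ode_solution_exists:
  fixes prod :: "'a::euclidean_space \<Rightarrow> 'b::euclidean_space \<Rightarrow> 'b"
  assumes "bounded_bilinear prod" and M: "L1_loc M"
  shows "\<exists>y. y 0 = v \<and> AC_deriv y (\<lambda>t. prod (M t) (y t))"
proof -
  interpret bounded_bilinear prod by fact
  obtain K where K: "K > 0" "\<And>a b. norm (prod a b) \<le> norm a * norm b * K"
    using pos_bounded by blast
  define k where "k t = K * norm (M t)" for t
  have k: "L1_loc k" unfolding k_def
    by (rule L1_loc_linear[OF bounded_linear_mult_right L1_loc_norm[OF M]])
  have k0: "k t \<ge> 0" for t using K(1) by (simp add: k_def)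
  define m where "m x = 0 + integral {0..x} k" for x
  have m: "AC_deriv m k" unfolding m_def by (rule AC_deriv_indefinite_integral[OF k])
  have m0: "m 0 = 0" by (simp add: m_def)
  have mpow: "((\<lambda>t. real (Suc n) * m t ^ n * k t) has_integral m x ^ Suc n) {0..x}" if "x \<ge> 0" for n x
    using AC_deriv_integral[OF AC_deriv_power[OF m, of n], of 0 x] that by (simp add: m0)
  have m_mono: "0 \<le> m x \<and> m x \<le> m d" if "0 \<le> x" "x \<le> d" for x d
    using that k0 unfolding m_def
    by (auto intro!: integral_nonneg integral_subset_le L1_loc_integrable[OF k])
  define y where "y = rec_nat (\<lambda>_. v) (\<lambda>_ u x. v + integral {0..x} (\<lambda>t. prod (M t) (u t)))"
  have y0: "y 0 = (\<lambda>_. v)" and ySuc: "y (Suc n) = (\<lambda>x. v + integral {0..x} (\<lambda>t. prod (M t) (y n t)))" for n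
    by (simp_all add: y_def)
  have yc: "continuous_on {0..} (y n)" for n
  proof (induction n)
    case 0 then show ?case by (simp add: y0)
  next
    case (Suc n)
    have "L1_loc (\<lambda>t. prod (M t) (y n t))" by (rule L1_loc_bilinear'[OF assms Suc])
    then show ?case unfolding ySuc
      by (intro AC_loc_continuous AC_loc_indefinite_integral)
  qed
  have My: "L1_loc (\<lambda>t. prod (M t) (u t))" if "continuous_on {0..} u" for u
    by (rule L1_loc_bilinear'[OF assms that])
  have step: "norm (y (Suc n) x - y n x) \<le> norm v * (m x ^ Suc n / fact (Suc n))" if "x \<ge> 0" for n x
    using that
  proof (induction n arbitrary: x)
    case 0
    have "y (Suc 0) x - y 0 x = integral {0..x} (\<lambda>t. prod (M t) v)"
      by (simp add: ySuc y0)
    also have "norm \<dots> \<le> integral {0..x} (\<lambda>t. norm v * k t)"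
    proof (rule Henstock_Kurzweil_Integration.integral_norm_bound_integral)
      show "(\<lambda>t. prod (M t) v) integrable_on {0..x}"
        by (rule L1_loc_integrable[OF My]) auto
      show "(\<lambda>t. norm v * k t) integrable_on {0..x}"
        by (intro integrable_on_mult_right L1_loc_integrable[OF k]) auto
      show "norm (prod (M t) v) \<le> norm v * k t" for t
        using K(2)[of "M t" v] by (simp add: k_def mult_ac)
    qed
    finally show ?case by (simp add: m_def)
  next
    case (Suc n)
    have "y (Suc (Suc n)) x - y (Suc n) x = integral {0..x} (\<lambda>t. prod (M t) (y (Suc n) t))
        - integral {0..x} (\<lambda>t. prod (M t) (y n t))"
      unfolding ySuc[of "Suc n"] ySuc[of n] by simp
    also have "\<dots> = integral {0..x} (\<lambda>t. prod (M t) (y (Suc n) t) - prod (M t) (y n t))"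
      by (rule Henstock_Kurzweil_Integration.integral_diff[symmetric])
         (auto intro!: L1_loc_integrable My yc)
    also have "norm \<dots> \<le> integral {0..x} (\<lambda>t. norm v / fact (Suc (Suc n)) * (real (Suc (Suc n)) * m t ^ Suc n * k t))"
    proof (rule Henstock_Kurzweil_Integration.integral_norm_bound_integral)
      show "(\<lambda>t. prod (M t) (y (Suc n) t) - prod (M t) (y n t)) integrable_on {0..x}"
        by (intro Henstock_Kurzweil_Integration.integrable_diff L1_loc_integrable My yc) auto
      show "(\<lambda>t. norm v / fact (Suc (Suc n)) * (real (Suc (Suc n)) * m t ^ Suc n * k t)) integrable_on {0..x}"
        using mpow[OF Suc.prems, of "Suc n"] by (intro integrable_on_mult_right) (auto simp: integrable_on_def)
      fix t assume t: "t \<in> {0..x}"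
      have "norm (prod (M t) (y (Suc n) t) - prod (M t) (y n t)) = norm (prod (M t) (y (Suc n) t - y n t))"
        by (simp add: diff_right)
      also have "\<dots> \<le> k t * norm (y (Suc n) t - y n t)"
        using K(2)[of "M t" "y (Suc n) t - y n t"] by (simp add: k_def mult_ac)
      also have "\<dots> \<le> k t * (norm v * (m t ^ Suc n / fact (Suc n)))"
        using Suc.IH[of t] t k0 by (intro mult_left_mono) auto
      also have "\<dots> = norm v / fact (Suc (Suc n)) * (real (Suc (Suc n)) * m t ^ Suc n * k t)"
        by (simp add: divide_simps del: power_Suc)
      finally show "norm (prod (M t) (y (Suc n) t) - prod (M t) (y n t)) \<le> \<dots>" .
    qed
    also have "\<dots> = norm v / fact (Suc (Suc n)) * m x ^ Suc (Suc n)"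
      unfolding Henstock_Kurzweil_Integration.integral_mult_right
        integral_unique[OF mpow[OF Suc.prems, of "Suc n"]] ..
    finally show ?case by simp
  qed
  define Y where "Y x = v + (\<Sum>i. y (Suc i) x - y i x)" for x
  have unif: "uniform_limit {0..d} y Y sequentially" if "d \<ge> 0" for d
  proof -
    have "uniform_limit {0..d} (\<lambda>n x. \<Sum>i<n. y (Suc i) x - y i x) (\<lambda>x. \<Sum>i. y (Suc i) x - y i x) sequentially"
    proof (rule Weierstrass_m_test)
      show "norm (y (Suc n) x - y n x) \<le> norm v * (m d ^ Suc n / fact (Suc n))" if "x \<in> {0..d}" for n x
      proof -
        have "norm (y (Suc n) x - y n x) \<le> norm v * (m x ^ Suc n / fact (Suc n))"
          by (rule step) (use that in simp)
        also have "\<dots> \<le> norm v * (m d ^ Suc n / fact (Suc n))"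
          using m_mono[of x d] that by (intro mult_left_mono divide_right_mono power_mono) auto
        finally show ?thesis .
      qed
      have "summable (\<lambda>n. inverse (fact n) * m d ^ n)" by (rule summable_exp)
      then have "summable (\<lambda>n. inverse (fact (Suc n)) * m d ^ Suc n)" by (subst summable_Suc_iff)
      then show "summable (\<lambda>n. norm v * (m d ^ Suc n / fact (Suc n)))"
        by (intro summable_mult) (simp add: field_simps)
    qed
    then have "uniform_limit {0..d} (\<lambda>n x. v + (\<Sum>i<n. y (Suc i) x - y i x)) Y sequentially"
      unfolding Y_def by (intro uniform_limit_intros)
    moreover have "(\<lambda>n x. v + (\<Sum>i<n. y (Suc i) x - y i x)) = y"
      by (intro ext, subst sum_lessThan_telescope) (simp add: y0)
    ultimately show ?thesis by simp
  qed
  have Ycd: "continuous_on {0..d} Y" if "d \<ge> 0" for d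
    by (rule uniform_limit_theorem[OF _ unif[OF that]])
       (auto intro!: always_eventually continuous_on_subset[OF yc])
  have Yc: "continuous_on {0..} Y"
    unfolding continuous_on_eq_continuous_within
  proof
    fix x :: real assume x: "x \<in> {0..}"
    have "continuous (at x within {0..x+1}) Y"
      using x Ycd[of "x + 1"] by (simp add: continuous_on_eq_continuous_within)
    moreover have "at x within {0..x+1} = at x within {0..}"
      by (rule at_within_nhd[of _ "{..<x+1}"]) (use x in auto)
    ultimately show "continuous (at x within {0..}) Y" by simp
  qed
  have eq: "v + integral {0..x} (\<lambda>t. prod (M t) (Y t)) = Y x" if x: "x \<ge> 0" for x
  proof -
    have "(\<lambda>n. integral {0..x} (\<lambda>t. prod (M t) (y n t))) \<longlonglongrightarrow> integral {0..x} (\<lambda>t. prod (M t) (Y t))"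
    proof (rule tendstoI)
      fix e :: real assume "e > 0"
      define e' where "e' = e / (m x + 1)"
      have mx: "m x \<ge> 0" using m_mono[of x x] x by simp
      have "e' > 0" using \<open>e > 0\<close> mx by (simp add: e'_def)
      have "eventually (\<lambda>n. \<forall>t\<in>{0..x}. dist (y n t) (Y t) < e') sequentially"
        using unif[OF x] \<open>e' > 0\<close> by (auto simp: uniform_limit_iff)
      then show "eventually (\<lambda>n. dist (integral {0..x} (\<lambda>t. prod (M t) (y n t)))
          (integral {0..x} (\<lambda>t. prod (M t) (Y t))) < e) sequentially"
      proof eventually_elim
        case (elim n)
        have "integral {0..x} (\<lambda>t. prod (M t) (y n t)) - integral {0..x} (\<lambda>t. prod (M t) (Y t))
            = integral {0..x} (\<lambda>t. prod (M t) (y n t) - prod (M t) (Y t))"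
          by (rule Henstock_Kurzweil_Integration.integral_diff[symmetric])
             (auto intro!: L1_loc_integrable My yc Yc)
        also have "norm \<dots> \<le> integral {0..x} (\<lambda>t. e' * k t)"
        proof (rule Henstock_Kurzweil_Integration.integral_norm_bound_integral)
          show "(\<lambda>t. prod (M t) (y n t) - prod (M t) (Y t)) integrable_on {0..x}"
            by (intro Henstock_Kurzweil_Integration.integrable_diff L1_loc_integrable My yc Yc) auto
          show "(\<lambda>t. e' * k t) integrable_on {0..x}"
            by (intro integrable_on_mult_right L1_loc_integrable[OF k]) auto
          fix t assume t: "t \<in> {0..x}"
          have "norm (prod (M t) (y n t) - prod (M t) (Y t)) = norm (prod (M t) (y n t - Y t))"
            by (simp add: diff_right)
          also have "\<dots> \<le> k t * norm (y n t - Y t)"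
            using K(2)[of "M t" "y n t - Y t"] by (simp add: k_def mult_ac)
          also have "\<dots> \<le> k t * e'"
            using elim t k0 by (intro mult_left_mono) (auto simp: dist_norm less_imp_le)
          finally show "norm (prod (M t) (y n t) - prod (M t) (Y t)) \<le> e' * k t" by (simp add: mult_ac)
        qed
        also have "\<dots> = e' * m x" by (simp add: m_def)
        also have "\<dots> < e" using \<open>e > 0\<close> mx by (simp add: e'_def field_simps)
        finally show ?case by (simp add: dist_norm)
      qed
    qed
    then have "(\<lambda>n. y (Suc n) x) \<longlonglongrightarrow> v + integral {0..x} (\<lambda>t. prod (M t) (Y t))"
      unfolding ySuc by (intro tendsto_intros)
    moreover have "(\<lambda>n. y (Suc n) x) \<longlonglongrightarrow> Y x"
      using tendsto_uniform_limitI[OF unif[OF x], of x] x LIMSEQ_Suc[of "\<lambda>n. y n x"] by simp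
    ultimately show ?thesis by (rule LIMSEQ_unique)
  qed
  have "AC_deriv Y (\<lambda>t. prod (M t) (Y t))"
    by (rule AC_deriv_cong[OF AC_deriv_indefinite_integral[OF My[OF Yc], of v] eq])
  moreover have "Y 0 = v" using eq[of 0] by simp
  ultimately show ?thesis by (intro exI[of _ Y] conjI)
qed

lemma AC_deriv_zero_constant:
  fixes u :: "real \<Rightarrow> 'a::banach"
  assumes "AC_deriv u (\<lambda>_. 0)" "0 \<le> t"
  shows "u t = u 0"
  using has_integral_unique[OF AC_deriv_integral[OF assms(1), of 0 t] has_integral_0] assms(2)
  by simp

lemma bounded_bilinear_matrix_mult:
  "bounded_bilinear ((**) :: complex ^ 'm ^ 'n \<Rightarrow> complex ^ 'k ^ 'm \<Rightarrow> complex ^ 'k ^ ('n::finite))"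
  unfolding bilinear_conv_bounded_bilinear[symmetric] bilinear_def
  by (intro conjI allI linearI)
     (simp_all add: matrix_matrix_mult_def vec_eq_iff distrib_left distrib_right sum.distrib scaleR_sum_right)

lemma bounded_bilinear_matrix_vector:
  "bounded_bilinear ((*v) :: complex ^ 'm ^ 'n \<Rightarrow> complex ^ 'm \<Rightarrow> complex ^ ('n::finite))"
  unfolding bilinear_conv_bounded_bilinear[symmetric] bilinear_def
  by (intro conjI allI linearI)
     (simp_all add: matrix_vector_mult_def vec_eq_iff distrib_left distrib_right sum.distrib scaleR_sum_right)

text \<open>The inverse is obtained as the solution \<open>Z\<close> of the adjoint equation, since \<open>Z Y\<close> has derivative zero.\<close>

theorem fundamental_matrix_exists:
  fixes A :: "real \<Rightarrow> complex ^ 'n ^ ('n::finite)"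
  assumes A: "L1_loc A"
  shows "\<exists>Y Z. Y 0 = mat 1 \<and> AC_deriv Y (\<lambda>t. A t ** Y t) \<and> AC_deriv Z (\<lambda>t. - (Z t ** A t)) \<and>
    (\<forall>t\<ge>0. Z t ** Y t = mat 1 \<and> Y t ** Z t = mat 1)"
proof -
  obtain Y where Y: "Y 0 = mat 1" "AC_deriv Y (\<lambda>t. A t ** Y t)"
    using linear_ode_solution_exists[OF bounded_bilinear_matrix_mult A, of "mat 1"]
    by (elim exE conjE) assumption
  have nA: "L1_loc (\<lambda>t. - A t)" by (rule L1_loc_linear[OF bounded_linear_minus[OF bounded_linear_ident] A])
  obtain Z where Z: "Z 0 = mat 1" "AC_deriv Z (\<lambda>t. Z t ** - A t)"
    using linear_ode_solution_exists[OF bounded_bilinear.flip[OF bounded_bilinear_matrix_mult] nA, of "mat 1"] by (elim exE conjE)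
  interpret mm: bounded_bilinear "(**) :: complex ^ 'n ^ 'n \<Rightarrow> complex ^ 'n ^ 'n \<Rightarrow> _"
    by (rule bounded_bilinear_matrix_mult)
  have "AC_deriv (\<lambda>t. Z t ** Y t) (\<lambda>t. Z t ** (A t ** Y t) + (Z t ** - A t) ** Y t)"
    by (rule AC_deriv_bilinear[OF bounded_bilinear_matrix_mult Z(2) Y(2)])
  moreover have "Z t ** (A t ** Y t) + (Z t ** - A t) ** Y t = 0" for t
    by (simp add: mm.minus_left mm.minus_right matrix_mul_assoc)
  ultimately have "AC_deriv (\<lambda>t. Z t ** Y t) (\<lambda>_. 0)" by simp
  then have ZY: "Z t ** Y t = mat 1" if "t \<ge> 0" for t
    using AC_deriv_zero_constant[of "\<lambda>t. Z t ** Y t" t] that Y(1) Z(1) by simp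
  then have YZ: "Y t ** Z t = mat 1" if "t \<ge> 0" for t
    using that matrix_left_right_inverse by blast
  have "AC_deriv Z (\<lambda>t. - (Z t ** A t))" using Z(2) by (simp add: mm.minus_right)
  with Y ZY YZ show ?thesis by (intro exI[of _ Y] exI[of _ Z]) simp
qed

section \<open>The Hilbert space of square integrable functions\<close>

lemma l2_rel_refl: "l2_rel f f \<longleftrightarrow> square_integrable f"
  by (simp add: l2_rel_def)

lemma l2_class_eq_iff:
  assumes "square_integrable f" "square_integrable g"
  shows "l2_class f = l2_class g \<longleftrightarrow> (AE t in half_line. f t = g t)"
  using Quotient3_rel[OF Quotient3_l2, of f g] assms by (auto simp: l2_rel_def)

lemma l2_class_exists: "\<exists>f. square_integrable f \<and> u = l2_class f"
  using Quotient3_abs_rep[OF Quotient3_l2, of u] Quotient3_rep_reflp[OF Quotient3_l2, of u]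
  by (intro exI[of _ "l2_rep u"]) (simp add: l2_rel_refl)

lemma l2_class_add:
  "square_integrable f \<Longrightarrow> square_integrable g \<Longrightarrow> l2_class f + l2_class g = l2_class (\<lambda>t. f t + g t)"
  by (simp add: plus_l2.abs_eq l2_rel_refl)

lemma l2_class_scale: "square_integrable f \<Longrightarrow> c *\<^sub>C l2_class f = l2_class (\<lambda>t. c *s f t)"
  by (simp add: scaleC.abs_eq l2_rel_refl)

lemma diff_eq_add_smult: "x - y = x + (-1) *s (y :: complex ^ 'n::finite)"
  by (simp add: vec_eq_iff)

lemma square_integrable_diff:
  assumes "square_integrable f" "square_integrable g"
  shows "square_integrable (\<lambda>t. f t - g t)"
  unfolding diff_eq_add_smult by (rule square_integrable_add[OF assms(1) square_integrable_scale[OF assms(2)]])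

lemma l2_class_diff:
  assumes "square_integrable f" "square_integrable g"
  shows "l2_class f - l2_class g = l2_class (\<lambda>t. f t - g t)"
  unfolding minus_l2_def uminus_l2_def diff_eq_add_smult l2_class_scale[OF assms(2)]
  by (rule l2_class_add[OF assms(1) square_integrable_scale[OF assms(2)]])

lemma l2_class_zero: "l2_class (\<lambda>_. 0) = 0"
  by (simp add: zero_l2_def)

lemma cinner_l2_class:
  "square_integrable f \<Longrightarrow> square_integrable g \<Longrightarrow>
    cinner (l2_class f) (l2_class g) = integral\<^sup>L half_line (\<lambda>t. cdot (f t) (g t))"
  by (simp add: cinner.abs_eq l2_rel_refl)

lemma norm_l2_class:
  assumes "square_integrable f"
  shows "(norm (l2_class f))\<^sup>2 = integral\<^sup>L half_line (\<lambda>t. (norm (f t))\<^sup>2)"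
proof -
  have "(norm (l2_class f))\<^sup>2 = Re (integral\<^sup>L half_line (\<lambda>t. cdot (f t) (f t)))"
    using assms by (simp add: power2_norm_eq_inner inner_l2_def cinner_l2_class)
  also have "\<dots> = integral\<^sup>L half_line (\<lambda>t. Re (cdot (f t) (f t)))"
    by (rule integral_Re[OF integrable_cdot[OF assms assms], symmetric])
  finally show ?thesis by (simp add: Re_cdot power2_norm_eq_inner)
qed

lemma nn_integral_norm_l2_class:
  assumes "square_integrable f"
  shows "(\<integral>\<^sup>+ t. ennreal ((norm (f t))\<^sup>2) \<partial>half_line) = ennreal ((norm (l2_class f))\<^sup>2)"
  unfolding norm_l2_class[OF assms]
  by (rule nn_integral_eq_integral) (use assms in \<open>auto simp: square_integrable_def\<close>)

lemma half_power_square: "((1/2) ^ k)\<^sup>2 = ((1/4) ^ k :: real)"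
proof -
  have "((1/2) ^ k)\<^sup>2 = (((1/2)\<^sup>2) ^ k :: real)" by (simp only: power_mult[symmetric] mult.commute)
  then show ?thesis by (simp only: power_divide one_power2) simp
qed

text \<open>The proof of the theorem of Riesz and Fischer: along a subsequence with \<open>\<parallel>X\<^sub>k\<^sub>+\<^sub>1 - X\<^sub>k\<parallel> \<le> 2\<^sup>-\<^sup>k\<close> the representatives
converge almost everywhere, and Fatou's lemma bounds the distance to the limit.\<close>

theorem l2_Cauchy_convergent:
  fixes X :: "nat \<Rightarrow> 'n::finite l2"
  assumes "Cauchy X"
  shows "convergent X"
proof -
  have "\<exists>r. \<forall>k. (\<forall>m\<ge>r k. \<forall>n\<ge>r k. norm (X m - X n) < (1/2) ^ k) \<and> r k < r (Suc k)"
  proof (rule dependent_nat_choice)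
    show "\<exists>N. \<forall>m\<ge>N. \<forall>n\<ge>N. norm (X m - X n) < (1/2) ^ 0"
      using CauchyD[OF assms, of 1] by simp
    fix N :: nat and k
    obtain N' where "\<forall>m\<ge>N'. \<forall>n\<ge>N'. norm (X m - X n) < (1/2) ^ Suc k"
      using CauchyD[OF assms, of "(1/2) ^ Suc k"] by auto
    then show "\<exists>N'. (\<forall>m\<ge>N'. \<forall>n\<ge>N'. norm (X m - X n) < (1/2) ^ Suc k) \<and> N < N'"
      by (intro exI[of _ "max N' (Suc N)"]) simp
  qed
  then obtain r where r: "\<And>k m n. m \<ge> r k \<Longrightarrow> n \<ge> r k \<Longrightarrow> norm (X m - X n) < (1/2) ^ k"
    and "\<And>k. r k < r (Suc k)" by auto
  then have sm: "strict_mono r" by (simp add: strict_mono_Suc_iff)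
  have "\<forall>k. \<exists>f. square_integrable f \<and> X (r k) = l2_class f" using l2_class_exists by blast
  then obtain f where f: "\<And>k. square_integrable (f k)" and Xf: "\<And>k. X (r k) = l2_class (f k)"
    by metis
  have fm[measurable]: "f k \<in> borel_measurable half_line" for k
    using f by (simp add: square_integrable_def)
  have dist: "norm (l2_class (\<lambda>t. f m t - f k t)) \<le> (1/2) ^ k" if "m \<ge> k" for k m
    using r[of k "r m" "r k"] strict_mono_leD[OF sm that]
    by (simp add: l2_class_diff[OF f f, symmetric] Xf less_imp_le)
  have int: "(\<integral>\<^sup>+ t. ennreal ((norm (f m t - f k t))\<^sup>2) \<partial>half_line) \<le> ennreal ((1/4) ^ k)" if "m \<ge> k" for k m
  proof -
    have "(norm (l2_class (\<lambda>t. f m t - f k t)))\<^sup>2 \<le> ((1/2) ^ k)\<^sup>2"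
      by (intro power_mono dist that) auto
    also note half_power_square
    finally show ?thesis
      by (subst nn_integral_norm_l2_class[OF square_integrable_diff[OF f f]]) (rule ennreal_leI)
  qed
  \<comment> \<open>The weight \<open>2\<^sup>k\<close> keeps the integrals summable and, by \<open>2 d \<le> 2\<^sup>-\<^sup>k + 2\<^sup>k d\<^sup>2\<close>, makes the increments themselves summable.\<close>
  define s where "s k t = 2 ^ k * (norm (f (Suc k) t - f k t))\<^sup>2" for k t
  have [measurable]: "s k \<in> borel_measurable half_line" for k
    unfolding s_def[abs_def] by measurable
  have "(\<integral>\<^sup>+ t. (\<Sum>k. ennreal (s k t)) \<partial>half_line) = (\<Sum>k. \<integral>\<^sup>+ t. ennreal (s k t) \<partial>half_line)"
    by (rule nn_integral_suminf) measurable
  also have "\<dots> \<le> (\<Sum>k. ennreal ((1/2) ^ k))"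
  proof (rule suminf_le)
    fix k
    have "(\<integral>\<^sup>+ t. ennreal (s k t) \<partial>half_line)
        = ennreal (2 ^ k) * (\<integral>\<^sup>+ t. ennreal ((norm (f (Suc k) t - f k t))\<^sup>2) \<partial>half_line)"
      unfolding s_def by (subst nn_integral_cmult[symmetric]) (auto simp: ennreal_mult)
    also have "\<dots> \<le> ennreal (2 ^ k) * ennreal ((1/4) ^ k)"
      by (intro mult_left_mono int) auto
    also have "\<dots> = ennreal ((1/2) ^ k)"
      by (simp add: ennreal_mult[symmetric] power_mult_distrib[symmetric])
    finally show "(\<integral>\<^sup>+ t. ennreal (s k t) \<partial>half_line) \<le> ennreal ((1/2) ^ k)" .
  qed auto
  also have "\<dots> = ennreal (\<Sum>k. (1/2) ^ k)"
    by (rule suminf_ennreal2) (auto simp: summable_geometric_iff)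
  also have "\<dots> < \<infinity>" by simp
  finally have fin: "(\<integral>\<^sup>+ t. (\<Sum>k. ennreal (s k t)) \<partial>half_line) \<noteq> \<infinity>" by simp
  have "AE t in half_line. (\<Sum>k. ennreal (s k t)) \<noteq> \<infinity>"
    by (rule nn_integral_PInf_AE[OF _ fin]) measurable
  then have conv: "AE t in half_line. convergent (\<lambda>k. f k t)"
  proof eventually_elim
    case (elim t)
    have "summable (\<lambda>k. s k t)"
      by (rule summable_suminf_not_top) (use elim in \<open>auto simp: s_def\<close>)
    then have "summable (\<lambda>k. (1/2) ^ k + s k t)"
      by (intro summable_add) (auto simp: summable_geometric_iff)
    then have "summable (\<lambda>k. norm (f (Suc k) t - f k t))"
    proof (rule summable_comparison_test'[where N = 0])
      fix k :: nat
      define d where "d = norm (f (Suc k) t - f k t)"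
      have "0 \<le> (1 - 2 ^ k * d)\<^sup>2" by simp
      then have "2 * (2 ^ k * d) \<le> 1 + (2 ^ k * d)\<^sup>2" by (simp add: power2_diff)
      then have "2 * d \<le> (1/2) ^ k + 2 ^ k * d\<^sup>2"
        by (simp add: field_simps power2_eq_square power_divide)
      then have "d \<le> (1/2) ^ k + 2 ^ k * d\<^sup>2" using norm_ge_zero[of "f (Suc k) t - f k t"]
        unfolding d_def[symmetric] by linarith
      then show "norm (norm (f (Suc k) t - f k t)) \<le> (1/2) ^ k + s k t" by (simp add: s_def d_def)
    qed
    then have "summable (\<lambda>k. f (Suc k) t - f k t)" by (rule summable_norm_cancel)
    then have "convergent (\<lambda>n. f 0 t + (\<Sum>k<n. f (Suc k) t - f k t))"
      by (intro convergent_add convergent_const) (simp add: summable_iff_convergent)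
    moreover have "(\<lambda>n. f 0 t + (\<Sum>k<n. f (Suc k) t - f k t)) = (\<lambda>n. f n t)"
      by (intro ext, subst sum_lessThan_telescope) simp
    ultimately show ?case by (simp only:)
  qed
  define g where "g t = lim (\<lambda>k. f k t)" for t
  have gm[measurable]: "g \<in> borel_measurable half_line"
    unfolding g_def by (rule borel_measurable_lim_metric) (rule fm)
  have lim: "AE t in half_line. (\<lambda>k. f k t) \<longlonglongrightarrow> g t"
    using conv by eventually_elim (simp add: g_def convergent_LIMSEQ_iff)
  have gint: "(\<integral>\<^sup>+ t. ennreal ((norm (g t - f k t))\<^sup>2) \<partial>half_line) \<le> ennreal ((1/4) ^ k)" for k
  proof -
    have "(\<integral>\<^sup>+ t. ennreal ((norm (g t - f k t))\<^sup>2) \<partial>half_line)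
        = (\<integral>\<^sup>+ t. liminf (\<lambda>m. ennreal ((norm (f m t - f k t))\<^sup>2)) \<partial>half_line)"
    proof (rule nn_integral_cong_AE)
      show "AE t in half_line. ennreal ((norm (g t - f k t))\<^sup>2) = liminf (\<lambda>m. ennreal ((norm (f m t - f k t))\<^sup>2))"
        using lim
      proof eventually_elim
        case (elim t)
        have "(\<lambda>m. ennreal ((norm (f m t - f k t))\<^sup>2)) \<longlonglongrightarrow> ennreal ((norm (g t - f k t))\<^sup>2)"
          by (intro tendsto_ennrealI tendsto_intros elim)
        then show ?case by (intro lim_imp_Liminf[symmetric]) auto
      qed
    qed
    also have "\<dots> \<le> liminf (\<lambda>m. \<integral>\<^sup>+ t. ennreal ((norm (f m t - f k t))\<^sup>2) \<partial>half_line)"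
      by (rule nn_integral_liminf) measurable
    also have "\<dots> \<le> limsup (\<lambda>m. \<integral>\<^sup>+ t. ennreal ((norm (f m t - f k t))\<^sup>2) \<partial>half_line)"
      by (rule Liminf_le_Limsup) simp
    also have "\<dots> \<le> ennreal ((1/4) ^ k)"
      by (rule Limsup_bounded) (use int in \<open>auto simp: eventually_sequentially\<close>)
    finally show ?thesis .
  qed
  have sqd: "square_integrable (\<lambda>t. g t - f k t)" for k
    unfolding square_integrable_def
  proof
    have "(\<integral>\<^sup>+ t. ennreal ((norm (g t - f k t))\<^sup>2) \<partial>half_line) < \<infinity>"
      using gint[of k] by (rule order_le_less_trans) simp
    then show "integrable half_line (\<lambda>t. (norm (g t - f k t))\<^sup>2)"
      by (intro integrableI_bounded) auto
  qed measurable
  have sqg: "square_integrable g"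
    using square_integrable_add[OF sqd[of 0] f[of 0]] by simp
  have rate: "norm (X (r k) - l2_class g) \<le> (1/2) ^ k" for k
  proof -
    have "ennreal ((norm (l2_class (\<lambda>t. g t - f k t)))\<^sup>2) \<le> ennreal ((1/4) ^ k)"
      using gint[of k] by (simp add: nn_integral_norm_l2_class[OF sqd])
    then have "(norm (l2_class (\<lambda>t. g t - f k t)))\<^sup>2 \<le> (1/4) ^ k" by simp
    also note half_power_square[symmetric]
    finally have "norm (l2_class (\<lambda>t. g t - f k t)) \<le> (1/2) ^ k"
      by (rule power2_le_imp_le) simp
    then show ?thesis
      by (simp add: l2_class_diff[OF sqg f, symmetric] Xf norm_minus_commute)
  qed
  have "(\<lambda>k. X (r k) - l2_class g) \<longlonglongrightarrow> 0"
  proof (rule Lim_null_comparison)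
    show "eventually (\<lambda>k. norm (X (r k) - l2_class g) \<le> (1/2) ^ k) sequentially"
      by (intro always_eventually allI rate)
    show "(\<lambda>k. (1/2) ^ k :: real) \<longlonglongrightarrow> 0" by (rule LIMSEQ_power_zero) simp
  qed
  then have "(X \<circ> r) \<longlonglongrightarrow> l2_class g" by (simp add: Lim_null[symmetric] o_def)
  then have "X \<longlonglongrightarrow> l2_class g" by (rule Cauchy_converges_subseq[OF assms sm])
  then show ?thesis by (rule convergentI)
qed

instance l2 :: (finite) complete_space
  by standard (rule l2_Cauchy_convergent)

lemma norm_sub_scaleR_square:
  "(norm (v - c *\<^sub>R y))\<^sup>2 = (norm v)\<^sup>2 - 2 * c * inner v y + c * c * inner y y"
  by (simp add: power2_norm_eq_inner inner_diff_left inner_diff_right inner_commute algebra_simps)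

text \<open>A minimizing sequence for the distance is a Cauchy sequence by the parallelogram law.\<close>

theorem orthogonal_projection_exists:
  fixes S :: "'a::{real_inner,complete_space} set"
  assumes "closed S" "subspace S"
  shows "\<exists>s\<in>S. \<forall>y\<in>S. inner (x - s) y = 0"
proof -
  define d where "d = (INF s\<in>S. (norm (x - s))\<^sup>2)"
  have "0 \<in> S" using assms(2) by (rule subspace_0)
  have bdd: "bdd_below ((\<lambda>s. (norm (x - s))\<^sup>2) ` S)" by (rule bdd_belowI2[of _ 0]) simp
  have d: "d \<le> (norm (x - s))\<^sup>2" if "s \<in> S" for s
    unfolding d_def by (rule cINF_lower[OF bdd that])
  have "\<exists>s\<in>S. (norm (x - s))\<^sup>2 < d + 1 / (real n + 1)" for n
  proof -
    have "d < d + 1 / (real n + 1)" by simp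
    then show ?thesis unfolding d_def using cINF_less_iff[OF _ bdd] \<open>0 \<in> S\<close> by blast
  qed
  then obtain s where s: "\<And>n. s n \<in> S" "\<And>n. (norm (x - s n))\<^sup>2 < d + 1 / (real n + 1)" by metis
  have gen: "a \<le> 2 * (b - d) + 2 * (c - d)" if "d \<le> q" "a + 4 * q = 2 * b + 2 * c" for a b c q d :: real
    using that by simp
  have gen2: "2 * (a - d) + 2 * (b - d) \<le> 2 * p + 2 * q" if "a < d + p" "b < d + q" for a b p q :: real
    using that by simp
  have par: "(norm (s n - s m))\<^sup>2 \<le> 2 / (real n + 1) + 2 / (real m + 1)" for m n
  proof -
    have "(1/2) *\<^sub>R (s n + s m) \<in> S" using s(1) assms(2) by (intro subspace_scale subspace_add) auto
    then have "d \<le> (norm (x - (1/2) *\<^sub>R (s n + s m)))\<^sup>2" by (rule d)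
    moreover have "(norm (s n - s m))\<^sup>2 + 4 * (norm (x - (1/2) *\<^sub>R (s n + s m)))\<^sup>2
        = 2 * (norm (x - s n))\<^sup>2 + 2 * (norm (x - s m))\<^sup>2"
      by (simp add: power2_norm_eq_inner inner_simps algebra_simps inner_commute)
    ultimately have "(norm (s n - s m))\<^sup>2 \<le> 2 * ((norm (x - s n))\<^sup>2 - d) + 2 * ((norm (x - s m))\<^sup>2 - d)"
      by (rule gen)
    also have "\<dots> \<le> 2 * (1 / (real n + 1)) + 2 * (1 / (real m + 1))"
      by (rule gen2[OF s(2) s(2)])
    finally show ?thesis by simp
  qed
  have "Cauchy s"
  proof (rule metric_CauchyI)
    fix e :: real assume "e > 0"
    obtain N :: nat where N: "real N > 4 / e\<^sup>2" using reals_Archimedean2 by blast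
    have "dist (s m) (s n) < e" if "m \<ge> N" "n \<ge> N" for m n
    proof -
      have "(norm (s m - s n))\<^sup>2 \<le> 2 / (real m + 1) + 2 / (real n + 1)" by (rule par)
      also have "\<dots> \<le> 2 / (real N + 1) + 2 / (real N + 1)"
        using that by (intro add_mono divide_left_mono) auto
      also have "\<dots> = 4 / (real N + 1)" by simp
      also have "\<dots> < e\<^sup>2"
      proof -
        have "4 < e\<^sup>2 * real N" using N \<open>e > 0\<close> by (simp add: field_simps)
        also have "\<dots> \<le> e\<^sup>2 * (real N + 1)" by (intro mult_left_mono) auto
        finally show ?thesis by (simp add: field_simps)
      qed
      finally show ?thesis using \<open>e > 0\<close> by (simp add: dist_norm power2_less_imp_less)
    qed
    then show "\<exists>M. \<forall>m\<ge>M. \<forall>n\<ge>M. dist (s m) (s n) < e" by blast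
  qed
  then obtain l where l: "s \<longlonglongrightarrow> l" using Cauchy_convergent convergent_def by blast
  have "l \<in> S" using closed_sequentially[OF assms(1) s(1) l] .
  have "(norm (x - l))\<^sup>2 \<le> d + 0"
  proof (rule LIMSEQ_le)
    show "(\<lambda>n. (norm (x - s n))\<^sup>2) \<longlonglongrightarrow> (norm (x - l))\<^sup>2" by (intro tendsto_intros l)
    show "(\<lambda>n. d + 1 / (real n + 1)) \<longlonglongrightarrow> d + 0"
      by (intro tendsto_intros LIMSEQ_ignore_initial_segment[of "\<lambda>n. 1 / real n" 0 1, simplified add.commute] lim_1_over_n)
        (use LIMSEQ_inverse_real_of_nat in \<open>simp add: inverse_eq_divide add.commute\<close>)
    show "\<exists>N. \<forall>n\<ge>N. (norm (x - s n))\<^sup>2 \<le> d + 1 / (real n + 1)" using s(2) less_imp_le by blast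
  qed
  then have xl: "(norm (x - l))\<^sup>2 \<le> d" by simp
  have min: "(norm (x - l))\<^sup>2 \<le> (norm (x - l - t *\<^sub>R y))\<^sup>2" if "y \<in> S" for t y
  proof -
    have "l + t *\<^sub>R y \<in> S" using that \<open>l \<in> S\<close> assms(2) by (intro subspace_add subspace_scale)
    then have "d \<le> (norm (x - (l + t *\<^sub>R y)))\<^sup>2" by (rule d)
    with xl show ?thesis by (simp only: diff_diff_eq)
  qed
  have "inner (x - l) y = 0" if "y \<in> S" for y
  proof (cases "y = 0")
    case False
    define a where "a = inner (x - l) y"
    define b where "b = inner y y"
    have "b > 0" using False by (simp add: b_def)
    have "(norm (x - l - (a / b) *\<^sub>R y))\<^sup>2 = (norm (x - l))\<^sup>2 - 2 * (a / b) * a + (a / b) * (a / b) * b"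
      unfolding a_def b_def by (rule norm_sub_scaleR_square)
    also have "\<dots> = (norm (x - l))\<^sup>2 - a * a / b" using \<open>b > 0\<close> by (simp add: field_simps)
    finally have "a * a / b \<le> 0" using min[OF that, of "a / b"] by linarith
    then have "a * a \<le> 0" using \<open>b > 0\<close> by (simp add: divide_le_0_iff)
    then show ?thesis by (auto simp: a_def[symmetric] mult_le_0_iff)
  qed simp
  with \<open>l \<in> S\<close> show ?thesis by blast
qed

lemma cinner_add_right: "cinner u (v + w) = cinner u v + cinner u w"
  using cinner_commute[of u "v + w"] cinner_commute[of u v] cinner_commute[of u w]
  by (simp add: cinner_add_left)

lemma cinner_scaleC_right: "cinner u (c *\<^sub>C v) = cnj c * cinner u v"
  using cinner_commute[of u "c *\<^sub>C v"] cinner_commute[of u v] by (simp add: cinner_scaleC_left)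

lemma norm_scaleC: "norm (c *\<^sub>C u) = cmod c * norm (u :: 'n::finite l2)"
proof -
  have "cinner (c *\<^sub>C u) (c *\<^sub>C u) = of_real ((cmod c)\<^sup>2) * cinner u u"
    using complex_norm_square[of c] by (simp add: cinner_scaleC_left cinner_scaleC_right mult_ac)
  then have "inner (c *\<^sub>C u) (c *\<^sub>C u) = (cmod c)\<^sup>2 * inner u u"
    by (simp add: inner_l2_def)
  then show ?thesis by (simp add: norm_l2_def real_sqrt_mult)
qed

lemma cinner_le_norm: "cmod (cinner u v) \<le> norm u * norm (v :: 'n::finite l2)"
proof (cases "cinner u v = 0")
  case False
  define c where "c = cnj (cinner u v) / of_real (cmod (cinner u v))"
  have c: "cmod c = 1" using False by (simp add: c_def norm_divide)
  have "cinner (c *\<^sub>C u) v = of_real (cmod (cinner u v))"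
    using False complex_norm_square[of "cinner u v"]
    by (simp add: cinner_scaleC_left c_def field_simps power2_eq_square)
  then have "cmod (cinner u v) = inner (c *\<^sub>C u) v" by (simp add: inner_l2_def)
  also have "\<dots> \<le> norm (c *\<^sub>C u) * norm v" by (rule norm_cauchy_schwarz)
  finally show ?thesis by (simp add: norm_scaleC c)
qed simp

lemma scaleR_scaleC: "r *\<^sub>R u = complex_of_real r *\<^sub>C u"
  by (simp add: scaleR_l2_def)

lemma bounded_bilinear_cinner: "bounded_bilinear cinner"
proof
  show "\<exists>K. \<forall>a b. norm (cinner a b) \<le> norm a * norm b * K"
    by (intro exI[of _ 1]) (simp add: cinner_le_norm)
qed (simp_all add: cinner_add_left cinner_add_right scaleR_scaleC cinner_scaleC_left
    cinner_scaleC_right scaleR_conv_of_real)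

lemma bounded_bilinear_scaleC: "bounded_bilinear scaleC"
proof
  show "\<exists>K. \<forall>a b. norm (a *\<^sub>C b) \<le> norm a * norm b * K"
    by (intro exI[of _ 1]) (simp add: norm_scaleC)
qed (simp_all add: scaleR_scaleC l2.scale_left_distrib l2.scale_right_distrib scaleR_conv_of_real
    l2.scale_left_commute)

lemma subspace_complex_subspace: "l2.subspace S \<Longrightarrow> subspace S"
  by (simp add: subspace_def l2.subspace_def scaleR_scaleC)

text \<open>On a complex subspace, orthogonality for the real inner product applied to \<open>y\<close> and \<open>\<i> y\<close> is orthogonality
for the complex one.\<close>

lemma complex_orthogonal_projection_exists:
  fixes S :: "'n::finite l2 set"
  assumes "closed S" "l2.subspace S"
  shows "\<exists>s\<in>S. \<forall>y\<in>S. cinner (x - s) y = 0"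
proof -
  obtain s where s: "s \<in> S" "\<And>y. y \<in> S \<Longrightarrow> inner (x - s) y = 0"
    using orthogonal_projection_exists[OF assms(1) subspace_complex_subspace[OF assms(2)], of x] by blast
  have "cinner (x - s) y = 0" if "y \<in> S" for y
  proof (rule complex_eqI)
    show "Re (cinner (x - s) y) = Re 0" using s(2)[OF that] by (simp add: inner_l2_def)
    have "\<i> *\<^sub>C y \<in> S" using that assms(2) by (rule l2.subspace_scale[rotated])
    then show "Im (cinner (x - s) y) = Im 0"
      using s(2)[of "\<i> *\<^sub>C y"] by (simp add: inner_l2_def cinner_scaleC_right)
  qed
  with s(1) show ?thesis by blast
qed

text \<open>The functional is only given on the closed subspace \<open>S\<close>, and the representing vector is found in \<open>S\<close>: it spans the
orthogonal complement of the kernel in \<open>S\<close>.\<close>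

theorem riesz_representation:
  fixes S :: "'n::finite l2 set" and \<phi> :: "'n l2 \<Rightarrow> complex"
  assumes S: "closed S" "l2.subspace S"
    and add: "\<And>u v. u \<in> S \<Longrightarrow> v \<in> S \<Longrightarrow> \<phi> (u + v) = \<phi> u + \<phi> v"
    and scale: "\<And>c u. u \<in> S \<Longrightarrow> \<phi> (c *\<^sub>C u) = c * \<phi> u"
    and bound: "\<And>u. u \<in> S \<Longrightarrow> cmod (\<phi> u) \<le> C * norm u"
  shows "\<exists>g\<in>S. \<forall>u\<in>S. \<phi> u = cinner u g"
proof (cases "\<forall>u\<in>S. \<phi> u = 0")
  case True
  then show ?thesis using l2.subspace_0[OF S(2)] bounded_bilinear.zero_right[OF bounded_bilinear_cinner]
    by (intro bexI[of _ 0]) auto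
next
  case False
  then obtain m where m: "m \<in> S" "\<phi> m \<noteq> 0" by blast
  have diff: "\<phi> (u - v) = \<phi> u - \<phi> v" if "u \<in> S" "v \<in> S" for u v
  proof -
    have "(-1) *\<^sub>C v \<in> S" by (rule l2.subspace_scale[OF S(2) that(2)])
    then show ?thesis using add[OF that(1), of "(-1) *\<^sub>C v"] scale[OF that(2), of "-1"]
      by (simp add: l2.scale_minus_left)
  qed
  define K where "K = {u\<in>S. \<phi> u = 0}"
  have K: "l2.subspace K"
    unfolding l2.subspace_def
  proof (intro conjI ballI allI)
    show "0 \<in> K" using l2.subspace_0[OF S(2)] scale[of 0 0] by (simp add: K_def)
    show "u + v \<in> K" if "u \<in> K" "v \<in> K" for u v
      using that l2.subspace_add[OF S(2)] add[of u v] by (simp add: K_def)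
    show "c *\<^sub>C u \<in> K" if "u \<in> K" for c u
      using that l2.subspace_scale[OF S(2)] scale[of u c] by (simp add: K_def)
  qed
  have "closed K"
    unfolding closed_sequential_limits
  proof (intro allI impI, elim conjE)
    fix x l assume x: "\<forall>n. x n \<in> K" and lim: "x \<longlonglongrightarrow> l"
    have "l \<in> S" using closed_sequentially[OF S(1) _ lim] x by (simp add: K_def)
    have "cmod (\<phi> l) \<le> C * norm (l - x n)" for n
      using bound[of "l - x n"] diff[of l "x n"] x \<open>l \<in> S\<close> l2.subspace_diff[OF S(2)] by (simp add: K_def)
    moreover have "(\<lambda>n. C * norm (l - x n)) \<longlonglongrightarrow> C * norm (l - l)" by (intro tendsto_intros lim)
    ultimately have "cmod (\<phi> l) \<le> C * norm (l - l)"
      by (intro LIMSEQ_le_const[of "\<lambda>n. C * norm (l - x n)"]) auto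
    then show "l \<in> K" using \<open>l \<in> S\<close> by (simp add: K_def)
  qed
  obtain s where s: "s \<in> K" "\<And>y. y \<in> K \<Longrightarrow> cinner (m - s) y = 0"
    using complex_orthogonal_projection_exists[OF \<open>closed K\<close> K, of m] by blast
  define w where "w = m - s"
  have sS: "s \<in> S" "\<phi> s = 0" using s(1) by (auto simp: K_def)
  have w: "w \<in> S" "\<phi> w = \<phi> m" using m sS diff l2.subspace_diff[OF S(2)] by (auto simp: w_def)
  have "w \<noteq> 0"
  proof
    assume "w = 0"
    then have "\<phi> w = \<phi> (0 *\<^sub>C w)" by simp
    then show False using w(2) m(2) scale[OF w(1), of 0] by simp
  qed
  have ww: "cinner w w \<noteq> 0"
  proof
    assume "cinner w w = 0"
    then have "Re (cinner w w) = 0" by simp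
    with conjunct2[OF Re_cinner_self[of w]] have "w = 0" by (rule iffD1)
    with \<open>w \<noteq> 0\<close> show False ..
  qed
  define g where "g = cnj (\<phi> m / cinner w w) *\<^sub>C w"
  have "\<phi> u = cinner u g" if u: "u \<in> S" for u
  proof -
    have "u - (\<phi> u / \<phi> m) *\<^sub>C w \<in> K"
      using u w m diff[of u "(\<phi> u / \<phi> m) *\<^sub>C w"] scale[OF w(1)] l2.subspace_diff[OF S(2)] l2.subspace_scale[OF S(2)]
      by (simp add: K_def)
    then have "cinner w (u - (\<phi> u / \<phi> m) *\<^sub>C w) = 0" using s(2) by (simp add: w_def)
    then have "cinner (u - (\<phi> u / \<phi> m) *\<^sub>C w) w = 0" using cinner_commute[of "u - (\<phi> u / \<phi> m) *\<^sub>C w" w] by simp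
    then have "cinner u w = (\<phi> u / \<phi> m) * cinner w w"
      by (simp add: bounded_bilinear.diff_left[OF bounded_bilinear_cinner] cinner_scaleC_left)
    then show ?thesis using ww m(2) by (simp add: g_def cinner_scaleC_right)
  qed
  moreover have "g \<in> S" unfolding g_def by (rule l2.subspace_scale[OF S(2) w(1)])
  ultimately show ?thesis by blast
qed

section \<open>Closed operators and their fields of regularity\<close>

definition linear_graph :: "'n::finite op_graph \<Rightarrow> bool" where
  "linear_graph A \<longleftrightarrow> (0, 0) \<in> A \<and> (\<forall>u f v g. (u, f) \<in> A \<longrightarrow> (v, g) \<in> A \<longrightarrow> (u + v, f + g) \<in> A) \<and>
     (\<forall>c u f. (u, f) \<in> A \<longrightarrow> (c *\<^sub>C u, c *\<^sub>C f) \<in> A)"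

lemma linear_graph_add: "linear_graph A \<Longrightarrow> (u, f) \<in> A \<Longrightarrow> (v, g) \<in> A \<Longrightarrow> (u + v, f + g) \<in> A"
  unfolding linear_graph_def by blast

lemma linear_graph_scale: "linear_graph A \<Longrightarrow> (u, f) \<in> A \<Longrightarrow> (c *\<^sub>C u, c *\<^sub>C f) \<in> A"
  unfolding linear_graph_def by blast

lemma linear_graph_diff:
  assumes "linear_graph A" "(u, f) \<in> A" "(v, g) \<in> A"
  shows "(u - v, f - g) \<in> A"
  using linear_graph_add[OF assms(1,2) linear_graph_scale[OF assms(1,3), of "-1"]]
  by (simp only: minus_l2_def uminus_l2_def)

lemma linear_graph_closure:
  assumes "linear_graph A"
  shows "linear_graph (closure A)"
  unfolding linear_graph_def
proof (intro conjI allI impI)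
  show "(0, 0) \<in> closure A" using assms closure_subset[of A] by (auto simp: linear_graph_def)
next
  fix u f v g assume "(u, f) \<in> closure A" "(v, g) \<in> closure A"
  then obtain x y where x: "\<And>n. x n \<in> A" "x \<longlonglongrightarrow> (u, f)" and y: "\<And>n. y n \<in> A" "y \<longlonglongrightarrow> (v, g)"
    unfolding closure_sequential by blast
  have "x n + y n \<in> A" for n
    using linear_graph_add[OF assms, of "fst (x n)" "snd (x n)" "fst (y n)" "snd (y n)"] x(1)[of n] y(1)[of n]
    by (simp add: plus_prod_def)
  moreover have "(\<lambda>n. x n + y n) \<longlonglongrightarrow> (u, f) + (v, g)" by (intro tendsto_intros x y)
  ultimately show "(u + v, f + g) \<in> closure A"
    unfolding closure_sequential by (intro exI[of _ "\<lambda>n. x n + y n"]) simp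
next
  fix c u f assume "(u, f) \<in> closure A"
  then obtain x where x: "\<And>n. x n \<in> A" "x \<longlonglongrightarrow> (u, f)"
    unfolding closure_sequential by blast
  have "(c *\<^sub>C fst (x n), c *\<^sub>C snd (x n)) \<in> A" for n
    using linear_graph_scale[OF assms, of "fst (x n)" "snd (x n)"] x(1)[of n] by simp
  moreover have "(\<lambda>n. (c *\<^sub>C fst (x n), c *\<^sub>C snd (x n))) \<longlonglongrightarrow> (c *\<^sub>C fst (u, f), c *\<^sub>C snd (u, f))"
    by (intro tendsto_Pair bounded_bilinear.tendsto[OF bounded_bilinear_scaleC tendsto_const]
        tendsto_fst tendsto_snd x)
  ultimately show "(c *\<^sub>C u, c *\<^sub>C f) \<in> closure A"
    unfolding closure_sequential by (intro exI[of _ "\<lambda>n. (c *\<^sub>C fst (x n), c *\<^sub>C snd (x n))"]) simp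
qed

definition shifted_range :: "'n::finite op_graph \<Rightarrow> complex \<Rightarrow> 'n l2 set" where
  "shifted_range A z = {f - z *\<^sub>C u | u f. (u, f) \<in> A}"

lemma field_of_regularityE:
  assumes "z \<in> field_of_regularity A"
  obtains \<epsilon> where "\<epsilon> > 0" "\<And>u f. (u, f) \<in> A \<Longrightarrow> \<epsilon> * norm u \<le> norm (f - z *\<^sub>C u)"
  using assms unfolding field_of_regularity_def by auto

text \<open>The triangle inequality: the bound \<open>\<epsilon>\<close> at \<open>z\<close> leaves \<open>\<epsilon>/2\<close> on the disc of radius \<open>\<epsilon>/2\<close>.\<close>

lemma open_field_of_regularity: "open (field_of_regularity A)"
  unfolding open_dist
proof
  fix z assume "z \<in> field_of_regularity A"
  then obtain \<epsilon> where \<epsilon>: "\<epsilon> > 0" "\<And>u f. (u, f) \<in> A \<Longrightarrow> \<epsilon> * norm u \<le> norm (f - z *\<^sub>C u)"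
    by (rule field_of_regularityE) blast
  have "w \<in> field_of_regularity A" if "dist w z < \<epsilon> / 2" for w
  proof -
    have "\<epsilon> / 2 * norm u \<le> norm (f - w *\<^sub>C u)" if uf: "(u, f) \<in> A" for u f
    proof -
      have "f - z *\<^sub>C u = (f - w *\<^sub>C u) + (w - z) *\<^sub>C u"
        by (simp add: l2.scale_left_diff_distrib)
      then have "norm (f - z *\<^sub>C u) \<le> norm (f - w *\<^sub>C u) + cmod (w - z) * norm u"
        by (metis norm_scaleC norm_triangle_ineq)
      moreover have "cmod (w - z) * norm u \<le> \<epsilon> / 2 * norm u"
        using that \<open>dist w z < \<epsilon> / 2\<close> by (intro mult_right_mono) (auto simp: dist_norm)
      ultimately show ?thesis using \<epsilon>(2)[OF uf] by (simp add: algebra_simps)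
    qed
    then show ?thesis unfolding field_of_regularity_def using \<epsilon>(1)
      by (auto intro!: exI[of _ "\<epsilon> / 2"])
  qed
  then show "\<exists>e>0. \<forall>w. dist w z < e \<longrightarrow> w \<in> field_of_regularity A"
    using \<epsilon>(1) by (intro exI[of _ "\<epsilon> / 2"]) simp
qed

lemma shifted_range_subspace:
  assumes "linear_graph A"
  shows "l2.subspace (shifted_range A z)"
  unfolding l2.subspace_def
proof (intro conjI ballI allI)
  show "0 \<in> shifted_range A z"
    unfolding shifted_range_def using assms
    by (intro CollectI exI[of _ 0]) (simp add: linear_graph_def)
next
  fix x y assume "x \<in> shifted_range A z" "y \<in> shifted_range A z"
  then obtain u f v g where *: "(u, f) \<in> A" "(v, g) \<in> A" "x = f - z *\<^sub>C u" "y = g - z *\<^sub>C v"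
    unfolding shifted_range_def by blast
  then have "(u + v, f + g) \<in> A" "x + y = (f + g) - z *\<^sub>C (u + v)"
    using linear_graph_add[OF assms] by (simp_all add: l2.scale_right_distrib)
  then show "x + y \<in> shifted_range A z" unfolding shifted_range_def by blast
next
  fix c x assume "x \<in> shifted_range A z"
  then obtain u f where *: "(u, f) \<in> A" "x = f - z *\<^sub>C u"
    unfolding shifted_range_def by blast
  then have "(c *\<^sub>C u, c *\<^sub>C f) \<in> A" "c *\<^sub>C x = c *\<^sub>C f - z *\<^sub>C (c *\<^sub>C u)"
    using linear_graph_scale[OF assms] by (simp_all add: l2.scale_right_diff_distrib mult.commute)
  then show "c *\<^sub>C x \<in> shifted_range A z" unfolding shifted_range_def by blast
qed

text \<open>The lower bound makes the preimages of a Cauchy sequence in the range a Cauchy sequence, and the graph is closed.\<close>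

theorem shifted_range_closed:
  assumes "closed A" "linear_graph A" "z \<in> field_of_regularity A"
  shows "closed (shifted_range A z)"
  unfolding closed_sequential_limits
proof (intro allI impI, elim conjE)
  fix x l assume x: "\<forall>n. x n \<in> shifted_range A z" and lim: "x \<longlonglongrightarrow> l"
  obtain \<epsilon> where \<epsilon>: "\<epsilon> > 0" "\<And>u f. (u, f) \<in> A \<Longrightarrow> \<epsilon> * norm u \<le> norm (f - z *\<^sub>C u)"
    using field_of_regularityE[OF assms(3)] by blast
  have "\<exists>p. p \<in> A \<and> x n = snd p - z *\<^sub>C fst p" for n
  proof -
    obtain u f where "x n = f - z *\<^sub>C u" "(u, f) \<in> A"
      using x unfolding shifted_range_def by blast
    then show ?thesis by (intro exI[of _ "(u, f)"]) simp
  qed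
  then obtain p where p: "\<And>n. p n \<in> A" "\<And>n. x n = snd (p n) - z *\<^sub>C fst (p n)" by metis
  define u where "u n = fst (p n)" for n
  define f where "f n = snd (p n)" for n
  have uf: "(u n, f n) \<in> A" "x n = f n - z *\<^sub>C u n" for n using p[of n] by (auto simp: u_def f_def)
  have du: "norm (u m - u n) \<le> norm (x m - x n) / \<epsilon>" for m n
  proof -
    have "(u m - u n, f m - f n) \<in> A" by (rule linear_graph_diff[OF assms(2) uf(1) uf(1)])
    then have "\<epsilon> * norm (u m - u n) \<le> norm (f m - f n - z *\<^sub>C (u m - u n))" by (rule \<epsilon>(2))
    also have "f m - f n - z *\<^sub>C (u m - u n) = x m - x n"
      by (simp add: uf l2.scale_right_diff_distrib)
    finally show ?thesis using \<epsilon>(1) by (simp add: field_simps)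
  qed
  have "Cauchy x" using lim LIMSEQ_imp_Cauchy by blast
  have "Cauchy u"
  proof (rule CauchyI)
    fix e :: real assume "e > 0"
    then have "e * \<epsilon> > 0" using \<epsilon>(1) by simp
    then obtain M where M: "\<forall>m\<ge>M. \<forall>n\<ge>M. norm (x m - x n) < e * \<epsilon>" using CauchyD[OF \<open>Cauchy x\<close>] by blast
    have "norm (u m - u n) < e" if "m \<ge> M" "n \<ge> M" for m n
    proof -
      have "norm (x m - x n) / \<epsilon> < e" using M that \<epsilon>(1) by (simp add: field_simps)
      with du[of m n] show ?thesis by linarith
    qed
    then show "\<exists>M. \<forall>m\<ge>M. \<forall>n\<ge>M. norm (u m - u n) < e" by blast
  qed
  then obtain a where a: "u \<longlonglongrightarrow> a" using Cauchy_convergent convergent_def by blast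
  have "f \<longlonglongrightarrow> l + z *\<^sub>C a"
  proof -
    have "(\<lambda>n. x n + z *\<^sub>C u n) \<longlonglongrightarrow> l + z *\<^sub>C a"
      by (intro tendsto_add lim bounded_bilinear.tendsto[OF bounded_bilinear_scaleC tendsto_const a])
    then show ?thesis by (simp add: uf)
  qed
  then have "(\<lambda>n. (u n, f n)) \<longlonglongrightarrow> (a, l + z *\<^sub>C a)" by (intro tendsto_Pair a)
  then have "(a, l + z *\<^sub>C a) \<in> A" using closed_sequentially[OF assms(1), of "\<lambda>n. (u n, f n)"] uf by blast
  then show "l \<in> shifted_range A z" unfolding shifted_range_def
    by (intro CollectI exI[of _ a] exI[of _ "l + z *\<^sub>C a"]) simp
qed

text \<open>The inverse \<open>T\<close> of \<open>A - z\<close> is bounded on the closed range \<open>M\<close> of \<open>A - z\<close>. Its adjoint \<open>G\<close>, given by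
\<open>\<langle>T m, f\<rangle> = \<langle>m, G f\<rangle>\<close> through the Riesz representation on \<open>M\<close>, is a right inverse of \<open>A\<^sup>* - cnj z\<close>.\<close>

theorem adjoint_right_inverse_exists:
  assumes "closed A" "linear_graph A" "z \<in> field_of_regularity A"
  shows "\<exists>G C. (\<forall>f. (G f, f + cnj z *\<^sub>C G f) \<in> adjoint_op A) \<and> (\<forall>f g. G (f + g) = G f + G g) \<and>
    (\<forall>c f. G (c *\<^sub>C f) = c *\<^sub>C G f) \<and> C > 0 \<and> (\<forall>f. norm (G f) \<le> C * norm f)"
proof -
  obtain \<epsilon> where \<epsilon>: "\<epsilon> > 0" "\<And>u f. (u, f) \<in> A \<Longrightarrow> \<epsilon> * norm u \<le> norm (f - z *\<^sub>C u)"
    using field_of_regularityE[OF assms(3)] by blast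
  define M where "M = shifted_range A z"
  have M: "closed M" "l2.subspace M"
    using shifted_range_closed[OF assms] shifted_range_subspace[OF assms(2)] by (auto simp: M_def)
  have "\<exists>u. (u, m + z *\<^sub>C u) \<in> A" if m: "m \<in> M" for m
  proof -
    obtain u f where "m = f - z *\<^sub>C u" "(u, f) \<in> A"
      using m unfolding M_def shifted_range_def by blast
    then show ?thesis by (intro exI[of _ u]) simp
  qed
  then obtain T where T: "\<And>m. m \<in> M \<Longrightarrow> (T m, m + z *\<^sub>C T m) \<in> A" by metis
  have uniq: "u = v" if "(u, m + z *\<^sub>C u) \<in> A" "(v, m + z *\<^sub>C v) \<in> A" for u v m
  proof -
    have "(u - v, (m + z *\<^sub>C u) - (m + z *\<^sub>C v)) \<in> A" by (rule linear_graph_diff[OF assms(2) that])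
    then have "\<epsilon> * norm (u - v) \<le> norm ((m + z *\<^sub>C u) - (m + z *\<^sub>C v) - z *\<^sub>C (u - v))" by (rule \<epsilon>(2))
    also have "\<dots> = 0" by (simp add: l2.scale_right_diff_distrib)
    finally show ?thesis using \<epsilon>(1) by (simp add: mult_le_0_iff)
  qed
  have Tu: "T (f - z *\<^sub>C u) = u" if "(u, f) \<in> A" for u f
  proof (rule uniq[OF T])
    show "f - z *\<^sub>C u \<in> M" using that unfolding M_def shifted_range_def by blast
    show "(u, f - z *\<^sub>C u + z *\<^sub>C u) \<in> A" using that by simp
  qed
  have Tadd: "T (m + n) = T m + T n" if "m \<in> M" "n \<in> M" for m n
  proof (rule uniq[OF T])
    show "m + n \<in> M" by (rule l2.subspace_add[OF M(2) that])
    have "(T m + T n, (m + z *\<^sub>C T m) + (n + z *\<^sub>C T n)) \<in> A"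
      by (rule linear_graph_add[OF assms(2) T[OF that(1)] T[OF that(2)]])
    then show "(T m + T n, m + n + z *\<^sub>C (T m + T n)) \<in> A"
      by (simp add: l2.scale_right_distrib add_ac)
  qed
  have Tscale: "T (c *\<^sub>C m) = c *\<^sub>C T m" if "m \<in> M" for c m
  proof (rule uniq[OF T])
    show "c *\<^sub>C m \<in> M" by (rule l2.subspace_scale[OF M(2) that])
    have "(c *\<^sub>C T m, c *\<^sub>C (m + z *\<^sub>C T m)) \<in> A"
      by (rule linear_graph_scale[OF assms(2) T[OF that]])
    then show "(c *\<^sub>C T m, c *\<^sub>C m + z *\<^sub>C (c *\<^sub>C T m)) \<in> A"
      by (simp add: l2.scale_right_distrib mult.commute)
  qed
  have Tb: "norm (T m) \<le> norm m / \<epsilon>" if "m \<in> M" for m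
    using \<epsilon>(2)[OF T[OF that]] \<epsilon>(1) by (simp add: field_simps)
  have "\<exists>g\<in>M. \<forall>m\<in>M. cinner (T m) f = cinner m g" for f
  proof (rule riesz_representation[OF M])
    show "cmod (cinner (T m) f) \<le> (norm f / \<epsilon>) * norm m" if "m \<in> M" for m
    proof -
      have "cmod (cinner (T m) f) \<le> norm (T m) * norm f" by (rule cinner_le_norm)
      also have "\<dots> \<le> (norm m / \<epsilon>) * norm f" by (intro mult_right_mono Tb that) simp
      finally show ?thesis by (simp add: field_simps)
    qed
  qed (simp_all add: Tadd Tscale cinner_add_left cinner_scaleC_left)
  then obtain G where G: "\<And>f. G f \<in> M" "\<And>f m. m \<in> M \<Longrightarrow> cinner (T m) f = cinner m (G f)" by metis
  have Guniq: "G f = g" if g: "g \<in> M" "\<And>m. m \<in> M \<Longrightarrow> cinner (T m) f = cinner m g" for f g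
  proof -
    have d: "G f - g \<in> M" by (rule l2.subspace_diff[OF M(2) G(1) g(1)])
    have "cinner (G f - g) (G f - g) = cinner (G f - g) (G f) - cinner (G f - g) g"
      by (rule bounded_bilinear.diff_right[OF bounded_bilinear_cinner])
    also have "\<dots> = 0" using G(2)[OF d, of f] g(2)[OF d] by simp
    finally show ?thesis using Re_cinner_self[of "G f - g"] by simp
  qed
  have adj: "(G f, f + cnj z *\<^sub>C G f) \<in> adjoint_op A" for f
    unfolding adjoint_op_def
  proof (clarify)
    fix u h assume uh: "(u, h) \<in> A"
    then have "h - z *\<^sub>C u \<in> M" unfolding M_def shifted_range_def by blast
    from G(2)[OF this, of f] have "cinner u f = cinner (h - z *\<^sub>C u) (G f)"
      by (simp add: Tu[OF uh])
    then show "cinner h (G f) = cinner u (f + cnj z *\<^sub>C G f)"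
      by (simp add: bounded_bilinear.diff_left[OF bounded_bilinear_cinner] cinner_scaleC_left
          cinner_add_right cinner_scaleC_right)
  qed
  have Gadd: "G (f + g) = G f + G g" for f g
    by (rule Guniq) (simp_all add: cinner_add_right G(2) l2.subspace_add[OF M(2) G(1) G(1)])
  have Gscale: "G (c *\<^sub>C f) = c *\<^sub>C G f" for c f
    by (rule Guniq) (simp_all add: cinner_scaleC_right G(2) l2.subspace_scale[OF M(2) G(1)])
  have Gb: "norm (G f) \<le> (1 / \<epsilon>) * norm f" for f
  proof (cases "G f = 0")
    case False
    have "norm (G f) * norm (G f) = cmod (cinner (G f) (G f))"
    proof -
      have "Re (cinner (G f) (G f)) = norm (G f) * norm (G f)"
        by (simp add: norm_l2_def inner_l2_def Re_cinner_self)
      moreover have "Im (cinner (G f) (G f)) = 0"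
        using arg_cong[OF cinner_commute[of "G f" "G f"], of Im] by simp
      ultimately show ?thesis by (simp add: cmod_eq_Re)
    qed
    also have "\<dots> = cmod (cinner (T (G f)) f)" using G by simp
    also have "\<dots> \<le> norm (T (G f)) * norm f" by (rule cinner_le_norm)
    also have "\<dots> \<le> (norm (G f) / \<epsilon>) * norm f" by (intro mult_right_mono Tb G) simp
    finally have "norm (G f) * norm (G f) \<le> norm (G f) * ((1 / \<epsilon>) * norm f)" by simp
    then show ?thesis by (rule mult_left_le_imp_le) (use False in simp)
  qed (use \<epsilon> in simp)
  show ?thesis
    by (rule exI[of _ G], rule exI[of _ "1 / \<epsilon>"]) (use adj Gadd Gscale Gb \<epsilon>(1) in simp)
qed

text \<open>For \<open>|z - z\<^sub>0| C < 1/2\<close> the map \<open>x \<mapsto> a + (z - z\<^sub>0) G x\<close> is a contraction with fixed point of norm at most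
\<open>2 \<parallel>a\<parallel>\<close>. This bound is used three times: for \<open>S\<close> itself, for its increments, and for the remainder after
subtracting the derivative, which is the fixed point \<open>D\<close> of \<open>D = G (S z) + (z - z\<^sub>0) G D\<close>.\<close>

theorem holomorphic_perturbation:
  fixes G :: "'n::finite l2 \<Rightarrow> 'n l2"
  assumes add: "\<And>f g. G (f + g) = G f + G g" and scale: "\<And>c f. G (c *\<^sub>C f) = c *\<^sub>C G f"
    and C: "C > 0" "\<And>f. norm (G f) \<le> C * norm f"
  shows "\<exists>S. S z0 = y0 \<and> (\<forall>z\<in>ball z0 (1 / (2 * C)). S z = y0 + (z - z0) *\<^sub>C G (S z)) \<and>
     l2_holomorphic_on S (ball z0 (1 / (2 * C)))"
proof -
  let ?B = "ball z0 (1 / (2 * C))"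
  have diff: "G (f - g) = G f - G g" for f g
    by (simp only: minus_l2_def uminus_l2_def add scale)
  have small: "cmod (z - z0) * C \<le> 1 / 2" if "z \<in> ?B" for z
    using that C(1) by (simp add: dist_norm norm_minus_commute field_simps)
  have ex: "\<exists>!x. a + (z - z0) *\<^sub>C G x = x" if "z \<in> ?B" for z a
  proof (rule banach_fix_type[of "1/2"])
    show "\<forall>x y. dist (a + (z - z0) *\<^sub>C G x) (a + (z - z0) *\<^sub>C G y) \<le> 1 / 2 * dist x y"
    proof (intro allI)
      fix x y
      have "dist (a + (z - z0) *\<^sub>C G x) (a + (z - z0) *\<^sub>C G y) = cmod (z - z0) * norm (G (x - y))"
        by (simp add: dist_norm diff norm_scaleC[symmetric] l2.scale_right_diff_distrib)
      also have "\<dots> \<le> cmod (z - z0) * (C * norm (x - y))" by (intro mult_left_mono C) simp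
      also have "\<dots> = (cmod (z - z0) * C) * norm (x - y)" by simp
      also have "\<dots> \<le> 1 / 2 * norm (x - y)" by (intro mult_right_mono small that) simp
      finally show "dist (a + (z - z0) *\<^sub>C G x) (a + (z - z0) *\<^sub>C G y) \<le> 1 / 2 * dist x y"
        by (simp add: dist_norm)
    qed
  qed auto
  have apriori: "norm x \<le> 2 * norm a" if "z \<in> ?B" "x = a + (z - z0) *\<^sub>C G x" for x a z
  proof -
    have "norm x \<le> norm a + norm ((z - z0) *\<^sub>C G x)"
      by (subst that(2)) (rule norm_triangle_ineq)
    also have "norm ((z - z0) *\<^sub>C G x) \<le> cmod (z - z0) * (C * norm x)"
      unfolding norm_scaleC by (intro mult_left_mono C) simp
    also have "\<dots> = (cmod (z - z0) * C) * norm x" by simp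
    also have "\<dots> \<le> 1 / 2 * norm x" by (intro mult_right_mono small that) simp
    finally show ?thesis by simp
  qed
  have "\<forall>z\<in>?B. \<exists>x. x = y0 + (z - z0) *\<^sub>C G x" using ex by metis
  then obtain S where S: "\<And>z. z \<in> ?B \<Longrightarrow> S z = y0 + (z - z0) *\<^sub>C G (S z)" by metis
  have Sb: "norm (S z) \<le> 2 * norm y0" if "z \<in> ?B" for z by (rule apriori[OF that S[OF that]])
  have "\<exists>D. (S has_derivative (\<lambda>h. h *\<^sub>C D)) (at z within ?B)" if z: "z \<in> ?B" for z
  proof -
    obtain D where D: "D = G (S z) + (z - z0) *\<^sub>C G D" using ex[OF z] by metis
    have lip: "norm (S w - S z) \<le> 2 * cmod (w - z) * (C * (2 * norm y0))" if w: "w \<in> ?B" for w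
    proof -
      have "S w - S z = (w - z) *\<^sub>C G (S w) + (z - z0) *\<^sub>C G (S w - S z)"
      proof -
        have "S w - S z = (w - z0) *\<^sub>C G (S w) - (z - z0) *\<^sub>C G (S z)"
          using S[OF w] S[OF z] by (metis add_diff_cancel_left)
        also have "\<dots> = (w - z) *\<^sub>C G (S w) + (z - z0) *\<^sub>C (G (S w) - G (S z))"
          by (simp add: l2.scale_left_diff_distrib l2.scale_right_diff_distrib)
        finally show ?thesis unfolding diff .
      qed
      then have "norm (S w - S z) \<le> 2 * norm ((w - z) *\<^sub>C G (S w))" by (rule apriori[OF z])
      also have "\<dots> = 2 * cmod (w - z) * norm (G (S w))" by (simp add: norm_scaleC)
      also have "\<dots> \<le> 2 * cmod (w - z) * (C * (2 * norm y0))"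
        by (intro mult_left_mono order_trans[OF C(2)] Sb w) (use C(1) in auto)
      finally show ?thesis .
    qed
    define E where "E w = S w - S z - (w - z) *\<^sub>C D" for w
    define c where "c = 2 * (C * (2 * (C * (2 * norm y0))))"
    have Eb: "norm (E w) \<le> c * (cmod (w - z) * cmod (w - z))" if w: "w \<in> ?B" for w
    proof -
      have "E w = (w - z) *\<^sub>C G (S w - S z) + (z - z0) *\<^sub>C G (E w)"
      proof -
        have "S w - S z = (w - z0) *\<^sub>C G (S w) - (z - z0) *\<^sub>C G (S z)"
          using S[OF w] S[OF z] by (metis add_diff_cancel_left)
        moreover have "(w - z) *\<^sub>C D = (w - z) *\<^sub>C G (S z) + (z - z0) *\<^sub>C ((w - z) *\<^sub>C G D)"
          by (subst D) (simp add: l2.scale_right_distrib mult.commute)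
        ultimately have "E w = (w - z0) *\<^sub>C G (S w) - (z - z0) *\<^sub>C G (S z)
            - ((w - z) *\<^sub>C G (S z) + (z - z0) *\<^sub>C ((w - z) *\<^sub>C G D))"
          by (simp only: E_def)
        also have "\<dots> = (w - z) *\<^sub>C (G (S w) - G (S z))
            + (z - z0) *\<^sub>C (G (S w) - G (S z) - (w - z) *\<^sub>C G D)"
          by (simp add: l2.scale_left_diff_distrib l2.scale_right_diff_distrib)
        also have "\<dots> = (w - z) *\<^sub>C G (S w - S z) + (z - z0) *\<^sub>C G (E w)"
          by (simp only: E_def diff scale)
        finally show ?thesis .
      qed
      then have "norm (E w) \<le> 2 * norm ((w - z) *\<^sub>C G (S w - S z))" by (rule apriori[OF z])
      also have "\<dots> = 2 * cmod (w - z) * norm (G (S w - S z))" by (simp add: norm_scaleC)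
      also have "\<dots> \<le> 2 * cmod (w - z) * (C * (2 * cmod (w - z) * (C * (2 * norm y0))))"
        by (intro mult_left_mono order_trans[OF C(2)] lip w) (use C(1) in auto)
      finally show ?thesis by (simp add: c_def algebra_simps)
    qed
    have "(S has_derivative (\<lambda>h. h *\<^sub>C D)) (at z within ?B)"
      unfolding has_derivative_within_alt
    proof (intro conjI allI impI)
      show "bounded_linear (\<lambda>h. h *\<^sub>C D)" by (rule bounded_bilinear.bounded_linear_left[OF bounded_bilinear_scaleC])
      fix e :: real assume "e > 0"
      have "c \<ge> 0" using C(1) by (simp add: c_def)
      show "\<exists>d>0. \<forall>w\<in>?B. norm (w - z) < d \<longrightarrow> norm (S w - S z - (w - z) *\<^sub>C D) \<le> e * norm (w - z)"
      proof (intro exI[of _ "e / (c + 1)"] conjI ballI impI)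
        show "e / (c + 1) > 0" using \<open>e > 0\<close> \<open>c \<ge> 0\<close> by simp
        fix w assume w: "w \<in> ?B" "norm (w - z) < e / (c + 1)"
        have "c * cmod (w - z) \<le> c * (e / (c + 1))" using w(2) \<open>c \<ge> 0\<close> by (intro mult_left_mono) auto
        also have "\<dots> \<le> e" using \<open>e > 0\<close> \<open>c \<ge> 0\<close> by (simp add: field_simps)
        finally have "c * cmod (w - z) * cmod (w - z) \<le> e * cmod (w - z)"
          by (rule mult_right_mono) simp
        then show "norm (S w - S z - (w - z) *\<^sub>C D) \<le> e * norm (w - z)"
          using Eb[OF w(1)] by (simp add: E_def mult.assoc)
      qed
    qed
    then show ?thesis ..
  qed
  moreover have "S z0 = y0" using S[of z0] C(1) by simp
  ultimately show ?thesis using S unfolding l2_holomorphic_on_def by blast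
qed

section \<open>Integration over the half-line\<close>

lemma half_line_integrable_iff:
  fixes f :: "real \<Rightarrow> 'b::{banach,second_countable_topology}"
  shows "integrable half_line f \<longleftrightarrow> set_integrable lebesgue {0..} f"
  by (simp add: integrable_restrict_space set_integrable_def)

lemma half_line_indicator_measurable: "A \<in> sets lebesgue \<Longrightarrow> indicat_real A \<in> borel_measurable half_line"
  by (intro measurable_restrict_space1 borel_measurable_indicator)

lemma square_integrable_cong_AE:
  assumes "square_integrable f" "AE t in half_line. f t = g t" "g \<in> borel_measurable half_line"
  shows "square_integrable g"
  unfolding square_integrable_def
proof
  note [measurable] = assms(3) conjunct1[OF assms(1)[unfolded square_integrable_def]]
  have "AE t in half_line. (norm (f t))\<^sup>2 = (norm (g t))\<^sup>2"
    using assms(2) by eventually_elim simp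
  then show "integrable half_line (\<lambda>t. (norm (g t))\<^sup>2)"
    using assms(1) by (subst integrable_cong_AE[symmetric, where f = "\<lambda>t. (norm (f t))\<^sup>2"])
      (auto simp: square_integrable_def)
qed fact

lemma continuous_half_line_measurable:
  "continuous_on {0..} f \<Longrightarrow> f \<in> borel_measurable half_line"
  by (rule continuous_imp_measurable_on_sets_lebesgue) auto

lemma square_integrable_compact_support:
  fixes f :: "real \<Rightarrow> complex ^ 'n::finite"
  assumes f[measurable]: "f \<in> borel_measurable half_line"
    and bound: "\<And>t. 0 \<le> t \<Longrightarrow> t \<le> T \<Longrightarrow> norm (f t) \<le> B" and supp: "\<And>t. t > T \<Longrightarrow> f t = 0"
  shows "square_integrable f"
  unfolding square_integrable_def
proof
  have "set_integrable lebesgue {0..T} (\<lambda>_. B\<^sup>2)"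
    by (intro absolutely_integrable_continuous_real continuous_on_const)
  moreover have "(\<lambda>t. indicator {0..} t *\<^sub>R (indicator {0..T} t * B\<^sup>2)) = (\<lambda>t. indicator {0..T} t *\<^sub>R B\<^sup>2)"
    by (auto simp: indicator_def)
  ultimately have "set_integrable lebesgue {0..} (\<lambda>t. indicator {0..T} t * B\<^sup>2)"
    by (simp only: set_integrable_def)
  then have "integrable half_line (\<lambda>t. indicator {0..T} t * B\<^sup>2)"
    unfolding half_line_integrable_iff .
  then show "integrable half_line (\<lambda>t. (norm (f t))\<^sup>2)"
  proof (rule Bochner_Integration.integrable_bound)
    show "AE t in half_line. norm ((norm (f t))\<^sup>2) \<le> norm (indicator {0..T} t * B\<^sup>2)"
    proof (rule AE_I2)
      fix t assume "t \<in> space half_line"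
      then have "0 \<le> t" by simp
      then show "norm ((norm (f t))\<^sup>2) \<le> norm (indicator {0..T} t * B\<^sup>2)"
        using bound[of t] supp[of t] by (cases "t \<le> T") (auto intro!: power_mono)
    qed
  qed measurable
qed fact

text \<open>From \<open>r \<le> 1 + r\<^sup>2\<close> on bounded intervals.\<close>

lemma square_integrable_L1_loc:
  fixes f :: "real \<Rightarrow> complex ^ 'n::finite"
  assumes "square_integrable f"
  shows "L1_loc f"
  unfolding L1_loc_def
proof (intro allI impI)
  fix d :: real assume "0 \<le> d"
  have "set_integrable lebesgue {0..} (\<lambda>t. (norm (f t))\<^sup>2)"
    using assms by (simp add: square_integrable_def integrable_restrict_space set_integrable_def)
  then have "set_integrable lebesgue {0..d} (\<lambda>t. (norm (f t))\<^sup>2)"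
    by (rule set_integrable_subset) auto
  then have 1: "set_integrable lebesgue {0..d} (\<lambda>t. 1 + (norm (f t))\<^sup>2)"
    by (rule set_integral_add(1)[rotated]) (rule absolutely_integrable_continuous_real continuous_on_const)+
  have 2: "set_borel_measurable lebesgue {0..d} f"
  proof -
    have "(\<lambda>t. indicator {0..} t *\<^sub>R f t) \<in> borel_measurable lebesgue"
      using assms by (simp add: square_integrable_def borel_measurable_restrict_space_iff)
    then have "(\<lambda>t. indicator {0..d} t *\<^sub>R (indicator {0..} t *\<^sub>R f t)) \<in> borel_measurable lebesgue"
      by (rule borel_measurable_scaleR[OF borel_measurable_indicator, rotated]) simp
    also have "(\<lambda>t. indicator {0..d} t *\<^sub>R (indicator {0..} t *\<^sub>R f t)) = (\<lambda>t. indicator {0..d} t *\<^sub>R f t)"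
      by (auto simp: indicator_def)
    finally show ?thesis by (simp add: set_borel_measurable_def)
  qed
  have le: "r \<le> 1 + r\<^sup>2" for r :: real
  proof -
    have "0 \<le> (1 - r)\<^sup>2" by simp
    then have "2 * r \<le> 1 + r\<^sup>2" by (simp add: power2_diff)
    moreover have "0 \<le> 1 + r\<^sup>2" by simp
    ultimately show ?thesis by linarith
  qed
  have "norm (f t) \<le> norm (1 + (norm (f t))\<^sup>2)" for t
    using le[of "norm (f t)"] by simp
  then show "f absolutely_integrable_on {0..d}"
    by (intro set_integrable_bound[OF 1 2] AE_I2) auto
qed

lemma half_line_integral_support:
  fixes F :: "real \<Rightarrow> complex"
  assumes F: "integrable half_line F" and ab: "0 \<le> a"
    and supp: "\<And>t. 0 \<le> t \<Longrightarrow> t \<notin> {a..b} \<Longrightarrow> F t = 0"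
  shows "integral\<^sup>L half_line F = integral {a..b} F"
proof -
  have "set_integrable lebesgue {0..} F" using F by (simp add: integrable_restrict_space set_integrable_def)
  then have si: "set_integrable lebesgue {a..b} F" by (rule set_integrable_subset) (use ab in auto)
  have "integral\<^sup>L half_line F = integral\<^sup>L lebesgue (\<lambda>t. indicator {0..} t *\<^sub>R F t)"
    by (simp add: integral_restrict_space)
  also have "\<dots> = integral\<^sup>L lebesgue (\<lambda>t. indicator {a..b} t *\<^sub>R F t)"
    by (intro Bochner_Integration.integral_cong refl) (use ab supp in \<open>auto simp: indicator_def\<close>)
  also have "\<dots> = integral {a..b} F"
    using set_lebesgue_integral_eq_integral(2)[OF si] by (simp add: set_lebesgue_integral_def)
  finally show ?thesis .
qed

lemma half_line_integral_limit:
  fixes F :: "real \<Rightarrow> complex"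
  assumes F: "integrable half_line F"
  shows "((\<lambda>T. integral {0..T} F) \<longlongrightarrow> integral\<^sup>L half_line F) at_top"
proof -
  note [measurable] = borel_measurable_integrable[OF F]
  have "((\<lambda>T. integral\<^sup>L half_line (\<lambda>t. indicator {0..T} t *\<^sub>R F t)) \<longlongrightarrow> integral\<^sup>L half_line F) at_top"
  proof (rule integral_dominated_convergence_at_top[where w = "\<lambda>t. norm (F t)"])
    show "eventually (\<lambda>T. AE t in half_line. norm (indicator {0..T} t *\<^sub>R F t) \<le> norm (F t)) at_top"
      by (intro always_eventually allI AE_I2) (auto simp: indicator_def)
    show "AE t in half_line. ((\<lambda>T. indicator {0..T} t *\<^sub>R F t) \<longlongrightarrow> F t) at_top"
    proof (rule AE_I2)
      fix t assume t: "t \<in> space half_line"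
      have "eventually (\<lambda>T. indicator {0..T} t *\<^sub>R F t = F t) at_top"
        using eventually_ge_at_top[of t] by eventually_elim (use t in auto)
      then show "((\<lambda>T. indicator {0..T} t *\<^sub>R F t) \<longlongrightarrow> F t) at_top" by (rule tendsto_eventually)
    qed
  qed (use F in \<open>auto intro!: borel_measurable_scaleR half_line_indicator_measurable\<close>)
  moreover have "integral\<^sup>L half_line (\<lambda>t. indicator {0..T} t *\<^sub>R F t) = integral {0..T} F" for T
  proof -
    have "integrable half_line (\<lambda>t. indicator {0..T} t *\<^sub>R F t)"
    proof (rule Bochner_Integration.integrable_bound[OF F])
      show "(\<lambda>t. indicat_real {0..T} t *\<^sub>R F t) \<in> borel_measurable half_line"
        by (intro borel_measurable_scaleR half_line_indicator_measurable borel_measurable_integrable[OF F]) simp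
      show "AE t in half_line. norm (indicat_real {0..T} t *\<^sub>R F t) \<le> norm (F t)"
        by (intro AE_I2) (auto simp: indicator_def)
    qed
    then have "integral\<^sup>L half_line (\<lambda>t. indicator {0..T} t *\<^sub>R F t) = integral {0..T} (\<lambda>t. indicator {0..T} t *\<^sub>R F t)"
      by (rule half_line_integral_support) auto
    also have "\<dots> = integral {0..T} F"
      by (rule Henstock_Kurzweil_Integration.integral_cong) auto
    finally show ?thesis .
  qed
  ultimately show ?thesis by simp
qed

text \<open>An integrable function cannot tend to a nonzero constant at infinity. This removes the boundary term at infinity in
Green's formula without any pointwise decay estimate.\<close>

lemma integrable_limit_at_top_zero:
  fixes F :: "real \<Rightarrow> complex"
  assumes F: "integrable half_line F" and lim: "(F \<longlongrightarrow> c) at_top"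
  shows "c = 0"
proof (rule ccontr)
  assume "c \<noteq> 0"
  then have "eventually (\<lambda>t. dist (F t) c < cmod c / 2) at_top"
    using tendstoD[OF lim, of "cmod c / 2"] by simp
  then obtain T0 where T0: "\<And>t. t \<ge> T0 \<Longrightarrow> dist (F t) c < cmod c / 2"
    by (auto simp: eventually_at_top_linorder)
  define T where "T = max 0 T0"
  have "integrable lebesgue (\<lambda>t. indicator {0..} t *\<^sub>R F t)"
    using F by (simp add: integrable_restrict_space set_integrable_def)
  then have "integrable lebesgue (\<lambda>t. 2 / cmod c * norm (indicator {0..} t *\<^sub>R F t))"
    by (intro integrable_mult_right integrable_norm)
  then have "integrable lebesgue (indicat_real {T..})"
  proof (rule Bochner_Integration.integrable_bound)
    have "1 \<le> 2 / cmod c * norm (F t)" if "t \<ge> T" for t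
    proof -
      have "cmod c \<le> norm (F t) + dist (F t) c"
        using norm_triangle_ineq4[of "F t" "F t - c"] by (simp add: dist_norm)
      then have "cmod c / 2 \<le> norm (F t)" using T0[of t] that by (simp add: T_def)
      then show ?thesis using \<open>c \<noteq> 0\<close> by (simp add: field_simps)
    qed
    then show "AE t in lebesgue. norm (indicat_real {T..} t) \<le> norm (2 / cmod c * norm (indicator {0..} t *\<^sub>R F t))"
      by (intro AE_I2) (auto simp: indicator_def T_def)
  qed (rule borel_measurable_indicator, simp)
  then have lm: "{T..} \<in> lmeasurable" by (simp add: lmeasurable_iff_integrable)
  obtain n :: nat where n: "real n > measure lebesgue {T..}" using reals_Archimedean2 by blast
  have "measure lebesgue {T..T + real n} \<le> measure lebesgue {T..}"
    by (rule measure_mono_fmeasurable[OF _ _ lm]) auto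
  then show False using n by simp
qed

section \<open>The bilinear form of the conjugation and Green's formula\<close>

definition swap_index :: "'p + 'p \<Rightarrow> 'p + 'p" where
  "swap_index i = (case i of Inl k \<Rightarrow> Inr k | Inr k \<Rightarrow> Inl k)"

definition J_sign :: "'p + 'p \<Rightarrow> complex" where
  "J_sign i = (case i of Inl k \<Rightarrow> \<i> | Inr k \<Rightarrow> - \<i>)"

text \<open>The complex bilinear form obtained from the inner product by conjugating the second argument with \<open>j\<close>.\<close>

definition bform :: "complex ^ ('p::finite + 'p) \<Rightarrow> complex ^ ('p + 'p) \<Rightarrow> complex" where
  "bform x y = (\<Sum>i\<in>UNIV. x $ i * y $ swap_index i)"

text \<open>The boundary form of Green's formula.\<close>

definition sform :: "complex ^ ('p::finite + 'p) \<Rightarrow> complex ^ ('p + 'p) \<Rightarrow> complex" where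
  "sform x y = bform x (J_mat *v y)"

lemma swap_index_swap_index [simp]: "swap_index (swap_index i) = i"
  by (simp add: swap_index_def split: sum.splits)

lemma J_sign_swap_index: "J_sign (swap_index i) = - J_sign i"
  by (simp add: swap_index_def J_sign_def split: sum.splits)

lemma J_sign_square: "J_sign i * J_sign i = -1"
  by (simp add: J_sign_def split: sum.splits)

lemma sum_swap_index: "(\<Sum>i\<in>UNIV. h (swap_index i)) = (\<Sum>i\<in>UNIV. h (i :: 'p::finite + 'p))"
  unfolding swap_index_def by (rule sum_case_swap)

lemma cdot_swap_conj_bform: "cdot x (swap_conj y) = bform x y"
  by (simp add: cdot_def bform_def swap_conj_nth swap_index_def)

lemma J_mat_nth: "(J_mat *v x) $ i = J_sign i * x $ i"
proof -
  have UNIV_Plus: "(UNIV :: ('a + 'a) set) = UNIV <+> UNIV"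
    by simp
  show ?thesis
    by (cases i) (simp_all add: J_mat_def J_sign_def block_matrix_def matrix_vector_mult_def
        UNIV_Plus sum.Plus mat_def if_distrib[where f = "\<lambda>c. c * _"] cong: if_cong del: UNIV_Plus_UNIV)
qed

lemma J_J: "J_mat *v (J_mat *v x) = - x"
  by (simp add: vec_eq_iff J_mat_nth J_sign_square flip: mult.assoc)

lemma bform_commute: "bform x y = bform y x"
  using sum_swap_index[of "\<lambda>i. x $ i * y $ swap_index i"] by (simp add: bform_def mult.commute)

lemma bounded_bilinear_bform: "bounded_bilinear (bform :: complex ^ ('p::finite + 'p) \<Rightarrow> _)"
  unfolding bilinear_conv_bounded_bilinear[symmetric] bilinear_def
  by (intro conjI allI linearI)
     (simp_all add: bform_def distrib_left distrib_right sum.distrib scaleR_sum_right)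

interpretation bform: bounded_bilinear "bform :: complex ^ ('p::finite + 'p) \<Rightarrow> _"
  by (rule bounded_bilinear_bform)

lemma bform_scale_left: "bform (c *s x) y = c * bform x y"
  by (simp add: bform_def sum_distrib_left mult.assoc)

lemma bform_scale_right: "bform x (c *s y) = c * bform x y"
  by (simp add: bform_def sum_distrib_left mult_ac)

lemma bform_J: "bform (J_mat *v x) y = - bform x (J_mat *v y)"
  by (simp add: bform_def J_mat_nth J_sign_swap_index sum_negf[symmetric] mult_ac)

lemma bform_axis: "bform x (axis (swap_index i) 1) = x $ i"
proof -
  have "bform x (axis (swap_index i) 1) = (\<Sum>j\<in>UNIV. if j = i then x $ i else 0)"
    unfolding bform_def
  proof (rule sum.cong)
    fix j
    have "swap_index j = swap_index i \<longleftrightarrow> j = i" by (metis swap_index_swap_index)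
    then show "x $ j * axis (swap_index i) 1 $ swap_index j = (if j = i then x $ i else 0)"
      by (auto simp: axis_def)
  qed simp
  then show ?thesis by simp
qed

lemma bform_nondegenerate: "(\<And>y. bform x y = 0) \<Longrightarrow> x = 0"
  by (metis bform_axis vec_eq_iff zero_index)

lemma bounded_linear_J: "bounded_linear ((*v) (J_mat :: complex ^ ('p::finite + 'p) ^ ('p + 'p)))"
  by (rule bounded_bilinear.bounded_linear_right[OF bounded_bilinear_matrix_vector])

lemma J_minus: "J_mat *v (- x) = - (J_mat *v x)"
  by (simp add: vec_eq_iff J_mat_nth)

lemma bounded_bilinear_sform: "bounded_bilinear (sform :: complex ^ ('p::finite + 'p) \<Rightarrow> _)"
  unfolding sform_def
  using bounded_bilinear.comp[OF bounded_bilinear_bform bounded_linear_ident bounded_linear_J] .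

interpretation sform: bounded_bilinear "sform :: complex ^ ('p::finite + 'p) \<Rightarrow> _"
  by (rule bounded_bilinear_sform)

lemma sform_J: "sform x (- (J_mat *v y)) = bform x y"
  by (simp add: sform_def J_minus J_J)

lemma J_sform: "sform (- (J_mat *v x)) y = - bform x y"
  by (simp add: sform_def bform.minus_left bform_J J_J bform.minus_right)

text \<open>The transpose of a matrix with respect to \<open>bform\<close>; see \<open>bform_matrix\<close>.\<close>

definition sharp :: "complex ^ ('p::finite + 'p) ^ ('p + 'p) \<Rightarrow> complex ^ ('p + 'p) ^ ('p + 'p)" where
  "sharp A = (\<chi> i k. A $ swap_index k $ swap_index i)"

lemma bform_matrix: "bform (A *v x) y = bform x (sharp A *v y)"
proof -
  have "bform (A *v x) y = (\<Sum>i\<in>UNIV. \<Sum>k\<in>UNIV. A $ i $ k * x $ k * y $ swap_index i)"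
    by (simp add: bform_def matrix_vector_mult_def sum_distrib_right)
  also have "\<dots> = (\<Sum>k\<in>UNIV. \<Sum>i\<in>UNIV. A $ i $ k * x $ k * y $ swap_index i)" by (rule sum.swap)
  also have "\<dots> = (\<Sum>k\<in>UNIV. x $ k * (\<Sum>i\<in>UNIV. sharp A $ swap_index k $ swap_index i * y $ swap_index i))"
    by (simp add: sharp_def sum_distrib_left mult_ac)
  also have "\<dots> = (\<Sum>k\<in>UNIV. x $ k * (\<Sum>i\<in>UNIV. sharp A $ swap_index k $ i * y $ i))"
    by (subst sum_swap_index) (rule refl)
  finally show ?thesis by (simp add: bform_def matrix_vector_mult_def)
qed

text \<open>The equation \<open>J y' + Q y = g\<close>, solved for the derivative by means of \<open>J\<^sup>-\<^sup>1 = - J\<close>.\<close>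

definition solves :: "(real \<Rightarrow> complex ^ ('p::finite + 'p) ^ ('p + 'p)) \<Rightarrow> (real \<Rightarrow> complex ^ ('p + 'p)) \<Rightarrow>
    (real \<Rightarrow> complex ^ ('p + 'p)) \<Rightarrow> bool" where
  "solves Q y g \<longleftrightarrow> AC_deriv y (\<lambda>t. - (J_mat *v (g t - Q t *v y t)))"

lemma dirac_max_iff:
  "(u, f) \<in> dirac_max Q \<longleftrightarrow>
    (\<exists>y g. u = l2_class y \<and> f = l2_class g \<and> square_integrable y \<and> square_integrable g \<and> solves Q y g)"
proof -
  have "(\<exists>y'. AC_deriv y y' \<and> (AE t in half_line. g t = J_mat *v y' t + Q t *v y t)) \<longleftrightarrow> solves Q y g"
    for y g :: "real \<Rightarrow> complex ^ ('a + 'a)"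
  proof
    assume "\<exists>y'. AC_deriv y y' \<and> (AE t in half_line. g t = J_mat *v y' t + Q t *v y t)"
    then obtain y' where y': "AC_deriv y y'" "AE t in half_line. g t = J_mat *v y' t + Q t *v y t" by (elim exE conjE)
    have "AE t in half_line. y' t = - (J_mat *v (g t - Q t *v y t))"
      using y'(2) by eventually_elim (simp add: J_J)
    then show "solves Q y g" unfolding solves_def by (rule AC_deriv_cong_AE[OF y'(1)])
  next
    assume s: "solves Q y g"
    have "AE t in half_line. g t = J_mat *v (- (J_mat *v (g t - Q t *v y t))) + Q t *v y t"
      by (simp add: J_minus J_J)
    with s show "\<exists>y'. AC_deriv y y' \<and> (AE t in half_line. g t = J_mat *v y' t + Q t *v y t)"
      unfolding solves_def by (intro exI[of _ "\<lambda>t. - (J_mat *v (g t - Q t *v y t))"] conjI)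
  qed
  then show ?thesis
    unfolding dirac_max_def AC_deriv_def by blast
qed

lemma solves_cong_AE:
  assumes "solves Q y g" "AE t in half_line. g t = h t"
  shows "solves Q y h"
  unfolding solves_def
  by (rule AC_deriv_cong_AE[OF assms(1)[unfolded solves_def]]) (use assms(2) in eventually_elim, simp)

lemma solves_continuous: "solves Q y g \<Longrightarrow> continuous_on {0..} y"
  by (simp add: solves_def AC_deriv_def AC_loc_continuous)

lemma solves_add:
  assumes "solves Q y g" "solves Q w h"
  shows "solves Q (\<lambda>t. y t + w t) (\<lambda>t. g t + h t)"
proof -
  have "- (J_mat *v (g t - Q t *v y t)) + - (J_mat *v (h t - Q t *v w t))
      = - (J_mat *v ((g t + h t) - Q t *v (y t + w t)))" for t
  proof -
    have "(g t + h t) - Q t *v (y t + w t) = (g t - Q t *v y t) + (h t - Q t *v w t)"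
      by (simp add: matrix_vector_right_distrib)
    then show ?thesis by (simp only: matrix_vector_right_distrib minus_add_distrib)
  qed
  then show ?thesis
    using AC_deriv_add[OF assms[unfolded solves_def]] unfolding solves_def by (simp only:)
qed

lemma bounded_linear_smult: "bounded_linear (\<lambda>x :: complex ^ 'n::finite. c *s x)"
  by (rule linear_conv_bounded_linear[THEN iffD1], rule linearI)
    (simp_all add: vector_add_ldistrib vec_eq_iff)

lemma solves_scale:
  assumes "solves Q y g"
  shows "solves Q (\<lambda>t. c *s y t) (\<lambda>t. c *s g t)"
proof -
  have "c *s (- (J_mat *v (g t - Q t *v y t))) = - (J_mat *v (c *s g t - Q t *v (c *s y t)))" for t
  proof -
    have "c *s (- (J_mat *v x)) = - (J_mat *v (c *s x))" for x :: "complex ^ ('a + 'a)"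
      by (simp add: vec_eq_iff J_mat_nth)
    moreover have "c *s (g t - Q t *v y t) = c *s g t - Q t *v (c *s y t)"
      by (simp only: vector_scalar_commute vector_ssub_ldistrib)
    ultimately show ?thesis by (simp only:)
  qed
  then show ?thesis
    using AC_deriv_linear[OF bounded_linear_smult[of c] assms[unfolded solves_def]] unfolding solves_def by (simp only:)
qed

text \<open>The product rule for \<open>s(y, w)\<close>. The terms in \<open>Q\<close> are kept, since the identity serves to prove that \<open>Q\<close> is symmetric.\<close>

theorem sform_integral_general:
  assumes y: "solves Q y g" and w: "solves Q w h" and ab: "0 \<le> a" "a \<le> b"
  shows "((\<lambda>t. bform (y t) (h t - Q t *v w t) - bform (g t - Q t *v y t) (w t)) has_integral
     (sform (y b) (w b) - sform (y a) (w a))) {a..b}"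
  using AC_deriv_integral[OF AC_deriv_bilinear[OF bounded_bilinear_sform y[unfolded solves_def] w[unfolded solves_def]] ab]
  by (simp add: sform_J J_sform)

theorem green_formula:
  assumes Q: "AE t in half_line. sharp (Q t) = Q t"
    and y: "solves Q y g" and w: "solves Q w h" and ab: "0 \<le> a" "a \<le> b"
  shows "((\<lambda>t. bform (y t) (h t) - bform (g t) (w t)) has_integral
     (sform (y b) (w b) - sform (y a) (w a))) {a..b}"
proof (rule has_integral_spike[OF _ _ sform_integral_general[OF y w ab]])
  show "negligible {t. 0 \<le> t \<and> sharp (Q t) \<noteq> Q t}" using Q by (simp add: AE_half_line_iff)
  show "bform (y t) (h t) - bform (g t) (w t) = bform (y t) (h t - Q t *v w t) - bform (g t - Q t *v y t) (w t)"
    if "t \<in> {a..b} - {t. 0 \<le> t \<and> sharp (Q t) \<noteq> Q t}" for t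
    using that ab bform_matrix[of "Q t" "y t" "w t"] by (simp add: bform.diff_left bform.diff_right)
qed

lemma integrable_bform:
  assumes "square_integrable f" "square_integrable g"
  shows "integrable half_line (\<lambda>t. bform (f t) (g t))"
  using integrable_cdot[OF assms(1) square_integrable_swap_conj[OF assms(2)]] by (simp add: cdot_swap_conj_bform)

text \<open>By Green's formula \<open>s(y(T), w(T))\<close> converges as \<open>T\<close> grows. It is also integrable over the half-line, being built
from a product of two square integrable functions, so its limit is zero.\<close>

theorem green_formula_half_line:
  assumes Q: "AE t in half_line. sharp (Q t) = Q t"
    and y: "solves Q y g" "square_integrable y" "square_integrable g"
    and w: "solves Q w h" "square_integrable w" "square_integrable h"
  shows "integral\<^sup>L half_line (\<lambda>t. bform (y t) (h t) - bform (g t) (w t)) = - sform (y 0) (w 0)"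
proof -
  define F where "F t = bform (y t) (h t) - bform (g t) (w t)" for t
  have F: "integrable half_line F" unfolding F_def
    by (intro Bochner_Integration.integrable_diff integrable_bform y w)
  have eq: "sform (y T) (w T) = sform (y 0) (w 0) + integral {0..T} F" if "T \<ge> 0" for T
    using integral_unique[OF green_formula[OF Q y(1) w(1), of 0 T]] that by (simp add: F_def[abs_def] algebra_simps)
  have "((\<lambda>T. sform (y 0) (w 0) + integral {0..T} F) \<longlongrightarrow> sform (y 0) (w 0) + integral\<^sup>L half_line F) at_top"
    by (intro tendsto_intros half_line_integral_limit F)
  then have lim: "((\<lambda>T. sform (y T) (w T)) \<longlongrightarrow> sform (y 0) (w 0) + integral\<^sup>L half_line F) at_top"
  proof (rule Lim_transform_eventually)
    show "eventually (\<lambda>T. sform (y 0) (w 0) + integral {0..T} F = sform (y T) (w T)) at_top"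
      using eventually_ge_at_top[of 0] by eventually_elim (rule eq[symmetric])
  qed
  have "square_integrable (\<lambda>t. J_mat *v w t)"
    unfolding square_integrable_def
  proof
    show m: "(\<lambda>t. J_mat *v w t) \<in> borel_measurable half_line"
      using w(2) by (intro measurable_compose[OF _ borel_measurable_continuous_onI[OF bounded_linear.continuous_on[OF bounded_linear_J continuous_on_id]]])
        (auto simp: square_integrable_def)
    obtain K where K: "\<And>x. norm (J_mat *v x :: complex ^ ('a + 'a)) \<le> norm x * K"
      using bounded_linear.pos_bounded[OF bounded_linear_J] by blast
    have "integrable half_line (\<lambda>t. K\<^sup>2 * (norm (w t))\<^sup>2)" using w(2) by (auto simp: square_integrable_def)
    then show "integrable half_line (\<lambda>t. (norm (J_mat *v w t))\<^sup>2)"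
    proof (rule Bochner_Integration.integrable_bound)
      show "AE t in half_line. norm ((norm (J_mat *v w t))\<^sup>2) \<le> norm (K\<^sup>2 * (norm (w t))\<^sup>2)"
        using power_mono[OF K norm_ge_zero] by (intro AE_I2) (simp add: power_mult_distrib mult.commute)
    qed (use m in measurable)
  qed
  then have "integrable half_line (\<lambda>t. sform (y t) (w t))"
    unfolding sform_def by (rule integrable_bform[OF y(2)])
  from integrable_limit_at_top_zero[OF this lim] show ?thesis
    by (simp add: F_def[abs_def] add_eq_0_iff)
qed

section \<open>Cut-off functions as test functions\<close>

lemma AC_deriv_unique:
  assumes "AC_deriv u v" "AC_deriv u w"
  shows "AE t in half_line. v t = w t"
proof -
  have "AE t in half_line. (u has_vector_derivative v t) (at t within {0..})"
    "AE t in half_line. (u has_vector_derivative w t) (at t within {0..})"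
    using assms by (simp_all add: AC_deriv_def ae_derivative_def)
  then show ?thesis using AE_half_line_nonneg
  proof eventually_elim
    case (elim t)
    have "at t within {0..} \<noteq> bot"
    proof
      assume bot: "at t within {0..} = bot"
      have "at t within {t<..} \<le> at t within {0..}" by (rule at_le) (use elim(3) in auto)
      then have "at_right t = bot" unfolding bot by (rule bot.extremum_uniqueI)
      then show False using trivial_limit_at_right_real[of t] by blast
    qed
    then show ?case by (rule vector_derivative_unique_within[OF _ elim(1,2)])
  qed
qed

lemma continuous_AE_eq:
  fixes f g :: "real \<Rightarrow> 'a::real_normed_vector"
  assumes "continuous_on {0..} f" "continuous_on {0..} g" "AE t in half_line. f t = g t" "0 \<le> t"
  shows "f t = g t"
proof (rule ccontr)
  assume "f t \<noteq> g t"
  define h where "h s = norm (f s - g s)" for s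
  have h: "continuous_on {0..} h" unfolding h_def by (intro continuous_intros assms)
  have "h t > 0" using \<open>f t \<noteq> g t\<close> by (simp add: h_def)
  then obtain d where "d > 0" and d: "\<And>s. s \<in> {0..} \<Longrightarrow> dist s t < d \<Longrightarrow> dist (h s) (h t) < h t"
    using h[unfolded continuous_on_iff] assms(4) by (metis atLeast_iff)
  have sub: "{t<..<t+d} \<subseteq> {s. 0 \<le> s \<and> f s \<noteq> g s}"
  proof
    fix s assume s: "s \<in> {t<..<t+d}"
    then have "dist (h s) (h t) < h t" using assms(4) by (intro d) (auto simp: dist_real_def)
    then have "h s \<noteq> 0" by (auto simp: dist_real_def)
    then show "s \<in> {s. 0 \<le> s \<and> f s \<noteq> g s}" using s assms(4) by (auto simp: h_def)
  qed
  have "negligible {s. 0 \<le> s \<and> f s \<noteq> g s}"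
    using assms(3) by (simp add: AE_half_line_iff)
  then have "negligible {t<..<t+d}" by (rule negligible_subset[OF _ sub])
  moreover have "open {t<..<t+d}" "{t<..<t+d} \<noteq> {}" using \<open>d > 0\<close> by simp_all
  ultimately show False using open_not_negligible by blast
qed

text \<open>The piecewise linear cut-off that is \<open>0\<close> before \<open>a\<close> and \<open>1\<close> after \<open>b\<close>.\<close>

definition ramp :: "real \<Rightarrow> real \<Rightarrow> real \<Rightarrow> real" where
  "ramp a b t = min 1 (max 0 ((t - a) / (b - a)))"

definition ramp_slope :: "real \<Rightarrow> real \<Rightarrow> real \<Rightarrow> real" where
  "ramp_slope a b t = (if t \<in> {a..b} then 1 / (b - a) else 0)"

lemma ramp_left: "a < b \<Longrightarrow> t \<le> a \<Longrightarrow> ramp a b t = 0"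
  by (simp add: ramp_def max_def min_def divide_simps)

lemma ramp_right: "a < b \<Longrightarrow> b \<le> t \<Longrightarrow> ramp a b t = 1"
  by (simp add: ramp_def max_def min_def divide_simps)

lemma ramp_bounds: "0 \<le> ramp a b t" "ramp a b t \<le> 1"
  by (auto simp: ramp_def)

lemma ramp_slope_integral:
  fixes k :: "real \<Rightarrow> 'a::banach"
  assumes "0 \<le> a" "a < b" "b \<le> T" and k: "k integrable_on {a..b}"
  shows "((\<lambda>t. ramp_slope a b t *\<^sub>R k t) has_integral (integral {a..b} k /\<^sub>R (b - a))) {0..T}"
proof -
  have "((\<lambda>t. (1 / (b - a)) *\<^sub>R k t) has_integral (1 / (b - a)) *\<^sub>R integral {a..b} k) {a..b}"
    by (intro has_integral_cmul integrable_integral k)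
  then have "((\<lambda>t. if t \<in> {a..b} then (1 / (b - a)) *\<^sub>R k t else 0) has_integral (1 / (b - a)) *\<^sub>R integral {a..b} k) {0..T}"
    by (subst has_integral_restrict) (use assms in auto)
  also have "(\<lambda>t. if t \<in> {a..b} then (1 / (b - a)) *\<^sub>R k t else 0) = (\<lambda>t. ramp_slope a b t *\<^sub>R k t)"
    by (auto simp: ramp_slope_def)
  finally show ?thesis by (simp add: inverse_eq_divide)
qed

lemma ramp_slope_measurable: "ramp_slope a b \<in> borel_measurable half_line"
proof -
  have "(\<lambda>t. indicat_real {a..b} t * (1 / (b - a))) \<in> borel_measurable half_line"
    by (intro borel_measurable_times half_line_indicator_measurable) auto
  also have "(\<lambda>t. indicat_real {a..b} t * (1 / (b - a))) = ramp_slope a b"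
    by (auto simp: ramp_slope_def indicator_def)
  finally show ?thesis .
qed

lemma ramp_slope_bound: "a < b \<Longrightarrow> \<bar>ramp_slope a b t\<bar> \<le> 1 / (b - a)"
  by (simp add: ramp_slope_def)

lemma AC_deriv_ramp:
  assumes "0 \<le> a" "a < b"
  shows "AC_deriv (ramp a b) (ramp_slope a b)"
proof -
  have int: "(ramp_slope a b has_integral ramp a b x) {0..x}" if "0 \<le> x" for x
  proof -
    have "((\<lambda>t. 1 / (b - a)) has_integral measure lborel {a..min b x} *\<^sub>R (1 / (b - a))) {a..min b x}"
      by (rule has_integral_const_real)
    then have "((\<lambda>t. if t \<in> {a..b} then 1 / (b - a) else 0) has_integral measure lborel {a..min b x} *\<^sub>R (1 / (b - a))) {0..x}"
      unfolding has_integral_restrict_Int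
      by (rule back_subst[where P = "\<lambda>S. (_ has_integral _) S"]) (use assms that in auto)
    moreover have "measure lborel {a..min b x} *\<^sub>R (1 / (b - a)) = ramp a b x"
    proof (cases "a \<le> x")
      case True
      then show ?thesis using assms by (auto simp: ramp_def min_def max_def field_simps)
    next
      case False
      then have "{a..min b x} = {}" by auto
      then show ?thesis using False assms ramp_left[of a b x] by (simp del: atLeastatMost_empty_iff atLeastatMost_empty_iff2)
    qed
    ultimately show ?thesis by (simp add: ramp_slope_def[abs_def])
  qed
  have "L1_loc (ramp_slope a b)"
    unfolding L1_loc_def
  proof (intro allI impI)
    fix d :: real assume "0 \<le> d"
    show "ramp_slope a b absolutely_integrable_on {0..d}"
      by (rule nonnegative_absolutely_integrable_1)
        (use int[OF \<open>0 \<le> d\<close>] assms in \<open>auto simp: ramp_slope_def\<close>)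
  qed
  then have "AC_deriv (\<lambda>x. 0 + integral {0..x} (ramp_slope a b)) (ramp_slope a b)"
    by (rule AC_deriv_indefinite_integral)
  then show ?thesis
    by (rule AC_deriv_cong) (use int in \<open>simp add: integral_unique\<close>)
qed

text \<open>The indefinite integral \<open>F\<close> of \<open>k\<close> has constant slope \<open>C\<close>, so \<open>k\<close> and \<open>C\<close> are both derivatives of it.\<close>

theorem equal_averages_AE_constant:
  fixes k :: "real \<Rightarrow> complex"
  assumes k: "L1_loc k"
    and avg: "\<And>a b a' b'. 0 < a \<Longrightarrow> a < b \<Longrightarrow> 0 < a' \<Longrightarrow> a' < b' \<Longrightarrow>
      integral {a..b} k /\<^sub>R (b - a) = integral {a'..b'} k /\<^sub>R (b' - a')"
  shows "\<exists>C. AE t in half_line. k t = C"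
proof -
  define C where "C = integral {1..2} k /\<^sub>R (2 - 1)"
  define F where "F x = 0 + integral {0..x} k" for x
  have F: "AC_deriv F k" unfolding F_def by (rule AC_deriv_indefinite_integral[OF k])
  have Fc: "continuous_on {0..} F" using F by (simp add: AC_deriv_def AC_loc_continuous)
  have diff: "F b - F a = (b - a) *\<^sub>R C" if ab: "0 < a" "a < b" for a b
  proof -
    have "F b - F a = integral {a..b} k"
      using integral_unique[OF AC_deriv_integral[OF F, of a b]] ab by simp
    also have "\<dots> = (b - a) *\<^sub>R (integral {a..b} k /\<^sub>R (b - a))" using ab by simp
    also have "integral {a..b} k /\<^sub>R (b - a) = C" unfolding C_def by (rule avg) (use ab in auto)
    finally show ?thesis .
  qed
  have lin: "AC_deriv (\<lambda>t. t *\<^sub>R C) (\<lambda>t. C)"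
  proof -
    have "AC_deriv (\<lambda>x. 0 + integral {0..x} (\<lambda>_. C)) (\<lambda>_. C)"
      by (intro AC_deriv_indefinite_integral L1_loc_continuous continuous_on_const)
    then show ?thesis by (rule AC_deriv_cong) (simp add: integral_const_real)
  qed
  have "F b = b *\<^sub>R C" if "b \<ge> 0" for b
  proof (rule continuous_AE_eq[OF Fc _ _ that])
    show "continuous_on {0..} (\<lambda>b. b *\<^sub>R C)" by (intro continuous_intros)
    define G where "G t = F t - t *\<^sub>R C - (F 1 - 1 *\<^sub>R C)" for t
    have Gc: "continuous_on {0..} G" unfolding G_def by (intro continuous_intros Fc)
    have G0: "G t = 0" if "t > 0" for t
      using diff[of t 1] diff[of 1 t] that
      by (cases t "1::real" rule: linorder_cases) (auto simp: G_def algebra_simps)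
    have "G 0 = 0"
    proof (rule continuous_AE_eq[OF Gc continuous_on_const])
      have "{t. 0 \<le> t \<and> G t \<noteq> 0} \<subseteq> {0}"
      proof
        fix t assume "t \<in> {t. 0 \<le> t \<and> G t \<noteq> 0}"
        then show "t \<in> {0}" using G0[of t] by (cases "t = 0") auto
      qed
      then have "negligible {t. 0 \<le> t \<and> G t \<noteq> 0}" using negligible_sing negligible_subset by blast
      then show "AE t in half_line. G t = 0" by (simp add: AE_half_line_iff)
    qed simp
    then have G: "G t = 0" if "t \<ge> 0" for t using G0[of t] that by (cases "t = 0") auto
    have "F t = t *\<^sub>R C" if "t \<ge> 0" for t
    proof -
      have "F 0 = 0" by (simp add: F_def)
      then have "F 1 - 1 *\<^sub>R C = 0" using G[of 0] by (simp add: G_def)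
      then show ?thesis using G[OF that] unfolding G_def by simp
    qed
    then show "AE t in half_line. F t = t *\<^sub>R C"
      using AE_half_line_nonneg by (auto elim: eventually_mono)
  qed
  then have "AC_deriv (\<lambda>t. t *\<^sub>R C) k" using AC_deriv_cong[OF F, of "\<lambda>t. t *\<^sub>R C"] by simp
  from AC_deriv_unique[OF this lin] show ?thesis by blast
qed

text \<open>A lemma of du Bois-Reymond type: the derivative of the compactly supported function
\<open>ramp a b - ramp a' b'\<close> compares two averages of \<open>k\<close>. These test functions suffice to recognize constants.\<close>

theorem ramp_orthogonal_AE_constant:
  fixes k :: "real \<Rightarrow> complex"
  assumes k: "L1_loc k"
    and orth: "\<And>a b a' b'. 0 < a \<Longrightarrow> a < b \<Longrightarrow> 0 < a' \<Longrightarrow> a' < b' \<Longrightarrow>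
      ((\<lambda>t. (ramp_slope a b t - ramp_slope a' b' t) *\<^sub>R k t) has_integral 0) {0..max b b'}"
  shows "\<exists>C. AE t in half_line. k t = C"
proof (rule equal_averages_AE_constant[OF k])
  fix a b a' b' :: real assume ab: "0 < a" "a < b" "0 < a'" "a' < b'"
  have "((\<lambda>t. ramp_slope a b t *\<^sub>R k t - ramp_slope a' b' t *\<^sub>R k t) has_integral
      (integral {a..b} k /\<^sub>R (b - a) - integral {a'..b'} k /\<^sub>R (b' - a'))) {0..max b b'}"
    by (intro has_integral_diff ramp_slope_integral L1_loc_integrable[OF k]) (use ab in auto)
  then have "((\<lambda>t. (ramp_slope a b t - ramp_slope a' b' t) *\<^sub>R k t) has_integral
      (integral {a..b} k /\<^sub>R (b - a) - integral {a'..b'} k /\<^sub>R (b' - a'))) {0..max b b'}"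
    by (simp only: scaleR_left_diff_distrib)
  from has_integral_unique[OF this orth[OF ab]]
  show "integral {a..b} k /\<^sub>R (b - a) = integral {a'..b'} k /\<^sub>R (b' - a')" by simp
qed

lemma J_scaleR: "J_mat *v (r *\<^sub>R x) = r *\<^sub>R (J_mat *v x)"
  by (rule linear_scale[OF bounded_linear.linear[OF bounded_linear_J]])

lemma matrix_vector_scaleR: "A *v (r *\<^sub>R x) = r *\<^sub>R (A *v (x :: complex ^ 'n::finite))"
  by (rule bounded_bilinear.scaleR_right[OF bounded_bilinear_matrix_vector])

lemma solves_cutoff:
  assumes y: "solves Q y h" and c: "AC_deriv c c'"
  shows "solves Q (\<lambda>t. c t *\<^sub>R y t) (\<lambda>t. c' t *\<^sub>R (J_mat *v y t) + c t *\<^sub>R h t)"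
proof -
  have "c t *\<^sub>R (- (J_mat *v (h t - Q t *v y t))) + c' t *\<^sub>R y t
      = - (J_mat *v ((c' t *\<^sub>R (J_mat *v y t) + c t *\<^sub>R h t) - Q t *v (c t *\<^sub>R y t)))" for t
  proof -
    have "(c' t *\<^sub>R (J_mat *v y t) + c t *\<^sub>R h t) - Q t *v (c t *\<^sub>R y t)
        = c' t *\<^sub>R (J_mat *v y t) + c t *\<^sub>R (h t - Q t *v y t)"
      by (simp only: matrix_vector_scaleR scaleR_right_diff_distrib add_diff_eq)
    then have "J_mat *v ((c' t *\<^sub>R (J_mat *v y t) + c t *\<^sub>R h t) - Q t *v (c t *\<^sub>R y t))
        = c' t *\<^sub>R (- y t) + c t *\<^sub>R (J_mat *v (h t - Q t *v y t))"
      by (simp only: matrix_vector_right_distrib J_scaleR J_J)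
    then show ?thesis by (simp only: minus_add_distrib scaleR_minus_right minus_minus add.commute)
  qed
  then show ?thesis
    using AC_deriv_bilinear[OF bounded_bilinear_scaleR c y[unfolded solves_def]] unfolding solves_def
    by (simp only:)
qed

lemma square_integrable_cutoff:
  fixes y :: "real \<Rightarrow> complex ^ 'n::finite"
  assumes y: "continuous_on {0..} y" and c: "c \<in> borel_measurable half_line"
    and B: "\<And>t. \<bar>c t\<bar> \<le> B" and supp: "\<And>t. t > T \<Longrightarrow> c t = 0"
  shows "square_integrable (\<lambda>t. c t *\<^sub>R y t)"
proof -
  have "continuous_on {0..T} y" by (rule continuous_on_subset[OF y]) auto
  then have "bounded (y ` {0..T})" by (intro compact_imp_bounded compact_continuous_image) auto
  then obtain K where K: "\<And>t. t \<in> {0..T} \<Longrightarrow> norm (y t) \<le> K" unfolding bounded_iff by blast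
  show ?thesis
  proof (rule square_integrable_compact_support)
    show "(\<lambda>t. c t *\<^sub>R y t) \<in> borel_measurable half_line"
      by (intro borel_measurable_scaleR c continuous_half_line_measurable y)
    show "norm (c t *\<^sub>R y t) \<le> B * K" if "0 \<le> t" "t \<le> T" for t
      unfolding norm_scaleR using B[of t] K[of t] that by (intro mult_mono) (auto intro: order_trans[OF abs_ge_zero])
  qed (simp add: supp)
qed

lemma continuous_J: "continuous_on S y \<Longrightarrow> continuous_on S (\<lambda>t. J_mat *v y t)"
  by (rule bounded_linear.continuous_on[OF bounded_linear_J])

text \<open>Elements of the minimal operator made from solutions of the homogeneous equation. Applying the operator only
leaves the term in which the cut-off is differentiated.\<close>

lemma ramp_difference_in_dirac_min:
  fixes Q :: "real \<Rightarrow> complex ^ ('p::finite + 'p) ^ ('p + 'p)"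
  assumes y: "solves Q y (\<lambda>_. 0)" and ab: "0 < a" "a < b" "0 < a'" "a' < b'"
  defines "u \<equiv> \<lambda>t. (ramp a b t - ramp a' b' t) *\<^sub>R y t"
    and "f \<equiv> \<lambda>t. (ramp_slope a b t - ramp_slope a' b' t) *\<^sub>R (J_mat *v y t)"
  shows "(l2_class u, l2_class f) \<in> dirac_min Q" "square_integrable u" "square_integrable f" "solves Q u f"
    "\<And>t. t \<le> min a a' \<Longrightarrow> u t = 0" "\<And>t. max b b' \<le> t \<Longrightarrow> u t = 0"
    "\<And>t. t < min a a' \<Longrightarrow> f t = 0" "\<And>t. max b b' < t \<Longrightarrow> f t = 0"
proof -
  have c: "AC_deriv (\<lambda>t. ramp a b t - ramp a' b' t) (\<lambda>t. ramp_slope a b t - ramp_slope a' b' t)"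
  proof -
    have "AC_deriv (\<lambda>t. ramp a b t + - ramp a' b' t) (\<lambda>t. ramp_slope a b t + - ramp_slope a' b' t)"
      using ab by (intro AC_deriv_add AC_deriv_ramp AC_deriv_linear[OF bounded_linear_minus[OF bounded_linear_ident]]) auto
    then show ?thesis by simp
  qed
  have yc: "continuous_on {0..} y" by (rule solves_continuous[OF y])
  show 1: "solves Q u f" using solves_cutoff[OF y c] unfolding u_def f_def by simp
  show u0: "\<And>t. t \<le> min a a' \<Longrightarrow> u t = 0" and u1: "\<And>t. max b b' \<le> t \<Longrightarrow> u t = 0"
    using ab by (simp_all add: u_def ramp_left ramp_right)
  show "\<And>t. t < min a a' \<Longrightarrow> f t = 0" "\<And>t. max b b' < t \<Longrightarrow> f t = 0"
    using ab by (simp_all add: f_def ramp_slope_def)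
  show 2: "square_integrable u" unfolding u_def
  proof (rule square_integrable_cutoff[OF yc])
    show "(\<lambda>t. ramp a b t - ramp a' b' t) \<in> borel_measurable half_line"
      using c by (intro continuous_half_line_measurable AC_loc_continuous) (simp add: AC_deriv_def)
    show "\<bar>ramp a b t - ramp a' b' t\<bar> \<le> 1" for t
      using ramp_bounds[of a b t] ramp_bounds[of a' b' t] by linarith
    show "ramp a b t - ramp a' b' t = 0" if "t > max b b'" for t
      using that ab by (simp add: ramp_right)
  qed
  show 3: "square_integrable f" unfolding f_def
  proof (rule square_integrable_cutoff[OF continuous_J[OF yc]])
    show "(\<lambda>t. ramp_slope a b t - ramp_slope a' b' t) \<in> borel_measurable half_line"
      by (intro borel_measurable_diff ramp_slope_measurable)
    show "\<bar>ramp_slope a b t - ramp_slope a' b' t\<bar> \<le> 1 / (b - a) + 1 / (b' - a')" for t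
      using ramp_slope_bound[OF ab(2), of t] ramp_slope_bound[OF ab(4), of t] by linarith
    show "ramp_slope a b t - ramp_slope a' b' t = 0" if "t > max b b'" for t
      using that by (simp add: ramp_slope_def)
  qed
  have sub: "closure {t\<in>{0..}. u t \<noteq> 0} \<subseteq> {min a a'..max b b'}"
  proof (rule closure_minimal)
    show "{t\<in>{0..}. u t \<noteq> 0} \<subseteq> {min a a'..max b b'}"
    proof
      fix t assume "t \<in> {t\<in>{0..}. u t \<noteq> 0}"
      then have "u t \<noteq> 0" by simp
      then have "\<not> t \<le> min a a'" "\<not> max b b' \<le> t" using u0 u1 by blast+
      then show "t \<in> {min a a'..max b b'}"
        unfolding not_le atLeastAtMost_iff by (intro conjI less_imp_le)
    qed
  qed simp
  have "compactly_supported (l2_class u)"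
    unfolding compactly_supported_def
  proof (intro exI[of _ u] conjI 2 refl)
    show "compact (closure {t\<in>{0..}. u t \<noteq> 0})"
      using sub bounded_subset[OF bounded_closed_interval] by (auto simp: compact_eq_bounded_closed)
    show "closure {t\<in>{0..}. u t \<noteq> 0} \<subseteq> {0<..}"
      using sub ab by (auto dest!: subsetD)
  qed
  moreover have "(l2_class u, l2_class f) \<in> dirac_max Q"
    unfolding dirac_max_iff using 1 2 3 by blast
  ultimately show "(l2_class u, l2_class f) \<in> dirac_min Q"
    unfolding dirac_min_def by (intro subsetD[OF closure_subset]) simp
qed

lemma dirac_conj_l2_class: "square_integrable f \<Longrightarrow> dirac_conj (l2_class f) = l2_class (\<lambda>t. swap_conj (f t))"
  by (simp add: dirac_conj.abs_eq l2_rel_refl)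

lemma dirac_conj_dirac_conj: "dirac_conj (dirac_conj u) = u"
  using conjugation_dirac_conj unfolding conjugation_def by blast

lemma cinner_dirac_conj_l2_class:
  assumes "square_integrable f" "square_integrable g"
  shows "cinner (l2_class f) (dirac_conj (l2_class g)) = integral\<^sup>L half_line (\<lambda>t. bform (f t) (g t))"
  using assms by (simp add: dirac_conj_l2_class cinner_l2_class square_integrable_swap_conj cdot_swap_conj_bform)

lemma j_symmetric_adjoint:
  assumes "j_symmetric dirac_conj A" "(u, f) \<in> A"
  shows "(dirac_conj u, dirac_conj f) \<in> adjoint_op A"
proof -
  obtain w where "f = dirac_conj w" "(dirac_conj u, w) \<in> adjoint_op A"
    using assms unfolding j_symmetric_def by blast
  then show ?thesis by (simp add: dirac_conj_dirac_conj)
qed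

section \<open>Fundamental matrices and symmetry of the potential\<close>

lemma mat_vector_mult: "mat c *v x = c *s (x :: complex ^ 'n::finite)"
  by (simp add: vec_eq_iff matrix_vector_mult_def mat_def if_distrib[where f = "\<lambda>a. a * _"] cong: if_cong)

lemma matrix_axis_nth: "(M *v axis k 1) $ j = (M :: complex ^ 'n ^ 'm) $ j $ (k :: 'n::finite)"
  by (simp add: matrix_vector_mult_def axis_def if_distrib[where f = "\<lambda>a. _ * a"] cong: if_cong)

lemma bform_axis_left: "bform (axis (swap_index i) 1) x = x $ i"
  using bform_axis[of x i] by (simp add: bform_commute)

lemma bform_matrix_eq_zero:
  assumes "\<And>i k. bform (axis i 1) (M *v axis k 1) = 0"
  shows "M = 0"
proof -
  have "M $ j $ k = 0" for j k
    using assms[of "swap_index j" k] by (simp add: bform_axis_left matrix_axis_nth)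
  then show ?thesis by (simp add: vec_eq_iff)
qed

text \<open>The coefficient in \<open>y' = A(t) y\<close> for solutions of \<open>J y' + Q y = z y\<close>.\<close>

definition dirac_coeff :: "(real \<Rightarrow> complex ^ ('p::finite + 'p) ^ ('p + 'p)) \<Rightarrow> complex \<Rightarrow> real \<Rightarrow> complex ^ ('p + 'p) ^ ('p + 'p)" where
  "dirac_coeff Q z t = J_mat ** (Q t - mat z)"

lemma dirac_coeff_mult: "dirac_coeff Q z t *v x = - (J_mat *v (z *s x - Q t *v x))"
proof -
  have "dirac_coeff Q z t *v x = J_mat *v (Q t *v x - z *s x)"
    by (simp add: dirac_coeff_def matrix_vector_mul_assoc[symmetric] matrix_vector_mult_diff_rdistrib mat_vector_mult)
  also have "Q t *v x - z *s x = - (z *s x - Q t *v x)" by simp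
  finally show ?thesis by (simp only: J_minus)
qed

definition is_fundamental :: "(real \<Rightarrow> complex ^ ('p::finite + 'p) ^ ('p + 'p)) \<Rightarrow> complex \<Rightarrow>
    (real \<Rightarrow> complex ^ ('p + 'p) ^ ('p + 'p)) \<Rightarrow> (real \<Rightarrow> complex ^ ('p + 'p) ^ ('p + 'p)) \<Rightarrow> bool" where
  "is_fundamental Q z Y Z \<longleftrightarrow> Y 0 = mat 1 \<and> AC_deriv Y (\<lambda>t. dirac_coeff Q z t ** Y t) \<and>
     AC_deriv Z (\<lambda>t. - (Z t ** dirac_coeff Q z t)) \<and> (\<forall>t\<ge>0. Z t ** Y t = mat 1 \<and> Y t ** Z t = mat 1)"

definition fundamental_pair where
  "fundamental_pair Q z = (SOME (Y, Z). is_fundamental Q z Y Z)"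

definition fund where "fund Q z = fst (fundamental_pair Q z)"

definition fund_inv where "fund_inv Q z = snd (fundamental_pair Q z)"

locale dirac_system =
  fixes Q :: "real \<Rightarrow> complex ^ ('p::finite + 'p) ^ ('p + 'p)"
  assumes L1: "L1_loc Q"
begin

lemma is_fundamental: "is_fundamental Q z (fund Q z) (fund_inv Q z)"
proof -
  have "L1_loc (\<lambda>t. Q t + - mat z)"
    by (intro L1_loc_add L1 L1_loc_continuous continuous_on_const)
  then have "L1_loc (dirac_coeff Q z)"
    unfolding dirac_coeff_def[abs_def]
    using L1_loc_linear[OF bounded_bilinear.bounded_linear_right[OF bounded_bilinear_matrix_mult], of "\<lambda>t. Q t - mat z" J_mat]
    by simp
  from fundamental_matrix_exists[OF this] have "\<exists>YZ. case YZ of (Y, Z) \<Rightarrow> is_fundamental Q z Y Z"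
    unfolding is_fundamental_def by fast
  then have "case fundamental_pair Q z of (Y, Z) \<Rightarrow> is_fundamental Q z Y Z"
    unfolding fundamental_pair_def by (rule someI_ex)
  then show ?thesis by (simp add: fund_def fund_inv_def split_def)
qed

lemma fund_0 [simp]: "fund Q z 0 = mat 1"
  using is_fundamental[of z] by (simp add: is_fundamental_def)

lemma fund_inverse: "0 \<le> t \<Longrightarrow> fund_inv Q z t ** fund Q z t = mat 1" "0 \<le> t \<Longrightarrow> fund Q z t ** fund_inv Q z t = mat 1"
  using is_fundamental[of z] by (simp_all add: is_fundamental_def)

lemma fund_inv_mult: "0 \<le> t \<Longrightarrow> fund_inv Q z t *v (fund Q z t *v x) = x"
  "0 \<le> t \<Longrightarrow> fund Q z t *v (fund_inv Q z t *v x) = x"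
  by (simp_all add: matrix_vector_mul_assoc fund_inverse)

lemma fund_inv_0: "fund_inv Q z 0 = mat 1"
  using fund_inverse(1)[of 0 z] by simp

lemma AC_deriv_fund: "AC_deriv (fund Q z) (\<lambda>t. dirac_coeff Q z t ** fund Q z t)"
  using is_fundamental[of z] by (simp add: is_fundamental_def)

lemma AC_deriv_fund_inv: "AC_deriv (fund_inv Q z) (\<lambda>t. - (fund_inv Q z t ** dirac_coeff Q z t))"
  using is_fundamental[of z] by (simp add: is_fundamental_def)

lemma fund_continuous: "continuous_on {0..} (fund Q z)" "continuous_on {0..} (fund_inv Q z)"
  using AC_deriv_fund AC_deriv_fund_inv AC_loc_continuous by (auto simp: AC_deriv_def)

text \<open>Variation of constants.\<close>

lemma fund_variation:
  assumes "AC_deriv \<eta> s"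
  shows "solves Q (\<lambda>t. fund Q z t *v \<eta> t) (\<lambda>t. J_mat *v (fund Q z t *v s t) + z *s (fund Q z t *v \<eta> t))"
proof -
  have "fund Q z t *v s t + (dirac_coeff Q z t ** fund Q z t) *v \<eta> t
      = - (J_mat *v (J_mat *v (fund Q z t *v s t) + z *s (fund Q z t *v \<eta> t) - Q t *v (fund Q z t *v \<eta> t)))" for t
  proof -
    have "- (J_mat *v (J_mat *v (fund Q z t *v s t) + z *s (fund Q z t *v \<eta> t) - Q t *v (fund Q z t *v \<eta> t)))
      = - (J_mat *v (J_mat *v (fund Q z t *v s t)) + J_mat *v (z *s (fund Q z t *v \<eta> t) - Q t *v (fund Q z t *v \<eta> t)))"
      by (simp only: matrix_vector_right_distrib[symmetric] add_diff_eq)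
    also have "\<dots> = fund Q z t *v s t + dirac_coeff Q z t *v (fund Q z t *v \<eta> t)"
      by (simp only: J_J dirac_coeff_mult minus_add_distrib minus_minus)
    finally show ?thesis by (simp only: matrix_vector_mul_assoc)
  qed
  then show ?thesis
    using AC_deriv_bilinear[OF bounded_bilinear_matrix_vector AC_deriv_fund assms, of z] unfolding solves_def
    by (simp only:)
qed

lemma fund_solves: "solves Q (\<lambda>t. fund Q z t *v v) (\<lambda>t. z *s (fund Q z t *v v))"
  using fund_variation[OF AC_deriv_const, of z v] by simp

lemma solves_unique:
  assumes y: "solves Q y (\<lambda>t. z *s y t)" and t: "0 \<le> t"
  shows "y t = fund Q z t *v y 0"
proof -
  have "AC_deriv y (\<lambda>t. dirac_coeff Q z t *v y t)"
    using y unfolding solves_def by (simp only: dirac_coeff_mult)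
  from AC_deriv_bilinear[OF bounded_bilinear_matrix_vector AC_deriv_fund_inv this, of z]
  have "AC_deriv (\<lambda>t. fund_inv Q z t *v y t) (\<lambda>t. fund_inv Q z t *v (dirac_coeff Q z t *v y t) +
      - (fund_inv Q z t ** dirac_coeff Q z t) *v y t)" .
  moreover have "fund_inv Q z t *v (dirac_coeff Q z t *v y t) + - (fund_inv Q z t ** dirac_coeff Q z t) *v y t = 0" for t
    by (simp add: matrix_vector_mul_assoc bounded_bilinear.minus_left[OF bounded_bilinear_matrix_vector])
  ultimately have "AC_deriv (\<lambda>t. fund_inv Q z t *v y t) (\<lambda>_. 0)" by simp
  from AC_deriv_zero_constant[OF this t] have "fund_inv Q z t *v y t = y 0" by (simp add: fund_inv_0)
  then have "fund Q z t *v (fund_inv Q z t *v y t) = fund Q z t *v y 0" by simp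
  then show ?thesis using t by (simp add: fund_inv_mult)
qed

lemma particular_solution_exists:
  assumes g: "L1_loc g"
  shows "\<exists>y. solves Q y g"
proof -
  define s where "s t = fund_inv Q 0 t *v (- (J_mat *v g t))" for t
  have "L1_loc (\<lambda>t. - (J_mat *v g t))"
    by (rule L1_loc_linear[OF bounded_linear_minus[OF bounded_linear_J] g])
  then have "L1_loc s" unfolding s_def
    by (rule L1_loc_bilinear[OF bounded_bilinear_matrix_vector fund_continuous(2)])
  then have "AC_deriv (\<lambda>x. 0 + integral {0..x} s) s" by (rule AC_deriv_indefinite_integral)
  from fund_variation[OF this, of 0]
  have "solves Q (\<lambda>t. fund Q 0 t *v (0 + integral {0..t} s))
      (\<lambda>t. J_mat *v (fund Q 0 t *v s t) + 0 *s (fund Q 0 t *v (0 + integral {0..t} s)))" .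
  moreover have "AE t in half_line. J_mat *v (fund Q 0 t *v s t) + 0 *s (fund Q 0 t *v (0 + integral {0..t} s)) = g t"
    using AE_half_line_nonneg
    by eventually_elim (simp add: s_def fund_inv_mult J_minus J_J)
  ultimately show ?thesis using solves_cong_AE by blast
qed

lemma homogeneous_solves: "solves Q (\<lambda>t. fund Q 0 t *v v) (\<lambda>_. 0)"
  using fund_solves[of 0 v] by simp

text \<open>Let \<open>y, x\<close> solve the homogeneous equation and let \<open>\<kappa> = b(Q y, x) - b(y, Q x)\<close>. Applying \<open>j\<close>-symmetry to
\<open>c y\<close>, with a cut-off \<open>c\<close>, and to a second cut-off of \<open>x\<close> that equals \<open>x\<close> on the support of \<open>c\<close>, gives
\<open>\<integral> c \<kappa> = 0\<close>. Integrating by parts against an antiderivative \<open>K\<close> of \<open>\<kappa>\<close> gives \<open>\<integral> c' K = 0\<close>; since \<open>c\<close> is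
an arbitrary difference of ramps, \<open>K\<close> is constant and \<open>\<kappa> = 0\<close> almost everywhere. Letting \<open>y\<close> and \<open>x\<close> run through the columns of the
fundamental matrix, which is invertible, shows that \<open>Q\<close> is symmetric for \<open>b\<close>. Homogeneous solutions are used as test
functions because arbitrary smooth functions need not be in the domain when \<open>Q\<close> is merely locally integrable.\<close>

theorem j_symmetric_imp_sharp:
  assumes sym: "j_symmetric dirac_conj (dirac_min Q)"
  shows "AE t in half_line. sharp (Q t) = Q t"
proof -
  define \<kappa> where "\<kappa> v w t = bform (Q t *v (fund Q 0 t *v v)) (fund Q 0 t *v w)
      - bform (fund Q 0 t *v v) (Q t *v (fund Q 0 t *v w))" for v w t
  have "AE t in half_line. \<kappa> v w t = 0" for v w
  proof -
    define y where "y t = fund Q 0 t *v v" for t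
    define x where "x t = fund Q 0 t *v w" for t
    have y: "solves Q y (\<lambda>_. 0)" and x: "solves Q x (\<lambda>_. 0)"
      unfolding y_def x_def by (rule homogeneous_solves)+
    have yc: "continuous_on {0..} y" and xc: "continuous_on {0..} x"
      by (rule solves_continuous[OF y], rule solves_continuous[OF x])
    have k: "L1_loc (\<kappa> v w)"
    proof -
      have "L1_loc (\<lambda>t. bform (Q t *v y t) (x t) + - bform (y t) (Q t *v x t))"
        by (intro L1_loc_add L1_loc_linear[OF bounded_linear_minus[OF bounded_linear_ident]]
            L1_loc_bilinear'[OF bounded_bilinear_bform _ xc] L1_loc_bilinear[OF bounded_bilinear_bform yc]
            L1_loc_bilinear'[OF bounded_bilinear_matrix_vector L1] yc xc)
      then show ?thesis by (simp add: \<kappa>_def[abs_def] y_def x_def)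
    qed
    define K where "K t = 0 + integral {0..t} (\<kappa> v w)" for t
    have K: "AC_deriv K (\<kappa> v w)" unfolding K_def by (rule AC_deriv_indefinite_integral[OF k])
    have Kc: "continuous_on {0..} K" using K by (simp add: AC_deriv_def AC_loc_continuous)
    have "\<exists>C. AE t in half_line. K t = C"
    proof (rule ramp_orthogonal_AE_constant[OF L1_loc_continuous[OF Kc]])
      fix a b a' b' :: real assume ab: "0 < a" "a < b" "0 < a'" "a' < b'"
      define l where "l = min a a'"
      define r where "r = max b b'"
      have lr: "0 < l / 2" "l / 2 < l" "0 < r" "r < r + 1" "l < r" using ab by (auto simp: l_def r_def)
      define c where "c t = ramp a b t - ramp a' b' t" for t
      define c' where "c' t = ramp_slope a b t - ramp_slope a' b' t" for t
      define u where "u = (\<lambda>t. (ramp a b t - ramp a' b' t) *\<^sub>R y t)"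
      define f where "f = (\<lambda>t. (ramp_slope a b t - ramp_slope a' b' t) *\<^sub>R (J_mat *v y t))"
      \<comment> \<open>The second cut-off equals \<open>1\<close> on \<open>[l, r]\<close>, which contains the support of the first.\<close>
      define m where "m = (\<lambda>t. (ramp (l / 2) l t - ramp r (r + 1) t) *\<^sub>R x t)"
      define h where "h = (\<lambda>t. (ramp_slope (l / 2) l t - ramp_slope r (r + 1) t) *\<^sub>R (J_mat *v x t))"
      note uf = ramp_difference_in_dirac_min[OF y ab, folded u_def f_def]
      note mh = ramp_difference_in_dirac_min[OF x lr(1,2,3,4), folded m_def h_def]
      have u0: "u t = 0" if "t \<le> l" for t using that ab by (simp add: u_def l_def ramp_left)
      have u1: "u t = 0" if "r \<le> t" for t using that ab by (simp add: u_def r_def ramp_right)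
      have f1: "f t = 0" if "r < t" for t using that by (simp add: f_def r_def ramp_slope_def)
      define T where "T = r + 1"
      have T: "0 \<le> T" using lr by (simp add: T_def)
      have "(dirac_conj (l2_class u), dirac_conj (l2_class f)) \<in> adjoint_op (dirac_min Q)"
        by (rule j_symmetric_adjoint[OF sym uf(1)])
      then have "cinner (l2_class h) (dirac_conj (l2_class u)) = cinner (l2_class m) (dirac_conj (l2_class f))"
        using mh(1) unfolding adjoint_op_def by blast
      then have "integral\<^sup>L half_line (\<lambda>t. bform (h t) (u t)) = integral\<^sup>L half_line (\<lambda>t. bform (m t) (f t))"
        using uf mh by (simp add: cinner_dirac_conj_l2_class)
      moreover have "integral\<^sup>L half_line (\<lambda>t. bform (h t) (u t)) = integral {0..T} (\<lambda>t. bform (h t) (u t))"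
        by (rule half_line_integral_support[OF integrable_bform[OF mh(3) uf(2)]])
          (use u1 lr in \<open>auto simp: T_def bform.zero_right\<close>)
      moreover have "integral\<^sup>L half_line (\<lambda>t. bform (m t) (f t)) = integral {0..T} (\<lambda>t. bform (m t) (f t))"
        by (rule half_line_integral_support[OF integrable_bform[OF mh(2) uf(3)]])
          (use f1 lr in \<open>auto simp: T_def bform.zero_right\<close>)
      ultimately have eq: "integral {0..T} (\<lambda>t. bform (h t) (u t)) = integral {0..T} (\<lambda>t. bform (m t) (f t))" by simp
      have int: "(\<lambda>t. bform (h t) (u t)) integrable_on {0..T}" "(\<lambda>t. bform (m t) (f t)) integrable_on {0..T}"
        by (intro L1_loc_integrable L1_loc_bilinear'[OF bounded_bilinear_bform] L1_loc_bilinear[OF bounded_bilinear_bform]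
            square_integrable_L1_loc mh uf solves_continuous[OF uf(4)] solves_continuous[OF mh(4)] order_refl)+
      have 1: "((\<lambda>t. bform (h t) (u t) - bform (m t) (f t)) has_integral 0) {0..T}"
        using has_integral_diff[OF integrable_integral[OF int(1)] integrable_integral[OF int(2)]] eq by simp
      have 2: "((\<lambda>t. bform (u t) (h t - Q t *v m t) - bform (f t - Q t *v u t) (m t)) has_integral 0) {0..T}"
        using sform_integral_general[OF uf(4) mh(4) order_refl T] u0[of 0] u1[of T] lr
        by (simp add: sform.zero_left T_def)
      have "((\<lambda>t. (bform (u t) (h t - Q t *v m t) - bform (f t - Q t *v u t) (m t))
          - (bform (h t) (u t) - bform (m t) (f t))) has_integral 0) {0..T}"
        using has_integral_diff[OF 2 1] by simp
      then have 3: "((\<lambda>t. c t *\<^sub>R \<kappa> v w t) has_integral 0) {0..T}"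
      proof (rule has_integral_eq[rotated])
        fix t assume t: "t \<in> {0..T}"
        have "(bform (u t) (h t - Q t *v m t) - bform (f t - Q t *v u t) (m t))
          - (bform (h t) (u t) - bform (m t) (f t)) = bform (Q t *v u t) (m t) - bform (u t) (Q t *v m t)"
          by (simp add: bform.diff_left bform.diff_right bform_commute[of "h t"] bform_commute[of "m t"])
        also have "\<dots> = (c t * (ramp (l / 2) l t - ramp r (r + 1) t)) *\<^sub>R \<kappa> v w t"
          by (simp add: u_def m_def c_def \<kappa>_def y_def x_def matrix_vector_scaleR bform.scaleR_left
              bform.scaleR_right scaleR_right_diff_distrib mult.commute)
        also have "c t * (ramp (l / 2) l t - ramp r (r + 1) t) = c t"
        proof -
          consider "t \<le> l" | "l \<le> t" "t \<le> r" | "r \<le> t" by linarith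
          then show ?thesis
          proof cases
            case 1
            then show ?thesis using ab by (simp add: c_def l_def ramp_left)
          next
            case 2
            then show ?thesis using lr by (simp add: ramp_right[of "l/2" l] ramp_left[of r])
          next
            case 3
            then show ?thesis using ab by (simp add: c_def r_def ramp_right)
          qed
        qed
        finally show "(bform (u t) (h t - Q t *v m t) - bform (f t - Q t *v u t) (m t))
          - (bform (h t) (u t) - bform (m t) (f t)) = c t *\<^sub>R \<kappa> v w t" .
      qed
      have cAC: "AC_deriv c c'"
      proof -
        have "AC_deriv (\<lambda>t. ramp a b t + - ramp a' b' t) (\<lambda>t. ramp_slope a b t + - ramp_slope a' b' t)"
          using ab by (intro AC_deriv_add AC_deriv_ramp AC_deriv_linear[OF bounded_linear_minus[OF bounded_linear_ident]]) auto
        then show ?thesis by (simp add: c_def[abs_def] c'_def[abs_def])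
      qed
      have "((\<lambda>t. c t *\<^sub>R \<kappa> v w t + c' t *\<^sub>R K t) has_integral (c T *\<^sub>R K T - c 0 *\<^sub>R K 0)) {0..T}"
        by (rule AC_deriv_integral[OF AC_deriv_bilinear[OF bounded_bilinear_scaleR cAC K] order_refl T])
      moreover have "c T = 0" using ab by (simp add: c_def T_def r_def ramp_right)
      moreover have "K 0 = 0" by (simp add: K_def)
      ultimately have "((\<lambda>t. c t *\<^sub>R \<kappa> v w t + c' t *\<^sub>R K t) has_integral 0) {0..T}" by simp
      from has_integral_diff[OF this 3]
      have 4: "((\<lambda>t. c' t *\<^sub>R K t) has_integral 0) {0..T}" by simp
      have "(\<lambda>t. c' t *\<^sub>R K t) integrable_on {0..r}"
        using 4 by (intro integrable_on_subinterval[OF has_integral_integrable[OF 4]]) (auto simp: T_def)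
      moreover have "integral {0..r} (\<lambda>t. c' t *\<^sub>R K t) = integral {0..T} (\<lambda>t. c' t *\<^sub>R K t)"
      proof (rule integral_spike_set)
        have e1: "{x \<in> {0..r} - {0..T}. c' x *\<^sub>R K x \<noteq> 0} = {}" by (auto simp: T_def)
        have e2: "{x \<in> {0..T} - {0..r}. c' x *\<^sub>R K x \<noteq> 0} = {}" by (auto simp: c'_def ramp_slope_def r_def)
        show "negligible {x \<in> {0..r} - {0..T}. c' x *\<^sub>R K x \<noteq> 0}" unfolding e1 by (rule negligible_empty)
        show "negligible {x \<in> {0..T} - {0..r}. c' x *\<^sub>R K x \<noteq> 0}" unfolding e2 by (rule negligible_empty)
      qed
      ultimately show "((\<lambda>t. (ramp_slope a b t - ramp_slope a' b' t) *\<^sub>R K t) has_integral 0) {0..max b b'}"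
        using integral_unique[OF 4] by (simp add: has_integral_iff c'_def r_def)
    qed
    then obtain C where C: "AE t in half_line. K t = C" by blast
    have "K t = C" if "0 \<le> t" for t
      by (rule continuous_AE_eq[OF Kc continuous_on_const C that])
    then have "AC_deriv (\<lambda>_. C) (\<kappa> v w)" by (rule AC_deriv_cong[OF K])
    from AC_deriv_unique[OF this AC_deriv_const] show ?thesis .
  qed
  then have "AE t in half_line. \<forall>i\<in>UNIV. \<forall>k\<in>UNIV. \<kappa> (axis i 1) (axis k 1) t = 0"
    by (intro AE_finite_allI) auto
  then show ?thesis using AE_half_line_nonneg
  proof eventually_elim
    case (elim t)
    define Y where "Y = fund Q 0 t"
    define M where "M = sharp (Q t ** Y) ** Y - sharp Y ** (Q t ** Y)"
    have M: "bform x (M *v y) = bform (Q t *v (Y *v x)) (Y *v y) - bform (Y *v x) (Q t *v (Y *v y))" for x y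
      by (simp add: M_def matrix_vector_mult_diff_rdistrib bform.diff_right matrix_vector_mul_assoc[symmetric] bform_matrix[symmetric])
    have "M = 0"
      by (rule bform_matrix_eq_zero) (use elim(1) in \<open>simp add: M \<kappa>_def Y_def\<close>)
    then have *: "bform (Q t *v (Y *v x)) (Y *v y) = bform (Y *v x) (Q t *v (Y *v y))" for x y
      using M[of x y] by (simp add: bform.zero_right)
    have **: "bform (Q t *v x) y = bform x (Q t *v y)" for x y
      using *[of "fund_inv Q 0 t *v x" "fund_inv Q 0 t *v y"] elim(2) by (simp add: Y_def fund_inv_mult)
    have "sharp (Q t) - Q t = 0"
    proof (rule bform_matrix_eq_zero)
      fix i k
      show "bform (axis i 1) ((sharp (Q t) - Q t) *v axis k 1) = 0"
        by (simp add: matrix_vector_mult_diff_rdistrib bform.diff_right bform_matrix[symmetric] **)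
    qed
    then show ?case by simp
  qed
qed

end

section \<open>The adjoint of the minimal operator\<close>

lemma dirac_conj_scaleC: "dirac_conj (c *\<^sub>C u) = cnj c *\<^sub>C dirac_conj u"
  using conjugation_dirac_conj unfolding conjugation_def by blast

lemma dirac_conj_add: "dirac_conj (u + v) = dirac_conj u + dirac_conj v"
  using conjugation_dirac_conj unfolding conjugation_def by blast

lemma compactly_supported_add:
  assumes "compactly_supported u" "compactly_supported v"
  shows "compactly_supported (u + v)"
proof -
  obtain f where f: "square_integrable f" "u = l2_class f" "compact (closure {t\<in>{0..}. f t \<noteq> 0})"
      "closure {t\<in>{0..}. f t \<noteq> 0} \<subseteq> {0<..}"
    using assms(1) unfolding compactly_supported_def by blast
  obtain g where g: "square_integrable g" "v = l2_class g" "compact (closure {t\<in>{0..}. g t \<noteq> 0})"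
      "closure {t\<in>{0..}. g t \<noteq> 0} \<subseteq> {0<..}"
    using assms(2) unfolding compactly_supported_def by blast
  have "closure {t\<in>{0..}. f t + g t \<noteq> 0} \<subseteq> closure ({t\<in>{0..}. f t \<noteq> 0} \<union> {t\<in>{0..}. g t \<noteq> 0})"
    by (rule closure_mono) auto
  then have sub: "closure {t\<in>{0..}. f t + g t \<noteq> 0} \<subseteq> closure {t\<in>{0..}. f t \<noteq> 0} \<union> closure {t\<in>{0..}. g t \<noteq> 0}"
    by (simp only: closure_Un)
  have "compact (closure {t\<in>{0..}. f t \<noteq> 0} \<union> closure {t\<in>{0..}. g t \<noteq> 0})"
    by (intro compact_Un f g)
  then have "bounded (closure {t\<in>{0..}. f t + g t \<noteq> 0})"
    using sub by (rule bounded_subset[OF compact_imp_bounded])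
  then have "compact (closure {t\<in>{0..}. f t + g t \<noteq> 0})"
    by (simp add: compact_eq_bounded_closed)
  moreover have "closure {t\<in>{0..}. f t + g t \<noteq> 0} \<subseteq> {0<..}" using sub f(4) g(4) by blast
  ultimately show ?thesis
    unfolding compactly_supported_def
    using square_integrable_add[OF f(1) g(1)] l2_class_add[OF f(1) g(1)] f(2) g(2)
    by (intro exI[of _ "\<lambda>t. f t + g t"]) simp
qed

lemma compactly_supported_scale:
  assumes "compactly_supported u"
  shows "compactly_supported (c *\<^sub>C u)"
proof -
  obtain f where f: "square_integrable f" "u = l2_class f" "compact (closure {t\<in>{0..}. f t \<noteq> 0})"
      "closure {t\<in>{0..}. f t \<noteq> 0} \<subseteq> {0<..}"
    using assms(1) unfolding compactly_supported_def by blast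
  have sub: "closure {t\<in>{0..}. c *s f t \<noteq> 0} \<subseteq> closure {t\<in>{0..}. f t \<noteq> 0}"
    by (rule closure_mono) auto
  then have "bounded (closure {t\<in>{0..}. c *s f t \<noteq> 0})"
    by (rule bounded_subset[OF compact_imp_bounded[OF f(3)]])
  then have "compact (closure {t\<in>{0..}. c *s f t \<noteq> 0})"
    by (simp add: compact_eq_bounded_closed)
  then show ?thesis
    unfolding compactly_supported_def
    using square_integrable_scale[OF f(1)] l2_class_scale[OF f(1)] f(2) sub f(4)
    by (intro exI[of _ "\<lambda>t. c *s f t"]) auto
qed

lemma linear_graph_dirac_max: "linear_graph (dirac_max Q)"
  unfolding linear_graph_def
proof (intro conjI allI impI)
  have "solves Q (\<lambda>_. 0) (\<lambda>_. 0)"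
    using AC_deriv_const[of 0] by (simp add: solves_def)
  then show "(0, 0) \<in> dirac_max Q"
    unfolding dirac_max_iff using square_integrable_zero l2_class_zero by metis
next
  fix u f v g assume "(u, f) \<in> dirac_max Q" "(v, g) \<in> dirac_max Q"
  then obtain y f' w g' where yw: "u = l2_class y" "f = l2_class f'" "square_integrable y" "square_integrable f'" "solves Q y f'"
    "v = l2_class w" "g = l2_class g'" "square_integrable w" "square_integrable g'" "solves Q w g'"
    unfolding dirac_max_iff by blast
  show "(u + v, f + g) \<in> dirac_max Q"
    unfolding dirac_max_iff
    by (intro exI[of _ "\<lambda>t. y t + w t"] exI[of _ "\<lambda>t. f' t + g' t"])
      (simp add: yw l2_class_add square_integrable_add solves_add)
next
  fix c u f assume "(u, f) \<in> dirac_max Q"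
  then obtain y f' where y: "u = l2_class y" "f = l2_class f'" "square_integrable y" "square_integrable f'" "solves Q y f'"
    unfolding dirac_max_iff by blast
  show "(c *\<^sub>C u, c *\<^sub>C f) \<in> dirac_max Q"
    unfolding dirac_max_iff
    by (intro exI[of _ "\<lambda>t. c *s y t"] exI[of _ "\<lambda>t. c *s f' t"])
      (simp add: y l2_class_scale square_integrable_scale solves_scale)
qed

lemma linear_graph_dirac_min: "linear_graph (dirac_min Q)"
  unfolding dirac_min_def
proof (rule linear_graph_closure)
  have "compactly_supported 0"
    unfolding compactly_supported_def
    by (intro exI[of _ "\<lambda>_. 0"]) (simp add: square_integrable_zero l2_class_zero)
  then show "linear_graph {(u, f). (u, f) \<in> dirac_max Q \<and> compactly_supported u}"
    using linear_graph_dirac_max[of Q] unfolding linear_graph_def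
    by (auto intro!: compactly_supported_add compactly_supported_scale)
qed

lemma closed_dirac_min: "closed (dirac_min Q)"
  unfolding dirac_min_def by (rule closed_closure)

locale j_symmetric_dirac = dirac_system Q for Q :: "real \<Rightarrow> complex ^ ('p::finite + 'p) ^ ('p + 'p)" +
  assumes sym: "j_symmetric dirac_conj (dirac_min Q)"
begin

lemma sharp_Q: "AE t in half_line. sharp (Q t) = Q t"
  by (rule j_symmetric_imp_sharp[OF sym])

text \<open>Homogeneous solutions have constant boundary form: the fundamental matrix is symplectic.\<close>

lemma sform_fund:
  assumes "0 \<le> t"
  shows "sform (fund Q 0 t *v x) (fund Q 0 t *v y) = sform x y"
proof -
  have "((\<lambda>t. 0 :: complex) has_integral (sform (fund Q 0 t *v x) (fund Q 0 t *v y) - sform x y)) {0..t}"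
    using green_formula[OF sharp_Q homogeneous_solves[of x] homogeneous_solves[of y] order_refl assms]
    by (simp add: bform.zero_left bform.zero_right)
  then show ?thesis using has_integral_unique[OF _ has_integral_0] by (metis right_minus_eq)
qed

text \<open>Let \<open>y\<close> be any solution of \<open>D y = j w\<close>. Testing with cut-off homogeneous solutions shows that \<open>r = j v - y\<close> satisfies
\<open>b(J x, r) = const\<close> for every homogeneous solution \<open>x\<close>. As the fundamental matrix preserves \<open>s\<close>, this forces \<open>r\<close> to be a
homogeneous solution itself, and \<open>j v = y + r\<close> solves \<open>D (j v) = j w\<close>.\<close>

theorem adjoint_dirac_min:
  assumes "(v, w) \<in> adjoint_op (dirac_min Q)"
  shows "(dirac_conj v, dirac_conj w) \<in> dirac_max Q"
proof -
  obtain v' where v': "square_integrable v'" "dirac_conj v = l2_class v'" using l2_class_exists by blast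
  obtain w' where w': "square_integrable w'" "dirac_conj w = l2_class w'" using l2_class_exists by blast
  have v: "v = dirac_conj (l2_class v')" using v'(2) dirac_conj_dirac_conj[of v] by simp
  have w: "w = dirac_conj (l2_class w')" using w'(2) dirac_conj_dirac_conj[of w] by simp
  obtain y where y: "solves Q y w'" using particular_solution_exists[OF square_integrable_L1_loc[OF w'(1)]] by blast
  have yc: "continuous_on {0..} y" by (rule solves_continuous[OF y])
  define r where "r t = v' t - y t" for t
  have r: "L1_loc r"
  proof -
    have "L1_loc (\<lambda>t. v' t + - y t)"
      by (intro L1_loc_add square_integrable_L1_loc v' L1_loc_continuous continuous_intros yc)
    then show ?thesis by (simp add: r_def[abs_def])
  qed
  have const: "\<exists>C. AE t in half_line. bform (J_mat *v (fund Q 0 t *v e)) (r t) = C" for e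
  proof (rule ramp_orthogonal_AE_constant)
    define x where "x t = fund Q 0 t *v e" for t
    have x: "solves Q x (\<lambda>_. 0)" unfolding x_def by (rule homogeneous_solves)
    have xc: "continuous_on {0..} x" by (rule solves_continuous[OF x])
    show "L1_loc (\<lambda>t. bform (J_mat *v (fund Q 0 t *v e)) (r t))"
      by (rule L1_loc_bilinear[OF bounded_bilinear_bform _ r]) (use continuous_J[OF xc] in \<open>simp add: x_def\<close>)
    fix a b a' b' :: real assume ab: "0 < a" "a < b" "0 < a'" "a' < b'"
    define u where "u = (\<lambda>t. (ramp a b t - ramp a' b' t) *\<^sub>R x t)"
    define f where "f = (\<lambda>t. (ramp_slope a b t - ramp_slope a' b' t) *\<^sub>R (J_mat *v x t))"
    note uf = ramp_difference_in_dirac_min(1-4)[OF x ab, folded u_def f_def]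
    define T where "T = max b b'"
    have T: "0 \<le> T" using ab by (simp add: T_def)
    have u0: "u 0 = 0" using ab by (simp add: u_def ramp_left)
    have uT: "u t = 0" if "T \<le> t" for t using that ab by (simp add: u_def T_def ramp_right)
    have fT: "f t = 0" if "T < t" for t using that by (simp add: f_def T_def ramp_slope_def)
    have "cinner (l2_class f) v = cinner (l2_class u) w"
      using assms uf(1) unfolding adjoint_op_def by blast
    then have "integral\<^sup>L half_line (\<lambda>t. bform (f t) (v' t)) = integral\<^sup>L half_line (\<lambda>t. bform (u t) (w' t))"
      unfolding v w using uf v'(1) w'(1) by (simp add: cinner_dirac_conj_l2_class)
    moreover have "integral\<^sup>L half_line (\<lambda>t. bform (f t) (v' t)) = integral {0..T} (\<lambda>t. bform (f t) (v' t))"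
      by (rule half_line_integral_support[OF integrable_bform[OF uf(3) v'(1)]])
        (use fT in \<open>auto simp: bform.zero_left\<close>)
    moreover have "integral\<^sup>L half_line (\<lambda>t. bform (u t) (w' t)) = integral {0..T} (\<lambda>t. bform (u t) (w' t))"
      by (rule half_line_integral_support[OF integrable_bform[OF uf(2) w'(1)]])
        (use uT in \<open>auto simp: bform.zero_left\<close>)
    ultimately have eq: "integral {0..T} (\<lambda>t. bform (f t) (v' t)) = integral {0..T} (\<lambda>t. bform (u t) (w' t))" by simp
    have fv: "(\<lambda>t. bform (f t) (v' t)) integrable_on {0..T}"
    proof -
      have "(\<lambda>t. bform (f t) (v' t)) absolutely_integrable_on {0..T}"
        using integrable_bform[OF uf(3) v'(1)] unfolding half_line_integrable_iff
        by (rule set_integrable_subset) auto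
      then show ?thesis by (rule set_lebesgue_integral_eq_integral(1))
    qed
    have uw: "(\<lambda>t. bform (u t) (w' t)) integrable_on {0..T}"
      by (rule L1_loc_integrable[OF L1_loc_bilinear[OF bounded_bilinear_bform solves_continuous[OF uf(4)] square_integrable_L1_loc[OF w'(1)]] order_refl])
    have 1: "((\<lambda>t. bform (f t) (v' t) - bform (u t) (w' t)) has_integral 0) {0..T}"
      using has_integral_diff[OF integrable_integral[OF fv] integrable_integral[OF uw]] eq by simp
    \<comment> \<open>Adding Green's formula for the solution \<open>y\<close>, the terms with \<open>j w\<close> cancel.\<close>
    have 2: "((\<lambda>t. bform (u t) (w' t) - bform (f t) (y t)) has_integral 0) {0..T}"
      using green_formula[OF sharp_Q uf(4) y order_refl T] u0 uT[of T] by (simp add: sform.zero_left)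
    have "((\<lambda>t. (bform (f t) (v' t) - bform (u t) (w' t)) + (bform (u t) (w' t) - bform (f t) (y t))) has_integral 0) {0..T}"
      using has_integral_add[OF 1 2] by simp
    moreover have "(\<lambda>t. (bform (f t) (v' t) - bform (u t) (w' t)) + (bform (u t) (w' t) - bform (f t) (y t)))
        = (\<lambda>t. (ramp_slope a b t - ramp_slope a' b' t) *\<^sub>R bform (J_mat *v (fund Q 0 t *v e)) (r t))"
    proof
      fix t
      have "(bform (f t) (v' t) - bform (u t) (w' t)) + (bform (u t) (w' t) - bform (f t) (y t)) = bform (f t) (r t)"
        by (simp add: r_def bform.diff_right)
      also have "\<dots> = (ramp_slope a b t - ramp_slope a' b' t) *\<^sub>R bform (J_mat *v (fund Q 0 t *v e)) (r t)"
        by (simp only: f_def bform.scaleR_left x_def)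
      finally show "(bform (f t) (v' t) - bform (u t) (w' t)) + (bform (u t) (w' t) - bform (f t) (y t))
        = (ramp_slope a b t - ramp_slope a' b' t) *\<^sub>R bform (J_mat *v (fund Q 0 t *v e)) (r t)" .
    qed
    ultimately show "((\<lambda>t. (ramp_slope a b t - ramp_slope a' b' t) *\<^sub>R bform (J_mat *v (fund Q 0 t *v e)) (r t)) has_integral 0) {0..max b b'}"
      by (simp only: T_def)
  qed
  then have "\<forall>i. \<exists>C. AE t in half_line. bform (J_mat *v (fund Q 0 t *v axis i 1)) (r t) = C" by blast
  from choice[OF this]
  obtain C where C: "\<forall>i. AE t in half_line. bform (J_mat *v (fund Q 0 t *v axis i 1)) (r t) = C i" by (elim exE)
  define d :: "complex ^ ('p + 'p)" where "d = (\<chi> m. C (swap_index m))"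
  define c where "c = J_mat *v d"
  \<comment> \<open>The vector \<open>c\<close> is chosen so that the solution starting at \<open>c\<close> produces the same constants as \<open>r\<close>.\<close>
  have sc: "sform (axis i 1) c = - C i" for i
    using bform_axis_left[of "swap_index i" "- d"] by (simp add: sform_def c_def J_J d_def)
  have "AE t in half_line. \<forall>i\<in>UNIV. bform (J_mat *v (fund Q 0 t *v axis i 1)) (r t) = C i"
    by (rule AE_finite_allI) (simp_all add: C[rule_format])
  then have AE: "AE t in half_line. v' t = y t + fund Q 0 t *v c" using AE_half_line_nonneg
  proof eventually_elim
    case (elim t)
    define x where "x = J_mat *v (r t - fund Q 0 t *v c)"
    have "bform (fund Q 0 t *v axis i 1) x = 0" for i
    proof -
      have "- bform (fund Q 0 t *v axis i 1) x = bform (J_mat *v (fund Q 0 t *v axis i 1)) (r t)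
          - bform (J_mat *v (fund Q 0 t *v axis i 1)) (fund Q 0 t *v c)"
        unfolding x_def bform_J[symmetric] bform.diff_right ..
      also have "bform (J_mat *v (fund Q 0 t *v axis i 1)) (fund Q 0 t *v c) = - sform (fund Q 0 t *v axis i 1) (fund Q 0 t *v c)"
        by (simp only: bform_J sform_def)
      also have "\<dots> = C i" using elim(2) by (simp only: sform_fund sc minus_minus)
      finally show ?thesis using elim(1) by simp
    qed
    then have "bform (axis i 1) (sharp (fund Q 0 t) *v x) = 0" for i by (simp only: bform_matrix[symmetric])
    then have "(sharp (fund Q 0 t) *v x) $ j = 0" for j
      using bform_axis_left[of j "sharp (fund Q 0 t) *v x"] by metis
    then have s0: "sharp (fund Q 0 t) *v x = 0" by (simp add: vec_eq_iff)
    have "bform x z = 0" for z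
    proof -
      have "bform z x = bform (fund Q 0 t *v (fund_inv Q 0 t *v z)) x"
        by (simp only: fund_inv_mult(2)[OF elim(2)])
      also have "\<dots> = bform (fund_inv Q 0 t *v z) (sharp (fund Q 0 t) *v x)" by (rule bform_matrix)
      also have "\<dots> = 0" by (simp only: s0 bform.zero_right)
      finally show ?thesis using bform_commute[of x z] by simp
    qed
    then have "x = 0" by (rule bform_nondegenerate)
    then have "J_mat *v x = 0" by simp
    then have "r t - fund Q 0 t *v c = 0" by (simp only: x_def J_J neg_equal_0_iff_equal)
    then show ?case by (simp add: r_def algebra_simps)
  qed
  define Y where "Y t = y t + fund Q 0 t *v c" for t
  have Y: "solves Q Y w'" using solves_add[OF y homogeneous_solves[of c]] by (simp add: Y_def[abs_def])
  have sqY: "square_integrable Y"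
    by (rule square_integrable_cong_AE[OF v'(1) AE[folded Y_def] continuous_half_line_measurable[OF solves_continuous[OF Y]]])
  have "l2_class v' = l2_class Y" using l2_class_eq_iff[OF v'(1) sqY] AE by (simp add: Y_def)
  then show ?thesis
    unfolding dirac_max_iff v'(2) w'(2) using Y sqY w'(1) by blast
qed

text \<open>By \<open>j\<close>-symmetry the minimal operator lies in \<open>j D\<^sub>m\<^sub>i\<^sub>n\<^sup>* j\<close>, and this in \<open>D\<^sub>m\<^sub>a\<^sub>x\<close>. This avoids proving that the
maximal operator is closed.\<close>

lemma dirac_min_subset_max: "dirac_min Q \<subseteq> dirac_max Q"
proof
  fix p assume "p \<in> dirac_min Q"
  moreover obtain u f where p: "p = (u, f)" by (cases p)
  ultimately have "(dirac_conj u, dirac_conj f) \<in> adjoint_op (dirac_min Q)"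
    using j_symmetric_adjoint[OF sym] by blast
  from adjoint_dirac_min[OF this] show "p \<in> dirac_max Q" by (simp add: p dirac_conj_dirac_conj)
qed

text \<open>Green's formula on \<open>[t, t + 1]\<close> with a cut-off homogeneous solution \<open>w\<close> that has a prescribed value at \<open>t\<close> and vanishes at
\<open>t + 1\<close>: the value of \<open>y\<close> at \<open>t\<close> becomes a sum of two inner products.\<close>

theorem evaluation_functional:
  assumes t: "0 \<le> t"
  shows "\<exists>a b. \<forall>y g. solves Q y g \<longrightarrow> square_integrable y \<longrightarrow> square_integrable g \<longrightarrow>
    y t $ i = cinner (l2_class y) a + cinner (l2_class g) b"
proof -
  \<comment> \<open>With this value at \<open>t\<close>, the boundary term \<open>s(y(t), d)\<close> is the \<open>i\<close>-th component of \<open>y(t)\<close>.\<close>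
  define d where "d = - (J_mat *v axis (swap_index i) 1)"
  define x where "x s = fund Q 0 s *v (fund_inv Q 0 t *v d)" for s
  have x: "solves Q x (\<lambda>_. 0)" unfolding x_def by (rule homogeneous_solves)
  have xc: "continuous_on {0..} x" by (rule solves_continuous[OF x])
  have xt: "x t = d" using t by (simp add: x_def fund_inv_mult)
  define c where "c s = 1 + - ramp t (t + 1) s" for s
  define c' where "c' s = 0 + - ramp_slope t (t + 1) s" for s
  have cAC: "AC_deriv c c'" unfolding c_def c'_def
    using t by (intro AC_deriv_add AC_deriv_const AC_deriv_linear[OF bounded_linear_minus[OF bounded_linear_ident]] AC_deriv_ramp) auto
  define w where "w s = c s *\<^sub>R x s" for s
  define h where "h s = c' s *\<^sub>R (J_mat *v x s)" for s
  have w: "solves Q w h" using solves_cutoff[OF x cAC] by (simp add: w_def[abs_def] h_def[abs_def])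
  have wt: "w t = d" by (simp add: w_def c_def ramp_left xt)
  have w1: "w (t + 1) = 0" by (simp add: w_def c_def ramp_right)
  let ?I = "{t..t+1}"
  define b' where "b' s = (indicator ?I s * c s) *\<^sub>R x s" for s
  define a' where "a' s = (- (indicator ?I s * c' s)) *\<^sub>R (J_mat *v x s)" for s
  have ind: "indicat_real ?I \<in> borel_measurable half_line" by (rule half_line_indicator_measurable) simp
  have b': "square_integrable b'" unfolding b'_def
  proof (rule square_integrable_cutoff[OF xc])
    have "c \<in> borel_measurable half_line"
      using cAC by (intro continuous_half_line_measurable AC_loc_continuous) (simp add: AC_deriv_def)
    then show "(\<lambda>s. indicat_real ?I s * c s) \<in> borel_measurable half_line" by (intro borel_measurable_times ind)
    show "\<bar>indicat_real ?I s * c s\<bar> \<le> 1" for s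
      using ramp_bounds[of t "t + 1" s] by (auto simp: indicator_def c_def)
    show "indicat_real ?I s * c s = 0" if "s > t + 1" for s using that by (simp add: indicator_def)
  qed
  have a': "square_integrable a'" unfolding a'_def
  proof (rule square_integrable_cutoff[OF continuous_J[OF xc]])
    have "c' \<in> borel_measurable half_line"
      unfolding c'_def by (intro borel_measurable_add borel_measurable_uminus ramp_slope_measurable borel_measurable_const)
    then show "(\<lambda>s. - (indicat_real ?I s * c' s)) \<in> borel_measurable half_line"
      by (intro borel_measurable_uminus borel_measurable_times ind)
    show "\<bar>- (indicat_real ?I s * c' s)\<bar> \<le> 1" for s
      using ramp_slope_bound[of t "t + 1" s] by (auto simp: indicator_def c'_def)
    show "- (indicat_real ?I s * c' s) = 0" if "s > t + 1" for s using that by (simp add: indicator_def)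
  qed
  have "y t $ i = cinner (l2_class y) (dirac_conj (l2_class a')) + cinner (l2_class g) (dirac_conj (l2_class b'))"
    if y: "solves Q y g" and sy: "square_integrable y" and sg: "square_integrable g" for y g
  proof -
    have e1: "cinner (l2_class y) (dirac_conj (l2_class a')) = integral ?I (\<lambda>s. bform (y s) (a' s))"
      unfolding cinner_dirac_conj_l2_class[OF sy a']
      by (rule half_line_integral_support[OF integrable_bform[OF sy a'] t])
        (auto simp: a'_def bform.zero_right)
    have e2: "cinner (l2_class g) (dirac_conj (l2_class b')) = integral ?I (\<lambda>s. bform (g s) (b' s))"
      unfolding cinner_dirac_conj_l2_class[OF sg b']
      by (rule half_line_integral_support[OF integrable_bform[OF sg b'] t])
        (auto simp: b'_def bform.zero_right)
    have i1: "(\<lambda>s. bform (y s) (a' s)) integrable_on ?I"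
      by (intro L1_loc_integrable L1_loc_bilinear[OF bounded_bilinear_bform] solves_continuous[OF y] square_integrable_L1_loc a' t)
    have i2: "(\<lambda>s. bform (g s) (b' s)) integrable_on ?I"
    proof -
      have "(\<lambda>s. bform (g s) (b' s)) absolutely_integrable_on ?I"
        using integrable_bform[OF sg b'] unfolding half_line_integrable_iff
        by (rule set_integrable_subset) (use t in auto)
      then show ?thesis by (rule set_lebesgue_integral_eq_integral(1))
    qed
    have "integral ?I (\<lambda>s. bform (y s) (a' s)) + integral ?I (\<lambda>s. bform (g s) (b' s))
        = integral ?I (\<lambda>s. bform (y s) (a' s) + bform (g s) (b' s))"
      by (rule Henstock_Kurzweil_Integration.integral_add[OF i1 i2, symmetric])
    also have "\<dots> = integral ?I (\<lambda>s. - (bform (y s) (h s) - bform (g s) (w s)))"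
      by (rule Henstock_Kurzweil_Integration.integral_cong)
        (simp add: a'_def b'_def h_def w_def bform.minus_right)
    also have "\<dots> = - (sform (y (t+1)) (w (t+1)) - sform (y t) (w t))"
      using t by (intro integral_unique has_integral_neg green_formula[OF sharp_Q y w]) auto
    also have "\<dots> = bform (y t) (J_mat *v d)" by (simp add: w1 wt sform_def bform.zero_right)
    also have "J_mat *v d = axis (swap_index i) 1" by (simp add: d_def J_minus J_J)
    also have "bform (y t) (axis (swap_index i) 1) = y t $ i" by (rule bform_axis)
    finally show ?thesis using e1 e2 by simp
  qed
  then show ?thesis by blast
qed

text \<open>The initial value vanishes on the operator before the closure is taken, and it is continuous in the graph norm.\<close>

lemma dirac_min_initial_value:
  assumes "(l2_class y, l2_class g) \<in> dirac_min Q" "solves Q y g" "square_integrable y" "square_integrable g"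
  shows "y 0 = 0"
proof -
  have "y 0 $ i = 0" for i
  proof -
    obtain a b where ab: "\<And>y g. solves Q y g \<Longrightarrow> square_integrable y \<Longrightarrow> square_integrable g \<Longrightarrow>
      y 0 $ i = cinner (l2_class y) a + cinner (l2_class g) b"
      using evaluation_functional[OF order_refl, of i] by metis
    define Z where "Z = {p. cinner (fst p) a + cinner (snd p) b = 0}"
    have "closed Z" unfolding Z_def
      by (intro closed_Collect_eq continuous_intros bounded_bilinear.continuous_on[OF bounded_bilinear_cinner])
    have "dirac_min Q \<subseteq> Z" unfolding dirac_min_def
    proof (rule closure_minimal[OF _ \<open>closed Z\<close>], clarify)
      fix u f assume uf: "(u, f) \<in> dirac_max Q" and cs: "compactly_supported u"
      obtain x h where x: "u = l2_class x" "f = l2_class h" "square_integrable x" "square_integrable h" "solves Q x h"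
        using uf unfolding dirac_max_iff by blast
      obtain x' where x': "square_integrable x'" "u = l2_class x'" "closure {t\<in>{0..}. x' t \<noteq> 0} \<subseteq> {0<..}"
        using cs unfolding compactly_supported_def by blast
      have ae: "AE t in half_line. x t = x' t" using l2_class_eq_iff[OF x(3) x'(1)] x(1) x'(2) by simp
      have "0 \<in> - closure {t\<in>{0..}. x' t \<noteq> 0}" using x'(3) by auto
      then obtain \<delta> where \<delta>: "\<delta> > 0" "ball 0 \<delta> \<subseteq> - closure {t\<in>{0..}. x' t \<noteq> 0}"
        using open_contains_ball[of "- closure {t\<in>{0..}. x' t \<noteq> 0}"] by (auto simp: open_Compl)
      \<comment> \<open>Multiplying by a bump at \<open>0\<close> lets the identity theorem for continuous functions on the half-line be applied.\<close>
      have "max 0 (\<delta> - 0) *\<^sub>R x 0 = 0"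
      proof (rule continuous_AE_eq[where f = "\<lambda>t. max 0 (\<delta> - t) *\<^sub>R x t" and g = "\<lambda>_. 0"])
        show "continuous_on {0..} (\<lambda>t. max 0 (\<delta> - t) *\<^sub>R x t)"
          by (intro continuous_intros solves_continuous[OF x(5)])
        show "AE t in half_line. max 0 (\<delta> - t) *\<^sub>R x t = 0"
          using ae AE_half_line_nonneg
        proof eventually_elim
          case (elim t)
          show ?case
          proof (cases "t < \<delta>")
            case True
            have "dist 0 t = t" using elim(2) unfolding dist_real_def by linarith
            with True have "t \<in> ball 0 \<delta>" by (simp only: mem_ball)
            from subsetD[OF \<delta>(2) this] have "t \<notin> closure {t\<in>{0..}. x' t \<noteq> 0}" by (rule ComplD)
            then have "t \<notin> {t\<in>{0..}. x' t \<noteq> 0}" by (rule contra_subsetD[OF closure_subset])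
            then show ?thesis using elim by simp
          qed simp
        qed
      qed auto
      then have "x 0 = 0" using \<delta>(1) by simp
      then show "(u, f) \<in> Z" using ab[OF x(5,3,4)] x(1,2) by (simp add: Z_def)
    qed
    then show ?thesis using assms(1) ab[OF assms(2-4)] by (auto simp: Z_def)
  qed
  then show ?thesis by (simp add: vec_eq_iff)
qed

lemma orthogonal_shifted_range:
  assumes "\<And>m. m \<in> shifted_range (dirac_min Q) z \<Longrightarrow> cinner m x = 0"
  shows "(dirac_conj x, z *\<^sub>C dirac_conj x) \<in> dirac_max Q"
proof -
  have "(x, cnj z *\<^sub>C x) \<in> adjoint_op (dirac_min Q)"
    unfolding adjoint_op_def
  proof clarify
    fix u f assume "(u, f) \<in> dirac_min Q"
    then have "cinner (f - z *\<^sub>C u) x = 0" by (intro assms) (auto simp: shifted_range_def)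
    then show "cinner f x = cinner u (cnj z *\<^sub>C x)"
      by (simp add: bounded_bilinear.diff_left[OF bounded_bilinear_cinner] cinner_scaleC_left cinner_scaleC_right)
  qed
  from adjoint_dirac_min[OF this] show ?thesis by (simp add: dirac_conj_scaleC)
qed

section \<open>Initial values of square integrable solutions\<close>

definition boundary_space :: "complex \<Rightarrow> (complex ^ ('p + 'p)) set" where
  "boundary_space z = {v. square_integrable (\<lambda>t. fund Q z t *v v)}"

lemma boundary_space_subspace: "vec.subspace (boundary_space z)"
  unfolding vec.subspace_def boundary_space_def
  by (simp add: matrix_vector_right_distrib vector_scalar_commute square_integrable_zero
      square_integrable_add square_integrable_scale)

lemma kernel_solution:
  assumes y: "solves Q y g" "square_integrable y" "square_integrable g" and eq: "l2_class g = z *\<^sub>C l2_class y"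
  shows "y 0 \<in> boundary_space z" "0 \<le> t \<Longrightarrow> y t = fund Q z t *v y 0" "l2_class y = l2_class (\<lambda>t. fund Q z t *v y 0)"
proof -
  have "AE t in half_line. g t = z *s y t"
    using eq y l2_class_eq_iff[OF y(3) square_integrable_scale[OF y(2)]] by (simp add: l2_class_scale)
  then have "solves Q y (\<lambda>t. z *s y t)" by (rule solves_cong_AE[OF y(1)])
  then show yt: "y t = fund Q z t *v y 0" if "0 \<le> t" for t using that by (rule solves_unique)
  have ae: "AE t in half_line. y t = fund Q z t *v y 0"
    using AE_half_line_nonneg by eventually_elim (rule yt)
  have "square_integrable (\<lambda>t. fund Q z t *v y 0)"
    by (rule square_integrable_cong_AE[OF y(2) ae continuous_half_line_measurable[OF solves_continuous[OF fund_solves]]])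
  then show "y 0 \<in> boundary_space z" "l2_class y = l2_class (\<lambda>t. fund Q z t *v y 0)"
    using l2_class_eq_iff[OF y(2)] ae by (auto simp: boundary_space_def)
qed

lemma boundary_space_kernel:
  assumes "v \<in> boundary_space z"
  shows "(l2_class (\<lambda>t. fund Q z t *v v), z *\<^sub>C l2_class (\<lambda>t. fund Q z t *v v)) \<in> dirac_max Q"
  using assms fund_solves[of z v] square_integrable_scale unfolding dirac_max_iff boundary_space_def
  by (auto simp: l2_class_scale)

text \<open>In Green's formula for two solutions with the same \<open>z\<close> the integrand vanishes.\<close>

lemma boundary_space_isotropic:
  assumes "v \<in> boundary_space z" "w \<in> boundary_space z"
  shows "sform v w = 0"
proof -
  have "integral\<^sup>L half_line (\<lambda>t. bform (fund Q z t *v v) (z *s (fund Q z t *v w)) - bform (z *s (fund Q z t *v v)) (fund Q z t *v w))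
      = - sform (fund Q z 0 *v v) (fund Q z 0 *v w)"
    using assms by (intro green_formula_half_line[OF sharp_Q] fund_solves square_integrable_scale) (auto simp: boundary_space_def)
  then show ?thesis by (simp add: bform_scale_left bform_scale_right)
qed

text \<open>Cut the solution starting at \<open>v\<close> off to \<open>u\<close> and let \<open>f = (D - z) u\<close>. The component \<open>q\<close> of \<open>f\<close> orthogonal to the closed range of
\<open>D\<^sub>m\<^sub>i\<^sub>n - z\<close> is \<open>j k\<close> for a square integrable solution \<open>k\<close>, and \<open>\<langle>f, q\<rangle> = s(v, k(0)) = 0\<close> by Green's formula and the hypothesis. So \<open>q = 0\<close>, and \<open>f\<close>
is in the range; subtracting a preimage, whose initial value is zero, from \<open>u\<close> gives a square integrable solution starting at \<open>v\<close>.\<close>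

theorem boundary_space_coisotropic:
  assumes z: "z \<in> field_of_regularity (dirac_min Q)" and v: "\<And>w. w \<in> boundary_space z \<Longrightarrow> sform v w = 0"
  shows "v \<in> boundary_space z"
proof -
  define M where "M = shifted_range (dirac_min Q) z"
  have M: "closed M" "l2.subspace M"
    unfolding M_def by (intro shifted_range_closed shifted_range_subspace closed_dirac_min linear_graph_dirac_min z)+
  define x where "x t = fund Q z t *v v" for t
  have x: "solves Q x (\<lambda>t. z *s x t)" unfolding x_def by (rule fund_solves)
  have xc: "continuous_on {0..} x" by (rule solves_continuous[OF x])
  define c where "c s = 1 + - ramp 0 1 s" for s
  define c' where "c' s = 0 + - ramp_slope 0 1 s" for s
  have cAC: "AC_deriv c c'" unfolding c_def c'_def
    by (intro AC_deriv_add AC_deriv_const AC_deriv_linear[OF bounded_linear_minus[OF bounded_linear_ident]] AC_deriv_ramp) auto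
  define u where "u s = c s *\<^sub>R x s" for s
  define f where "f s = c' s *\<^sub>R (J_mat *v x s)" for s
  have "solves Q u (\<lambda>t. f t + c t *\<^sub>R (z *s x t))"
    using solves_cutoff[OF x cAC] by (simp add: u_def[abs_def] f_def[abs_def])
  moreover have "c t *\<^sub>R (z *s x t) = z *s u t" for t by (simp add: u_def vec_eq_iff)
  ultimately have u: "solves Q u (\<lambda>t. f t + z *s u t)" by simp
  have squ: "square_integrable u" unfolding u_def
  proof (rule square_integrable_cutoff[OF xc])
    show "c \<in> borel_measurable half_line"
      using cAC by (intro continuous_half_line_measurable AC_loc_continuous) (simp add: AC_deriv_def)
    show "\<bar>c s\<bar> \<le> 1" for s using ramp_bounds[of 0 1 s] by (auto simp: c_def)
    show "c s = 0" if "s > 1" for s using that by (simp add: c_def ramp_right)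
  qed
  have sqf: "square_integrable f" unfolding f_def
  proof (rule square_integrable_cutoff[OF continuous_J[OF xc]])
    show "c' \<in> borel_measurable half_line"
      unfolding c'_def by (intro borel_measurable_add borel_measurable_uminus ramp_slope_measurable borel_measurable_const)
    show "\<bar>c' s\<bar> \<le> 1" for s using ramp_slope_bound[of 0 1 s] by (auto simp: c'_def)
    show "c' s = 0" if "s > 1" for s using that by (simp add: c'_def ramp_slope_def)
  qed
  have u0: "u 0 = v" by (simp add: u_def c_def ramp_left x_def)
  obtain s where s: "s \<in> M" "\<And>m. m \<in> M \<Longrightarrow> cinner (l2_class f - s) m = 0"
    using complex_orthogonal_projection_exists[OF M, of "l2_class f"] by blast
  define q where "q = l2_class f - s"
  have qM: "cinner m q = 0" if "m \<in> M" for m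
    using s(2)[OF that] cinner_commute[of m q] by (simp add: q_def)
  have "(dirac_conj q, z *\<^sub>C dirac_conj q) \<in> dirac_max Q"
    by (rule orthogonal_shifted_range) (use qM in \<open>simp add: M_def\<close>)
  then obtain y g where y: "dirac_conj q = l2_class y" "z *\<^sub>C dirac_conj q = l2_class g" "square_integrable y" "square_integrable g" "solves Q y g"
    unfolding dirac_max_iff by blast
  have yz: "l2_class g = z *\<^sub>C l2_class y" using y(1,2) by simp
  define e where "e = y 0"
  have e: "e \<in> boundary_space z" unfolding e_def by (rule kernel_solution(1)[OF y(5,3,4) yz])
  define k where "k t = fund Q z t *v e" for t
  have sqk: "square_integrable k" using e by (simp add: boundary_space_def k_def[abs_def])
  have qk: "q = dirac_conj (l2_class k)"
    using kernel_solution(3)[OF y(5,3,4) yz] y(1) dirac_conj_dirac_conj[of q] by (simp add: k_def[abs_def] e_def)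
  have k: "solves Q k (\<lambda>t. z *s k t)" unfolding k_def by (rule fund_solves)
  have "cinner (l2_class f) q = 0"
  proof -
    have "cinner (l2_class f) q = integral\<^sup>L half_line (\<lambda>t. bform (f t) (k t))"
      unfolding qk by (rule cinner_dirac_conj_l2_class[OF sqf sqk])
    also have "\<dots> = - integral\<^sup>L half_line (\<lambda>t. bform (u t) (z *s k t) - bform (f t + z *s u t) (k t))"
      by (simp add: bform.add_left bform_scale_left bform_scale_right)
    also have "\<dots> = sform (u 0) (k 0)"
      by (subst green_formula_half_line[OF sharp_Q u squ _ k sqk])
        (intro square_integrable_add square_integrable_scale sqf squ sqk, intro square_integrable_scale sqk, simp)
    also have "\<dots> = 0" using v[OF e] by (simp add: u0 k_def)
    finally show ?thesis .
  qed
  moreover have "cinner s q = 0" by (rule qM[OF s(1)])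
  ultimately have "cinner q q = 0"
    by (simp add: q_def bounded_bilinear.diff_left[OF bounded_bilinear_cinner])
  then have "Re (cinner q q) = 0" by simp
  with conjunct2[OF Re_cinner_self[of q]] have "q = 0" by (rule iffD1)
  then have "l2_class f \<in> M" using s(1) by (simp add: q_def)
  then obtain u1 f1 where uf1: "(u1, f1) \<in> dirac_min Q" "l2_class f = f1 - z *\<^sub>C u1"
    unfolding M_def shifted_range_def by blast
  have "(u1, f1) \<in> dirac_max Q" using uf1(1) dirac_min_subset_max by blast
  then obtain y1 g1 where y1: "u1 = l2_class y1" "f1 = l2_class g1" "square_integrable y1" "square_integrable g1" "solves Q y1 g1"
    unfolding dirac_max_iff by blast
  have y10: "y1 0 = 0" by (rule dirac_min_initial_value[OF uf1(1)[unfolded y1(1,2)] y1(5,3,4)])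
  have d: "solves Q (\<lambda>t. u t + (-1) *s y1 t) (\<lambda>t. (f t + z *s u t) + (-1) *s g1 t)"
    by (intro solves_add u solves_scale y1)
  have sqd: "square_integrable (\<lambda>t. u t + (-1) *s y1 t)" "square_integrable (\<lambda>t. (f t + z *s u t) + (-1) *s g1 t)"
    by (intro square_integrable_add square_integrable_scale squ sqf y1)+
  have "l2_class (\<lambda>t. (f t + z *s u t) + (-1) *s g1 t) = (l2_class f + z *\<^sub>C l2_class u) + (-1) *\<^sub>C f1"
    by (simp only: l2_class_add[symmetric] l2_class_scale[symmetric] square_integrable_add square_integrable_scale squ sqf y1)
  also have "\<dots> = z *\<^sub>C (l2_class u + (-1) *\<^sub>C u1)"
    unfolding uf1(2) by (simp add: l2.scale_right_distrib l2.scale_right_diff_distrib)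
  also have "\<dots> = z *\<^sub>C l2_class (\<lambda>t. u t + (-1) *s y1 t)"
    by (simp only: l2_class_add[symmetric] l2_class_scale[symmetric] square_integrable_add square_integrable_scale squ y1)
  finally have "u 0 + (-1) *s y1 0 \<in> boundary_space z"
    by (rule kernel_solution(1)[OF d sqd])
  then show ?thesis by (simp add: u0 y10)
qed

end

section \<open>Holomorphic matrix functions\<close>

definition mat_holo :: "(complex \<Rightarrow> complex ^ 'm::finite ^ 'n::finite) \<Rightarrow> complex set \<Rightarrow> bool" where
  "mat_holo F S \<longleftrightarrow> (\<forall>i j. (\<lambda>z. F z $ i $ j) holomorphic_on S)"

lemma mat_holoD: "mat_holo F S \<Longrightarrow> (\<lambda>z. F z $ i $ j) holomorphic_on S"
  by (simp add: mat_holo_def)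

lemma mat_holo_subset: "mat_holo F S \<Longrightarrow> T \<subseteq> S \<Longrightarrow> mat_holo F T"
  by (auto simp: mat_holo_def intro: holomorphic_on_subset)

lemma mat_holo_cong: "mat_holo F S \<Longrightarrow> (\<And>z. z \<in> S \<Longrightarrow> F z = G z) \<Longrightarrow> mat_holo G S"
  unfolding mat_holo_def
proof (intro allI)
  fix i j assume F: "\<forall>i j. (\<lambda>z. F z $ i $ j) holomorphic_on S" and eq: "\<And>z. z \<in> S \<Longrightarrow> F z = G z"
  show "(\<lambda>z. G z $ i $ j) holomorphic_on S"
    by (rule holomorphic_transform[OF F[rule_format, of i j]]) (simp add: eq)
qed

lemma mat_holo_const: "mat_holo (\<lambda>_. A) S"
  by (simp add: mat_holo_def)

lemma mat_holo_mult: "mat_holo F S \<Longrightarrow> mat_holo G S \<Longrightarrow> mat_holo (\<lambda>z. F z ** G z) S"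
  by (auto simp: mat_holo_def matrix_matrix_mult_def intro!: holomorphic_intros)

lemma mat_holo_mat: "f holomorphic_on S \<Longrightarrow> mat_holo (\<lambda>z. mat (f z)) S"
  unfolding mat_holo_def mat_def
proof (intro allI)
  fix i j :: 'a
  assume "f holomorphic_on S"
  then show "(\<lambda>z. (\<chi> i j. if i = j then f z else 0) $ i $ j) holomorphic_on S"
    by (cases "i = j") simp_all
qed

lemma mat_holo_open_Un: "mat_holo F S \<Longrightarrow> mat_holo F T \<Longrightarrow> open S \<Longrightarrow> open T \<Longrightarrow> mat_holo F (S \<union> T)"
  by (auto simp: mat_holo_def intro: holomorphic_on_Un)

lemma mat_holo_det:
  assumes "mat_holo F S"
  shows "(\<lambda>z. det (F z :: complex ^ 'n::finite ^ 'n)) holomorphic_on S"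
  unfolding det_def by (intro holomorphic_intros mat_holoD[OF assms])

lemma mat_holo_continuous:
  assumes "mat_holo F S"
  shows "continuous_on S F"
proof -
  have "continuous_on S (\<lambda>z. \<chi> i j. F z $ i $ j)"
    by (intro continuous_on_vec_lambda holomorphic_on_imp_continuous_on mat_holoD[OF assms])
  then show ?thesis by simp
qed

text \<open>The adjugate matrix, whose entries are those of Cramer's rule. Unlike the inverse it is holomorphic wherever the matrix is.\<close>

definition cofactors :: "complex ^ 'n ^ 'n \<Rightarrow> complex ^ 'n ^ ('n::finite)" where
  "cofactors A = (\<chi> k l. det (\<chi> i j. if j = k then axis l 1 $ i else A $ i $ j))"

lemma cofactors_mult: "det A \<noteq> 0 \<Longrightarrow> A ** cofactors A = mat (det A)"
proof -
  assume nz: "det A \<noteq> 0"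
  have "(A ** cofactors A) $ i $ l = mat (det A) $ i $ l" for i l
  proof -
    define x where "x = (\<chi> k. det (\<chi> i j. if j = k then axis l 1 $ i else A $ i $ j) / det A)"
    have "A *v x = axis l 1" using cramer[OF nz, of x "axis l 1"] by (simp add: x_def)
    then have "(A *v x) $ i = axis l 1 $ i" by simp
    moreover have "(A ** cofactors A) $ i $ l = det A * (A *v x) $ i"
      using nz by (simp add: matrix_matrix_mult_def matrix_vector_mult_def x_def cofactors_def sum_distrib_left)
    ultimately show ?thesis by (simp add: mat_def axis_def)
  qed
  then show ?thesis by (simp add: vec_eq_iff)
qed

lemma mat_holo_cofactors:
  assumes "mat_holo F S"
  shows "mat_holo (\<lambda>z. cofactors (F z)) S"
  unfolding mat_holo_def
proof (intro allI)
  fix k l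
  have "mat_holo (\<lambda>z. \<chi> i j. if j = k then axis l 1 $ i else F z $ i $ j) S"
    unfolding mat_holo_def
  proof (intro allI)
    fix i j
    show "(\<lambda>z. (\<chi> i j. if j = k then axis l 1 $ i else F z $ i $ j) $ i $ j) holomorphic_on S"
      using mat_holoD[OF assms, of i j] by (cases "j = k") simp_all
  qed
  from mat_holo_det[OF this] show "(\<lambda>z. cofactors (F z) $ k $ l) holomorphic_on S"
    by (simp add: cofactors_def)
qed

lemma mat_mult_mat: "A ** mat c = mat c ** (A :: complex ^ 'm::finite ^ 'n::finite)"
  by (simp add: vec_eq_iff matrix_matrix_mult_def mat_def if_distrib[where f = "\<lambda>x. x * _"]
      if_distrib[where f = "\<lambda>x. _ * x"] mult.commute cong: if_cong)

lemma mat_mult_nth: "(mat c ** A) $ i $ j = c * (A :: complex ^ 'm::finite ^ 'n::finite) $ i $ j"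
  by (simp add: matrix_matrix_mult_def mat_def if_distrib[where f = "\<lambda>x. x * _"] cong: if_cong)

lemma mat_mult_mat_nth: "((A :: complex ^ 'm::finite ^ 'n::finite) ** mat c) $ i $ j = c * A $ i $ j"
  by (simp add: mat_mult_mat mat_mult_nth)

lemma invertible_mult_eq_0: "invertible (A :: complex ^ 'n::finite ^ 'n) \<Longrightarrow> A *v x = 0 \<Longrightarrow> x = 0"
  by (metis invertible_def matrix_left_invertible_ker)

lemma singular_kernel:
  assumes "det (A :: complex ^ 'n::finite ^ 'n) = 0"
  shows "\<exists>x. x \<noteq> 0 \<and> A *v x = 0"
  using assms matrix_left_invertible_ker[of A] invertible_left_inverse[of A] invertible_det_nz[of A] by auto

lemma zero_order_factorization:
  assumes f: "f holomorphic_on ball a r" "r > 0" and nz: "\<And>z. z \<in> ball a r - {a} \<Longrightarrow> f z \<noteq> 0"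
  shows "\<exists>n g s. 0 < s \<and> s \<le> r \<and> g holomorphic_on ball a s \<and> (\<forall>z\<in>ball a s. g z \<noteq> 0 \<and> f z = (z - a) ^ n * g z)"
proof (cases "f a = 0")
  case False
  then have "f z \<noteq> 0" if "z \<in> ball a r" for z using nz that by (cases "z = a") auto
  then show ?thesis using f by (intro exI[of _ 0] exI[of _ f] exI[of _ r]) simp
next
  case True
  have "\<not> f constant_on ball a r"
  proof
    assume "f constant_on ball a r"
    then obtain c where c: "\<And>z. z \<in> ball a r \<Longrightarrow> f z = c" unfolding constant_on_def by blast
    have "f (a + of_real (r/2)) = f a" using c \<open>r > 0\<close> by (simp add: dist_norm)
    moreover have "a + of_real (r/2) \<in> ball a r - {a}" using \<open>r > 0\<close> by (simp add: dist_norm)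
    ultimately show False using nz True by metis
  qed
  then obtain g s n where "0 < n" "0 < s" "ball a s \<subseteq> ball a r" "g holomorphic_on ball a s"
      "\<And>w. w \<in> ball a s \<Longrightarrow> f w = (w - a) ^ n * g w" "\<And>w. w \<in> ball a s \<Longrightarrow> g w \<noteq> 0"
    using holomorphic_factor_zero_nonconstant[OF f(1) open_ball connected_ball _ True] \<open>r > 0\<close>
    by (metis centre_in_ball)
  then show ?thesis using \<open>r > 0\<close> by (intro exI[of _ n] exI[of _ g] exI[of _ s]) (auto simp: ball_subset_ball_iff)
qed

section \<open>Factors with one zero that are close to one on a compact set\<close>

text \<open>The condition on \<open>b\<close> is what makes the factors below explicit: a point outside the set is either far from the origin or
close to a point of the complement of \<open>\<Omega>\<close>.\<close>

definition exhaust_compact :: "complex set \<Rightarrow> nat \<Rightarrow> complex set" where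
  "exhaust_compact \<Omega> m = {z. norm z \<le> 2 ^ m \<and> (\<forall>b. b \<notin> \<Omega> \<longrightarrow> (1/2) ^ m \<le> norm (z - b))}"

lemma exhaust_compact_subset: "exhaust_compact \<Omega> m \<subseteq> \<Omega>"
proof
  fix z assume z: "z \<in> exhaust_compact \<Omega> m"
  show "z \<in> \<Omega>"
  proof (rule ccontr)
    assume "z \<notin> \<Omega>"
    then have "(1/2) ^ m \<le> norm (z - z)" using z unfolding exhaust_compact_def by blast
    moreover have "(1/2::real) ^ m > 0" by simp
    ultimately show False by simp
  qed
qed

lemma compact_exhaust_compact: "compact (exhaust_compact \<Omega> m)"
proof -
  have "exhaust_compact \<Omega> m = cball 0 (2 ^ m) \<inter> (\<Inter>b\<in>-\<Omega>. {z. (1/2) ^ m \<le> norm (z - b)})"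
    by (auto simp: exhaust_compact_def)
  moreover have "closed (\<Inter>b\<in>-\<Omega>. {z. (1/2) ^ m \<le> norm (z - b)})"
    by (intro closed_INT ballI closed_Collect_le continuous_intros)
  ultimately show ?thesis by (simp add: compact_Int_closed)
qed

lemma exhaust_compact_mono: "exhaust_compact \<Omega> m \<subseteq> exhaust_compact \<Omega> (Suc m)"
proof
  fix z assume z: "z \<in> exhaust_compact \<Omega> m"
  have "(2::real) ^ m \<le> 2 ^ Suc m" "(1/2::real) ^ Suc m \<le> (1/2) ^ m"
    by (intro power_increasing power_decreasing; simp)+
  then show "z \<in> exhaust_compact \<Omega> (Suc m)"
    using z unfolding exhaust_compact_def by (auto intro: order_trans)
qed

lemma exhaust_compact_interior:
  assumes "open \<Omega>" "z \<in> \<Omega>"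
  shows "\<exists>m. z \<in> interior (exhaust_compact \<Omega> m)"
proof -
  obtain r where r: "r > 0" "ball z r \<subseteq> \<Omega>" using assms open_contains_ball by blast
  obtain m1 where m1: "(1/2::real) ^ m1 < r / 2" using real_arch_pow_inv[of "r/2" "1/2"] r by auto
  obtain m2 where m2: "norm z + r / 2 < 2 ^ m2" using real_arch_pow[of 2 "norm z + r / 2"] by auto
  define m where "m = max m1 m2"
  have "(1/2::real) ^ m \<le> (1/2) ^ m1" "(2::real) ^ m2 \<le> 2 ^ m"
    by (intro power_decreasing power_increasing; simp add: m_def)+
  then have m: "(1/2::real) ^ m < r / 2" "norm z + r / 2 < 2 ^ m" using m1 m2 by linarith+
  have "ball z (r / 2) \<subseteq> exhaust_compact \<Omega> m"
  proof
    fix w assume "w \<in> ball z (r / 2)"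
    then have w: "norm (z - w) < r / 2" by (simp add: dist_norm)
    have "norm w \<le> norm z + norm (z - w)" using norm_triangle_ineq4[of z "z - w"] by simp
    then have "norm w \<le> 2 ^ m" using w m by linarith
    moreover have "(1/2) ^ m \<le> norm (w - b)" if "b \<notin> \<Omega>" for b
    proof -
      have "b \<notin> ball z r" using that r by blast
      then have "r \<le> norm (z - b)" by (simp add: dist_norm)
      moreover have "norm (z - b) \<le> norm (z - w) + norm (w - b)" using norm_triangle_ineq[of "z - w" "w - b"] by simp
      ultimately show ?thesis using w m by linarith
    qed
    ultimately show "w \<in> exhaust_compact \<Omega> m" by (simp add: exhaust_compact_def)
  qed
  then have "ball z (r/2) \<subseteq> interior (exhaust_compact \<Omega> m)" by (rule interior_maximal) simp
  then show ?thesis using r by (intro exI[of _ m]) auto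
qed

text \<open>The index is shifted so that the first two members are empty: the first correction then has nothing to
approximate, and no degeneracy lies in the set where the first frame must be correct.\<close>

definition exhaustion :: "complex set \<Rightarrow> nat \<Rightarrow> complex set" where
  "exhaustion \<Omega> m = (if m < 2 then {} else exhaust_compact \<Omega> (m - 2))"

lemma exhaustion_mono: "m \<le> n \<Longrightarrow> exhaustion \<Omega> m \<subseteq> exhaustion \<Omega> n"
proof (rule lift_Suc_mono_le)
  fix k
  show "exhaustion \<Omega> k \<subseteq> exhaustion \<Omega> (Suc k)"
  proof (cases "k < 2")
    case False
    then obtain j where "k = Suc (Suc j)" by (metis One_nat_def Suc_1 add_2_eq_Suc le_Suc_ex not_less)
    then show ?thesis using exhaust_compact_mono[of \<Omega> j] by (simp add: exhaustion_def)
  qed (simp add: exhaustion_def)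
qed

lemma exhaustion_subset: "exhaustion \<Omega> m \<subseteq> \<Omega>"
  using exhaust_compact_subset by (auto simp: exhaustion_def)

lemma compact_exhaustion: "compact (exhaustion \<Omega> m)"
  by (simp add: exhaustion_def compact_exhaust_compact)

lemma exhaustion_interior:
  assumes "open \<Omega>" "z \<in> \<Omega>"
  shows "\<exists>m. z \<in> interior (exhaustion \<Omega> m)"
proof -
  obtain m where "z \<in> interior (exhaust_compact \<Omega> m)" using exhaust_compact_interior[OF assms] by blast
  then show ?thesis by (intro exI[of _ "m + 2"]) (simp add: exhaustion_def)
qed

text \<open>The function \<open>e\<close> has its only zero at \<open>a\<close>. It is the Weierstrass factor \<open>E\<^sub>n(u) = (1 - u) exp(u + \<dots> + u\<^sup>n/n)\<close>, which tends to \<open>1\<close>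
uniformly for \<open>|u| \<le> 1/2\<close>, with \<open>u = z/a\<close> if \<open>a\<close> is far from the origin and \<open>u = (a - b)/(z - b)\<close> if \<open>a\<close> is close to a point
\<open>b\<close> outside \<open>\<Omega>\<close>. This replaces an appeal to Runge's theorem.\<close>

theorem elementary_factor_exists:
  assumes a: "a \<in> \<Omega>" "a \<notin> exhaustion \<Omega> (Suc m)" and "\<epsilon> > 0"
  shows "\<exists>e v. e holomorphic_on \<Omega> \<and> v holomorphic_on \<Omega> \<and> (\<forall>z\<in>\<Omega>. v z \<noteq> 0 \<and> e z = (z - a) * v z) \<and>
    (\<forall>z\<in>exhaustion \<Omega> m. norm (e z - 1) \<le> \<epsilon>)"
proof (cases "m < 2")
  case True
  show ?thesis
    by (rule exI[of _ "\<lambda>z. z - a"], rule exI[of _ "\<lambda>_. 1"])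
      (use True in \<open>auto simp: exhaustion_def intro!: holomorphic_intros\<close>)
next
  case False
  then obtain k where k: "m = Suc (Suc k)" by (metis One_nat_def Suc_1 add_2_eq_Suc le_Suc_ex not_less)
  have am: "a \<notin> exhaust_compact \<Omega> (Suc k)" "exhaustion \<Omega> m = exhaust_compact \<Omega> k"
    using a by (simp_all add: exhaustion_def k)
  obtain n where n: "(1/2::real) ^ n < \<epsilon> / 3" using real_arch_pow_inv[of "\<epsilon>/3" "1/2"] \<open>\<epsilon> > 0\<close> by auto
  have bound: "norm (weierstrass_factor n u - 1) \<le> \<epsilon>" if "norm u \<le> 1/2" for u
  proof -
    have "norm (weierstrass_factor n u - 1) \<le> 3 * norm u ^ Suc n" by (rule weierstrass_factor_bound[OF that])
    also have "\<dots> \<le> 3 * (1/2) ^ Suc n" by (intro mult_left_mono power_mono that) auto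
    also have "\<dots> \<le> 3 * (1/2) ^ n" by simp
    also have "\<dots> \<le> \<epsilon>" using n by simp
    finally show ?thesis .
  qed
  define E where "E u = exp (\<Sum>k=1..n. u ^ k / of_nat k)" for u :: complex
  have wf: "weierstrass_factor n u = (1 - u) * E u" for u by (simp add: weierstrass_factor_def E_def)
  consider "norm a > 2 ^ Suc k" | b where "b \<notin> \<Omega>" "norm (a - b) < (1/2) ^ Suc k"
    using am(1) unfolding exhaust_compact_def by force
  then show ?thesis
  proof cases
    case 1
    have "a \<noteq> 0"
    proof
      assume "a = 0"
      then show False using 1 zero_less_power[of "2::real" "Suc k"] by simp
    qed
    show ?thesis
    proof (rule exI[of _ "\<lambda>z. weierstrass_factor n (z / a)"], rule exI[of _ "\<lambda>z. - E (z / a) / a"], intro conjI ballI)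
      show "(\<lambda>z. weierstrass_factor n (z / a)) holomorphic_on \<Omega>"
        using \<open>a \<noteq> 0\<close> by (intro holomorphic_intros) auto
      show "(\<lambda>z. - E (z / a) / a) holomorphic_on \<Omega>"
        unfolding E_def using \<open>a \<noteq> 0\<close> by (intro holomorphic_intros) auto
      show "- E (z / a) / a \<noteq> 0" for z using \<open>a \<noteq> 0\<close> by (simp add: E_def)
      show "weierstrass_factor n (z / a) = (z - a) * (- E (z / a) / a)" for z
        using \<open>a \<noteq> 0\<close> by (simp add: wf field_simps)
      fix z assume "z \<in> exhaustion \<Omega> m"
      then have "norm z \<le> 2 ^ k" by (simp add: am(2) exhaust_compact_def)
      then have "2 * norm z \<le> norm a" using 1 by simp
      then have "norm (z / a) \<le> 1/2" using \<open>a \<noteq> 0\<close> by (simp add: norm_divide field_simps)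
      then show "norm (weierstrass_factor n (z / a) - 1) \<le> \<epsilon>" by (rule bound)
    qed
  next
    case 2
    have nz: "z - b \<noteq> 0" if "z \<in> \<Omega>" for z using that 2(1) by auto
    show ?thesis
    proof (rule exI[of _ "\<lambda>z. weierstrass_factor n ((a - b) / (z - b))"], rule exI[of _ "\<lambda>z. E ((a - b) / (z - b)) / (z - b)"], intro conjI ballI)
      show "(\<lambda>z. weierstrass_factor n ((a - b) / (z - b))) holomorphic_on \<Omega>"
        using nz by (intro holomorphic_intros) auto
      show "(\<lambda>z. E ((a - b) / (z - b)) / (z - b)) holomorphic_on \<Omega>"
        unfolding E_def using nz by (intro holomorphic_intros) auto
      show "E ((a - b) / (z - b)) / (z - b) \<noteq> 0" if "z \<in> \<Omega>" for z using nz[OF that] by (simp add: E_def)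
      show "weierstrass_factor n ((a - b) / (z - b)) = (z - a) * (E ((a - b) / (z - b)) / (z - b))" if "z \<in> \<Omega>" for z
        using nz[OF that] by (simp add: wf field_simps)
      fix z assume "z \<in> exhaustion \<Omega> m"
      then have z: "(1/2) ^ k \<le> norm (z - b)" using 2(1) by (simp add: am(2) exhaust_compact_def)
      have "0 < norm (z - b)" using z zero_less_power[of "1/2::real" k] by linarith
      moreover have "2 * norm (a - b) \<le> norm (z - b)" using 2(2) z by simp
      ultimately have "norm ((a - b) / (z - b)) \<le> 1/2" by (simp add: norm_divide field_simps)
      then show "norm (weierstrass_factor n ((a - b) / (z - b)) - 1) \<le> \<epsilon>" by (rule bound)
    qed
  qed
qed

section \<open>Removing the degeneracies of a meromorphic frame\<close>

lemma continuous_eq_at_centre: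
  fixes f g :: "complex \<Rightarrow> 'b::t2_space"
  assumes "continuous_on (ball a s) f" "continuous_on (ball a s) g" "s > 0"
    and "\<And>z. z \<in> ball a s - {a} \<Longrightarrow> f z = g z"
  shows "f a = g a"
proof -
  have "isCont f a" "isCont g a"
    using assms(1-3) by (auto simp: continuous_on_eq_continuous_at)
  then have f: "(f \<longlongrightarrow> f a) (at a)" and g: "(g \<longlongrightarrow> g a) (at a)" by (simp_all add: isCont_def)
  have "eventually (\<lambda>z. g z = f z) (at a)"
    unfolding eventually_at using assms(3,4) by (intro exI[of _ s]) (auto simp: dist_commute)
  with g have "(f \<longlongrightarrow> g a) (at a)" by (rule Lim_transform_eventually)
  with f show ?thesis by (intro tendsto_unique[OF _ f]) auto
qed

lemma matrix_eqI: "(\<And>x. A *v x = B *v x) \<Longrightarrow> A = (B :: complex ^ 'm::finite ^ 'n::finite)"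
  by (simp add: matrix_eq)

lemma norm_matrix_mult_bound:
  "\<exists>K>0. \<forall>(A :: complex ^ 'n::finite ^ 'n) B :: complex ^ 'n ^ 'n. norm (A ** B) \<le> K * norm A * norm B"
proof -
  obtain K where "K > 0" "\<And>A B. norm ((A :: complex ^ 'n ^ 'n) ** (B :: complex ^ 'n ^ 'n)) \<le> norm A * norm B * K"
    using bounded_bilinear.pos_bounded[OF bounded_bilinear_matrix_mult] by blast
  then show ?thesis by (intro exI[of _ K]) (simp add: mult_ac)
qed

text \<open>A holomorphic family of \<open>p\<close>-dimensional subspaces \<open>V(z)\<close>. The chart \<open>W a\<close> parametrizes \<open>V(z)\<close> for \<open>z\<close> near \<open>a\<close> and is normalized by the
constant left inverse \<open>Pi a\<close>, which therefore gives coordinates on \<open>V(z)\<close>.\<close>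

locale holomorphic_bundle =
  fixes \<Omega> :: "complex set" and V :: "complex \<Rightarrow> (complex ^ 'n::finite) set"
    and Pi :: "complex \<Rightarrow> complex ^ 'n ^ 'p::finite" and W :: "complex \<Rightarrow> complex \<Rightarrow> complex ^ 'p ^ 'n"
    and rad :: "complex \<Rightarrow> real"
  assumes open_base: "open \<Omega>"
    and rad: "a \<in> \<Omega> \<Longrightarrow> rad a > 0" "a \<in> \<Omega> \<Longrightarrow> ball a (rad a) \<subseteq> \<Omega>"
    and W: "a \<in> \<Omega> \<Longrightarrow> mat_holo (W a) (ball a (rad a))"
    and Pi_W: "a \<in> \<Omega> \<Longrightarrow> z \<in> ball a (rad a) \<Longrightarrow> Pi a ** W a z = mat 1"
    and V_W: "a \<in> \<Omega> \<Longrightarrow> z \<in> ball a (rad a) \<Longrightarrow> V z = range ((*v) (W a z))"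
begin

definition frame_at :: "(complex \<Rightarrow> complex ^ 'p ^ 'n) \<Rightarrow> complex \<Rightarrow> bool" where
  "frame_at F z \<longleftrightarrow> (\<forall>x. F z *v x \<in> V z) \<and> (\<forall>x. F z *v x = 0 \<longrightarrow> x = 0)"

lemma W_Pi:
  assumes "a \<in> \<Omega>" "z \<in> ball a (rad a)" "x \<in> V z"
  shows "W a z *v (Pi a *v x) = x"
proof -
  obtain y where "x = W a z *v y" using assms(3) V_W[OF assms(1,2)] by auto
  then show ?thesis by (simp add: matrix_vector_mul_assoc matrix_mul_assoc[symmetric] Pi_W[OF assms(1,2)])
qed

lemma range_factor:
  assumes "a \<in> \<Omega>" "z \<in> ball a (rad a)" "\<And>x. M *v x \<in> V z"
  shows "M = W a z ** (Pi a ** M)"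
  using W_Pi[OF assms(1,2) assms(3)] by (intro matrix_eqI) (simp add: matrix_vector_mul_assoc[symmetric])

text \<open>Coordinates of the chart turn injectivity into a determinant condition.\<close>

lemma injective_iff_det:
  assumes "a \<in> \<Omega>" "z \<in> ball a (rad a)" "\<And>x. M *v x \<in> V z"
  shows "(\<forall>x. M *v x = 0 \<longrightarrow> x = 0) \<longleftrightarrow> det (Pi a ** M) \<noteq> 0"
proof
  assume inj: "\<forall>x. M *v x = 0 \<longrightarrow> x = 0"
  show "det (Pi a ** M) \<noteq> 0"
  proof
    assume "det (Pi a ** M) = 0"
    then obtain x where x: "x \<noteq> 0" "(Pi a ** M) *v x = 0" using singular_kernel by blast
    have "M *v x = W a z *v (Pi a *v (M *v x))" by (rule W_Pi[OF assms(1,2) assms(3), symmetric])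
    also have "\<dots> = 0" using x(2) by (simp add: matrix_vector_mul_assoc)
    finally show False using inj x(1) by blast
  qed
next
  assume "det (Pi a ** M) \<noteq> 0"
  then have inv: "invertible (Pi a ** M)" by (simp add: invertible_det_nz)
  show "\<forall>x. M *v x = 0 \<longrightarrow> x = 0"
  proof (intro allI impI)
    fix x assume "M *v x = 0"
    then have "(Pi a ** M) *v x = 0" by (simp add: matrix_vector_mul_assoc[symmetric])
    then show "x = 0" by (rule invertible_mult_eq_0[OF inv])
  qed
qed

lemma range_limit:
  assumes a: "a \<in> \<Omega>" and s: "0 < s" "s \<le> rad a" and F: "mat_holo F (ball a s)"
    and V: "\<And>z x. z \<in> ball a s - {a} \<Longrightarrow> F z *v x \<in> V z"
  shows "F a *v x \<in> V a"
proof -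
  have sub: "ball a s \<subseteq> ball a (rad a)" using s by auto
  have "F a = W a a ** (Pi a ** F a)"
  proof (rule continuous_eq_at_centre[where f = F and g = "\<lambda>z. W a z ** (Pi a ** F z)" and a = a and s = s])
    show "continuous_on (ball a s) F" by (rule mat_holo_continuous[OF F])
    show "continuous_on (ball a s) (\<lambda>z. W a z ** (Pi a ** F z))"
      by (intro mat_holo_continuous mat_holo_mult mat_holo_const F mat_holo_subset[OF W[OF a] sub])
    show "F z = W a z ** (Pi a ** F z)" if "z \<in> ball a s - {a}" for z
      by (rule range_factor[OF a _ V[OF that]]) (use that sub in blast)
  qed (rule s(1))
  then have "F a *v x = W a a *v ((Pi a ** F a) *v x)" by (simp add: matrix_vector_mul_assoc)
  then show ?thesis using V_W[OF a, of a] rad(1)[OF a] by simp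
qed

lemma frame_at_mult:
  assumes "frame_at F z" "det (G z :: complex ^ 'p ^ 'p) \<noteq> 0"
  shows "frame_at (\<lambda>z. F z ** G z) z"
proof -
  have "x = 0" if "F z *v (G z *v x) = 0" for x
  proof -
    have "G z *v x = 0" using assms(1) that by (simp add: frame_at_def)
    then show ?thesis using invertible_mult_eq_0 assms(2) by (metis invertible_det_nz)
  qed
  then show ?thesis using assms(1) by (simp add: frame_at_def matrix_vector_mul_assoc[symmetric])
qed

lemma frame_at_cong: "frame_at F z \<Longrightarrow> G z = F z \<Longrightarrow> frame_at G z"
  by (simp add: frame_at_def)

text \<open>Corrections: multiplying a frame by \<open>G\<close> on the right changes it only slightly on the \<open>m\<close>-th member of the exhaustion and keeps it a frame
away from the singular points in \<open>S\<close>.\<close>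

definition near_one :: "(complex \<Rightarrow> complex ^ 'p ^ 'p) \<Rightarrow> complex set \<Rightarrow> nat \<Rightarrow> real \<Rightarrow> bool" where
  "near_one G S m \<epsilon> \<longleftrightarrow> mat_holo G (\<Omega> - S) \<and> (\<forall>z\<in>\<Omega> - S. det (G z) \<noteq> 0) \<and>
     (\<forall>z\<in>exhaustion \<Omega> m. norm (G z - mat 1) \<le> \<epsilon>)"

lemma near_one_one: "0 \<le> \<epsilon> \<Longrightarrow> near_one (\<lambda>_. mat 1) S m \<epsilon>"
  by (simp add: near_one_def mat_holo_const)

text \<open>From \<open>G G' - 1 = (G - 1) G' + (G' - 1)\<close>.\<close>

lemma near_one_mult:
  assumes "\<epsilon> > 0"
  shows "\<exists>\<eta>>0. \<forall>G G' S S'. near_one G S m \<eta> \<longrightarrow> near_one G' S' m \<eta> \<longrightarrow> near_one (\<lambda>z. G z ** G' z) (S \<union> S') m \<epsilon>"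
proof -
  obtain K where K: "K > 0" "\<And>(A :: complex ^ 'p ^ 'p) (B :: complex ^ 'p ^ 'p). norm (A ** B) \<le> K * norm A * norm B"
    using norm_matrix_mult_bound by metis
  define s where "s = norm (mat 1 :: complex ^ 'p ^ 'p)"
  have s: "s \<ge> 0" by (simp add: s_def)
  define \<eta> where "\<eta> = min 1 (\<epsilon> / (K * (s + 1) + 1))"
  have pos: "K * (s + 1) + 1 > 0" using K(1) s by (intro add_nonneg_pos mult_nonneg_nonneg) auto
  have "\<eta> \<le> \<epsilon> / (K * (s + 1) + 1)" by (simp add: \<eta>_def)
  then have "\<eta> * (K * (s + 1) + 1) \<le> \<epsilon>" using pos by (simp only: pos_le_divide_eq)
  then have \<eta>: "\<eta> > 0" "\<eta> \<le> 1" "\<eta> * (K * (s + 1) + 1) \<le> \<epsilon>"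
    using assms pos by (simp_all add: \<eta>_def)
  have "near_one (\<lambda>z. G z ** G' z) (S \<union> S') m \<epsilon>" if G: "near_one G S m \<eta>" and G': "near_one G' S' m \<eta>" for G G' S S'
    unfolding near_one_def
  proof (intro conjI ballI)
    show "mat_holo (\<lambda>z. G z ** G' z) (\<Omega> - (S \<union> S'))"
      using G G' unfolding near_one_def by (intro mat_holo_mult) (auto elim: mat_holo_subset)
    show "det (G z ** G' z) \<noteq> 0" if "z \<in> \<Omega> - (S \<union> S')" for z
      using G G' that by (simp add: near_one_def det_mul)
    fix z assume z: "z \<in> exhaustion \<Omega> m"
    have g: "norm (G z - mat 1) \<le> \<eta>" "norm (G' z - mat 1) \<le> \<eta>" using G G' z by (auto simp: near_one_def)
    have "G z ** G' z - mat 1 = (G z - mat 1) ** G' z + (G' z - mat 1)"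
      by (simp add: bounded_bilinear.diff_left[OF bounded_bilinear_matrix_mult])
    then have "norm (G z ** G' z - mat 1) \<le> norm ((G z - mat 1) ** G' z) + norm (G' z - mat 1)"
      by (simp only: norm_triangle_ineq)
    also have "norm ((G z - mat 1) ** G' z) \<le> K * norm (G z - mat 1) * norm (G' z)" by (rule K(2))
    also have "\<dots> \<le> K * \<eta> * (s + 1)"
    proof (intro mult_mono g order_refl)
      have "norm (G' z) \<le> norm (G' z - mat 1) + s" using norm_triangle_ineq[of "G' z - mat 1" "mat 1"] by (simp add: s_def)
      then show "norm (G' z) \<le> s + 1" using g \<eta> by linarith
    qed (use K \<eta> s in auto)
    also have "K * \<eta> * (s + 1) + norm (G' z - mat 1) \<le> \<eta> * (K * (s + 1) + 1)"
      using g by (simp add: algebra_simps)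
    finally show "norm (G z ** G' z - mat 1) \<le> \<epsilon>" using \<eta>(3) by simp
  qed
  then show ?thesis using \<eta>(1) by (intro exI[of _ \<eta>]) simp
qed

lemma near_one_elementary:
  fixes \<Phi> :: "complex \<Rightarrow> complex ^ 'p ^ 'p"
  assumes \<Phi>: "mat_holo \<Phi> (- {0})" "\<Phi> 1 = mat 1" "\<And>s. s \<noteq> 0 \<Longrightarrow> det (\<Phi> s) \<noteq> 0"
    and a: "a \<in> \<Omega>" "a \<notin> exhaustion \<Omega> (Suc m)" and "\<epsilon> > 0"
  shows "\<exists>e v. v holomorphic_on \<Omega> \<and> (\<forall>z\<in>\<Omega>. v z \<noteq> 0 \<and> e z = (z - a) * v z) \<and> near_one (\<lambda>z. \<Phi> (e z)) {a} m \<epsilon>"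
proof -
  have "continuous_on (- {0}) \<Phi>" by (rule mat_holo_continuous[OF \<Phi>(1)])
  then have "isCont \<Phi> 1" by (simp add: continuous_on_eq_continuous_at open_Compl)
  then obtain d where d: "d > 0" "\<And>s. dist s 1 < d \<Longrightarrow> dist (\<Phi> s) (\<Phi> 1) < \<epsilon>"
    unfolding continuous_at_eps_delta using \<open>\<epsilon> > 0\<close> by blast
  obtain e v where ev: "e holomorphic_on \<Omega>" "v holomorphic_on \<Omega>" "\<And>z. z \<in> \<Omega> \<Longrightarrow> v z \<noteq> 0 \<and> e z = (z - a) * v z"
      "\<And>z. z \<in> exhaustion \<Omega> m \<Longrightarrow> norm (e z - 1) \<le> d / 2"
    using elementary_factor_exists[OF a, of "d / 2"] d(1) by (metis half_gt_zero)
  have enz: "e z \<noteq> 0" if "z \<in> \<Omega> - {a}" for z using ev(3)[of z] that by auto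
  have "near_one (\<lambda>z. \<Phi> (e z)) {a} m \<epsilon>"
    unfolding near_one_def
  proof (intro conjI ballI)
    show "mat_holo (\<lambda>z. \<Phi> (e z)) (\<Omega> - {a})"
      unfolding mat_holo_def
    proof (intro allI)
      fix i j
      have img: "e ` (\<Omega> - {a}) \<subseteq> - {0}" by (rule image_subsetI) (simp add: enz)
      have "((\<lambda>s. \<Phi> s $ i $ j) \<circ> e) holomorphic_on (\<Omega> - {a})"
        by (rule holomorphic_on_compose_gen[OF holomorphic_on_subset[OF ev(1)] mat_holoD[OF \<Phi>(1)] img]) simp
      then show "(\<lambda>z. \<Phi> (e z) $ i $ j) holomorphic_on (\<Omega> - {a})" by (simp add: o_def)
    qed
    show "det (\<Phi> (e z)) \<noteq> 0" if "z \<in> \<Omega> - {a}" for z by (rule \<Phi>(3)[OF enz[OF that]])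
    fix z assume "z \<in> exhaustion \<Omega> m"
    then have "dist (e z) 1 < d" using ev(4)[of z] d(1) by (simp add: dist_norm)
    from d(2)[OF this] show "norm (\<Phi> (e z) - mat 1) \<le> \<epsilon>" by (simp add: \<Phi>(2) dist_norm)
  qed
  then show ?thesis using ev(2,3) by (intro exI[of _ e] exI[of _ v]) simp
qed

text \<open>The invertible matrix that adds \<open>(1/s - 1) M c\<close> to the column \<open>k\<close> of \<open>M\<close> when it is multiplied to \<open>M\<close> from the right. If \<open>c\<close> has \<open>k\<close>-th entry
\<open>1\<close> and \<open>M c\<close> vanishes, then the column \<open>k\<close> is a combination of the others, and with \<open>s\<close> a local coordinate this change divides the degenerate
combination \<open>M c\<close> by \<open>s\<close>.\<close>

definition column_change :: "'p \<Rightarrow> complex ^ 'p \<Rightarrow> complex \<Rightarrow> complex ^ 'p ^ 'p" where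
  "column_change k c s = (\<chi> i j. if j = k then (if i = k then 1 else 0) + (1 / s - 1) * c $ i else (if i = j then 1 else 0))"

lemma det_column_change:
  fixes c :: "complex ^ 'p"
  assumes "c $ k = 1"
  shows "det (column_change k c s) = 1 / s"
proof -
  define x where "x = (\<chi> i. (if i = k then 1 else 0) + (1 / s - 1) * c $ i)"
  have "det (\<chi> i j. if j = k then ((mat 1 :: complex ^ 'p ^ 'p) *v x) $ i else (mat 1 :: complex ^ 'p ^ 'p) $ i $ j) = x $ k * det (mat 1 :: complex ^ 'p ^ 'p)"
    by (rule cramer_lemma)
  moreover have "(\<chi> i j. if j = k then ((mat 1 :: complex ^ 'p ^ 'p) *v x) $ i else (mat 1 :: complex ^ 'p ^ 'p) $ i $ j) = column_change k c s"
    unfolding matrix_vector_mul_lid by (simp add: vec_eq_iff column_change_def x_def) (simp add: mat_def)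
  ultimately show ?thesis using assms by (simp add: x_def)
qed

lemma mult_column_change:
  "(M ** column_change k c s) $ i $ j = M $ i $ j + (if j = k then (1 / s - 1) * (M *v c) $ i else 0)"
proof (cases "j = k")
  case True
  have "(M ** column_change k c s) $ i $ j = (\<Sum>l\<in>UNIV. M $ i $ l * ((if l = k then 1 else 0) + (1 / s - 1) * c $ l))"
    by (simp add: matrix_matrix_mult_def column_change_def True)
  also have "\<dots> = (\<Sum>l\<in>UNIV. M $ i $ l * (if l = k then 1 else 0)) + (1 / s - 1) * (\<Sum>l\<in>UNIV. M $ i $ l * c $ l)"
    by (simp add: distrib_left sum.distrib sum_distrib_left mult_ac)
  also have "(\<Sum>l\<in>UNIV. M $ i $ l * (if l = k then 1 else 0)) = M $ i $ k"
    by (simp add: if_distrib[where f = "\<lambda>x. _ * x"] cong: if_cong)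
  finally show ?thesis by (simp add: True matrix_vector_mult_def)
next
  case False
  then show ?thesis
    by (simp add: matrix_matrix_mult_def column_change_def if_distrib[where f = "\<lambda>x. _ * x"] cong: if_cong)
qed

lemma mat_holo_column_change: "mat_holo (column_change k c) (- {0})"
  unfolding mat_holo_def
proof (intro allI)
  fix i j
  show "(\<lambda>s. column_change k c s $ i $ j) holomorphic_on - {0}"
    by (cases "j = k") (auto simp: column_change_def intro!: holomorphic_intros)
qed

lemma column_change_1: "column_change k c 1 = mat 1"
  by (simp add: column_change_def mat_def vec_eq_iff)

text \<open>Induction on the order \<open>n\<close> of the zero of \<open>det (Pi a ** F z)\<close> at \<open>a\<close>. If \<open>n > 0\<close>, some combination \<open>F c\<close> of the columns vanishes at \<open>a\<close>. A column
change whose parameter \<open>e(z)\<close> has a simple zero at \<open>a\<close> divides this combination by \<open>z - a\<close>, so \<open>F\<close> stays holomorphic at \<open>a\<close> while the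
determinant loses a factor \<open>z - a\<close>.\<close>

lemma reduce_degeneracy:
  assumes a: "a \<in> Z" "a \<in> \<Omega>" "a \<notin> exhaustion \<Omega> (Suc m)" and op: "open (\<Omega> - Z)"
    and s: "0 < s" "s \<le> rad a" "ball a s \<inter> Z \<subseteq> {a}"
  shows "mat_holo F (\<Omega> - Z \<union> {a}) \<Longrightarrow> (\<And>z. z \<in> \<Omega> - Z \<Longrightarrow> frame_at F z) \<Longrightarrow>
    g holomorphic_on ball a s \<Longrightarrow> (\<And>z. z \<in> ball a s \<Longrightarrow> g z \<noteq> 0) \<Longrightarrow>
    (\<And>z. z \<in> ball a s \<Longrightarrow> det (Pi a ** F z) = (z - a) ^ n * g z) \<Longrightarrow> \<epsilon> > 0 \<Longrightarrow>
    \<exists>G F'. near_one G {a} m \<epsilon> \<and> mat_holo F' (\<Omega> - Z \<union> {a}) \<and> (\<forall>z\<in>\<Omega> - Z \<union> {a}. frame_at F' z) \<and>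
      (\<forall>z\<in>\<Omega> - Z. F' z = F z ** G z)"
proof (induction n arbitrary: F g \<epsilon>)
  have bsub: "ball a s \<subseteq> ball a (rad a)" using s by auto
  then have b\<Omega>: "ball a s \<subseteq> \<Omega>" using rad(2)[OF a(2)] by blast
  have bU: "ball a s \<subseteq> \<Omega> - Z \<union> {a}" using b\<Omega> s(3) by blast
  have aball: "a \<in> ball a s" using s(1) by simp
  note range = range_limit[OF a(2) s(1,2)]
  {
    case 0
    have Fb: "mat_holo F (ball a s)" by (rule mat_holo_subset[OF 0(1) bU])
    have ra: "F a *v x \<in> V a" for x
    proof (rule range[OF Fb])
      fix z x assume "z \<in> ball a s - {a}"
      then have "z \<in> \<Omega> - Z" using bU by blast
      then show "F z *v x \<in> V z" using 0(2) by (simp add: frame_at_def)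
    qed
    have "det (Pi a ** F a) \<noteq> 0" using 0(4,5)[OF aball] by simp
    then have "frame_at F a"
      using ra injective_iff_det[OF a(2) subsetD[OF bsub aball] ra] by (simp add: frame_at_def)
    then show ?case using 0 near_one_one[of \<epsilon> "{a}" m]
      by (intro exI[of _ "\<lambda>_. mat 1"] exI[of _ F]) auto
  next
    case (Suc n)
    have Fb: "mat_holo F (ball a s)" by (rule mat_holo_subset[OF Suc.prems(1) bU])
    have ra: "F a *v x \<in> V a" for x
    proof (rule range[OF Fb])
      fix z x assume "z \<in> ball a s - {a}"
      then have "z \<in> \<Omega> - Z" using bU by blast
      then show "F z *v x \<in> V z" using Suc.prems(2) by (simp add: frame_at_def)
    qed
    have "det (Pi a ** F a) = 0" using Suc.prems(5)[OF aball] by simp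
    then obtain c0 where c0: "c0 \<noteq> 0" "F a *v c0 = 0"
      using injective_iff_det[OF a(2) subsetD[OF bsub aball] ra] by blast
    then obtain k where k: "c0 $ k \<noteq> 0" by (metis vec_eq_iff zero_index)
    define c where "c = (1 / c0 $ k) *s c0"
    have ck: "c $ k = 1" using k by (simp add: c_def)
    have Fc: "F a *v c = 0" using c0(2) by (simp add: c_def vector_scalar_commute)
    obtain \<eta> where \<eta>: "\<eta> > 0" "\<And>G G' S S'. near_one G S m \<eta> \<Longrightarrow> near_one G' S' m \<eta> \<Longrightarrow> near_one (\<lambda>z. G z ** G' z) (S \<union> S') m \<epsilon>"
      using near_one_mult[OF Suc.prems(6)] by metis
    define P where "P = column_change k c"
    have detP: "det (P t) = 1 / t" for t unfolding P_def by (rule det_column_change[OF ck])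
    obtain e v where ev: "v holomorphic_on \<Omega>" "\<And>z. z \<in> \<Omega> \<Longrightarrow> v z \<noteq> 0 \<and> e z = (z - a) * v z" "near_one (\<lambda>z. P (e z)) {a} m \<eta>"
    proof -
      have "\<exists>e v. v holomorphic_on \<Omega> \<and> (\<forall>z\<in>\<Omega>. v z \<noteq> 0 \<and> e z = (z - a) * v z) \<and> near_one (\<lambda>z. P (e z)) {a} m \<eta>"
        by (rule near_one_elementary[OF _ _ _ a(2,3) \<eta>(1)])
          (simp_all add: P_def mat_holo_column_change column_change_1 det_column_change[OF ck])
      then show thesis using that by blast
    qed
    define f where "f i z = (F z *v c) $ i" for i z
    have fh: "f i holomorphic_on ball a s" for i
      unfolding f_def matrix_vector_mult_def using mat_holoD[OF Fb] by (auto intro!: holomorphic_intros)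
    have fa: "f i a = 0" for i by (simp add: f_def Fc)
    \<comment> \<open>The quotient of the vanishing combination \<open>F c\<close> by \<open>z - a\<close>.\<close>
    define q where "q i z = (if z = a then deriv (f i) a else (f i z - f i a) / (z - a))" for i z
    have qh: "q i holomorphic_on ball a s" for i
      unfolding q_def by (rule pole_lemma_open[OF fh open_ball])
    have fq: "f i z = (z - a) * q i z" for i z by (simp add: q_def fa)
    \<comment> \<open>The column change written without division by \<open>e(z)\<close>; it continues \<open>F z ** P (e z)\<close> to \<open>a\<close>.\<close>
    define L where "L z = (\<chi> i j. F z $ i $ j + (if j = k then q i z / v z - f i z else 0))" for z
    have Lh: "mat_holo L (ball a s)"
      unfolding mat_holo_def
    proof (intro allI)
      fix i j
      show "(\<lambda>z. L z $ i $ j) holomorphic_on ball a s"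
        using mat_holoD[OF Fb] qh fh holomorphic_on_subset[OF ev(1) b\<Omega>] ev(2) b\<Omega>
        by (cases "j = k") (auto simp: L_def intro!: holomorphic_intros)
    qed
    define F1 where "F1 z = (if z = a then L a else F z ** P (e z))" for z
    have F1L: "F1 z = L z" if "z \<in> ball a s" for z
    proof (cases "z = a")
      case False
      have "v z \<noteq> 0" "e z = (z - a) * v z" using ev(2) b\<Omega> that by blast+
      then have "1 / e z * f i z = q i z / v z" for i
        using False by (simp add: fq)
      then have "(1 / e z - 1) * f i z = q i z / v z - f i z" for i
        by (simp add: left_diff_distrib)
      then show ?thesis
        using False by (simp add: F1_def L_def vec_eq_iff P_def mult_column_change f_def)
    qed (simp add: F1_def)
    have Peh: "mat_holo (\<lambda>z. P (e z)) (\<Omega> - {a})" and Ped: "\<And>z. z \<in> \<Omega> - {a} \<Longrightarrow> det (P (e z)) \<noteq> 0"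
      using ev(3) by (auto simp: near_one_def)
    have F1h: "mat_holo F1 (\<Omega> - Z \<union> {a})"
    proof -
      have "mat_holo (\<lambda>z. F z ** P (e z)) (\<Omega> - Z)"
        by (intro mat_holo_mult mat_holo_subset[OF Suc.prems(1)] mat_holo_subset[OF Peh]) (use a in auto)
      then have "mat_holo F1 (\<Omega> - Z)" by (rule mat_holo_cong) (use a in \<open>auto simp: F1_def\<close>)
      moreover have "mat_holo F1 (ball a s)" by (rule mat_holo_cong[OF Lh]) (simp add: F1L)
      ultimately have "mat_holo F1 (\<Omega> - Z \<union> ball a s)" by (rule mat_holo_open_Un[OF _ _ op open_ball])
      then show ?thesis by (rule mat_holo_subset) (use aball in auto)
    qed
    have F1eq: "F1 z = F z ** P (e z)" if "z \<in> \<Omega> - Z" for z using that a by (auto simp: F1_def)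
    have F1f: "frame_at F1 z" if z: "z \<in> \<Omega> - Z" for z
    proof -
      have "frame_at (\<lambda>z. F z ** P (e z)) z"
        by (rule frame_at_mult[OF Suc.prems(2)[OF z] Ped]) (use z a in auto)
      then show ?thesis by (rule frame_at_cong) (rule F1eq[OF z])
    qed
    have vb: "v holomorphic_on ball a s" by (rule holomorphic_on_subset[OF ev(1) b\<Omega>])
    have gv: "(\<lambda>z. g z / v z) holomorphic_on ball a s"
      using Suc.prems(3) vb ev(2) b\<Omega> by (intro holomorphic_intros) auto
    have det1: "det (Pi a ** F1 z) = (z - a) ^ n * (g z / v z)" if "z \<in> ball a s - {a}" for z
    proof -
      have z: "z \<in> \<Omega>" "z \<in> ball a s" "z \<noteq> a" using that b\<Omega> by auto
      have "det (Pi a ** F1 z) = det ((Pi a ** F z) ** P (e z))"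
        using z by (simp add: F1_def matrix_mul_assoc)
      also have "\<dots> = ((z - a) ^ Suc n * g z) * (1 / ((z - a) * v z))"
        using Suc.prems(5)[OF z(2)] ev(2)[OF z(1)] by (simp add: det_mul detP)
      also have "\<dots> = (z - a) ^ n * (g z / v z)" using z(3) ev(2)[OF z(1)] by (simp add: field_simps)
      finally show ?thesis .
    qed
    have "det (Pi a ** F1 a) = (a - a) ^ n * (g a / v a)"
    proof (rule continuous_eq_at_centre[where f = "\<lambda>z. det (Pi a ** F1 z)" and g = "\<lambda>z. (z - a) ^ n * (g z / v z)" and s = s])
      show "continuous_on (ball a s) (\<lambda>z. det (Pi a ** F1 z))"
        by (intro holomorphic_on_imp_continuous_on mat_holo_det mat_holo_mult mat_holo_const mat_holo_subset[OF F1h bU])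
      show "continuous_on (ball a s) (\<lambda>z. (z - a) ^ n * (g z / v z))"
        by (intro holomorphic_on_imp_continuous_on holomorphic_on_mult gv holomorphic_intros)
    qed (use s(1) det1 in auto)
    then have det2: "det (Pi a ** F1 z) = (z - a) ^ n * (g z / v z)" if "z \<in> ball a s" for z
      using det1[of z] that by (cases "z = a") auto
    have gvnz: "g z / v z \<noteq> 0" if "z \<in> ball a s" for z using Suc.prems(4)[OF that] ev(2) b\<Omega> that by auto
    obtain G' F' where G': "near_one G' {a} m \<eta>" "mat_holo F' (\<Omega> - Z \<union> {a})" "\<forall>z\<in>\<Omega> - Z \<union> {a}. frame_at F' z"
      "\<forall>z\<in>\<Omega> - Z. F' z = F1 z ** G' z"
    proof -
      have "\<exists>G F'. near_one G {a} m \<eta> \<and> mat_holo F' (\<Omega> - Z \<union> {a}) \<and> (\<forall>z\<in>\<Omega> - Z \<union> {a}. frame_at F' z) \<and>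
        (\<forall>z\<in>\<Omega> - Z. F' z = F1 z ** G z)"
        by (rule Suc.IH[OF F1h F1f gv gvnz det2 \<eta>(1)])
      then show thesis by (elim exE conjE) (rule that)
    qed
    have "near_one (\<lambda>z. P (e z) ** G' z) {a} m \<epsilon>" using \<eta>(2)[OF ev(3) G'(1)] by simp
    moreover have "\<forall>z\<in>\<Omega> - Z. F' z = F z ** (P (e z) ** G' z)"
      using G'(4) F1eq by (simp add: matrix_mul_assoc)
    ultimately show ?case using G'(2,3) by (intro exI[of _ "\<lambda>z. P (e z) ** G' z"] exI[of _ F']) simp
  }
qed

text \<open>A frame away from a discrete set \<open>Z\<close>, with at most poles on \<open>Z\<close>.\<close>

definition meromorphic_frame :: "(complex \<Rightarrow> complex ^ 'p ^ 'n) \<Rightarrow> complex set \<Rightarrow> bool" where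
  "meromorphic_frame F Z \<longleftrightarrow> Z \<subseteq> \<Omega> \<and> (\<forall>a\<in>\<Omega>. \<exists>r>0. ball a r \<inter> Z \<subseteq> {a}) \<and>
     mat_holo F (\<Omega> - Z) \<and> (\<forall>z\<in>\<Omega> - Z. frame_at F z) \<and>
     (\<forall>a\<in>Z. \<exists>k r H. r > 0 \<and> mat_holo H (ball a r) \<and> (\<forall>z\<in>ball a r - {a}. H z = F z ** mat ((z - a) ^ k)))"

lemma meromorphic_frameD:
  assumes "meromorphic_frame F Z"
  shows "Z \<subseteq> \<Omega>" "a \<in> \<Omega> \<Longrightarrow> \<exists>r>0. ball a r \<inter> Z \<subseteq> {a}" "mat_holo F (\<Omega> - Z)"
    "z \<in> \<Omega> - Z \<Longrightarrow> frame_at F z"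
    "a \<in> Z \<Longrightarrow> \<exists>k r H. r > 0 \<and> mat_holo H (ball a r) \<and> (\<forall>z\<in>ball a r - {a}. H z = F z ** mat ((z - a) ^ k))"
  using assms by (simp_all add: meromorphic_frame_def)

lemma meromorphic_frame_open:
  assumes "meromorphic_frame F Z"
  shows "open (\<Omega> - Z)"
  unfolding open_contains_ball
proof
  fix z assume z: "z \<in> \<Omega> - Z"
  obtain r where r: "r > 0" "ball z r \<subseteq> \<Omega>" using open_base z open_contains_ball by blast
  obtain s where s: "s > 0" "ball z s \<inter> Z \<subseteq> {z}" using meromorphic_frameD(2)[OF assms, of z] z by blast
  have "ball z (min r s) \<subseteq> \<Omega> - Z"
  proof
    fix w assume w: "w \<in> ball z (min r s)"
    then have "w \<in> \<Omega>" "w \<in> ball z s" using r by auto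
    then show "w \<in> \<Omega> - Z" using s z by auto
  qed
  then show "\<exists>e>0. ball z e \<subseteq> \<Omega> - Z" using r s by (intro exI[of _ "min r s"]) simp
qed

lemma mat_power_mult: "(A ** mat c) ** mat d = (A :: complex ^ 'm::finite ^ 'k::finite) ** mat (c * d)"
  by (simp add: vec_eq_iff mat_mult_mat_nth mult_ac)

text \<open>Multiplication by the scalar matrix \<open>e(z)\<^sup>k\<close> removes the pole at \<open>a\<close>, and the remaining degeneracy is handled by \<open>reduce_degeneracy\<close>.\<close>

lemma resolve_degeneracy:
  assumes F: "meromorphic_frame F Z" and a: "a \<in> Z" "a \<notin> exhaustion \<Omega> (Suc m)" and \<epsilon>: "\<epsilon> > 0"
  shows "\<exists>G F'. near_one G {a} m \<epsilon> \<and> meromorphic_frame F' (Z - {a}) \<and> (\<forall>z\<in>\<Omega> - Z. F' z = F z ** G z)"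
proof -
  have a\<Omega>: "a \<in> \<Omega>" using meromorphic_frameD(1)[OF F] a by blast
  have op: "open (\<Omega> - Z)" by (rule meromorphic_frame_open[OF F])
  note Fh = meromorphic_frameD(3)[OF F] and Ff = meromorphic_frameD(4)[OF F]
  obtain \<eta> where \<eta>: "\<eta> > 0" "\<And>G G' S S'. near_one G S m \<eta> \<Longrightarrow> near_one G' S' m \<eta> \<Longrightarrow> near_one (\<lambda>z. G z ** G' z) (S \<union> S') m \<epsilon>"
    using near_one_mult[OF \<epsilon>] by metis
  obtain k r1 H where H: "r1 > 0" "mat_holo H (ball a r1)" "\<And>z. z \<in> ball a r1 - {a} \<Longrightarrow> H z = F z ** mat ((z - a) ^ k)"
    using meromorphic_frameD(5)[OF F a(1)] by blast
  obtain r2 where r2: "r2 > 0" "ball a r2 \<inter> Z \<subseteq> {a}" using meromorphic_frameD(2)[OF F a\<Omega>] by blast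
  define s where "s = min (rad a) (min r1 r2)"
  have s: "s > 0" "s \<le> rad a" "ball a s \<subseteq> ball a r1" "ball a s \<inter> Z \<subseteq> {a}"
    using H(1) r2 rad(1)[OF a\<Omega>] by (auto simp: s_def)
  have b\<Omega>: "ball a s \<subseteq> \<Omega>" using s(2) rad(2)[OF a\<Omega>] subset_ball[of s "rad a" a] by blast
  have bU: "ball a s \<subseteq> \<Omega> - Z \<union> {a}" using b\<Omega> s(4) by blast
  have aball: "a \<in> ball a s" using s(1) by simp
  have "\<exists>e v. v holomorphic_on \<Omega> \<and> (\<forall>z\<in>\<Omega>. v z \<noteq> 0 \<and> e z = (z - a) * v z) \<and> near_one (\<lambda>z. (\<lambda>t. mat (t ^ k)) (e z)) {a} m \<eta>"
    by (rule near_one_elementary[OF _ _ _ a\<Omega> a(2) \<eta>(1)])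
      (intro mat_holo_mat holomorphic_intros, simp_all add: det_diagonal mat_def)
  then obtain e v where ev: "v holomorphic_on \<Omega>" "\<And>z. z \<in> \<Omega> \<Longrightarrow> v z \<noteq> 0 \<and> e z = (z - a) * v z"
      "near_one (\<lambda>z. mat (e z ^ k)) {a} m \<eta>" by blast
  define F1 where "F1 z = (if z = a then H a ** mat (v a ^ k) else F z ** mat (e z ^ k))" for z
  have F1H: "F1 z = H z ** mat (v z ^ k)" if "z \<in> ball a s" for z
  proof (cases "z = a")
    case False
    have "H z = F z ** mat ((z - a) ^ k)" using H(3)[of z] s(3) that False by blast
    moreover have "e z = (z - a) * v z" using ev(2) b\<Omega> that by blast
    ultimately show ?thesis using False by (simp add: F1_def mat_power_mult power_mult_distrib)
  qed (simp add: F1_def)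
  have F1eq: "F1 z = F z ** mat (e z ^ k)" if "z \<in> \<Omega> - Z" for z using that a by (auto simp: F1_def)
  have eh: "mat_holo (\<lambda>z. mat (e z ^ k) :: complex ^ 'p ^ 'p) (\<Omega> - {a})" and ed: "\<And>z. z \<in> \<Omega> - {a} \<Longrightarrow> det (mat (e z ^ k) :: complex ^ 'p ^ 'p) \<noteq> 0"
    using ev(3) by (auto simp: near_one_def)
  have F1h: "mat_holo F1 (\<Omega> - Z \<union> {a})"
  proof -
    have "mat_holo (\<lambda>z. F z ** mat (e z ^ k)) (\<Omega> - Z)"
      by (intro mat_holo_mult Fh mat_holo_subset[OF eh]) (use a in auto)
    then have 1: "mat_holo F1 (\<Omega> - Z)" by (rule mat_holo_cong) (simp add: F1eq)
    have "mat_holo (\<lambda>z. H z ** mat (v z ^ k)) (ball a s)"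
      by (intro mat_holo_mult mat_holo_mat mat_holo_subset[OF H(2) s(3)] holomorphic_on_power holomorphic_on_subset[OF ev(1) b\<Omega>])
    then have 2: "mat_holo F1 (ball a s)" by (rule mat_holo_cong) (simp add: F1H)
    have "mat_holo F1 (\<Omega> - Z \<union> ball a s)" by (rule mat_holo_open_Un[OF 1 2 op open_ball])
    then show ?thesis by (rule mat_holo_subset) (use aball in auto)
  qed
  have F1f: "frame_at F1 z" if z: "z \<in> \<Omega> - Z" for z
  proof -
    have "frame_at (\<lambda>z. F z ** mat (e z ^ k)) z"
      by (rule frame_at_mult[OF Ff[OF z] ed]) (use z a in auto)
    then show ?thesis by (rule frame_at_cong) (rule F1eq[OF z])
  qed
  have "(\<lambda>z. det (Pi a ** F1 z)) holomorphic_on ball a s"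
    by (intro mat_holo_det mat_holo_mult mat_holo_const mat_holo_subset[OF F1h bU])
  moreover have "det (Pi a ** F1 z) \<noteq> 0" if "z \<in> ball a s - {a}" for z
  proof -
    have z: "z \<in> \<Omega> - Z" "z \<in> ball a (rad a)" using that bU s(2) by auto
    show ?thesis using F1f[OF z(1)] injective_iff_det[OF a\<Omega> z(2), of "F1 z"] by (simp add: frame_at_def)
  qed
  ultimately obtain n g s' where g: "0 < s'" "s' \<le> s" "g holomorphic_on ball a s'"
      "\<And>z. z \<in> ball a s' \<Longrightarrow> g z \<noteq> 0 \<and> det (Pi a ** F1 z) = (z - a) ^ n * g z"
    using zero_order_factorization[OF _ s(1), of "\<lambda>z. det (Pi a ** F1 z)" a] by blast
  have s': "s' \<le> rad a" "ball a s' \<inter> Z \<subseteq> {a}" using g(2) s subset_ball[of s' s a] by auto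
  obtain G' F' where G': "near_one G' {a} m \<eta>" "mat_holo F' (\<Omega> - Z \<union> {a})" "\<forall>z\<in>\<Omega> - Z \<union> {a}. frame_at F' z"
      "\<forall>z\<in>\<Omega> - Z. F' z = F1 z ** G' z"
  proof -
    have "\<exists>G F'. near_one G {a} m \<eta> \<and> mat_holo F' (\<Omega> - Z \<union> {a}) \<and> (\<forall>z\<in>\<Omega> - Z \<union> {a}. frame_at F' z) \<and>
      (\<forall>z\<in>\<Omega> - Z. F' z = F1 z ** G z)"
      by (rule reduce_degeneracy[OF a(1) a\<Omega> a(2) op g(1) s' F1h F1f g(3) conjunct1[OF g(4)] conjunct2[OF g(4)] \<eta>(1)])
    then show thesis by (elim exE conjE) (rule that)
  qed
  define G where "G z = mat (e z ^ k) ** G' z" for z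
  have G: "near_one G {a} m \<epsilon>" using \<eta>(2)[OF ev(3) G'(1)] by (simp add: G_def[abs_def])
  have F'eq: "F' z = F z ** G z" if "z \<in> \<Omega> - Z" for z
    using G'(4) F1eq that by (simp add: G_def matrix_mul_assoc)
  have U: "\<Omega> - (Z - {a}) = \<Omega> - Z \<union> {a}" using a\<Omega> a(1) by blast
  have "meromorphic_frame F' (Z - {a})"
    unfolding meromorphic_frame_def U
  proof (intro conjI ballI)
    show "Z - {a} \<subseteq> \<Omega>" using meromorphic_frameD(1)[OF F] by blast
    show "\<exists>r>0. ball b r \<inter> (Z - {a}) \<subseteq> {b}" if "b \<in> \<Omega>" for b
      using meromorphic_frameD(2)[OF F that] by blast
    show "mat_holo F' (\<Omega> - Z \<union> {a})" by fact
    show "frame_at F' z" if "z \<in> \<Omega> - Z \<union> {a}" for z using G'(3) that by blast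
    fix b assume b: "b \<in> Z - {a}"
    then have b\<Omega>: "b \<in> \<Omega>" using meromorphic_frameD(1)[OF F] by blast
    obtain kb rb Hb where Hb: "rb > 0" "mat_holo Hb (ball b rb)" "\<And>z. z \<in> ball b rb - {b} \<Longrightarrow> Hb z = F z ** mat ((z - b) ^ kb)"
      using meromorphic_frameD(5)[OF F, of b] b by blast
    obtain r3 where r3: "r3 > 0" "ball b r3 \<inter> Z \<subseteq> {b}" using meromorphic_frameD(2)[OF F b\<Omega>] by blast
    define t where "t = min (rad b) (min rb r3)"
    have t: "t > 0" "ball b t \<subseteq> ball b rb" "ball b t \<inter> Z \<subseteq> {b}" "ball b t \<subseteq> \<Omega>"
      using Hb(1) r3 rad[OF b\<Omega>] by (auto simp: t_def)
    have ta: "ball b t \<subseteq> \<Omega> - {a}" using t(3,4) a(1) b by blast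
    show "\<exists>k r H. r > 0 \<and> mat_holo H (ball b r) \<and> (\<forall>z\<in>ball b r - {b}. H z = F' z ** mat ((z - b) ^ k))"
    proof (intro exI conjI ballI)
      show "t > 0" by fact
      show "mat_holo (\<lambda>z. Hb z ** G z) (ball b t)"
        using G ta by (intro mat_holo_mult mat_holo_subset[OF Hb(2) t(2)]) (auto simp: near_one_def elim: mat_holo_subset)
      fix z assume z: "z \<in> ball b t - {b}"
      have "z \<in> \<Omega> - Z" using z t(3,4) by blast
      moreover have "Hb z = F z ** mat ((z - b) ^ kb)" using Hb(3)[of z] z t(2) by blast
      ultimately show "Hb z ** G z = F' z ** mat ((z - b) ^ kb)"
        by (simp add: F'eq matrix_mul_assoc[symmetric] mat_mult_mat[of "G z"])
    qed
  qed
  then show ?thesis using G F'eq by (intro exI[of _ G] exI[of _ F']) simp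
qed

lemma resolve_finitely_many:
  assumes "finite S"
  shows "meromorphic_frame F Z \<Longrightarrow> S \<subseteq> Z \<Longrightarrow> S \<inter> exhaustion \<Omega> (Suc m) = {} \<Longrightarrow> \<epsilon> > 0 \<Longrightarrow>
    \<exists>G F'. near_one G S m \<epsilon> \<and> meromorphic_frame F' (Z - S) \<and> (\<forall>z\<in>\<Omega> - Z. F' z = F z ** G z)"
  using assms
proof (induction S arbitrary: F Z \<epsilon> rule: finite_induct)
  case empty
  then show ?case using near_one_one[of \<epsilon> "{}" m] by (intro exI[of _ "\<lambda>_. mat 1"] exI[of _ F]) simp
next
  case (insert a S)
  obtain \<eta> where \<eta>: "\<eta> > 0" "\<And>G G' S S'. near_one G S m \<eta> \<Longrightarrow> near_one G' S' m \<eta> \<Longrightarrow> near_one (\<lambda>z. G z ** G' z) (S \<union> S') m \<epsilon>"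
    using near_one_mult[OF insert.prems(4)] by metis
  have a: "a \<in> Z" "a \<notin> exhaustion \<Omega> (Suc m)" using insert.prems by auto
  obtain G1 F1 where 1: "near_one G1 {a} m \<eta>" "meromorphic_frame F1 (Z - {a})" "\<forall>z\<in>\<Omega> - Z. F1 z = F z ** G1 z"
    using resolve_degeneracy[OF insert.prems(1) a \<eta>(1)] by (elim exE conjE)
  have S: "S \<subseteq> Z - {a}" "S \<inter> exhaustion \<Omega> (Suc m) = {}" using insert by auto
  obtain G2 F2 where 2: "near_one G2 S m \<eta>" "meromorphic_frame F2 (Z - {a} - S)" "\<forall>z\<in>\<Omega> - (Z - {a}). F2 z = F1 z ** G2 z"
    using insert.IH[OF 1(2) S \<eta>(1)] by (elim exE conjE)
  have "near_one (\<lambda>z. G1 z ** G2 z) (insert a S) m \<epsilon>" using \<eta>(2)[OF 1(1) 2(1)] by simp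
  moreover have "Z - insert a S = Z - {a} - S" by blast
  moreover have "\<forall>z\<in>\<Omega> - Z. F2 z = F z ** (G1 z ** G2 z)" using 1(3) 2(3) by (simp add: matrix_mul_assoc)
  ultimately show ?case using 2(2) by (intro exI[of _ "\<lambda>z. G1 z ** G2 z"] exI[of _ F2]) simp
qed

end

section \<open>Global holomorphic frames\<close>

lemma mat_holo_local:
  assumes "\<And>a. a \<in> S \<Longrightarrow> \<exists>r>0. mat_holo F (ball a r)"
  shows "mat_holo F S"
  unfolding mat_holo_def holomorphic_on_def
proof (intro allI ballI)
  fix i j a assume "a \<in> S"
  then obtain r where r: "r > 0" "mat_holo F (ball a r)" using assms by blast
  then have "(\<lambda>z. F z $ i $ j) field_differentiable (at a)"
    using holomorphic_on_imp_differentiable_at[OF mat_holoD[OF r(2), of i j] open_ball] by simp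
  then show "(\<lambda>z. F z $ i $ j) field_differentiable (at a within S)"
    by (rule field_differentiable_at_within)
qed

text \<open>Only finitely many singular points have to be treated in each step along the exhaustion.\<close>

lemma finite_discrete_compact:
  fixes K :: "complex set"
  assumes "compact K" and "\<And>a. a \<in> K \<Longrightarrow> \<exists>r>0. ball a r \<inter> Z \<subseteq> {a}"
  shows "finite (Z \<inter> K)"
proof (rule ccontr)
  assume "infinite (Z \<inter> K)"
  then obtain a where a: "a \<in> K" "a islimpt (Z \<inter> K)"
    using Heine_Borel_imp_Bolzano_Weierstrass[OF assms(1), of "Z \<inter> K"] by blast
  obtain r where r: "r > 0" "ball a r \<inter> Z \<subseteq> {a}" using assms(2)[OF a(1)] by blast
  obtain x where "x \<in> Z" "x \<noteq> a" "dist x a < r" using a(2) r(1) unfolding islimpt_approachable by blast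
  then show False using r(2) by (auto simp: dist_commute)
qed

primrec mprod :: "(nat \<Rightarrow> complex ^ 'p ^ ('p::finite)) \<Rightarrow> nat \<Rightarrow> complex ^ 'p ^ 'p" where
  "mprod G 0 = mat 1"
| "mprod G (Suc n) = mprod G n ** G n"

text \<open>If \<open>\<delta>\<close> is small compared with the constants of the matrix norm, the partial products stay within \<open>\<theta>\<close> of the identity, so the
increments decay geometrically and the limit is uniform, hence holomorphic. The limit is again within \<open>\<theta>\<close> of the identity, where \<open>\<theta>\<close> is so small
that it must be invertible.\<close>

lemma infinite_matrix_product:
  "\<exists>\<delta>>0. \<forall>U (G :: nat \<Rightarrow> complex \<Rightarrow> complex ^ 'p ^ ('p::finite)). open U \<longrightarrow> (\<forall>n. mat_holo (G n) U) \<longrightarrow>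
     (\<forall>n. \<forall>z\<in>U. norm (G n z - mat 1) \<le> \<delta> * (1/2) ^ n) \<longrightarrow>
     (\<exists>P. mat_holo P U \<and> (\<forall>z\<in>U. det (P z) \<noteq> 0 \<and> mprod (\<lambda>n. G n z) \<longlonglongrightarrow> P z))"
proof -
  obtain K where K: "K > 0" "\<And>(A :: complex ^ 'p ^ 'p) (B :: complex ^ 'p ^ 'p). norm (A ** B) \<le> K * norm A * norm B"
    using norm_matrix_mult_bound by metis
  obtain K' where K': "K' > 0" "\<And>(A :: complex ^ 'p ^ 'p) x. norm (A *v x) \<le> norm A * norm x * K'"
    using bounded_bilinear.pos_bounded[OF bounded_bilinear_matrix_vector] by blast
  define s where "s = norm (mat 1 :: complex ^ 'p ^ 'p)"
  have "mat 1 \<noteq> (0 :: complex ^ 'p ^ 'p)" by (auto simp: mat_def vec_eq_iff)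
  then have s: "s > 0" by (simp add: s_def)
  define \<theta> where "\<theta> = min s (1 / (2 * K'))"
  have \<theta>: "\<theta> > 0" "\<theta> \<le> s" using s K'(1) by (simp_all add: \<theta>_def)
  have \<theta>K: "\<theta> * K' \<le> 1/2"
  proof -
    have "\<theta> * K' \<le> 1 / (2 * K') * K'" using K'(1) by (intro mult_right_mono) (simp_all add: \<theta>_def)
    then show ?thesis using K'(1) by simp
  qed
  \<comment> \<open>Chosen so that \<open>K\<close> times the bound \<open>2 s\<close> on the partial products times \<open>\<delta>\<close> is \<open>\<theta> / 2\<close>.\<close>
  define \<delta> where "\<delta> = \<theta> / (4 * K * s)"
  have \<delta>: "\<delta> > 0" "K * (2 * s) * \<delta> = \<theta> / 2" using K(1) s \<theta> by (simp_all add: \<delta>_def field_simps)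
  have "\<exists>P. mat_holo P U \<and> (\<forall>z\<in>U. det (P z) \<noteq> 0 \<and> mprod (\<lambda>n. G n z) \<longlonglongrightarrow> P z)"
    if U: "open U" and G: "\<And>n. mat_holo (G n) U"
      and small: "\<And>n z. z \<in> U \<Longrightarrow> norm (G n z - mat 1) \<le> \<delta> * (1/2) ^ n"
    for U and G :: "nat \<Rightarrow> complex \<Rightarrow> complex ^ 'p ^ 'p"
  proof -
    define p where "p n z = mprod (\<lambda>n. G n z) n" for n z
    have step: "norm (p (Suc n) z - p n z) \<le> \<theta> * (1/2) ^ Suc n" if "norm (p n z - mat 1) \<le> \<theta>" "z \<in> U" for n z
    proof -
      have "norm (p n z) \<le> norm (p n z - mat 1) + s"
        using norm_triangle_ineq[of "p n z - mat 1" "mat 1"] by (simp add: s_def)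
      then have pn: "norm (p n z) \<le> 2 * s" using that(1) \<theta>(2) by linarith
      have "p (Suc n) z - p n z = p n z ** (G n z - mat 1)"
        by (simp add: p_def bounded_bilinear.diff_right[OF bounded_bilinear_matrix_mult])
      then have "norm (p (Suc n) z - p n z) \<le> K * norm (p n z) * norm (G n z - mat 1)" using K(2) by simp
      also have "\<dots> \<le> K * (2 * s) * (\<delta> * (1/2) ^ n)"
        using K(1) s \<delta>(1) by (intro mult_mono mult_left_mono pn small[OF that(2)]) auto
      also have "\<dots> = (K * (2 * s) * \<delta>) * (1/2) ^ n" by simp
      also have "\<dots> = \<theta> * (1/2) ^ Suc n" unfolding \<delta>(2) by simp
      finally show ?thesis .
    qed
    have near: "norm (p n z - mat 1) \<le> \<theta> * (1 - (1/2) ^ n)" if "z \<in> U" for n z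
    proof (induction n)
      case 0 show ?case by (simp add: p_def)
    next
      case (Suc n)
      have "\<theta> * (1 - (1/2) ^ n) \<le> \<theta>" using \<theta>(1) by (simp add: mult_le_cancel_left1)
      then have le: "norm (p n z - mat 1) \<le> \<theta>" using Suc by linarith
      have "norm (p (Suc n) z - p n z) \<le> \<theta> * (1/2) ^ Suc n" by (rule step[OF le that])
      moreover have "norm (p (Suc n) z - mat 1) \<le> norm (p (Suc n) z - p n z) + norm (p n z - mat 1)"
        using norm_triangle_ineq[of "p (Suc n) z - p n z" "p n z - mat 1"] by simp
      moreover have "\<theta> * (1/2) ^ Suc n + \<theta> * (1 - (1/2) ^ n) = \<theta> * (1 - (1/2) ^ Suc n)"
        by (simp add: algebra_simps)
      ultimately show ?case using Suc by linarith
    qed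
    have near': "norm (p n z - mat 1) \<le> \<theta>" if "z \<in> U" for n z
    proof -
      have "\<theta> * (1 - (1/2) ^ n) \<le> \<theta>" using \<theta>(1) by (simp add: mult_le_cancel_left1)
      then show ?thesis using near[OF that, of n] by linarith
    qed
    have "uniform_limit U (\<lambda>n z. \<Sum>i<n. p (Suc i) z - p i z) (\<lambda>z. suminf (\<lambda>i. p (Suc i) z - p i z)) sequentially"
    proof (rule Weierstrass_m_test)
      show "norm (p (Suc n) z - p n z) \<le> \<theta> * (1/2) ^ Suc n" if "z \<in> U" for n z
        by (rule step[OF near'[OF that] that])
      show "summable (\<lambda>n. \<theta> * (1/2) ^ Suc n)" by (intro summable_mult) (simp add: summable_geometric summable_mult)
    qed
    moreover have "(\<Sum>i<n. p (Suc i) z - p i z) = p n z - mat 1" for n z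
      by (induction n) (simp_all add: p_def)
    ultimately have "uniform_limit U (\<lambda>n z. p n z - mat 1) (\<lambda>z. suminf (\<lambda>i. p (Suc i) z - p i z)) sequentially"
      by simp
    then have "uniform_limit U (\<lambda>n z. p n z - mat 1 + mat 1) (\<lambda>z. suminf (\<lambda>i. p (Suc i) z - p i z) + mat 1) sequentially"
      by (rule uniform_limit_add) (rule uniform_limit_const)
    then have ul: "uniform_limit U p (\<lambda>z. suminf (\<lambda>i. p (Suc i) z - p i z) + mat 1) sequentially" by simp
    define P where "P z = suminf (\<lambda>i. p (Suc i) z - p i z) + mat 1" for z
    have ul: "uniform_limit U p P sequentially" using ul by (simp add: P_def[abs_def])
    have lim: "(\<lambda>n. p n z) \<longlonglongrightarrow> P z" if "z \<in> U" for z by (rule tendsto_uniform_limitI[OF ul that])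
    have ph: "mat_holo (p n) U" for n
      unfolding p_def by (induction n) (auto intro: mat_holo_const mat_holo_mult G)
    have "mat_holo P U"
      unfolding mat_holo_def
    proof (intro allI)
      fix i j
      have bl: "bounded_linear (\<lambda>A :: complex ^ 'p ^ 'p. A $ i $ j)"
        by (intro bounded_linear_compose[OF bounded_linear_vec_nth bounded_linear_vec_nth])
      show "(\<lambda>z. P z $ i $ j) holomorphic_on U"
      proof (rule holomorphic_uniform_sequence[OF U])
        show "(\<lambda>z. p n z $ i $ j) holomorphic_on U" for n by (rule mat_holoD[OF ph])
        fix x assume "x \<in> U"
        then obtain d where d: "d > 0" "cball x d \<subseteq> U" using U open_contains_cball by blast
        have "uniform_limit U (\<lambda>n z. p n z $ i $ j) (\<lambda>z. P z $ i $ j) sequentially"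
          by (rule bounded_linear.uniform_limit[OF bl ul])
        from uniform_limit_on_subset[OF this d(2)] d
        show "\<exists>d>0. cball x d \<subseteq> U \<and> uniform_limit (cball x d) (\<lambda>n z. p n z $ i $ j) (\<lambda>z. P z $ i $ j) sequentially"
          by blast
      qed
    qed
    moreover have "det (P z) \<noteq> 0" if z: "z \<in> U" for z
    proof
      assume "det (P z) = 0"
      then obtain x where x: "x \<noteq> 0" "P z *v x = 0" using singular_kernel by blast
      have "norm (P z - mat 1) \<le> \<theta>"
        by (rule tendsto_upperbound[OF tendsto_norm[OF tendsto_diff[OF lim[OF z] tendsto_const]]])
          (simp_all add: near'[OF z])
      have "norm x = norm ((P z - mat 1) *v x)"
        using x(2) by (simp add: bounded_bilinear.diff_left[OF bounded_bilinear_matrix_vector])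
      also have "\<dots> \<le> norm (P z - mat 1) * norm x * K'" by (rule K'(2))
      also have "\<dots> = norm x * (norm (P z - mat 1) * K')" by simp
      also have "\<dots> \<le> norm x * (\<theta> * K')"
        using \<open>norm (P z - mat 1) \<le> \<theta>\<close> K'(1) by (intro mult_left_mono mult_right_mono) auto
      also have "\<dots> \<le> norm x * (1/2)" by (intro mult_left_mono \<theta>K) simp
      finally show False using x(1) by simp
    qed
    ultimately show ?thesis using lim by (intro exI[of _ P]) (simp add: p_def)
  qed
  then show ?thesis using \<delta>(1) by (intro exI[of _ \<delta>]) simp
qed

context holomorphic_bundle
begin

text \<open>A choice of one point in each connected component of \<open>\<Omega>\<close>. As a function of \<open>z\<close> it is locally constant, so that all components can be treated at
once.\<close>

definition base_point :: "complex \<Rightarrow> complex" where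
  "base_point z = (SOME x. x \<in> connected_component_set \<Omega> z)"

lemma base_point_cong: "a \<in> \<Omega> \<Longrightarrow> z \<in> connected_component_set \<Omega> a \<Longrightarrow> base_point z = base_point a"
  using connected_component_eq[of z \<Omega> a] by (simp add: base_point_def)

lemma base_point_in_component: "a \<in> \<Omega> \<Longrightarrow> base_point a \<in> connected_component_set \<Omega> a"
  unfolding base_point_def by (rule someI[of _ a]) simp

lemma ball_component: "a \<in> \<Omega> \<Longrightarrow> ball a (rad a) \<subseteq> connected_component_set \<Omega> a"
  by (rule connected_component_maximal) (use rad in auto)

text \<open>The points at which the fixed coordinates \<open>Pi\<close> of the base point fail to be coordinates on \<open>V(z)\<close>.\<close>

definition degeneracy_set :: "complex set" where
  "degeneracy_set = {z \<in> \<Omega>. \<exists>x\<in>V z. x \<noteq> 0 \<and> Pi (base_point z) *v x = 0}"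

definition chart_det :: "complex \<Rightarrow> complex \<Rightarrow> complex" where
  "chart_det a z = det (Pi (base_point a) ** W a z)"

lemma W_injective: "a \<in> \<Omega> \<Longrightarrow> z \<in> ball a (rad a) \<Longrightarrow> W a z *v x = 0 \<Longrightarrow> x = 0"
  using Pi_W[of a z] matrix_vector_mul_assoc[of "Pi a" "W a z" x] by simp

lemma base_point_ball: "a \<in> \<Omega> \<Longrightarrow> z \<in> ball a (rad a) \<Longrightarrow> base_point z = base_point a"
  using ball_component base_point_cong by blast

lemma degeneracy_set_iff:
  assumes a: "a \<in> \<Omega>" "z \<in> ball a (rad a)"
  shows "z \<in> degeneracy_set \<longleftrightarrow> chart_det a z = 0"
proof
  assume "z \<in> degeneracy_set"
  then obtain x where x: "x \<in> V z" "x \<noteq> 0" "Pi (base_point a) *v x = 0" by (auto simp: degeneracy_set_def base_point_ball[OF a])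
  then obtain y where y: "x = W a z *v y" using V_W[OF a] by auto
  show "chart_det a z = 0"
  proof (rule ccontr)
    assume "chart_det a z \<noteq> 0"
    then have "invertible (Pi (base_point a) ** W a z)" by (simp add: chart_det_def invertible_det_nz)
    moreover have "(Pi (base_point a) ** W a z) *v y = 0" using x(3) y by (simp add: matrix_vector_mul_assoc)
    ultimately have "y = 0" by (rule invertible_mult_eq_0)
    then show False using x(2) y by simp
  qed
next
  assume "chart_det a z = 0"
  then obtain y where y: "y \<noteq> 0" "(Pi (base_point a) ** W a z) *v y = 0" using singular_kernel by (auto simp: chart_det_def)
  have "W a z *v y \<in> V z" using V_W[OF a] by simp
  moreover have "W a z *v y \<noteq> 0" using W_injective[OF a] y(1) by blast
  moreover have "Pi (base_point a) *v (W a z *v y) = 0" using y(2) by (simp add: matrix_vector_mul_assoc)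
  moreover have "z \<in> \<Omega>" using rad(2)[OF a(1)] a(2) by blast
  ultimately show "z \<in> degeneracy_set" by (auto simp: degeneracy_set_def base_point_ball[OF a])
qed

lemma chart_det_holomorphic: "a \<in> \<Omega> \<Longrightarrow> chart_det a holomorphic_on ball a (rad a)"
  unfolding chart_det_def by (intro mat_holo_det mat_holo_mult mat_holo_const W)

text \<open>In each chart the set is the zero set of the holomorphic function \<open>chart_det\<close>. In a component, the points near which it is everything and the
points near which it is discrete are both open and cover the component, and the base point is of the second kind.\<close>

lemma degeneracy_set_discrete:
  assumes a: "a \<in> \<Omega>"
  shows "\<exists>r>0. ball a r \<inter> degeneracy_set \<subseteq> {a}"
proof -
  define A where "A = {a. \<exists>r>0. ball a r \<subseteq> degeneracy_set}"
  define B where "B = {a. \<exists>r>0. ball a r \<inter> degeneracy_set \<subseteq> {a}}"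
  let ?C = "connected_component_set \<Omega> a"
  have C\<Omega>: "?C \<subseteq> \<Omega>" by (rule connected_component_subset)
  have "open A" unfolding open_contains_ball
  proof
    fix x assume "x \<in> A"
    then obtain r where r: "r > 0" "ball x r \<subseteq> degeneracy_set" by (auto simp: A_def)
    have "y \<in> A" if yb: "y \<in> ball x r" for y
    proof -
      obtain e where "e > 0" "ball y e \<subseteq> ball x r" by (rule openE[OF open_ball yb])
      then show ?thesis using r(2) unfolding A_def by blast
    qed
    then show "\<exists>e>0. ball x e \<subseteq> A" using r(1) by blast
  qed
  moreover have "open B" unfolding open_contains_ball
  proof
    fix x assume "x \<in> B"
    then obtain r where r: "r > 0" "ball x r \<inter> degeneracy_set \<subseteq> {x}" by (auto simp: B_def)
    have "y \<in> B" if "y \<in> ball x r" for y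
    proof (cases "y = x")
      case True
      then show ?thesis using r unfolding B_def by blast
    next
      case False
      then have "y \<in> ball x r - {x}" using that by blast
      then obtain e where "e > 0" "ball y e \<subseteq> ball x r - {x}"
        using openE[of "ball x r - {x}" y] by (auto simp: open_Diff)
      then show ?thesis using r(2) unfolding B_def by blast
    qed
    then show "\<exists>e>0. ball x e \<subseteq> B" using r(1) by blast
  qed
  moreover have "A \<inter> B \<inter> ?C = {}"
  proof -
    have False if x: "x \<in> A" "x \<in> B" for x
    proof -
      obtain r where r: "r > 0" "ball x r \<subseteq> degeneracy_set" using x(1) by (auto simp: A_def)
      obtain q where q: "q > 0" "ball x q \<inter> degeneracy_set \<subseteq> {x}" using x(2) by (auto simp: B_def)
      define y where "y = x + of_real (min r q / 2)"
      have "y \<noteq> x" "y \<in> ball x r" "y \<in> ball x q" using r(1) q(1) by (auto simp: y_def dist_norm min_def)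
      then show False using r(2) q(2) by blast
    qed
    then show ?thesis by blast
  qed
  moreover have "?C \<subseteq> A \<union> B"
  proof
    fix x assume "x \<in> ?C"
    then have x: "x \<in> \<Omega>" using C\<Omega> by blast
    show "x \<in> A \<union> B"
    proof (cases "x islimpt {z \<in> ball x (rad x). chart_det x z = 0}")
      case True
      have "chart_det x w = 0" if "w \<in> ball x (rad x)" for w
        by (rule analytic_continuation[OF chart_det_holomorphic[OF x] open_ball connected_ball _ _ True _ that])
          (use rad(1)[OF x] in auto)
      then have "ball x (rad x) \<subseteq> degeneracy_set" using degeneracy_set_iff[OF x] by blast
      then show ?thesis using rad(1)[OF x] unfolding A_def by blast
    next
      case False
      then obtain e where e: "e > 0" "\<And>z. z \<in> ball x (rad x) \<Longrightarrow> chart_det x z = 0 \<Longrightarrow> z \<noteq> x \<Longrightarrow> \<not> dist z x < e"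
        unfolding islimpt_approachable by blast
      have "ball x (min e (rad x)) \<inter> degeneracy_set \<subseteq> {x}"
      proof
        fix z assume z: "z \<in> ball x (min e (rad x)) \<inter> degeneracy_set"
        then have zb: "z \<in> ball x (rad x)" "dist z x < e" by (auto simp: dist_commute)
        then have "chart_det x z = 0" using degeneracy_set_iff[OF x zb(1)] z by blast
        then show "z \<in> {x}" using e(2)[OF zb(1)] zb(2) by blast
      qed
      then show ?thesis using e(1) rad(1)[OF x] unfolding B_def by (metis (mono_tags) UnCI mem_Collect_eq min_less_iff_conj)
    qed
  qed
  ultimately have "A \<inter> ?C = {} \<or> B \<inter> ?C = {}"
    by (rule connectedD[OF connected_connected_component])
  moreover have "base_point a \<in> B \<inter> ?C"
  proof -
    have c: "base_point a \<in> ?C" by (rule base_point_in_component[OF a])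
    then have c\<Omega>: "base_point a \<in> \<Omega>" using C\<Omega> by blast
    have "base_point (base_point a) = base_point a" by (rule base_point_cong[OF a c])
    then have "chart_det (base_point a) z \<noteq> 0" if "z \<in> ball (base_point a) (rad (base_point a))" for z
      using Pi_W[OF c\<Omega> that] by (simp add: chart_det_def)
    then have "ball (base_point a) (rad (base_point a)) \<inter> degeneracy_set = {}" using degeneracy_set_iff[OF c\<Omega>] by blast
    then show ?thesis using rad(1)[OF c\<Omega>] c unfolding B_def by blast
  qed
  ultimately have "A \<inter> ?C = {}" by blast
  moreover have "a \<in> ?C" using a by simp
  ultimately have "a \<in> B" using \<open>?C \<subseteq> A \<union> B\<close> by blast
  then show ?thesis by (simp add: B_def)
qed

definition chart_frame :: "complex \<Rightarrow> complex \<Rightarrow> complex ^ 'p ^ 'n" where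
  "chart_frame a z = W a z ** cofactors (Pi (base_point a) ** W a z)"

lemma chart_frame_holo: "a \<in> \<Omega> \<Longrightarrow> mat_holo (chart_frame a) (ball a (rad a))"
  unfolding chart_frame_def by (intro mat_holo_mult mat_holo_cofactors mat_holo_const W)

text \<open>The inverse of the restriction of \<open>Pi (base_point z)\<close> to \<open>V(z)\<close>. The definition uses the chart centred at \<open>z\<close> itself; by \<open>initial_frame_eq\<close> any
other chart gives the same value, which shows that it is meromorphic.\<close>

definition initial_frame :: "complex \<Rightarrow> complex ^ 'p ^ 'n" where
  "initial_frame z = chart_frame z z ** mat (1 / chart_det z z)"

lemma Pi_chart_frame:
  assumes "a \<in> \<Omega>" "z \<in> ball a (rad a)" "z \<notin> degeneracy_set"
  shows "Pi (base_point a) ** (chart_frame a z ** mat (1 / chart_det a z)) = mat 1"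
proof -
  have nz: "chart_det a z \<noteq> 0" using degeneracy_set_iff[OF assms(1,2)] assms(3) by simp
  then have "Pi (base_point a) ** chart_frame a z = mat (chart_det a z)"
    unfolding chart_frame_def chart_det_def by (simp add: matrix_mul_assoc cofactors_mult)
  then have "Pi (base_point a) ** (chart_frame a z ** mat (1 / chart_det a z)) = mat (chart_det a z) ** mat (1 / chart_det a z)"
    by (simp add: matrix_mul_assoc)
  also have "\<dots> = mat 1" using nz by (simp add: vec_eq_iff mat_mult_nth) (simp add: mat_def)
  finally show ?thesis .
qed

lemma initial_frame_eq:
  assumes a: "a \<in> \<Omega>" "z \<in> ball a (rad a)" and z: "z \<notin> degeneracy_set"
  shows "initial_frame z = chart_frame a z ** mat (1 / chart_det a z)"
proof (rule matrix_eqI)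
  fix x
  have z\<Omega>: "z \<in> \<Omega>" using rad(2)[OF a(1)] a(2) by blast
  have zz: "z \<in> ball z (rad z)" using rad(1)[OF z\<Omega>] by simp
  have V: "(W b z ** A) *v x \<in> V z" if "b \<in> \<Omega>" "z \<in> ball b (rad b)" for b A x
    using V_W[OF that] by (simp add: matrix_vector_mul_assoc[symmetric])
  define d where "d = initial_frame z *v x - (chart_frame a z ** mat (1 / chart_det a z)) *v x"
  have sub: "u - v \<in> V z" if "u \<in> V z" "v \<in> V z" for u v
    using that V_W[OF a] by (auto simp: matrix_vector_mult_diff_distrib[symmetric])
  have "d \<in> V z"
    unfolding d_def initial_frame_def chart_frame_def matrix_mul_assoc[symmetric] by (intro sub V z\<Omega> zz a)
  moreover have "Pi (base_point z) *v d = 0"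
    using Pi_chart_frame[OF z\<Omega> zz z] Pi_chart_frame[OF a z]
    by (simp add: d_def initial_frame_def matrix_vector_mult_diff_distrib matrix_vector_mul_assoc base_point_ball[OF a])
  ultimately have "d = 0" using z z\<Omega> by (auto simp: degeneracy_set_def)
  then show "initial_frame z *v x = (chart_frame a z ** mat (1 / chart_det a z)) *v x" by (simp add: d_def)
qed

lemma meromorphic_frame_initial_frame: "meromorphic_frame initial_frame degeneracy_set"
proof -
  have ex: "\<exists>r>0. r \<le> rad a \<and> ball a r \<inter> degeneracy_set \<subseteq> {a}" if a: "a \<in> \<Omega>" for a
  proof -
    obtain r where "r > 0" "ball a r \<inter> degeneracy_set \<subseteq> {a}" using degeneracy_set_discrete[OF a] by blast
    then show ?thesis using rad(1)[OF a] by (intro exI[of _ "min r (rad a)"]) auto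
  qed
  show ?thesis
    unfolding meromorphic_frame_def
  proof (intro conjI ballI)
    show "degeneracy_set \<subseteq> \<Omega>" by (auto simp: degeneracy_set_def)
    show "\<exists>r>0. ball a r \<inter> degeneracy_set \<subseteq> {a}" if "a \<in> \<Omega>" for a by (rule degeneracy_set_discrete[OF that])
    show "mat_holo initial_frame (\<Omega> - degeneracy_set)"
    proof (rule mat_holo_local)
      fix a assume a': "a \<in> \<Omega> - degeneracy_set"
      then have a: "a \<in> \<Omega>" by blast
      obtain r where r: "r > 0" "r \<le> rad a" "ball a r \<inter> degeneracy_set \<subseteq> {a}" using ex[OF a] by blast
      have sub: "ball a r \<subseteq> ball a (rad a)" using r(2) by auto
      have nd: "z \<notin> degeneracy_set" if "z \<in> ball a r" for z using that r(3) a' by blast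
      have nz: "chart_det a z \<noteq> 0" if "z \<in> ball a r" for z
        using degeneracy_set_iff[OF a subsetD[OF sub that]] nd[OF that] by blast
      have "mat_holo (\<lambda>z. chart_frame a z ** mat (1 / chart_det a z)) (ball a r)"
        by (intro mat_holo_mult mat_holo_mat holomorphic_on_divide mat_holo_subset[OF chart_frame_holo[OF a] sub]
            holomorphic_on_subset[OF chart_det_holomorphic[OF a] sub] holomorphic_on_const nz)
      then have "mat_holo initial_frame (ball a r)"
        by (rule mat_holo_cong) (rule initial_frame_eq[OF a subsetD[OF sub] nd, symmetric])
      then show "\<exists>r>0. mat_holo initial_frame (ball a r)" using r(1) by blast
    qed
    show "frame_at initial_frame z" if z: "z \<in> \<Omega> - degeneracy_set" for z
    proof -
      have z1: "z \<in> \<Omega>" "z \<in> ball z (rad z)" "z \<notin> degeneracy_set" using z rad(1) by auto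
      have P: "Pi (base_point z) ** initial_frame z = mat 1" unfolding initial_frame_def by (rule Pi_chart_frame[OF z1])
      have "x = 0" if "initial_frame z *v x = 0" for x
      proof -
        have "(Pi (base_point z) ** initial_frame z) *v x = 0" using that by (simp add: matrix_vector_mul_assoc[symmetric])
        then show ?thesis by (simp add: P)
      qed
      moreover have "initial_frame z *v x \<in> V z" for x
        using V_W[OF z1(1,2)] by (simp add: initial_frame_def chart_frame_def matrix_vector_mul_assoc[symmetric])
      ultimately show ?thesis by (simp add: frame_at_def)
    qed
    fix a assume "a \<in> degeneracy_set"
    then have a: "a \<in> \<Omega>" by (simp add: degeneracy_set_def)
    obtain r where r: "r > 0" "r \<le> rad a" "ball a r \<inter> degeneracy_set \<subseteq> {a}" using ex[OF a] by blast
    have sub: "ball a r \<subseteq> ball a (rad a)" using r(2) by auto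
    have nz: "chart_det a z \<noteq> 0" if "z \<in> ball a r - {a}" for z
      using degeneracy_set_iff[OF a, of z] that sub r(3) by blast
    obtain n g s where g: "0 < s" "s \<le> r" "g holomorphic_on ball a s"
        "\<And>z. z \<in> ball a s \<Longrightarrow> g z \<noteq> 0 \<and> chart_det a z = (z - a) ^ n * g z"
      using zero_order_factorization[OF holomorphic_on_subset[OF chart_det_holomorphic[OF a] sub] r(1) nz] by blast
    have sub': "ball a s \<subseteq> ball a (rad a)" "ball a s \<subseteq> ball a r" using g(2) sub by auto
    show "\<exists>k r H. r > 0 \<and> mat_holo H (ball a r) \<and> (\<forall>z\<in>ball a r - {a}. H z = initial_frame z ** mat ((z - a) ^ k))"
    proof (intro exI conjI ballI)
      show "s > 0" by (rule g(1))
      show "mat_holo (\<lambda>z. chart_frame a z ** mat (1 / g z)) (ball a s)"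
        by (intro mat_holo_mult mat_holo_mat holomorphic_on_divide mat_holo_subset[OF chart_frame_holo[OF a] sub'(1)]
            g(3) holomorphic_on_const) (use g(4) in blast)
      fix z assume z: "z \<in> ball a s - {a}"
      have zn: "z \<in> ball a (rad a)" "z \<notin> degeneracy_set" using z sub' r(3) by blast+
      have "1 / chart_det a z * (z - a) ^ n = 1 / g z" using z g(4)[of z] by simp
      then show "chart_frame a z ** mat (1 / g z) = initial_frame z ** mat ((z - a) ^ n)"
        by (simp only: initial_frame_eq[OF a zn] mat_power_mult)
    qed
  qed
qed

text \<open>In step \<open>n\<close> the finitely many singular points in the member \<open>n + 2\<close> of the exhaustion are resolved, at the cost of a factor that is within
\<open>\<delta> 2\<^sup>-\<^sup>n\<close> of the identity on the member \<open>n\<close>. On the interior of the member \<open>m\<close> the sequence is, from the index \<open>m\<close> on, a holomorphic frame times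
partial products of such factors, so it converges to a holomorphic frame there.\<close>

theorem holomorphic_frame_exists: "\<exists>F. mat_holo F \<Omega> \<and> (\<forall>z\<in>\<Omega>. frame_at F z)"
proof -
  let ?K = "exhaustion \<Omega>" and ?Z = degeneracy_set
  define R where "R n = ?Z - ?K (Suc n)" for n
  define S where "S n = R n \<inter> ?K (Suc (Suc n))" for n
  obtain \<delta> where \<delta>: "\<delta> > 0" "\<And>U (G :: nat \<Rightarrow> complex \<Rightarrow> complex ^ 'p ^ 'p). open U \<Longrightarrow> (\<And>n. mat_holo (G n) U) \<Longrightarrow>
      (\<And>n z. z \<in> U \<Longrightarrow> norm (G n z - mat 1) \<le> \<delta> * (1/2) ^ n) \<Longrightarrow>
      \<exists>P. mat_holo P U \<and> (\<forall>z\<in>U. det (P z) \<noteq> 0 \<and> mprod (\<lambda>n. G n z) \<longlonglongrightarrow> P z)"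
    using infinite_matrix_product by metis
  have "\<exists>f. \<forall>n. meromorphic_frame (f n) (R n) \<and>
    (\<exists>G. near_one G (S n) n (\<delta> * (1/2) ^ n) \<and> (\<forall>z\<in>\<Omega> - R n. f (Suc n) z = f n z ** G z))"
  proof (rule dependent_nat_choice)
    show "\<exists>f. meromorphic_frame f (R 0)"
      using meromorphic_frame_initial_frame by (intro exI[of _ initial_frame]) (simp add: R_def exhaustion_def)
    fix f n assume f: "meromorphic_frame f (R n)"
    have "finite (S n)"
      unfolding S_def
    proof (rule finite_discrete_compact[OF compact_exhaustion])
      show "\<exists>r>0. ball a r \<inter> R n \<subseteq> {a}" if "a \<in> ?K (Suc (Suc n))" for a
        using degeneracy_set_discrete[of a] that exhaustion_subset unfolding R_def by blast
    qed
    moreover have "S n \<subseteq> R n" "S n \<inter> ?K (Suc n) = {}" by (auto simp: S_def R_def)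
    moreover have "\<delta> * (1/2) ^ n > 0" using \<delta>(1) by simp
    ultimately have "\<exists>G F'. near_one G (S n) n (\<delta> * (1/2) ^ n) \<and> meromorphic_frame F' (R n - S n) \<and> (\<forall>z\<in>\<Omega> - R n. F' z = f z ** G z)"
      by (intro resolve_finitely_many[OF _ f])
    moreover have "R n - S n = R (Suc n)"
      using exhaustion_mono[of "Suc n" "Suc (Suc n)" \<Omega>] by (auto simp: R_def S_def)
    ultimately show "\<exists>f'. meromorphic_frame f' (R (Suc n)) \<and>
        (\<exists>G. near_one G (S n) n (\<delta> * (1/2) ^ n) \<and> (\<forall>z\<in>\<Omega> - R n. f' z = f z ** G z))"
      by (elim exE conjE) (rule exI, rule conjI, simp, rule exI, rule conjI)
  qed
  then obtain f where f: "\<And>n. meromorphic_frame (f n) (R n)"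
    and "\<forall>n. \<exists>G. near_one G (S n) n (\<delta> * (1/2) ^ n) \<and> (\<forall>z\<in>\<Omega> - R n. f (Suc n) z = f n z ** G z)" by blast
  from choice[OF this(2)] obtain G where G: "\<And>n. near_one (G n) (S n) n (\<delta> * (1/2) ^ n)"
      "\<And>n z. z \<in> \<Omega> - R n \<Longrightarrow> f (Suc n) z = f n z ** G n z" by blast
  define F where "F z = lim (\<lambda>n. f n z)" for z
  have local: "\<exists>r>0. mat_holo F (ball a r) \<and> frame_at F a" if a: "a \<in> \<Omega>" for a
  proof -
    obtain m where m: "a \<in> interior (?K m)" using exhaustion_interior[OF open_base a] by blast
    let ?U = "interior (?K m)"
    have UK: "?U \<subseteq> ?K (m + n)" for n
      by (rule subset_trans[OF interior_subset exhaustion_mono]) simp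
    have UR: "?U \<subseteq> \<Omega> - R (m + n)" for n
    proof
      fix z assume "z \<in> ?U"
      then have z: "z \<in> ?K (m + n)" by (rule subsetD[OF UK])
      then have "z \<in> ?K (Suc (m + n))" by (rule subsetD[OF exhaustion_mono[OF le_SucI[OF order_refl]]])
      then show "z \<in> \<Omega> - R (m + n)" using subsetD[OF exhaustion_subset z] by (simp add: R_def)
    qed
    have US: "?U \<subseteq> \<Omega> - S (m + n)" for n using UR[of n] by (auto simp: S_def)
    have "\<exists>P. mat_holo P ?U \<and> (\<forall>z\<in>?U. det (P z) \<noteq> 0 \<and> mprod (\<lambda>n. G (m + n) z) \<longlonglongrightarrow> P z)"
    proof (rule \<delta>(2))
      show "mat_holo (G (m + n)) ?U" for n
        by (rule mat_holo_subset[OF _ US[of n]]) (use G(1)[of "m + n"] in \<open>simp add: near_one_def\<close>)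
      fix n z assume "z \<in> ?U"
      then have "z \<in> ?K (m + n)" by (rule subsetD[OF UK])
      then have "norm (G (m + n) z - mat 1) \<le> \<delta> * (1/2) ^ (m + n)"
        using G(1)[of "m + n"] by (simp add: near_one_def)
      also have "\<dots> \<le> \<delta> * (1/2) ^ n" using \<delta>(1) by (intro mult_left_mono power_decreasing) auto
      finally show "norm (G (m + n) z - mat 1) \<le> \<delta> * (1/2) ^ n" .
    qed simp
    then obtain P where P: "mat_holo P ?U" "\<And>z. z \<in> ?U \<Longrightarrow> det (P z) \<noteq> 0"
        "\<And>z. z \<in> ?U \<Longrightarrow> mprod (\<lambda>n. G (m + n) z) \<longlonglongrightarrow> P z" by metis
    have Fm: "F z = f m z ** P z" if z: "z \<in> ?U" for z
    proof -
      have eq: "f (m + n) z = f m z ** mprod (\<lambda>n. G (m + n) z) n" for n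
      proof (induction n)
        case (Suc n)
        then show ?case using G(2)[OF subsetD[OF UR z]] by (simp add: matrix_mul_assoc)
      qed simp
      have "(\<lambda>n. f m z ** mprod (\<lambda>n. G (m + n) z) n) \<longlonglongrightarrow> f m z ** P z"
        by (intro bounded_bilinear.tendsto[OF bounded_bilinear_matrix_mult] tendsto_const P(3) z)
      moreover have "f (n + m) z = f m z ** mprod (\<lambda>n. G (m + n) z) n" for n
        using eq[of n] by (simp only: add.commute[of n m])
      ultimately have "(\<lambda>n. f (n + m) z) \<longlonglongrightarrow> f m z ** P z" by simp
      then have "(\<lambda>n. f n z) \<longlonglongrightarrow> f m z ** P z" by (rule LIMSEQ_offset)
      then show ?thesis unfolding F_def by (rule limI)
    qed
    have "mat_holo (\<lambda>z. f m z ** P z) ?U"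
      using UR[of 0] by (intro mat_holo_mult P(1) mat_holo_subset[OF meromorphic_frameD(3)[OF f]]) simp
    then have "mat_holo F ?U" by (rule mat_holo_cong) (simp add: Fm)
    moreover obtain r where "r > 0" "ball a r \<subseteq> ?U" using m open_contains_ball[of ?U] by auto
    moreover have "frame_at F a"
    proof -
      have "a \<in> \<Omega> - R m" using subsetD[OF UR[of 0] m] by simp
      then have "frame_at (\<lambda>z. f m z ** P z) a"
        by (rule frame_at_mult[of "f m" a P, OF meromorphic_frameD(4)[OF f[of m]] P(2)[OF m]])
      then show ?thesis by (rule frame_at_cong) (rule Fm[OF m])
    qed
    ultimately show ?thesis by (blast intro: mat_holo_subset)
  qed
  have "mat_holo F \<Omega>" by (rule mat_holo_local) (use local in blast)
  then show ?thesis using local by blast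
qed

end

section \<open>Dimension of Lagrangian subspaces\<close>

text \<open>The antilinear map \<open>j J\<close>. It turns the form \<open>s\<close> into the inner product, see \<open>sform_cdot\<close>.\<close>

definition theta :: "complex ^ ('p::finite + 'p) \<Rightarrow> complex ^ ('p + 'p)" where
  "theta w = swap_conj (J_mat *v w)"

lemma cnj_J_sign: "cnj (J_sign i) = - J_sign i"
  by (simp add: J_sign_def split: sum.splits)

lemma theta_nth: "theta w $ i = J_sign i * cnj (w $ swap_index i)"
  by (simp add: theta_def swap_conj_nth J_mat_nth cnj_J_sign J_sign_swap_index flip: swap_index_def)

lemma theta_add: "theta (u + v) = theta u + theta v"
  by (simp add: vec_eq_iff theta_nth distrib_left)

lemma theta_scale: "theta (c *s v) = cnj c *s theta v"
  by (simp add: vec_eq_iff theta_nth)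

lemma theta_zero: "theta 0 = 0"
  by (simp add: vec_eq_iff theta_nth)

lemma theta_theta: "theta (theta v) = - v"
  by (simp add: vec_eq_iff theta_nth cnj_J_sign J_sign_swap_index J_sign_square flip: mult.assoc)

lemma sform_cdot: "sform x w = cdot x (theta w)"
  by (simp add: sform_def theta_def cdot_swap_conj_bform)

lemma sform_commute: "sform x y = - sform y x"
  by (simp add: sform_def bform_commute[of y] bform_J)

lemma dim_theta_le: "vec.dim (theta ` U) \<le> vec.dim U"
proof -
  obtain B where B: "B \<subseteq> U" "vec.independent B" "U \<subseteq> vec.span B" "card B = vec.dim U"
    using vec.basis_exists by blast
  have fin: "finite B" by (rule vec.finiteI_independent[OF B(2)])
  have "theta x \<in> vec.span (theta ` B)" if "x \<in> vec.span B" for x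
    using that
  proof (induction rule: vec.span_induct_alt)
    case base show ?case by (simp add: theta_zero vec.span_zero)
  next
    case (step c x y)
    then show ?case by (simp add: theta_add theta_scale vec.span_add vec.span_scale vec.span_base)
  qed
  then have "theta ` U \<subseteq> vec.span (theta ` B)" using B(3) by blast
  then have "vec.dim (theta ` U) \<le> card (theta ` B)" by (rule vec.dim_le_card) (simp add: fin)
  also have "\<dots> \<le> card B" by (rule card_image_le[OF fin])
  finally show ?thesis by (simp add: B(4))
qed

lemma dim_theta:
  assumes "vec.subspace U"
  shows "vec.dim (theta ` U) = vec.dim U"
proof (rule antisym[OF dim_theta_le])
  have "u \<in> theta ` theta ` U" if "u \<in> U" for u
    using theta_theta[of "- u"] vec.subspace_neg[OF assms that] by (auto intro: rev_image_eqI)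
  then have "U \<subseteq> theta ` theta ` U" by blast
  then have "vec.dim U \<le> vec.dim (theta ` theta ` U)" by (rule vec.dim_subset)
  then show "vec.dim U \<le> vec.dim (theta ` U)" using dim_theta_le[of "theta ` U"] by linarith
qed

lemma scaleR_vec: "r *\<^sub>R x = complex_of_real r *s (x :: complex ^ 'n::finite)"
  by (simp add: vec_eq_iff) (simp add: scaleR_conv_of_real)

lemma mat_mult_scalar: "mat c ** mat d = (mat (c * d) :: complex ^ 'n ^ 'n::finite)"
  by (simp add: vec_eq_iff mat_mult_nth) (simp add: mat_def)

lemma mult_axis: "A *v axis k 1 = column k (A :: complex ^ 'm::finite ^ 'n::finite)"
  by (simp add: vec_eq_iff matrix_vector_mult_def column_def axis_def if_distrib[where f = "\<lambda>x. _ * x"] cong: if_cong)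

text \<open>The map \<open>theta\<close> carries the \<open>s\<close>-orthogonal complement of \<open>U\<close> onto the orthogonal complement of \<open>U\<close>. If the former is \<open>U\<close> itself, the whole space is the direct
sum of \<open>U\<close> and \<open>theta ` U\<close>, and an antilinear bijection preserves dimensions.\<close>

theorem lagrangian_dim:
  fixes U :: "(complex ^ ('p::finite + 'p)) set"
  assumes U: "vec.subspace U" and iso: "\<And>u v. u \<in> U \<Longrightarrow> v \<in> U \<Longrightarrow> sform u v = 0"
    and coiso: "\<And>v. (\<And>w. w \<in> U \<Longrightarrow> sform v w = 0) \<Longrightarrow> v \<in> U"
  shows "vec.dim U = CARD('p)"
proof -
  have sub: "vec.subspace (theta ` U)"
  proof (rule vec.subspaceI)
    show "0 \<in> theta ` U" using vec.subspace_0[OF U] theta_zero by (metis imageI)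
  next
    fix x y assume "x \<in> theta ` U" "y \<in> theta ` U"
    then obtain u v where "x = theta u" "y = theta v" "u \<in> U" "v \<in> U" by blast
    then show "x + y \<in> theta ` U" using vec.subspace_add[OF U, of u v] by (simp flip: theta_add)
  next
    fix c x assume "x \<in> theta ` U"
    then obtain u where "x = theta u" "u \<in> U" by blast
    then show "c *s x \<in> theta ` U"
      using theta_scale[of "cnj c" u] vec.subspace_scale[OF U, of u "cnj c"] by (auto intro: rev_image_eqI)
  qed
  have "\<exists>y\<in>U. \<exists>w\<in>theta ` U. x = y + w" for x
  proof -
    have "subspace U"
      by (rule subspaceI) (use U in \<open>simp_all add: scaleR_vec vec.subspace_0 vec.subspace_add vec.subspace_scale\<close>)
    then have sp: "span U = U" by (simp add: span_eq_iff)
    obtain y z where yz: "y \<in> span U" "\<And>w. w \<in> span U \<Longrightarrow> orthogonal z w" "x = y + z"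
      using orthogonal_subspace_decomp_exists[of U x] by metis
    have z: "Re (cdot u z) = 0" if "u \<in> U" for u
      using yz(2) that by (simp add: sp Re_cdot orthogonal_def inner_commute)
    have c0: "cdot u z = 0" if u: "u \<in> U" for u
    proof -
      have "Re (cdot (\<i> *s u) z) = 0" by (intro z vec.subspace_scale[OF U] u)
      then have "Im (cdot u z) = 0" by (simp add: cdot_scale_left)
      then show ?thesis using z[OF u] by (simp add: complex_eq_iff)
    qed
    define w where "w = - theta z"
    have zw: "z = theta w"
      using theta_scale[of "-1" "theta z"] by (simp add: w_def theta_theta vec_eq_iff)
    have "w \<in> U"
    proof (rule coiso)
      fix u assume "u \<in> U"
      then have "sform u w = 0" using c0 by (simp add: sform_cdot zw)
      then show "sform w u = 0" by (subst sform_commute) simp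
    qed
    then show ?thesis using yz zw sp by (intro bexI[of _ y] bexI[of _ z]) auto
  qed
  then have sum: "{x + y |x y. x \<in> U \<and> y \<in> theta ` U} = UNIV" unfolding set_eq_iff by blast
  have int: "U \<inter> theta ` U = {0}"
  proof -
    have "x = 0" if x: "x \<in> U" "x \<in> theta ` U" for x
    proof -
      obtain w where w: "w \<in> U" "x = theta w" using x(2) by blast
      have "cdot x x = sform x w" by (simp add: sform_cdot w(2))
      also have "\<dots> = 0" by (rule iso[OF x(1) w(1)])
      finally have "inner x x = 0" using Re_cdot[of x x] by simp
      then show ?thesis by simp
    qed
    then show ?thesis using vec.subspace_0[OF U] vec.subspace_0[OF sub] by blast
  qed
  have "vec.dim (UNIV :: (complex ^ ('p + 'p)) set) = vec.dim U + vec.dim (theta ` U)"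
    using vec.dim_sums_Int[OF U sub] by (simp only: sum int) simp
  then show ?thesis unfolding vec_dim_card by (simp add: dim_theta[OF U])
qed

lemma subspace_parametrization:
  fixes U :: "(complex ^ 'n::finite) set"
  assumes "vec.subspace U" "vec.dim U = CARD('p::finite)"
  shows "\<exists>A :: complex ^ 'p ^ 'n. range ((*v) A) = U \<and> inj ((*v) A)"
proof -
  have "vec.dim (UNIV :: (complex ^ 'p) set) = vec.dim U" unfolding assms(2) by (rule vec_dim_card)
  then obtain f :: "complex ^ 'p \<Rightarrow> complex ^ 'n" where f: "Vector_Spaces.linear (*s) (*s) f" "f ` UNIV = U" "inj_on f UNIV"
    using vec.subspace_isomorphism[OF vec.subspace_UNIV assms(1)] by blast
  have "(*v) (matrix f) = f" using matrix_works[OF f(1)] by (rule ext)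
  then show ?thesis using f by (intro exI[of _ "matrix f"]) simp
qed

section \<open>Holomorphic functions with values in the Hilbert space\<close>

lemma norm_dirac_conj: "norm (dirac_conj u) = norm u"
proof -
  have "cinner (dirac_conj u) (dirac_conj u) = cinner (dirac_conj (dirac_conj u)) u"
    using conjugation_dirac_conj unfolding conjugation_def by blast
  then show ?thesis by (simp add: norm_l2_def inner_l2_def dirac_conj_dirac_conj)
qed

lemma l2_holomorphic_on_subset: "l2_holomorphic_on F S \<Longrightarrow> T \<subseteq> S \<Longrightarrow> l2_holomorphic_on F T"
  unfolding l2_holomorphic_on_def by (meson has_derivative_subset subsetD)

lemma l2_holomorphic_on_cong:
  assumes "l2_holomorphic_on F S" "\<And>z. z \<in> S \<Longrightarrow> F z = G z"
  shows "l2_holomorphic_on G S"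
  unfolding l2_holomorphic_on_def
proof
  fix z assume z: "z \<in> S"
  then obtain D where "(F has_derivative (\<lambda>h. h *\<^sub>C D)) (at z within S)"
    using assms(1) unfolding l2_holomorphic_on_def by blast
  then have "(G has_derivative (\<lambda>h. h *\<^sub>C D)) (at z within S)"
    by (rule has_derivative_transform[OF z, rotated]) (simp add: assms(2))
  then show "\<exists>D. (G has_derivative (\<lambda>h. h *\<^sub>C D)) (at z within S)" by blast
qed

lemma l2_holomorphic_sum_scale:
  fixes S :: "'k::finite \<Rightarrow> complex \<Rightarrow> 'n::finite l2"
  assumes S: "\<And>k. l2_holomorphic_on (S k) U" and c: "\<And>k. c k holomorphic_on U"
  shows "l2_holomorphic_on (\<lambda>z. \<Sum>k\<in>UNIV. c k z *\<^sub>C S k z) U"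
  unfolding l2_holomorphic_on_def
proof
  fix z assume z: "z \<in> U"
  have "\<forall>k. \<exists>D. (S k has_derivative (\<lambda>h. h *\<^sub>C D)) (at z within U)"
    using S z unfolding l2_holomorphic_on_def by blast
  then obtain D where D: "\<And>k. (S k has_derivative (\<lambda>h. h *\<^sub>C D k)) (at z within U)" by metis
  have "\<forall>k. \<exists>d. (c k has_field_derivative d) (at z within U)"
    using c z unfolding holomorphic_on_def field_differentiable_def by blast
  then obtain d where d: "\<And>k. (c k has_field_derivative d k) (at z within U)" by metis
  have "((\<lambda>z. \<Sum>k\<in>UNIV. c k z *\<^sub>C S k z) has_derivative
      (\<lambda>h. \<Sum>k\<in>UNIV. c k z *\<^sub>C (h *\<^sub>C D k) + (d k * h) *\<^sub>C S k z)) (at z within U)"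
    by (intro has_derivative_sum bounded_bilinear.FDERIV[OF bounded_bilinear_scaleC] D
        d[unfolded has_field_derivative_def])
  moreover have "(\<Sum>k\<in>UNIV. c k z *\<^sub>C (h *\<^sub>C D k) + (d k * h) *\<^sub>C S k z)
      = h *\<^sub>C (\<Sum>k\<in>UNIV. c k z *\<^sub>C D k + d k *\<^sub>C S k z)" for h
    by (simp add: l2.scale_sum_right l2.scale_right_distrib l2.scale_scale mult.commute)
  ultimately show "\<exists>D. ((\<lambda>z. \<Sum>k\<in>UNIV. c k z *\<^sub>C S k z) has_derivative (\<lambda>h. h *\<^sub>C D)) (at z within U)" by auto
qed

lemma cinner_holomorphic:
  assumes "l2_holomorphic_on S U"
  shows "(\<lambda>z. cinner (S z) a) holomorphic_on U"
  unfolding holomorphic_on_def field_differentiable_def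
proof
  fix z assume "z \<in> U"
  then obtain D where D: "(S has_derivative (\<lambda>h. h *\<^sub>C D)) (at z within U)"
    using assms unfolding l2_holomorphic_on_def by blast
  have "((\<lambda>z. cinner (S z) a) has_derivative (\<lambda>h. cinner (h *\<^sub>C D) a)) (at z within U)"
    by (rule bounded_linear.has_derivative[OF bounded_bilinear.bounded_linear_left[OF bounded_bilinear_cinner] D])
  then show "\<exists>f'. ((\<lambda>z. cinner (S z) a) has_field_derivative f') (at z within U)"
    by (intro exI[of _ "cinner D a"]) (simp add: has_field_derivative_def cinner_scaleC_left mult.commute[of _ "cinner D a"] cong: )
qed

context j_symmetric_dirac
begin

section \<open>The kernels of the maximal operator\<close>

lemma dim_boundary_space:
  assumes "z \<in> field_of_regularity (dirac_min Q)"
  shows "vec.dim (boundary_space z) = CARD('p)"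
  by (rule lagrangian_dim[OF boundary_space_subspace boundary_space_isotropic boundary_space_coisotropic[OF assms]])

definition weyl_class :: "complex \<Rightarrow> complex ^ ('p + 'p) \<Rightarrow> ('p + 'p) l2" where
  "weyl_class z v = l2_class (\<lambda>t. fund Q z t *v v)"

lemma weyl_class_add:
  "v \<in> boundary_space z \<Longrightarrow> w \<in> boundary_space z \<Longrightarrow> weyl_class z (v + w) = weyl_class z v + weyl_class z w"
  by (simp add: weyl_class_def boundary_space_def l2_class_add matrix_vector_right_distrib)

lemma weyl_class_scale:
  "v \<in> boundary_space z \<Longrightarrow> weyl_class z (c *s v) = c *\<^sub>C weyl_class z v"
  by (simp add: weyl_class_def boundary_space_def l2_class_scale vector_scalar_commute)

lemma weyl_class_zero: "weyl_class z 0 = 0"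
  by (simp add: weyl_class_def l2_class_zero)

lemma weyl_class_mult:
  assumes A: "\<And>x. A *v x \<in> boundary_space z"
  shows "weyl_class z (A *v x) = (\<Sum>k\<in>UNIV. x $ k *\<^sub>C weyl_class z (column k A))"
proof -
  have col: "column k A \<in> boundary_space z" for k
    using A[of "axis k 1"] by (simp add: mult_axis)
  have "finite T \<Longrightarrow> weyl_class z (\<Sum>k\<in>T. x $ k *s column k A) = (\<Sum>k\<in>T. x $ k *\<^sub>C weyl_class z (column k A))" for T
  proof (induction T rule: finite_induct)
    case (insert k T)
    have "(\<Sum>k\<in>T. x $ k *s column k A) \<in> boundary_space z"
      by (intro vec.subspace_sum[OF boundary_space_subspace] vec.subspace_scale[OF boundary_space_subspace] col)
    then show ?case
      using insert vec.subspace_scale[OF boundary_space_subspace col] by (simp add: weyl_class_add weyl_class_scale col)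
  qed (simp add: weyl_class_zero)
  from this[of UNIV] show ?thesis by (simp add: matrix_mult_sum)
qed

text \<open>A solution that vanishes almost everywhere vanishes at \<open>0\<close> by continuity.\<close>

lemma weyl_class_inj:
  assumes v: "v \<in> boundary_space z" and eq: "weyl_class z v = 0"
  shows "v = 0"
proof -
  have "AE t in half_line. fund Q z t *v v = 0"
    using v eq l2_class_eq_iff[of "\<lambda>t. fund Q z t *v v" "\<lambda>_. 0"]
    by (simp add: weyl_class_def boundary_space_def square_integrable_zero flip: l2_class_zero)
  then have "fund Q z 0 *v v = 0"
    by (intro continuous_AE_eq[where f = "\<lambda>t. fund Q z t *v v" and g = "\<lambda>_. 0"] solves_continuous[OF fund_solves] continuous_on_const) auto
  then show ?thesis by simp
qed

lemma kernel_iff: "(u, z *\<^sub>C u) \<in> dirac_max Q \<longleftrightarrow> (\<exists>v\<in>boundary_space z. u = weyl_class z v)"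
proof
  assume "(u, z *\<^sub>C u) \<in> dirac_max Q"
  then obtain y g where y: "u = l2_class y" "z *\<^sub>C u = l2_class g" "square_integrable y" "square_integrable g" "solves Q y g"
    unfolding dirac_max_iff by blast
  have eq: "l2_class g = z *\<^sub>C l2_class y" using y(1,2) by simp
  show "\<exists>v\<in>boundary_space z. u = weyl_class z v"
    using kernel_solution(1,3)[OF y(5,3,4) eq] y(1) by (intro bexI[of _ "y 0"]) (simp_all add: weyl_class_def)
next
  assume "\<exists>v\<in>boundary_space z. u = weyl_class z v"
  then show "(u, z *\<^sub>C u) \<in> dirac_max Q" using boundary_space_kernel by (auto simp: weyl_class_def)
qed

theorem dim_kernel:
  assumes z: "z \<in> field_of_regularity (dirac_min Q)"
  shows "l2.dim (kernel_op (shift_op (dirac_max Q) z)) = CARD('p)"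
proof -
  obtain A :: "complex ^ 'p ^ ('p + 'p)" where A: "range ((*v) A) = boundary_space z" "inj ((*v) A)"
    using subspace_parametrization[OF boundary_space_subspace dim_boundary_space[OF z]] by blast
  have Ax: "A *v x \<in> boundary_space z" for x using A(1) by blast
  define L where "L x = weyl_class z (A *v x)" for x
  have "kernel_op (shift_op (dirac_max Q) z) = {u. (u, z *\<^sub>C u) \<in> dirac_max Q}"
    unfolding kernel_op_def shift_op_def by auto
  also have "\<dots> = range L" unfolding kernel_iff A(1)[symmetric] L_def by auto
  finally have ker: "kernel_op (shift_op (dirac_max Q) z) = range L" .
  interpret P: finite_dimensional_vector_space_pair_1 "(*s) :: complex \<Rightarrow> complex ^ 'p \<Rightarrow> _" cart_basis
    "scaleC :: complex \<Rightarrow> ('p + 'p) l2 \<Rightarrow> _" by unfold_locales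
  have lin: "Vector_Spaces.linear (*s) scaleC L"
    by unfold_locales (simp_all add: L_def matrix_vector_right_distrib vector_scalar_commute weyl_class_add weyl_class_scale Ax)
  have "x = 0" if "L x = 0" for x
  proof -
    have "A *v x = 0" using weyl_class_inj[OF Ax] that by (simp add: L_def)
    then show ?thesis using A(2) by (metis injD matrix_vector_mult_0_right)
  qed
  then have "inj L"
    using P.linear_diff[OF lin] by (metis injI right_minus_eq)
  then have "l2.dim (range L) = vec.dim (UNIV :: (complex ^ 'p) set)"
    by (intro P.dim_image_eq[OF lin]) (rule inj_on_subset[of _ UNIV], auto)
  then show ?thesis by (simp only: ker vec_dim_card)
qed

text \<open>Conjugating the right inverse for the adjoint by \<open>j\<close> gives a bounded right inverse of \<open>D\<^sub>m\<^sub>a\<^sub>x - z\<^sub>0\<close>. The radius does not depend on \<open>v\<close>, since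
it only involves the norm of that inverse.\<close>

lemma local_kernel_sections:
  assumes z0: "z0 \<in> field_of_regularity (dirac_min Q)"
  shows "\<exists>r>0. \<forall>v\<in>boundary_space z0. \<exists>S. S z0 = weyl_class z0 v \<and> l2_holomorphic_on S (ball z0 r) \<and>
    (\<forall>z\<in>ball z0 r. (S z, z *\<^sub>C S z) \<in> dirac_max Q)"
proof -
  obtain G C where G: "\<And>f. (G f, f + cnj z0 *\<^sub>C G f) \<in> adjoint_op (dirac_min Q)" "\<And>f g. G (f + g) = G f + G g"
      "\<And>c f. G (c *\<^sub>C f) = c *\<^sub>C G f" "C > 0" "\<And>f. norm (G f) \<le> C * norm f"
    using adjoint_right_inverse_exists[OF closed_dirac_min linear_graph_dirac_min z0] by blast
  define G0 where "G0 f = dirac_conj (G (dirac_conj f))" for f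
  have G0: "(G0 f, f + z0 *\<^sub>C G0 f) \<in> dirac_max Q" for f
    using adjoint_dirac_min[OF G(1)[of "dirac_conj f"]]
    by (simp add: G0_def dirac_conj_add dirac_conj_scaleC dirac_conj_dirac_conj)
  have G0_add: "G0 (f + g) = G0 f + G0 g" for f g by (simp add: G0_def dirac_conj_add G(2))
  have G0_scale: "G0 (c *\<^sub>C f) = c *\<^sub>C G0 f" for c f by (simp add: G0_def dirac_conj_scaleC G(3))
  have G0_norm: "norm (G0 f) \<le> C * norm f" for f using G(5)[of "dirac_conj f"] by (simp add: G0_def norm_dirac_conj)
  have "\<exists>S. S z0 = weyl_class z0 v \<and> l2_holomorphic_on S (ball z0 (1 / (2 * C))) \<and>
    (\<forall>z\<in>ball z0 (1 / (2 * C)). (S z, z *\<^sub>C S z) \<in> dirac_max Q)" if v: "v \<in> boundary_space z0" for v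
  proof -
    let ?y = "weyl_class z0 v"
    have y: "(?y, z0 *\<^sub>C ?y) \<in> dirac_max Q" using v kernel_iff by blast
    obtain S where S: "S z0 = ?y" "\<And>z. z \<in> ball z0 (1 / (2 * C)) \<Longrightarrow> S z = ?y + (z - z0) *\<^sub>C G0 (S z)"
        "l2_holomorphic_on S (ball z0 (1 / (2 * C)))"
      using holomorphic_perturbation[of G0, OF G0_add G0_scale G(4) G0_norm, of z0 ?y] by (elim exE conjE) (rule that, simp_all)
    have "(S z, z *\<^sub>C S z) \<in> dirac_max Q" if z: "z \<in> ball z0 (1 / (2 * C))" for z
    proof -
      let ?c = "z - z0"
      have "(?y + ?c *\<^sub>C G0 (S z), z0 *\<^sub>C ?y + ?c *\<^sub>C (S z + z0 *\<^sub>C G0 (S z))) \<in> dirac_max Q"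
        by (intro linear_graph_add[OF linear_graph_dirac_max] linear_graph_scale[OF linear_graph_dirac_max] y G0)
      moreover have "z0 *\<^sub>C ?y + ?c *\<^sub>C (S z + z0 *\<^sub>C G0 (S z)) = z0 *\<^sub>C (?y + ?c *\<^sub>C G0 (S z)) + ?c *\<^sub>C S z"
        by (simp add: l2.scale_right_distrib l2.scale_scale mult.commute add_ac)
      moreover have "z0 *\<^sub>C S z + ?c *\<^sub>C S z = z *\<^sub>C S z"
        by (simp flip: l2.scale_left_distrib)
      ultimately show ?thesis using S(2)[OF z] by simp
    qed
    then show ?thesis using S by blast
  qed
  then show ?thesis using G(4) by (intro exI[of _ "1 / (2 * C)"]) simp
qed

text \<open>For an element \<open>y\<close> of the kernel at \<open>z\<close> one has \<open>D y = z y\<close>, so evaluation at \<open>t\<close> is given by two vectors that do not depend on \<open>z\<close>.\<close>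

lemma trace_functional:
  assumes "0 \<le> t"
  shows "\<exists>a b. \<forall>z. \<forall>v\<in>boundary_space z. (fund Q z t *v v) $ i = cinner (weyl_class z v) a + z * cinner (weyl_class z v) b"
proof -
  obtain a b where ab: "\<And>y g. solves Q y g \<Longrightarrow> square_integrable y \<Longrightarrow> square_integrable g \<Longrightarrow>
    y t $ i = cinner (l2_class y) a + cinner (l2_class g) b"
    using evaluation_functional[OF assms] by metis
  have "(fund Q z t *v v) $ i = cinner (weyl_class z v) a + z * cinner (weyl_class z v) b" if v: "v \<in> boundary_space z" for z v
  proof -
    have sq: "square_integrable (\<lambda>t. fund Q z t *v v)" using v by (simp add: boundary_space_def)
    show ?thesis
      using ab[OF fund_solves sq square_integrable_scale[OF sq]]
      by (simp add: weyl_class_def cinner_scaleC_left flip: l2_class_scale[OF sq])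
  qed
  then show ?thesis by blast
qed

text \<open>The initial values of the continued basis of \<open>V(z\<^sub>0)\<close> stay linearly independent near \<open>z\<^sub>0\<close>, where \<open>det (P ** W\<^sub>0 z)\<close> does not vanish. As all \<open>V(z)\<close> have
dimension \<open>p\<close>, they span.\<close>

theorem boundary_space_chart:
  assumes z0: "z0 \<in> field_of_regularity (dirac_min Q)"
  shows "\<exists>r (P :: complex ^ ('p + 'p) ^ 'p) W. r > 0 \<and> ball z0 r \<subseteq> field_of_regularity (dirac_min Q) \<and>
    mat_holo W (ball z0 r) \<and> (\<forall>z\<in>ball z0 r. P ** W z = mat 1 \<and> boundary_space z = range ((*v) (W z))) \<and>
    (\<forall>k. l2_holomorphic_on (\<lambda>z. weyl_class z (column k (W z))) (ball z0 r))"
proof -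
  let ?\<Omega> = "field_of_regularity (dirac_min Q)"
  obtain A :: "complex ^ 'p ^ ('p + 'p)" where A: "range ((*v) A) = boundary_space z0" "inj ((*v) A)"
    using subspace_parametrization[OF boundary_space_subspace dim_boundary_space[OF z0]] by blast
  obtain P :: "complex ^ ('p + 'p) ^ 'p" where P: "P ** A = mat 1" using A(2) matrix_left_invertible_injective by blast
  have colA: "column k A \<in> boundary_space z0" for k
    unfolding A(1)[symmetric] by (rule range_eqI[of _ _ "axis k 1"]) (simp add: mult_axis)
  obtain r1 where r1: "r1 > 0" "\<And>v. v \<in> boundary_space z0 \<Longrightarrow> \<exists>S. S z0 = weyl_class z0 v \<and> l2_holomorphic_on S (ball z0 r1) \<and>
    (\<forall>z\<in>ball z0 r1. (S z, z *\<^sub>C S z) \<in> dirac_max Q)"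
    using local_kernel_sections[OF z0] by blast
  have "\<forall>k. \<exists>S. S z0 = weyl_class z0 (column k A) \<and> l2_holomorphic_on S (ball z0 r1) \<and>
    (\<forall>z\<in>ball z0 r1. (S z, z *\<^sub>C S z) \<in> dirac_max Q)" using r1(2)[OF colA] by blast
  from choice[OF this] obtain S where S: "\<And>k. S k z0 = weyl_class z0 (column k A)" "\<And>k. l2_holomorphic_on (S k) (ball z0 r1)"
    "\<And>k z. z \<in> ball z0 r1 \<Longrightarrow> (S k z, z *\<^sub>C S k z) \<in> dirac_max Q" by blast
  have "\<forall>i. \<exists>a b. \<forall>z. \<forall>v\<in>boundary_space z. v $ i = cinner (weyl_class z v) a + z * cinner (weyl_class z v) b"
    using trace_functional[OF order_refl] by simp
  then obtain a b where ab: "\<And>i z v. v \<in> boundary_space z \<Longrightarrow> v $ i = cinner (weyl_class z v) (a i) + z * cinner (weyl_class z v) (b i)"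
    by metis
  define W0 :: "complex \<Rightarrow> complex ^ 'p ^ ('p + 'p)" where
    "W0 z = (\<chi> i k. cinner (S k z) (a i) + z * cinner (S k z) (b i))" for z
  have W0: "column k (W0 z) \<in> boundary_space z" "S k z = weyl_class z (column k (W0 z))" if z: "z \<in> ball z0 r1" for k z
  proof -
    obtain v where v: "v \<in> boundary_space z" "S k z = weyl_class z v" using S(3)[OF z, of k] kernel_iff by blast
    have "column k (W0 z) = v" using ab[OF v(1)] v(2) by (simp add: vec_eq_iff column_def W0_def)
    then show "column k (W0 z) \<in> boundary_space z" "S k z = weyl_class z (column k (W0 z))" using v by simp_all
  qed
  have W0V: "W0 z *v x \<in> boundary_space z" if "z \<in> ball z0 r1" for z x
    unfolding matrix_mult_sum
    by (intro vec.subspace_sum[OF boundary_space_subspace] vec.subspace_scale[OF boundary_space_subspace] W0 that)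
  have W00: "W0 z0 = A"
  proof -
    have "column k (W0 z0) $ i = column k A $ i" for k i
      using ab[OF colA[of k], of i] S(1)[of k] by (simp add: column_def W0_def)
    then show ?thesis by (simp add: vec_eq_iff column_def)
  qed
  have W0h: "mat_holo W0 (ball z0 r1)"
    unfolding mat_holo_def W0_def by (auto intro!: holomorphic_intros cinner_holomorphic S(2))
  define N where "N z = P ** W0 z" for z
  have Nh: "mat_holo N (ball z0 r1)" unfolding N_def by (intro mat_holo_mult mat_holo_const W0h)
  have "continuous_on (ball z0 r1) (\<lambda>z. det (N z))" by (intro holomorphic_on_imp_continuous_on mat_holo_det Nh)
  then have "isCont (\<lambda>z. det (N z)) z0" using r1(1) by (simp add: continuous_on_eq_continuous_at)
  moreover have "det (N z0) \<noteq> 0" by (simp add: N_def W00 P)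
  ultimately obtain r2 where r2: "r2 > 0" "\<And>z. dist z0 z < r2 \<Longrightarrow> det (N z) \<noteq> 0"
    using continuous_at_avoid[of z0 "\<lambda>z. det (N z)" 0] by (auto simp: isCont_def)
  obtain r3 where r3: "r3 > 0" "ball z0 r3 \<subseteq> ?\<Omega>" using open_field_of_regularity z0 open_contains_ball by metis
  define r where "r = min r1 (min r2 r3)"
  have r: "r > 0" "ball z0 r \<subseteq> ball z0 r1" "ball z0 r \<subseteq> ?\<Omega>" "\<And>z. z \<in> ball z0 r \<Longrightarrow> det (N z) \<noteq> 0"
    using r1(1) r2 r3 by (auto simp: r_def)
  define c where "c z = cofactors (N z) ** mat (1 / det (N z))" for z
  have ch: "mat_holo c (ball z0 r)"
    unfolding c_def using r(4) mat_holo_subset[OF Nh r(2)]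
    by (intro mat_holo_mult mat_holo_cofactors mat_holo_mat holomorphic_on_divide mat_holo_det holomorphic_on_const)
  define W where "W z = W0 z ** c z" for z
  have Wh: "mat_holo W (ball z0 r)" unfolding W_def by (intro mat_holo_mult ch mat_holo_subset[OF W0h r(2)])
  have PW: "P ** W z = mat 1" if z: "z \<in> ball z0 r" for z
  proof -
    have "P ** W z = (N z ** cofactors (N z)) ** mat (1 / det (N z))" by (simp add: W_def c_def N_def matrix_mul_assoc)
    also have "\<dots> = mat 1" using r(4)[OF z] by (simp add: cofactors_mult mat_mult_scalar)
    finally show ?thesis .
  qed
  have range: "boundary_space z = range ((*v) (W z))" if z: "z \<in> ball z0 r" for z
  proof -
    have "inj ((*v) (W z))" using PW[OF z] matrix_left_invertible_injective by blast
    then have "vec.dim (range ((*v) (W z))) = vec.dim (UNIV :: (complex ^ 'p) set)"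
      by (intro vec.dim_image_eq[OF matrix_vector_mul_linear_gen]) (rule inj_on_subset[of _ UNIV], auto)
    then have "vec.dim (range ((*v) (W z))) = CARD('p)" by (simp only: vec_dim_card)
    moreover have "vec.subspace (range ((*v) (W z)))"
      by (rule vec.linear_subspace_image[OF matrix_vector_mul_linear_gen vec.subspace_UNIV])
    moreover have "range ((*v) (W z)) \<subseteq> boundary_space z"
      using W0V[OF subsetD[OF r(2) z]] by (auto simp: W_def matrix_vector_mul_assoc[symmetric])
    moreover have "vec.dim (boundary_space z) = CARD('p)" using dim_boundary_space r(3) z by blast
    ultimately show ?thesis using vec.subspace_dim_equal[OF _ boundary_space_subspace] by (metis order_refl)
  qed
  have "l2_holomorphic_on (\<lambda>z. weyl_class z (column k (W z))) (ball z0 r)" for k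
  proof -
    have "l2_holomorphic_on (\<lambda>z. \<Sum>j\<in>UNIV. (c z $ j $ k) *\<^sub>C S j z) (ball z0 r)"
      by (intro l2_holomorphic_sum_scale l2_holomorphic_on_subset[OF S(2) r(2)] mat_holoD[OF ch])
    then show ?thesis
    proof (rule l2_holomorphic_on_cong)
      fix z assume "z \<in> ball z0 r"
      then have z: "z \<in> ball z0 r1" using r(2) by blast
      have "column k (W z) = W0 z *v column k (c z)"
        by (simp add: W_def vec_eq_iff column_def matrix_matrix_mult_def matrix_vector_mult_def)
      then have "weyl_class z (column k (W z)) = (\<Sum>j\<in>UNIV. column k (c z) $ j *\<^sub>C weyl_class z (column j (W0 z)))"
        using weyl_class_mult[OF W0V[OF z]] by simp
      then show "(\<Sum>j\<in>UNIV. (c z $ j $ k) *\<^sub>C S j z) = weyl_class z (column k (W z))"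
        by (simp add: W0(2)[OF z] column_def)
    qed
  qed
  then show ?thesis
    using r Wh PW range by (intro exI[of _ r] exI[of _ P] exI[of _ W]) simp
qed

section \<open>Holomorphic Weyl solutions\<close>

text \<open>The global frame is, near each point, a holomorphic combination of the columns of the chart, and these define holomorphic \<open>L\<^sup>2\<close>-valued functions.
So holomorphy in norm passes from the charts to the frame.\<close>

theorem holomorphic_boundary_frame:
  shows "\<exists>F :: complex \<Rightarrow> complex ^ 'p ^ ('p + 'p).
    mat_holo F (field_of_regularity (dirac_min Q)) \<and>
    (\<forall>z\<in>field_of_regularity (dirac_min Q). (\<forall>x. F z *v x \<in> boundary_space z) \<and> (\<forall>x. F z *v x = 0 \<longrightarrow> x = 0)) \<and>
    (\<forall>k. l2_holomorphic_on (\<lambda>z. weyl_class z (column k (F z))) (field_of_regularity (dirac_min Q)))"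
proof -
  let ?\<Omega> = "field_of_regularity (dirac_min Q)"
  define chart where "chart a r P W \<longleftrightarrow> r > 0 \<and> ball a r \<subseteq> ?\<Omega> \<and> mat_holo W (ball a r) \<and>
      (\<forall>z\<in>ball a r. P ** W z = mat 1 \<and> boundary_space z = range ((*v) (W z))) \<and>
      (\<forall>k. l2_holomorphic_on (\<lambda>z. weyl_class z (column k (W z))) (ball a r))"
    for a r and P :: "complex ^ ('p + 'p) ^ 'p" and W
  have "\<forall>a\<in>?\<Omega>. \<exists>r P W. chart a r P W"
    unfolding chart_def by (intro ballI boundary_space_chart)
  then obtain rad P W where c: "\<And>a. a \<in> ?\<Omega> \<Longrightarrow> chart a (rad a) (P a) (W a)" by metis
  have ch: "rad a > 0" "ball a (rad a) \<subseteq> ?\<Omega>" "mat_holo (W a) (ball a (rad a))"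
      "z \<in> ball a (rad a) \<Longrightarrow> P a ** W a z = mat 1" "z \<in> ball a (rad a) \<Longrightarrow> boundary_space z = range ((*v) (W a z))"
      "l2_holomorphic_on (\<lambda>z. weyl_class z (column k (W a z))) (ball a (rad a))" if "a \<in> ?\<Omega>" for a z k
    using c[OF that] unfolding chart_def by simp_all
  interpret holomorphic_bundle ?\<Omega> boundary_space P W rad
    by unfold_locales (rule open_field_of_regularity ch; assumption)+
  obtain F where F: "mat_holo F ?\<Omega>" "\<And>z. z \<in> ?\<Omega> \<Longrightarrow> frame_at F z" using holomorphic_frame_exists by blast
  have FV: "F z *v x \<in> boundary_space z" if "z \<in> ?\<Omega>" for z x using F(2)[OF that] by (simp add: frame_at_def)
  have "l2_holomorphic_on (\<lambda>z. weyl_class z (column k (F z))) ?\<Omega>" for k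
    unfolding l2_holomorphic_on_def
  proof
    fix a assume a: "a \<in> ?\<Omega>"
    define M where "M z = P a ** F z" for z
    have Mh: "mat_holo M (ball a (rad a))"
      unfolding M_def by (intro mat_holo_mult mat_holo_const mat_holo_subset[OF F(1) ch(2)[OF a]])
    have "l2_holomorphic_on (\<lambda>z. \<Sum>j\<in>UNIV. (M z $ j $ k) *\<^sub>C weyl_class z (column j (W a z))) (ball a (rad a))"
      by (intro l2_holomorphic_sum_scale ch(6)[OF a] mat_holoD[OF Mh])
    then have "l2_holomorphic_on (\<lambda>z. weyl_class z (column k (F z))) (ball a (rad a))"
    proof (rule l2_holomorphic_on_cong)
      fix z assume z: "z \<in> ball a (rad a)"
      then have z\<Omega>: "z \<in> ?\<Omega>" using ch(2)[OF a] by blast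
      have "F z = W a z ** M z" unfolding M_def by (rule range_factor[OF a z FV[OF z\<Omega>]])
      then have "column k (F z) = W a z *v column k (M z)"
        by (simp add: vec_eq_iff column_def matrix_matrix_mult_def matrix_vector_mult_def)
      moreover have "W a z *v x \<in> boundary_space z" for x using ch(5)[OF a z] by simp
      ultimately show "(\<Sum>j\<in>UNIV. (M z $ j $ k) *\<^sub>C weyl_class z (column j (W a z))) = weyl_class z (column k (F z))"
        by (simp add: weyl_class_mult column_def[of k "M z"])
    qed
    then obtain D where "((\<lambda>z. weyl_class z (column k (F z))) has_derivative (\<lambda>h. h *\<^sub>C D)) (at a within ball a (rad a))"
      using ch(1)[OF a] unfolding l2_holomorphic_on_def by (meson centre_in_ball)
    then have "((\<lambda>z. weyl_class z (column k (F z))) has_derivative (\<lambda>h. h *\<^sub>C D)) (at a)"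
      using at_within_open[of a "ball a (rad a)"] ch(1)[OF a] by simp
    then show "\<exists>D. ((\<lambda>z. weyl_class z (column k (F z))) has_derivative (\<lambda>h. h *\<^sub>C D)) (at a within ?\<Omega>)"
      using has_derivative_at_withinI by blast
  qed
  then show ?thesis using F FV by (intro exI[of _ F]) (simp add: frame_at_def)
qed

lemma weyl_matrix_solution_fund:
  fixes A :: "complex ^ 'p ^ ('p + 'p)"
  assumes A: "\<And>x. A *v x \<in> boundary_space z" "\<And>x. A *v x = 0 \<Longrightarrow> x = 0"
  shows "weyl_matrix_solution Q z (\<lambda>t. fund Q z t ** A)"
  unfolding weyl_matrix_solution_def
proof (intro conjI exI allI impI)
  have "AC_deriv (\<lambda>t. fund Q z t ** A) (\<lambda>t. (dirac_coeff Q z t ** fund Q z t) ** A)"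
    by (rule AC_deriv_linear[OF bounded_bilinear.bounded_linear_left[OF bounded_bilinear_matrix_mult] AC_deriv_fund])
  then show "AC_loc (\<lambda>t. fund Q z t ** A)" "ae_derivative (\<lambda>t. fund Q z t ** A) (\<lambda>t. (dirac_coeff Q z t ** fund Q z t) ** A)"
    by (simp_all add: AC_deriv_def)
  have "J_mat ** ((dirac_coeff Q z t ** fund Q z t) ** A) + Q t ** (fund Q z t ** A) = mat z ** (fund Q z t ** A)" for t
  proof (rule matrix_eqI)
    fix x
    let ?v = "fund Q z t *v (A *v x)"
    have "mat z *v ?v = z *s ?v"
      by (simp add: vec_eq_iff matrix_vector_mult_def mat_def if_distrib[where f = "\<lambda>x. x * _"] cong: if_cong)
    then show "(J_mat ** ((dirac_coeff Q z t ** fund Q z t) ** A) + Q t ** (fund Q z t ** A)) *v x = (mat z ** (fund Q z t ** A)) *v x"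
      by (simp add: matrix_vector_mult_add_rdistrib matrix_vector_mul_assoc[symmetric] dirac_coeff_mult J_minus J_J
          matrix_vector_mult_diff_distrib)
  qed
  then show "AE t in half_line. J_mat ** ((dirac_coeff Q z t ** fund Q z t) ** A) + Q t ** (fund Q z t ** A) = mat z ** (fund Q z t ** A)"
    by simp
next
  fix k
  have "column k A \<in> boundary_space z" using A(1)[of "axis k 1"] by (simp add: mult_axis)
  then show "square_integrable (\<lambda>t. column k (fund Q z t ** A))"
    by (simp add: boundary_space_def mult_axis[symmetric] matrix_vector_mul_assoc)
next
  fix c :: "complex ^ 'p"
  assume "\<forall>t\<ge>0. (\<Sum>k\<in>UNIV. c $ k *s column k (fund Q z t ** A)) = 0"
  from this[rule_format, of 0] have "A *v c = 0" by (simp add: matrix_mult_sum)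
  then show "c = 0" by (rule A(2))
qed

theorem weyl_solution_exists:
  "\<exists>\<Psi> :: complex \<Rightarrow> real \<Rightarrow> complex ^ 'p ^ ('p + 'p).
    (\<forall>z \<in> field_of_regularity (dirac_min Q). weyl_matrix_solution Q z (\<Psi> z)) \<and>
    (\<forall>k. l2_holomorphic_on (\<lambda>z. l2_class (\<lambda>t. column k (\<Psi> z t))) (field_of_regularity (dirac_min Q))) \<and>
    (\<forall>t\<ge>0. \<forall>i k. (\<lambda>z. \<Psi> z t $ i $ k) holomorphic_on field_of_regularity (dirac_min Q))"
proof -
  let ?\<Omega> = "field_of_regularity (dirac_min Q)"
  obtain F :: "complex \<Rightarrow> complex ^ 'p ^ ('p + 'p)" where F: "mat_holo F ?\<Omega>"
    "\<And>z x. z \<in> ?\<Omega> \<Longrightarrow> F z *v x \<in> boundary_space z" "\<And>z x. z \<in> ?\<Omega> \<Longrightarrow> F z *v x = 0 \<Longrightarrow> x = 0"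
    "\<And>k. l2_holomorphic_on (\<lambda>z. weyl_class z (column k (F z))) ?\<Omega>"
    using holomorphic_boundary_frame by blast
  have col: "column k (fund Q z t ** F z) = fund Q z t *v column k (F z)" for k z t
    by (simp add: mult_axis[symmetric] matrix_vector_mul_assoc)
  have pointwise: "(\<lambda>z. (fund Q z t ** F z) $ i $ k) holomorphic_on ?\<Omega>" if t: "0 \<le> t" for t i k
  proof -
    obtain a b where ab: "\<And>z v. v \<in> boundary_space z \<Longrightarrow>
        (fund Q z t *v v) $ i = cinner (weyl_class z v) a + z * cinner (weyl_class z v) b"
      using trace_functional[OF t, of i] by blast
    have "(\<lambda>z. cinner (weyl_class z (column k (F z))) a + z * cinner (weyl_class z (column k (F z))) b) holomorphic_on ?\<Omega>"
      by (intro holomorphic_intros cinner_holomorphic F(4))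
    then show ?thesis
    proof (rule holomorphic_transform)
      fix z assume z: "z \<in> ?\<Omega>"
      have "column k (F z) \<in> boundary_space z" using F(2)[OF z, of "axis k 1"] by (simp add: mult_axis)
      from ab[OF this] show "cinner (weyl_class z (column k (F z))) a + z * cinner (weyl_class z (column k (F z))) b
          = (fund Q z t ** F z) $ i $ k"
        by (simp flip: col) (simp add: column_def)
    qed
  qed
  show ?thesis
  proof (intro exI[of _ "\<lambda>z t. fund Q z t ** F z"] conjI ballI allI impI)
    show "weyl_matrix_solution Q z (\<lambda>t. fund Q z t ** F z)" if "z \<in> ?\<Omega>" for z
      by (rule weyl_matrix_solution_fund[OF F(2)[OF that] F(3)[OF that]])
    show "l2_holomorphic_on (\<lambda>z. l2_class (\<lambda>t. column k (fund Q z t ** F z))) ?\<Omega>" for k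
      using F(4) by (simp add: col weyl_class_def)
  qed (rule pointwise)
qed

end

theorem theorem1p2:
  fixes Q :: "real \<Rightarrow> complex ^ ('p::finite + 'p) ^ ('p + 'p)"
  assumes "L1_loc Q"
    and "j_symmetric dirac_conj (dirac_min Q)"
    and "field_of_regularity (dirac_min Q) \<noteq> {}"
  shows "(\<forall>z \<in> field_of_regularity (dirac_min Q).
            l2.dim (kernel_op (shift_op (dirac_max Q) z)) = CARD('p)) \<and>
         (\<exists>\<Psi> :: complex \<Rightarrow> real \<Rightarrow> complex ^ 'p ^ ('p + 'p).
            (\<forall>z \<in> field_of_regularity (dirac_min Q). weyl_matrix_solution Q z (\<Psi> z)) \<and>
            (\<forall>k. l2_holomorphic_on (\<lambda>z. l2_class (\<lambda>t. column k (\<Psi> z t)))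
                   (field_of_regularity (dirac_min Q))) \<and>
            (\<forall>t\<ge>0. \<forall>i k. (\<lambda>z. \<Psi> z t $ i $ k) holomorphic_on
                   field_of_regularity (dirac_min Q)))"
proof -
  interpret j_symmetric_dirac Q by unfold_locales (rule assms)+
  show ?thesis using dim_kernel weyl_solution_exists by (intro conjI ballI)
qed

end
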